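(* Let $T>0$ and suppose that the weak problem $$\int_I H(x_\rho)\, x_t\cdot\eta \,\mathrm{d}\rho+\int_I \Phi'(x_\rho)\cdot\eta_\rho\,\mathrm{d}\rho=0\qquad\forall\ \eta\in[H^1(I)]^d,\quad t\in(0,T],\qquad x(\cdot,0)=x_0,$$ has a smooth solution $x:I\times[0,T]\to\mathbb{R}^d$ satisfying $$x\in W^{1,\infty}(0,T;[W^{2,\infty}(I)]^d),\qquad x_{tt}\in L^\infty(0,T;[L^\infty(I)]^d),$$ and $$c_0\le |x_\rho|\le C_0\quad\text{in } I\times[0,T]$$ for some constants $c_0,C_0\in\mathbb{R}_{>0}$. Then there exist $\delta>0$ and $h_0>0$ (and a constant $C>0$), all independent of the mesh size $h$ and of the time step $\Delta t$, such that if $0<h\le h_0$ and $\Delta t\le\delta h$, then the fully discrete scheme: $x_h^0=Q_hx_0$ and, for $m=0,\dots,M-1$, $x_h^{m+1}\in\underline{V}^h$ with $$\frac1{\Delta t}\int_I H(x^m_{h,\rho})(x_h^{m+1}-x_h^m)\cdot\eta_h\,\mathrm{d}\rho+\int_I\Phi'(x^{m+1}_{h,\rho})\cdot\eta_{h,\rho}\,\mathrm{d}\rho=0\qquad\forall\ \eta_h\in\underline{V}^h,$$ has a unique solution $(x_h^m)_{m=0,\dots,M}$, and the following error bounds hold, where $x^m=x(\cdot,t_m)$: $$\max_{m=0,\dots,M}\|x^m-x_h^m\|_0^2\le C\left(h^4+(\Delta t)^2\right),\qquad \max_{m=0,\dots,M}|x^m-x_h^m|_1^2\le C\left(h^2+(\Delta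 t)^2\right).$$
   Context: Let $d\ge2$. Anisotropy: $\phi\in C^0(\mathbb{R}^d,\mathbb{R}_{\ge0})\cap C^4(\mathbb{R}^d\setminus\{0\},\mathbb{R}_{>0})$ satisfies $\phi(\lambda p)=|\lambda|\phi(p)$ for all $p\in\mathbb{R}^d$, $\lambda\in\mathbb{R}$, and the strict convexity condition $\phi''(p)q\cdot q>0$ for all $p,q\in\mathbb{R}^d$ with $|p|=|q|=1$, $p\cdot q=0$. Here $\phi',\phi''$ denote gradient and Hessian. Set $\Phi(p)=\tfrac12\phi^2(p)$; then $\Phi\in C^1(\mathbb{R}^d)\cap C^4(\mathbb{R}^d\setminus\{0\})$. Mobility: $\mathfrak{m}:\mathbb{S}^{d-1}\to\mathbb{R}_{>0}$, extended $0$-homogeneously to $\mathbb{R}^d\setminus\{0\}$, with $\mathfrak{m}\in C^3(\mathbb{R}^d\setminus\{0\})$. Matrix $H$: for $p\in\mathbb{R}^d\setminus\{0\}$, $$H(p)=\alpha(p)\left[\mathrm{Id}+\frac{w(p)\otimes(\frac{p}{|p|}-w(p))-\frac{p}{|p|}\otimes(w(p)+|w(p)|^2\frac{p}{|p|})}{1+|w(p)|^2}\right],$$ with $\alpha(p)=\mathfrak{m}(p)|p|\phi(p)$ and $w(p)=\frac{|p|}{\phi(p)}\phi'(p)-\frac{p}{|p|}$, where $a\otimes b=ab^T$. Notation: $I=\mathbb{R}/\mathbb{Z}$ is the periodic unit interval (functions on $I$ are $1$-periodic); subscripts $\rho$ and $t$ denote partial derivatives; $\|\cdot\|_0$ is the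 $L^2(I)$ norm and $|\cdot|_1$ the $H^1(I)$ semi-norm ($|f|_1=\|f_\rho\|_0$), also for vector-valued functions. Mesh: $0=q_0<q_1<\dots<q_J=1$, $I_j=[q_{j-1},q_j]$, $h_j=q_j-q_{j-1}$, $h=\max_j h_j$, and there is a fixed constant $c>0$ (the same for the whole family of partitions) with $h\le c\,h_j$ for all $1\le j\le J$. $q_J=1$ is identified with $q_0=0$. $V^h=\{\chi\in C^0(I):\chi|_{I_j}\text{ is affine},\ j=1,\dots,J\}$ and $\underline{V}^h=[V^h]^d$. Time discretization: $t_m=m\Delta t$, $m=0,\dots,M$, with $\Delta t=T/M>0$, $M$ a positive integer. Projection $Q_h$: for $y\in[W^{2,\infty}(I)]^d$ with $|y_\rho|$ bounded below by a positive constant, $Q_hy\in\underline{V}^h$ is the unique function with $$\int_I\Phi''(y_\rho)(Q_hy-y)_\rho\cdot\eta_{h,\rho}\,\mathrm{d}\rho+\int_I(Q_hy-y)\cdot\eta_h\,\mathrm{d}\rho=0\qquad\forall\ \eta_h\in\underline{V}^h.$$ A solution of the scheme is understood to satisfy $x^m_{h,\rho}\neq0$ a.e. in $I$ for $m=0,\dots,M-1$, so that $H(x^m_{h,\rho})$ is defined. *)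

theory Defs
  imports "HOL-Analysis.Analysis"
begin

section \<open>Differential calculus on \<open>\<real>\<^sup>d\<close>\<close>

text \<open>The class $C^k(S)$, for open \<open>S\<close>.\<close>

fun Ck_on :: "nat \<Rightarrow> 'a::real_normed_vector set \<Rightarrow> ('a \<Rightarrow> 'b::real_normed_vector) \<Rightarrow> bool" where
  "Ck_on 0 S f \<longleftrightarrow> continuous_on S f"
| "Ck_on (Suc k) S f \<longleftrightarrow>
     (\<forall>p\<in>S. f differentiable (at p)) \<and> (\<forall>v. Ck_on k S (\<lambda>p. frechet_derivative f (at p) v))"

definition grad :: "(real^'d \<Rightarrow> real) \<Rightarrow> real^'d \<Rightarrow> real^'d" where
  "grad f p = (\<chi> i. frechet_derivative f (at p) (axis i 1))"

definition hessian :: "(real^'d \<Rightarrow> real) \<Rightarrow> real^'d \<Rightarrow> real^'d^'d" where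
  "hessian f p = jacobian (grad f) (at p)"

definition outer :: "real^'d \<Rightarrow> real^'d \<Rightarrow> real^'d^'d" where
  "outer a b = (\<chi> i j. a $ i * b $ j)"


section \<open>Anisotropy, mobility and the matrix \<open>H\<close>\<close>

definition anisotropy :: "(real^'d \<Rightarrow> real) \<Rightarrow> bool" where
  "anisotropy \<phi> \<longleftrightarrow>
     continuous_on UNIV \<phi> \<and> Ck_on 4 (- {0}) \<phi> \<and>
     (\<forall>p. 0 \<le> \<phi> p) \<and> (\<forall>p. p \<noteq> 0 \<longrightarrow> 0 < \<phi> p) \<and>
     (\<forall>l p. \<phi> (l *\<^sub>R p) = \<bar>l\<bar> * \<phi> p) \<and>
     (\<forall>p q. norm p = 1 \<and> norm q = 1 \<and> p \<bullet> q = 0 \<longrightarrow> (hessian \<phi> p *v q) \<bullet> q > 0)"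

definition Phi :: "(real^'d \<Rightarrow> real) \<Rightarrow> real^'d \<Rightarrow> real" where
  "Phi \<phi> p = (\<phi> p)\<^sup>2 / 2"

text \<open>A mobility is a function on the unit sphere, so only its values there matter. Its
  0-homogeneous extension to nonzero vectors is \<open>p \<mapsto> \<mu> (sgn p)\<close>, since \<open>sgn p = p / |p|\<close>.\<close>

definition hom0_ext :: "(real^'d \<Rightarrow> real) \<Rightarrow> real^'d \<Rightarrow> real" where
  "hom0_ext \<mu> p = \<mu> (sgn p)"

definition mobility :: "(real^'d \<Rightarrow> real) \<Rightarrow> bool" where
  "mobility \<mu> \<longleftrightarrow> (\<forall>p\<in>sphere 0 1. 0 < \<mu> p) \<and> Ck_on 3 (- {0}) (hom0_ext \<mu>)"

definition w_vec :: "(real^'d \<Rightarrow> real) \<Rightarrow> real^'d \<Rightarrow> real^'d" where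
  "w_vec \<phi> p = (norm p / \<phi> p) *\<^sub>R grad \<phi> p - sgn p"

definition Hmat :: "(real^'d \<Rightarrow> real) \<Rightarrow> (real^'d \<Rightarrow> real) \<Rightarrow> real^'d \<Rightarrow> real^'d^'d" where
  "Hmat \<phi> \<mu> p =
     (let w = w_vec \<phi> p; \<tau> = sgn p; \<alpha> = hom0_ext \<mu> p * norm p * \<phi> p in
      \<alpha> *\<^sub>R (mat 1 + (1 / (1 + (norm w)\<^sup>2)) *\<^sub>R
        (outer w (\<tau> - w) - outer \<tau> (w + (norm w)\<^sup>2 *\<^sub>R \<tau>))))"


section \<open>Function spaces on the periodic unit interval\<close>

text \<open>Functions on \<open>\<real>/\<int>\<close> are functions on the real line, integrated over the period
  \<open>[0,1]\<close>. Elements of the \<open>L\<^sup>p\<close> and Sobolev spaces below are only looked at on \<open>[0,1]\<close>, up to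
  null sets; for these, periodicity is encoded in the periodicity of the test functions.\<close>

abbreviation \<I> :: "real measure" where
  "\<I> \<equiv> lebesgue_on {0..1}"

definition periodic1 :: "(real \<Rightarrow> 'a) \<Rightarrow> bool" where
  "periodic1 f \<longleftrightarrow> (\<forall>\<rho>. f (\<rho> + 1) = f \<rho>)"

text \<open>The pointwise derivative with respect to the space variable. It is used only for functions
  that are differentiable outside a finite subset of a period.\<close>

definition d_rho :: "(real \<Rightarrow> 'a::real_normed_vector) \<Rightarrow> real \<Rightarrow> 'a" where
  "d_rho f \<rho> = vector_derivative f (at \<rho>)"

definition L2_norm :: "(real \<Rightarrow> 'a::euclidean_space) \<Rightarrow> real" where
  "L2_norm f = sqrt (LINT \<rho>|\<I>. (norm (f \<rho>))\<^sup>2)"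

definition H1_seminorm :: "(real \<Rightarrow> 'a::euclidean_space) \<Rightarrow> real" where
  "H1_seminorm f = L2_norm (d_rho f)"

definition L2 :: "(real \<Rightarrow> 'a::euclidean_space) set" where
  "L2 = {f. f \<in> borel_measurable \<I> \<and> integrable \<I> (\<lambda>\<rho>. (norm (f \<rho>))\<^sup>2)}"

definition Linf :: "(real \<Rightarrow> 'a::euclidean_space) set" where
  "Linf = {f. f \<in> borel_measurable \<I> \<and> (\<exists>C. AE \<rho> in \<I>. norm (f \<rho>) \<le> C)}"

definition Linf_norm :: "(real \<Rightarrow> 'a::euclidean_space) \<Rightarrow> real" where
  "Linf_norm f = Inf {C. AE \<rho> in \<I>. norm (f \<rho>) \<le> C}"

definition has_weak_deriv :: "(real \<Rightarrow> 'a::euclidean_space) \<Rightarrow> (real \<Rightarrow> 'a) \<Rightarrow> bool" where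
  "has_weak_deriv f g \<longleftrightarrow>
     integrable \<I> f \<and> integrable \<I> g \<and>
     (\<forall>\<zeta>::real \<Rightarrow> real. \<zeta> C1_differentiable_on UNIV \<and> periodic1 \<zeta> \<longrightarrow>
        (LINT \<rho>|\<I>. deriv \<zeta> \<rho> *\<^sub>R f \<rho>) = - (LINT \<rho>|\<I>. \<zeta> \<rho> *\<^sub>R g \<rho>))"

text \<open>A member of $H^1$ together with (a representative of) its weak derivative.\<close>

definition H1_with_deriv :: "(real \<Rightarrow> 'a::euclidean_space) \<Rightarrow> (real \<Rightarrow> 'a) \<Rightarrow> bool" where
  "H1_with_deriv f g \<longleftrightarrow> f \<in> L2 \<and> g \<in> L2 \<and> has_weak_deriv f g"

definition W2inf :: "(real \<Rightarrow> 'a::euclidean_space) set" where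
  "W2inf = {f. f \<in> Linf \<and>
     (\<exists>g\<in>Linf. \<exists>k\<in>Linf. has_weak_deriv f g \<and> has_weak_deriv g k)}"

text \<open>Weak derivatives are unique up to null sets, so this is the maximum of the
  $L^\infty$ norms of \<open>f\<close> and its first two weak derivatives.\<close>

definition W2inf_norm :: "(real \<Rightarrow> 'a::euclidean_space) \<Rightarrow> real" where
  "W2inf_norm f =
     Inf {max (Linf_norm f) (max (Linf_norm g) (Linf_norm k)) | g k.
            g \<in> Linf \<and> k \<in> Linf \<and> has_weak_deriv f g \<and> has_weak_deriv g k}"


section \<open>Bochner spaces on \<open>(0,T)\<close>\<close>

text \<open>\<open>X\<close> is a space of functions on \<open>\<real>/\<int>\<close> with norm \<open>N\<close>. Strong measurability means being
  the limit almost everywhere, in the norm \<open>N\<close>, of \<open>X\<close>-valued simple functions.\<close>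

definition strongly_measurable ::
  "real \<Rightarrow> (real \<Rightarrow> 'a::euclidean_space) set \<Rightarrow> ((real \<Rightarrow> 'a) \<Rightarrow> real) \<Rightarrow> (real \<Rightarrow> real \<Rightarrow> 'a) \<Rightarrow> bool"
where
  "strongly_measurable T X N u \<longleftrightarrow>
     (\<exists>s::nat \<Rightarrow> real \<Rightarrow> real \<Rightarrow> 'a.
        (\<forall>n. finite (s n ` {0<..<T}) \<and> s n ` {0<..<T} \<subseteq> X \<and>
             (\<forall>v. {t\<in>{0<..<T}. s n t = v} \<in> sets lebesgue)) \<and>
        (AE t in lebesgue_on {0<..<T}. (\<lambda>n. N (\<lambda>\<rho>. s n t \<rho> - u t \<rho>)) \<longlonglongrightarrow> 0))"

definition Bochner_Linf ::
  "real \<Rightarrow> (real \<Rightarrow> 'a::euclidean_space) set \<Rightarrow> ((real \<Rightarrow> 'a) \<Rightarrow> real) \<Rightarrow> (real \<Rightarrow> real \<Rightarrow> 'a) \<Rightarrow> bool"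
where
  "Bochner_Linf T X N u \<longleftrightarrow>
     (AE t in lebesgue_on {0<..<T}. u t \<in> X) \<and> strongly_measurable T X N u \<and>
     (\<exists>C. AE t in lebesgue_on {0<..<T}. N (u t) \<le> C)"

text \<open>Weak time derivative: \<open>\<integral> \<zeta>' u dt = - \<integral> \<zeta> v dt\<close> for all test functions \<open>\<zeta>\<close>. The identity
  between the two function-valued integrals is stated after pairing with continuous functions
  \<open>\<eta>\<close> of the space variable, which is continuous on and separates the points of $L^\infty$.\<close>

definition has_weak_time_deriv ::
  "real \<Rightarrow> (real \<Rightarrow> real \<Rightarrow> 'a::euclidean_space) \<Rightarrow> (real \<Rightarrow> real \<Rightarrow> 'a) \<Rightarrow> bool" where
  "has_weak_time_deriv T u v \<longleftrightarrow>
     (\<forall>\<zeta>::real \<Rightarrow> real. \<forall>\<eta>::real \<Rightarrow> 'a.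
        \<zeta> C1_differentiable_on UNIV \<and>
        (\<exists>a b. 0 < a \<and> b < T \<and> (\<forall>t. t \<notin> {a..b} \<longrightarrow> \<zeta> t = 0)) \<and>
        continuous_on {0..1} \<eta> \<longrightarrow>
          (LINT t|lebesgue_on {0<..<T}. deriv \<zeta> t * (LINT \<rho>|\<I>. u t \<rho> \<bullet> \<eta> \<rho>)) =
          - (LINT t|lebesgue_on {0<..<T}. \<zeta> t * (LINT \<rho>|\<I>. v t \<rho> \<bullet> \<eta> \<rho>)))"

definition Bochner_W1inf ::
  "real \<Rightarrow> (real \<Rightarrow> 'a::euclidean_space) set \<Rightarrow> ((real \<Rightarrow> 'a) \<Rightarrow> real) \<Rightarrow> (real \<Rightarrow> real \<Rightarrow> 'a) \<Rightarrow> bool"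
where
  "Bochner_W1inf T X N u \<longleftrightarrow>
     Bochner_Linf T X N u \<and> (\<exists>v. Bochner_Linf T X N v \<and> has_weak_time_deriv T u v)"


section \<open>The continuous problem\<close>

text \<open>At the end points of \<open>[0,T]\<close> the time derivative is one-sided.\<close>

definition d_t :: "real \<Rightarrow> (real \<Rightarrow> real \<Rightarrow> 'a::real_normed_vector) \<Rightarrow> real \<Rightarrow> real \<Rightarrow> 'a" where
  "d_t T x \<rho> t = vector_derivative (x \<rho>) (at t within {0..T})"

text \<open>The smoothness required of a solution besides the Bochner-Sobolev regularity: just enough
  for the weak problem to make sense at every time, and for pointwise conditions on the space
  derivative to make sense everywhere.\<close>

definition C1_space_time :: "real \<Rightarrow> (real \<Rightarrow> real \<Rightarrow> 'a::real_normed_vector) \<Rightarrow> bool" where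
  "C1_space_time T x \<longleftrightarrow>
     (\<forall>t\<in>{0..T}. periodic1 (\<lambda>\<rho>. x \<rho> t)) \<and>
     (\<forall>\<rho>. \<forall>t\<in>{0..T}. (\<lambda>\<sigma>. x \<sigma> t) differentiable (at \<rho>) \<and>
                      x \<rho> differentiable (at t within {0..T})) \<and>
     continuous_on (UNIV \<times> {0..T}) (\<lambda>(\<rho>, t). x \<rho> t) \<and>
     continuous_on (UNIV \<times> {0..T}) (\<lambda>(\<rho>, t). d_rho (\<lambda>\<sigma>. x \<sigma> t) \<rho>) \<and>
     continuous_on (UNIV \<times> {0..T}) (\<lambda>(\<rho>, t). d_t T x \<rho> t)"

definition weak_solution ::
  "(real^'d \<Rightarrow> real) \<Rightarrow> (real^'d \<Rightarrow> real) \<Rightarrow> real \<Rightarrow> (real \<Rightarrow> real^'d) \<Rightarrow> (real \<Rightarrow> real \<Rightarrow> real^'d) \<Rightarrow> bool"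
where
  "weak_solution \<phi> \<mu> T x0 x \<longleftrightarrow>
     (\<forall>t\<in>{0<..T}. \<forall>\<eta> \<eta>'. H1_with_deriv \<eta> \<eta>' \<longrightarrow>
        (LINT \<rho>|\<I>. (Hmat \<phi> \<mu> (d_rho (\<lambda>\<sigma>. x \<sigma> t) \<rho>) *v d_t T x \<rho> t) \<bullet> \<eta> \<rho>) +
        (LINT \<rho>|\<I>. grad (Phi \<phi>) (d_rho (\<lambda>\<sigma>. x \<sigma> t) \<rho>) \<bullet> \<eta>' \<rho>) = 0) \<and>
     (\<forall>\<rho>. x \<rho> 0 = x0 \<rho>)"


section \<open>The fully discrete scheme\<close>

definition mesh :: "nat \<Rightarrow> (nat \<Rightarrow> real) \<Rightarrow> bool" where
  "mesh J q \<longleftrightarrow> 0 < J \<and> q 0 = 0 \<and> q J = 1 \<and> (\<forall>j\<in>{1..J}. q (j - 1) < q j)"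

definition mesh_size :: "nat \<Rightarrow> (nat \<Rightarrow> real) \<Rightarrow> real" where
  "mesh_size J q = Max ((\<lambda>j. q j - q (j - 1)) ` {1..J})"

definition quasi_uniform :: "real \<Rightarrow> nat \<Rightarrow> (nat \<Rightarrow> real) \<Rightarrow> bool" where
  "quasi_uniform c J q \<longleftrightarrow> (\<forall>j\<in>{1..J}. mesh_size J q \<le> c * (q j - q (j - 1)))"

text \<open>For functions with values in \<open>\<real>\<^sup>d\<close> this is the \<open>d\<close>-fold product of the scalar space.\<close>

definition Vh :: "nat \<Rightarrow> (nat \<Rightarrow> real) \<Rightarrow> (real \<Rightarrow> 'a::real_normed_vector) set" where
  "Vh J q = {f. continuous_on UNIV f \<and> periodic1 f \<and>
     (\<forall>j\<in>{1..J}. \<exists>a b. \<forall>\<rho>\<in>{q (j - 1)..q j}. f \<rho> = a + \<rho> *\<^sub>R b)}"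

definition Qh :: "(real^'d \<Rightarrow> real) \<Rightarrow> nat \<Rightarrow> (nat \<Rightarrow> real) \<Rightarrow> (real \<Rightarrow> real^'d) \<Rightarrow> real \<Rightarrow> real^'d" where
  "Qh \<phi> J q y = (THE z. z \<in> Vh J q \<and>
     (\<forall>\<eta>\<in>Vh J q.
        (LINT \<rho>|\<I>. (hessian (Phi \<phi>) (d_rho y \<rho>) *v d_rho (\<lambda>\<sigma>. z \<sigma> - y \<sigma>) \<rho>) \<bullet> d_rho \<eta> \<rho>) +
        (LINT \<rho>|\<I>. (z \<rho> - y \<rho>) \<bullet> \<eta> \<rho>) = 0))"

text \<open>Since \<open>xh\<close> is a finite sequence indexed by \<open>{0..M}\<close>, it is required to be extensional.\<close>

definition scheme_solution ::
  "(real^'d \<Rightarrow> real) \<Rightarrow> (real^'d \<Rightarrow> real) \<Rightarrow> nat \<Rightarrow> (nat \<Rightarrow> real) \<Rightarrow> nat \<Rightarrow> real \<Rightarrow>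
   (real \<Rightarrow> real^'d) \<Rightarrow> (nat \<Rightarrow> real \<Rightarrow> real^'d) \<Rightarrow> bool"
where
  "scheme_solution \<phi> \<mu> J q M \<Delta>t x0 xh \<longleftrightarrow>
     xh \<in> {0..M} \<rightarrow>\<^sub>E Vh J q \<and>
     xh 0 = Qh \<phi> J q x0 \<and>
     (\<forall>m<M. (AE \<rho> in \<I>. d_rho (xh m) \<rho> \<noteq> 0) \<and>
       (\<forall>\<eta>\<in>Vh J q.
          1 / \<Delta>t * (LINT \<rho>|\<I>.
             (Hmat \<phi> \<mu> (d_rho (xh m) \<rho>) *v (xh (Suc m) \<rho> - xh m \<rho>)) \<bullet> \<eta> \<rho>) +
          (LINT \<rho>|\<I>. grad (Phi \<phi>) (d_rho (xh (Suc m)) \<rho>) \<bullet> d_rho \<eta> \<rho>) = 0))"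

end

theory Submission
  imports Defs
begin

text \<open>
  The discrete curve is compared with the nodal interpolant of the exact one. In one space dimension the
  tangent \<open>P\<close> of the interpolant on an element is the mean value of the exact tangent $x_\rho$, so replacing
  $x_\rho$ by \<open>P\<close> inside a smooth nonlinearity costs, on average over the element, only the square of the mesh
  size (\<open>jensen_defect_eq\<close>). Hence the interpolant satisfies the scheme up to two terms: one of size
  $h^2 + \Delta t$ that is paired with the test function, and one, \<open>A\<close>, of size $h^2$ that is paired with the
  derivative of the test function (\<open>element_residual\<close>).

  The difference of the two schemes is tested with the time increment \<open>d\<close> of the nodal error. Since \<open>H\<close> is
  coercive (\<open>H_coercive\<close>), the mass term controls $|d|^2 / \Delta t$. Since $\Phi = \phi^2/2$ is uniformly convex
  (\<open>grad_Phi_monotone_Lipschitz\<close>), the difference of the fluxes dominates the increment of the energy of the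
  discrete tangent relative to \<open>P\<close> (\<open>breg_increment\<close>). The term with \<open>A\<close> contains the derivative of \<open>d\<close>, which
  neither of these controls; it is summed by parts in time, that is, moved into the energy. The corrected
  energy \<open>S\<close> grows within one step at most by the factor $1 + M_3 \Delta t$ and the summand
  $M_4 \Delta t (h^2 + \Delta t)^2$ (\<open>energy_step\<close>). It starts at the size $h^4$, because the projection of the
  initial value is superclose to the interpolant (\<open>projection_superclose\<close>). By Gronwall's argument it stays
  bounded by a multiple of $(h^2 + \Delta t)^2$ (\<open>trajectory_energy\<close>), and it controls the $H^1$ norm of the nodal error.
  Adding the interpolation error gives the two bounds (\<open>error_at_time\<close>).

  All this needs discrete tangents that stay away from the origin and from infinity, where \<open>H\<close> and the
  derivatives of the nonlinearities are not under control. The energy bound itself guarantees that: on a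
  quasi-uniform mesh with $\Delta t \le h$ it bounds the error of the tangent on every single element by a
  multiple of $h^{1/2}$ (\<open>near_exact_of_energy\<close>), so the induction over the time steps closes for small
  \<open>h\<close>. Each step is a strongly monotone and Lipschitz continuous system for the nodal values and therefore
  uniquely solvable (\<open>monotone_Lipschitz_zero\<close>, \<open>step_unique\<close>).

  The Bochner--Sobolev regularity of the solution enters through Lipschitz bounds at every point for the
  tangent, the velocity and the time increments of the tangent (\<open>regularity\<close>).
\<close>

section \<open>Functions of class \<open>C\<^sup>k\<close>\<close>

lemma Ck_on_SucD: "Ck_on (Suc k) S f \<Longrightarrow> Ck_on k S f"
proof (induction k arbitrary: f)
  case 0
  then show ?case
    by (auto intro!: continuous_at_imp_continuous_on differentiable_imp_continuous_within)
next
  case (Suc k)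
  then show ?case by (metis Ck_on.simps(2))
qed

lemma Ck_on_mono: "Ck_on n S f \<Longrightarrow> k \<le> n \<Longrightarrow> Ck_on k S f"
  by (induction n) (metis le_zero_eq, metis Ck_on_SucD le_Suc_eq)

lemma Ck_on_continuous: "Ck_on k S f \<Longrightarrow> continuous_on S f"
  using Ck_on_mono[of k S f 0] by simp

text \<open>Products, inverses and norms are differentiable only away from the origin, while the recursion that
  defines $C^k$ differentiates a function that is total. Values outside an open set must therefore
  be irrelevant.\<close>

lemma frechet_derivative_cong_open:
  assumes "open S" "p \<in> S" "\<And>x. x \<in> S \<Longrightarrow> f x = g x"
  shows "frechet_derivative f (at p) = frechet_derivative g (at p)"
proof -
  have "(f has_derivative D) (at p) \<longleftrightarrow> (g has_derivative D) (at p)" for D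
    using has_derivative_transform_within_open[of f D p UNIV S g]
      has_derivative_transform_within_open[of g D p UNIV S f] assms by auto
  then show ?thesis by (simp add: frechet_derivative_def)
qed

lemma Ck_on_cong:
  assumes "open S" "\<And>x. x \<in> S \<Longrightarrow> f x = g x" "Ck_on k S f"
  shows "Ck_on k S g"
  using assms(2,3)
proof (induction k arbitrary: f g)
  case 0
  then show ?case using continuous_on_cong[of S S f g] by auto
next
  case (Suc k)
  have d: "f differentiable (at p)" "g differentiable (at p)" if "p \<in> S" for p
    using that Suc.prems(2)
      has_derivative_transform_within_open[of f _ p UNIV S g, OF _ assms(1) that Suc.prems(1)]
    unfolding differentiable_def Ck_on.simps by blast+
  have "Ck_on k S (\<lambda>p. frechet_derivative g (at p) v)" for v
  proof (rule Suc.IH)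
    show "Ck_on k S (\<lambda>p. frechet_derivative f (at p) v)" using Suc.prems(2) by simp
    show "frechet_derivative f (at p) v = frechet_derivative g (at p) v" if "p \<in> S" for p
      using frechet_derivative_cong_open[OF assms(1) that Suc.prems(1)] by (rule fun_cong)
  qed
  then show ?case using d by simp
qed

text \<open>The form in which membership in $C^{k+1}$ is established below: it is enough to know some
  derivative of the function and to see that it is of class $C^k$.\<close>

lemma Ck_on_SucI:
  assumes "open S" "\<And>p. p \<in> S \<Longrightarrow> (f has_derivative D p) (at p)"
    "\<And>v. Ck_on k S (\<lambda>p. D p v)"
  shows "Ck_on (Suc k) S f"
proof -
  have "D p = frechet_derivative f (at p)" if "p \<in> S" for p
    using frechet_derivative_at assms(2) that by blast
  then have "Ck_on k S (\<lambda>p. frechet_derivative f (at p) v)" for v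
    using Ck_on_cong[OF assms(1) _ assms(3), of v "\<lambda>p. frechet_derivative f (at p) v"] by simp
  then show ?thesis using assms(2) by (auto simp: differentiable_def)
qed

lemma Ck_on_has_derivative:
  "Ck_on (Suc k) S f \<Longrightarrow> p \<in> S \<Longrightarrow> (f has_derivative frechet_derivative f (at p)) (at p)"
  by (simp add: frechet_derivative_works)

lemma Ck_on_frechet: "Ck_on (Suc k) S f \<Longrightarrow> Ck_on k S (\<lambda>p. frechet_derivative f (at p) v)"
  by simp

lemma Ck_on_const: "open S \<Longrightarrow> Ck_on k S (\<lambda>_. c)"
proof (induction k arbitrary: c)
  case (Suc k)
  then show ?case by (intro Ck_on_SucI[where D="\<lambda>_ _. 0"]) auto
qed simp

lemma Ck_on_bounded_linear: "open S \<Longrightarrow> bounded_linear f \<Longrightarrow> Ck_on k S f"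
proof (cases k)
  case (Suc n)
  assume "open S" "bounded_linear f"
  then show ?thesis unfolding Suc
    by (intro Ck_on_SucI[where D="\<lambda>_. f"] Ck_on_const bounded_linear_imp_has_derivative) auto
qed (simp add: linear_continuous_on)

lemma Ck_on_add:
  assumes "open S" shows "Ck_on k S f \<Longrightarrow> Ck_on k S g \<Longrightarrow> Ck_on k S (\<lambda>p. f p + g p)"
proof (induction k arbitrary: f g)
  case (Suc k)
  show ?case
    by (rule Ck_on_SucI[OF assms has_derivative_add[OF Ck_on_has_derivative[OF Suc.prems(1)]
              Ck_on_has_derivative[OF Suc.prems(2)]]])
      (assumption | intro Suc.IH Ck_on_frechet Suc.prems)+
qed (auto intro: continuous_on_add)

lemma Ck_on_mult:
  fixes f g :: "'a::real_normed_vector \<Rightarrow> real"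
  assumes "open S" shows "Ck_on k S f \<Longrightarrow> Ck_on k S g \<Longrightarrow> Ck_on k S (\<lambda>p. f p * g p)"
proof (induction k arbitrary: f g)
  case (Suc k)
  have "Ck_on k S f" "Ck_on k S g" using Suc.prems Ck_on_SucD by blast+
  then show ?case
    by (intro Ck_on_SucI[OF assms has_derivative_mult[OF Ck_on_has_derivative[OF Suc.prems(1)]
              Ck_on_has_derivative[OF Suc.prems(2)]]] Ck_on_add[OF assms] Suc.IH Ck_on_frechet Suc.prems)
qed (auto intro: continuous_on_mult)

lemma Ck_on_diff:
  fixes f g :: "'a::real_normed_vector \<Rightarrow> real"
  assumes "open S" "Ck_on k S f" "Ck_on k S g" shows "Ck_on k S (\<lambda>p. f p - g p)"
  using Ck_on_add[OF assms(1,2) Ck_on_mult[OF assms(1) Ck_on_const[OF assms(1), of _ "-1"] assms(3)]]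
  by simp

lemma Ck_on_sum:
  assumes "open S" "\<And>i. i \<in> I \<Longrightarrow> Ck_on k S (f i)" shows "Ck_on k S (\<lambda>p. \<Sum>i\<in>I. f i p)"
  using assms(2)
  by (induction I rule: infinite_finite_induct) (auto intro: Ck_on_const Ck_on_add assms(1))

text \<open>The derivative of \<open>1/f\<close> is \<open>- f'/f\<^sup>2\<close>, which contains \<open>1/f\<close> again, so the induction on \<open>k\<close> feeds on itself.\<close>

lemma Ck_on_inverse:
  fixes f :: "'a::real_normed_vector \<Rightarrow> real"
  assumes "open S" "\<And>p. p \<in> S \<Longrightarrow> f p \<noteq> 0"
  shows "Ck_on k S f \<Longrightarrow> Ck_on k S (\<lambda>p. inverse (f p))"
proof (induction k)
  case (Suc k)
  have *: "Ck_on k S f" using Suc.prems Ck_on_SucD by blast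
  have neg: "(\<lambda>p. - (inverse (f p) * frechet_derivative f (at p) v * inverse (f p)))
      = (\<lambda>p. (- 1) * (inverse (f p) * frechet_derivative f (at p) v * inverse (f p)))" for v
    by simp
  have "Ck_on k S (\<lambda>p. (- 1) * (inverse (f p) * frechet_derivative f (at p) v * inverse (f p)))" for v
    by (intro Ck_on_mult Ck_on_const assms(1) Suc.IH * Ck_on_frechet[OF Suc.prems])
  then have "Ck_on k S (\<lambda>p. - (inverse (f p) * frechet_derivative f (at p) v * inverse (f p)))" for v
    unfolding neg .
  with assms(2) show ?case
    by - (rule Ck_on_SucI[OF assms(1) Deriv.has_derivative_inverse[OF assms(2)
            Ck_on_has_derivative[OF Suc.prems]]])
qed (auto intro!: continuous_on_inverse assms(2))

lemma Ck_on_norm: "Ck_on k (- {0::real^'d}) norm"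
proof (induction k)
  case (Suc k)
  have "Ck_on k (- {0::real^'d}) (\<lambda>p. (v \<bullet> p) * inverse (norm p))" for v
    by (intro Ck_on_mult Ck_on_inverse Suc Ck_on_bounded_linear bounded_linear_inner_right) auto
  then have "Ck_on k (- {0::real^'d}) (\<lambda>p. v \<bullet> sgn p)" for v
    by (simp add: sgn_div_norm mult.commute)
  then show ?case using has_derivative_norm by (intro Ck_on_SucI[where D="\<lambda>p v. v \<bullet> sgn p"]) auto
qed (simp add: continuous_on_norm_id)

section \<open>Taylor remainders away from the origin\<close>

definition pd :: "'d \<Rightarrow> (real^'d \<Rightarrow> real) \<Rightarrow> real^'d \<Rightarrow> real" where
  "pd i G p = frechet_derivative G (at p) (axis i 1)"

lemma Ck_on_pd: "Ck_on (Suc k) S G \<Longrightarrow> Ck_on k S (pd i G)"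
  unfolding pd_def[abs_def] by (rule Ck_on_frechet)

lemma frechet_derivative_pd:
  fixes G :: "real^'d \<Rightarrow> real"
  assumes "G differentiable (at p)"
  shows "frechet_derivative G (at p) v = (\<Sum>i\<in>UNIV. v $ i * pd i G p)"
proof -
  have lin: "linear (frechet_derivative G (at p))"
    using assms linear_frechet_derivative by blast
  have "frechet_derivative G (at p) v = frechet_derivative G (at p) (\<Sum>i\<in>UNIV. (v $ i) *\<^sub>R axis i 1)"
    using basis_expansion[of v] by (simp add: scalar_mult_eq_scaleR)
  also have "\<dots> = (\<Sum>i\<in>UNIV. v $ i * pd i G p)"
    by (simp add: linear_sum[OF lin] linear_scale[OF lin] pd_def)
  finally show ?thesis .
qed

lemma Ck_on_has_derivative_pd:
  fixes G :: "real^'d \<Rightarrow> real"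
  assumes "Ck_on (Suc k) S G" "p \<in> S"
  shows "(G has_derivative (\<lambda>v. \<Sum>i\<in>UNIV. v $ i * pd i G p)) (at p)"
proof -
  have "frechet_derivative G (at p) = (\<lambda>v. \<Sum>i\<in>UNIV. v $ i * pd i G p)"
    using assms by (intro ext frechet_derivative_pd) auto
  then show ?thesis using Ck_on_has_derivative[OF assms] by simp
qed

lemma DERIV_along_line:
  fixes G :: "real^'d \<Rightarrow> real"
  assumes "Ck_on (Suc k) (- {0}) G" "P + s *\<^sub>R u \<noteq> 0"
  shows "((\<lambda>s. G (P + s *\<^sub>R u)) has_real_derivative (\<Sum>i\<in>UNIV. u $ i * pd i G (P + s *\<^sub>R u))) (at s)"
proof -
  have "((\<lambda>s. P + s *\<^sub>R u) has_derivative (\<lambda>t. t *\<^sub>R u)) (at s)"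
    by (auto intro!: derivative_eq_intros)
  from has_derivative_compose[OF this Ck_on_has_derivative_pd[OF assms(1), of "P + s *\<^sub>R u"]] assms(2)
  have "((\<lambda>s. G (P + s *\<^sub>R u)) has_derivative (\<lambda>t. \<Sum>i\<in>UNIV. (t *\<^sub>R u) $ i * pd i G (P + s *\<^sub>R u))) (at s)"
    by simp
  moreover have "(\<lambda>t. \<Sum>i\<in>UNIV. (t *\<^sub>R u) $ i * pd i G (P + s *\<^sub>R u)) = (*) (\<Sum>i\<in>UNIV. u $ i * pd i G (P + s *\<^sub>R u))"
    by (simp add: fun_eq_iff sum_distrib_left mult_ac)
  ultimately show ?thesis by (simp add: has_field_derivative_def)
qed

definition annulus :: "real \<Rightarrow> real \<Rightarrow> (real^'d) set" where
  "annulus a b = {p. a \<le> norm p \<and> norm p \<le> b}"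

lemma compact_annulus: "compact (annulus a b :: (real^'d) set)"
proof -
  have "(annulus a b :: (real^'d) set) = cball 0 b \<inter> (- ball 0 a)" by (auto simp: annulus_def)
  then show ?thesis by (auto simp: closed_Compl intro!: compact_Int_closed)
qed

lemma annulus_nonzero: "p \<in> annulus a b \<Longrightarrow> 0 < a \<Longrightarrow> p \<noteq> 0"
  by (auto simp: annulus_def)

lemma abs_sum_prods_le:
  fixes x y z w v :: real
  shows "\<bar>x * y + z * w\<bar> \<le> \<bar>x\<bar> * \<bar>y\<bar> + \<bar>z\<bar> * \<bar>w\<bar>"
    "\<bar>x * y + z * w * v\<bar> \<le> \<bar>x\<bar> * \<bar>y\<bar> + \<bar>z\<bar> * \<bar>w\<bar> * \<bar>v\<bar>"
  using abs_triangle_ineq[of "x * y" "z * w"] abs_triangle_ineq[of "x * y" "z * w * v"]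
  by (simp_all add: abs_mult)

lemma norm_vec_le:
  fixes v :: "real^'d" and b :: real assumes "\<And>i. \<bar>v $ i\<bar> \<le> b"
  shows "norm v \<le> CARD('d) * b"
  using norm_le_l1_cart[of v] sum_bounded_above[of UNIV "\<lambda>i. \<bar>v $ i\<bar>" b] assms by force

lemma abs_sum_card_le:
  fixes f :: "'d::finite \<Rightarrow> real" and b :: real
  assumes "\<And>i. \<bar>f i\<bar> \<le> b" shows "\<bar>\<Sum>i\<in>UNIV. f i\<bar> \<le> CARD('d) * b"
proof -
  have "\<bar>\<Sum>i\<in>UNIV. f i\<bar> \<le> (\<Sum>i\<in>UNIV. \<bar>f i\<bar>)" by (rule sum_abs)
  also have "\<dots> \<le> (\<Sum>i\<in>(UNIV :: 'd set). b)" using assms by (intro sum_mono)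
  finally show ?thesis by simp
qed

lemma norm_matvec_le:
  fixes M :: "real^'d^'d" and b :: real assumes "\<And>i j. \<bar>M $ i $ j\<bar> \<le> b"
  shows "norm (M *v y) \<le> (real CARD('d))\<^sup>2 * b * norm y"
proof -
  have b: "0 \<le> b" using assms[of undefined undefined] by simp
  have "\<bar>(M *v y) $ i\<bar> \<le> CARD('d) * (b * norm y)" for i
    unfolding matrix_vector_mult_def vec_lambda_beta
    by (rule abs_sum_card_le) (simp add: abs_mult mult_mono assms b component_le_norm_cart)
  from norm_vec_le[of "M *v y", OF this] show ?thesis by (simp add: power2_eq_square mult_ac)
qed

text \<open>Boundedness comes from compactness. The Lipschitz bound is claimed only for points whose segment stays
  in the annulus, since the annulus is not convex.\<close>

lemma C1_bounds_on_annulus: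
  fixes G :: "real^'d \<Rightarrow> real"
  assumes G: "Ck_on (Suc k) (- {0}) G" and a: "0 < a"
  obtains B where "0 \<le> B" "\<And>p. p \<in> annulus a b \<Longrightarrow> \<bar>G p\<bar> \<le> B"
    "\<And>p q. closed_segment p q \<subseteq> annulus a b \<Longrightarrow> \<bar>G p - G q\<bar> \<le> B * norm (p - q)"
proof -
  have bd: "\<exists>B\<ge>0. \<forall>p\<in>annulus a b. \<bar>g p\<bar> \<le> B" if "continuous_on (- {0}) g" for g :: "real^'d \<Rightarrow> real"
  proof -
    have "continuous_on (annulus a b) g"
      by (rule continuous_on_subset[OF that]) (use annulus_nonzero[OF _ a] in auto)
    then have "bounded (g ` annulus a b)"
      by (simp add: compact_annulus compact_continuous_image compact_imp_bounded)
    then show ?thesis by (auto simp: bounded_pos intro: less_imp_le)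
  qed
  have cont: "continuous_on (- {0}) (pd i G)" for i
    using Ck_on_continuous Ck_on_pd[OF G] by blast
  obtain B0 where B0: "B0 \<ge> 0" "\<And>p. p \<in> annulus a b \<Longrightarrow> \<bar>G p\<bar> \<le> B0"
    using bd[OF Ck_on_continuous[OF G]] by blast
  have "\<forall>i. \<exists>B\<ge>0. \<forall>p\<in>annulus a b. \<bar>pd i G p\<bar> \<le> B" using bd cont by blast
  then obtain B1 where B1: "\<And>i. B1 i \<ge> 0" "\<And>i p. p \<in> annulus a b \<Longrightarrow> \<bar>pd i G p\<bar> \<le> B1 i" by metis
  define B where "B = (\<Sum>i\<in>UNIV. B1 i)"
  have B1B: "0 \<le> B" by (auto simp: B_def B1 intro: sum_nonneg)
  have "\<bar>G p - G q\<bar> \<le> B * norm (p - q)" if seg: "closed_segment p q \<subseteq> annulus a b" for p q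
  proof -
    have "norm (G p - G q) \<le> B * norm (p - q)"
    proof (rule differentiable_bound)
      show "convex (closed_segment p q)" by simp
      fix x assume x: "x \<in> closed_segment p q"
      then have xa: "x \<in> annulus a b" using seg by auto
      then have "x \<in> - {0}" using annulus_nonzero[OF _ a] by auto
      from Ck_on_has_derivative_pd[OF G this]
      show "(G has_derivative (\<lambda>v. \<Sum>i\<in>UNIV. v $ i * pd i G x)) (at x within closed_segment p q)"
        by (rule has_derivative_at_withinI)
      show "onorm (\<lambda>v. \<Sum>i\<in>UNIV. v $ i * pd i G x) \<le> B"
      proof (rule onorm_le)
        fix v :: "real^'d"
        have "\<bar>\<Sum>i\<in>UNIV. v $ i * pd i G x\<bar> \<le> (\<Sum>i\<in>UNIV. \<bar>v $ i * pd i G x\<bar>)" by (rule sum_abs)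
        also have "\<dots> \<le> (\<Sum>i\<in>UNIV. norm v * B1 i)"
          by (intro sum_mono) (simp add: abs_mult mult_mono component_le_norm_cart B1 xa)
        finally show "norm (\<Sum>i\<in>UNIV. v $ i * pd i G x) \<le> B * norm v"
          by (simp add: B_def sum_distrib_left mult.commute)
      qed
    qed auto
    then show ?thesis by simp
  qed
  note lip = this
  show ?thesis
  proof (rule that[of "B0 + B"])
    show "0 \<le> B0 + B" using B0 B1B by simp
    show "\<bar>G p\<bar> \<le> B0 + B" if "p \<in> annulus a b" for p using B0(2)[OF that] B1B by simp
    show "\<bar>G p - G q\<bar> \<le> (B0 + B) * norm (p - q)" if "closed_segment p q \<subseteq> annulus a b" for p q
      using lip[OF that] mult_nonneg_nonneg[OF B0(1) norm_ge_zero[of "p - q"]] by (simp add: distrib_right)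
  qed
qed

text \<open>All estimates of nonlinear terms below are made with one constant \<open>B\<close> that controls a function
  and its first and second derivatives, and their Lipschitz constants, on an annulus.\<close>

definition C3_bound :: "real \<Rightarrow> real \<Rightarrow> real \<Rightarrow> (real^'d \<Rightarrow> real) \<Rightarrow> bool" where
  "C3_bound a b B G \<longleftrightarrow> 0 < a \<and> 0 \<le> B \<and> Ck_on 3 (- {0}) G \<and>
     (\<forall>g \<in> insert G (range (\<lambda>i. pd i G) \<union> range (\<lambda>(i, j). pd j (pd i G))).
        (\<forall>p\<in>annulus a b. \<bar>g p\<bar> \<le> B) \<and>
        (\<forall>p q. closed_segment p q \<subseteq> annulus a b \<longrightarrow> \<bar>g p - g q\<bar> \<le> B * norm (p - q)))"

lemma C3_bound_mono:
  assumes "C3_bound a b B G" "B \<le> B'" shows "C3_bound a b B' G"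
proof -
  have le: "B * norm (p - q) \<le> B' * norm (p - q)" for p q :: "real^'a"
    using assms(2) by (simp add: mult_right_mono)
  show ?thesis
    using assms order_trans[OF _ assms(2)] order_trans[OF _ le] unfolding C3_bound_def by blast
qed

lemma C3_bound_exists:
  fixes G :: "real^'d \<Rightarrow> real"
  assumes G: "Ck_on 3 (- {0}) G" and a: "0 < a"
  shows "\<exists>B. C3_bound a b B G"
proof -
  define F where "F = insert G (range (\<lambda>i. pd i G) \<union> range (\<lambda>(i, j). pd j (pd i G)))"
  have fin: "finite F" by (simp add: F_def)
  have G': "Ck_on (Suc (Suc (Suc 0))) (- {0}) G" using G by (simp add: numeral_3_eq_3)
  have C1: "Ck_on (Suc 0) (- {0}) g" if "g \<in> F" for g
    using that Ck_on_mono[OF G, of "Suc 0"] Ck_on_SucD[OF Ck_on_pd[OF G']] Ck_on_pd[OF Ck_on_pd[OF G']]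
    unfolding F_def by (auto simp del: Ck_on.simps)
  have "\<exists>B\<ge>0. (\<forall>p\<in>annulus a b. \<bar>g p\<bar> \<le> B) \<and>
        (\<forall>p q. closed_segment p q \<subseteq> annulus a b \<longrightarrow> \<bar>g p - g q\<bar> \<le> B * norm (p - q))" if "g \<in> F" for g
    using C1_bounds_on_annulus[OF C1[OF that] a, of b] by metis
  then obtain B where B: "\<And>g. g \<in> F \<Longrightarrow> B g \<ge> 0" "\<And>g p. g \<in> F \<Longrightarrow> p \<in> annulus a b \<Longrightarrow> \<bar>g p\<bar> \<le> B g"
    "\<And>g p q. g \<in> F \<Longrightarrow> closed_segment p q \<subseteq> annulus a b \<Longrightarrow> \<bar>g p - g q\<bar> \<le> B g * norm (p - q)"
    by metis
  define B' where "B' = sum B F"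
  have le: "B g \<le> B'" if "g \<in> F" for g
    unfolding B'_def by (rule member_le_sum[OF that _ fin]) (simp add: B(1))
  then have "B g * norm (p - q) \<le> B' * norm (p - q)" if "g \<in> F" for g and p q :: "real^'d"
    using that by (simp add: mult_right_mono)
  then have "C3_bound a b B' G"
    unfolding C3_bound_def F_def[symmetric]
    using G a order_trans[OF B(2) le] order_trans[OF B(3)] sum_nonneg[of F B, OF B(1)]
    unfolding B'_def[symmetric] by blast
  then show ?thesis by blast
qed

lemma C3_boundD:
  assumes "C3_bound a b B G"
  shows "0 < a" "0 \<le> B" "Ck_on (Suc (Suc (Suc 0))) (- {0}) G"
    "p \<in> annulus a b \<Longrightarrow> \<bar>G p\<bar> \<le> B" "p \<in> annulus a b \<Longrightarrow> \<bar>pd i G p\<bar> \<le> B"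
    "p \<in> annulus a b \<Longrightarrow> \<bar>pd j (pd i G) p\<bar> \<le> B"
    "closed_segment p q \<subseteq> annulus a b \<Longrightarrow> \<bar>G p - G q\<bar> \<le> B * norm (p - q)"
    "closed_segment p q \<subseteq> annulus a b \<Longrightarrow> \<bar>pd i G p - pd i G q\<bar> \<le> B * norm (p - q)"
    "closed_segment p q \<subseteq> annulus a b \<Longrightarrow> \<bar>pd j (pd i G) p - pd j (pd i G) q\<bar> \<le> B * norm (p - q)"
proof -
  define F where "F = insert G (range (\<lambda>i. pd i G) \<union> range (\<lambda>(i, j). pd j (pd i G)))"
  have F: "G \<in> F" "pd i G \<in> F" "pd j (pd i G) \<in> F"
    unfolding F_def by (auto intro: image_eqI[where x="(i, j)"])
  note * = assms[unfolded C3_bound_def F_def[symmetric]]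
  show "0 < a" "0 \<le> B" "Ck_on (Suc (Suc (Suc 0))) (- {0}) G"
    using * by (simp_all add: numeral_3_eq_3 del: Ck_on.simps)
  show "p \<in> annulus a b \<Longrightarrow> \<bar>G p\<bar> \<le> B" "p \<in> annulus a b \<Longrightarrow> \<bar>pd i G p\<bar> \<le> B"
    "p \<in> annulus a b \<Longrightarrow> \<bar>pd j (pd i G) p\<bar> \<le> B"
    "closed_segment p q \<subseteq> annulus a b \<Longrightarrow> \<bar>G p - G q\<bar> \<le> B * norm (p - q)"
    "closed_segment p q \<subseteq> annulus a b \<Longrightarrow> \<bar>pd i G p - pd i G q\<bar> \<le> B * norm (p - q)"
    "closed_segment p q \<subseteq> annulus a b \<Longrightarrow> \<bar>pd j (pd i G) p - pd j (pd i G) q\<bar> \<le> B * norm (p - q)"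
    using * F by blast+
qed

text \<open>The multivariate remainders below are reduced to this one along segments.\<close>

lemma real_taylor_remainder:
  fixes F F' F'' :: "real \<Rightarrow> real"
  assumes "\<And>s. s \<in> {0..1} \<Longrightarrow> (F has_real_derivative F' s) (at s)"
    "\<And>s. s \<in> {0..1} \<Longrightarrow> (F' has_real_derivative F'' s) (at s)"
    "\<And>s. s \<in> {0..1} \<Longrightarrow> \<bar>F'' s\<bar> \<le> C"
  shows "\<bar>F 1 - F 0 - F' 0\<bar> \<le> C"
proof -
  obtain z where z: "0 < z" "z < 1" "F 1 - F 0 = (1 - 0) * F' z"
    using MVT2[of 0 1 F F'] assms(1) by auto
  obtain y where y: "0 < y" "y < z" "F' z - F' 0 = (z - 0) * F'' y"
    using MVT2[of 0 z F' F''] assms(2) z by auto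
  have "\<bar>F 1 - F 0 - F' 0\<bar> = z * \<bar>F'' y\<bar>" using z y by (simp add: abs_mult)
  also have "\<dots> \<le> 1 * C" using z y assms(3)[of y] by (intro mult_mono) auto
  finally show ?thesis by simp
qed

definition taylor1 :: "(real^'d \<Rightarrow> real) \<Rightarrow> real^'d \<Rightarrow> real^'d \<Rightarrow> real" where
  "taylor1 G P p = G p - G P - (\<Sum>i\<in>UNIV. (p - P) $ i * pd i G P)"

lemma segment_point_in:
  assumes "convex S" "P \<in> S" "p \<in> S" "s \<in> {0..1::real}" shows "P + s *\<^sub>R (p - P) \<in> S"
  using convexD_alt[OF assms(1-3), of s] assms(4) by (simp add: algebra_simps)

lemma closed_segment_sub: "convex S \<Longrightarrow> S \<subseteq> A \<Longrightarrow> p \<in> S \<Longrightarrow> q \<in> S \<Longrightarrow> closed_segment p q \<subseteq> A"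
  using closed_segment_subset by fastforce

text \<open>Remainders taken at two different times have to be compared at the rate of the time increment without
  losing the quadratic smallness in \<open>p - P\<close>. Along the two segments, run through simultaneously, the
  difference of the remainders is the remainder of one function of the parameter, whose second
  derivative is a difference of quadratic forms.\<close>

lemma taylor1_difference:
  fixes G :: "real^'d \<Rightarrow> real" and B :: real
  assumes GB: "C3_bound a b B G" and S: "convex S" "S \<subseteq> annulus a b"
    and pts: "P \<in> S" "p \<in> S" "R \<in> S" "r \<in> S"
  defines "u \<equiv> p - P" and "v \<equiv> r - R"
  shows "\<bar>taylor1 G R r - taylor1 G P p\<bar> \<le> (real CARD('d))\<^sup>2 * B *
    (norm (v - u) * (norm v + norm u) + (norm (R - P) + norm (v - u)) * (norm u)\<^sup>2)"
proof -
  note D = C3_boundD[OF GB]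
  let ?k = "\<lambda>s. P + s *\<^sub>R u" and ?l = "\<lambda>s. R + s *\<^sub>R v"
  have k: "?k s \<in> S" "?l s \<in> S" if "s \<in> {0..1}" for s
    using segment_point_in[OF S(1)] pts that by (auto simp: u_def v_def)
  then have kA: "?k s \<in> annulus a b" "?l s \<in> annulus a b" if "s \<in> {0..1}" for s using that S(2) by auto
  have nz: "?k s \<noteq> 0" "?l s \<noteq> 0" if "s \<in> {0..1}" for s using kA[OF that] annulus_nonzero[OF _ D(1)] by auto
  define F where "F s = G (?l s) - G (?k s)" for s
  define F' where "F' s = (\<Sum>i\<in>UNIV. v $ i * pd i G (?l s)) - (\<Sum>i\<in>UNIV. u $ i * pd i G (?k s))" for s
  define F'' where "F'' s = (\<Sum>i\<in>UNIV. v $ i * (\<Sum>j\<in>UNIV. v $ j * pd j (pd i G) (?l s)))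
      - (\<Sum>i\<in>UNIV. u $ i * (\<Sum>j\<in>UNIV. u $ j * pd j (pd i G) (?k s)))" for s
  have "\<bar>F 1 - F 0 - F' 0\<bar> \<le> (real CARD('d))\<^sup>2 * B *
    (norm (v - u) * (norm v + norm u) + (norm (R - P) + norm (v - u)) * (norm u)\<^sup>2)"
  proof (rule real_taylor_remainder)
    fix s :: real assume s: "s \<in> {0..1}"
    show "(F has_real_derivative F' s) (at s)"
      unfolding F_def F'_def by (intro DERIV_diff DERIV_along_line[OF D(3)] nz s)
    show "(F' has_real_derivative F'' s) (at s)"
      unfolding F'_def F''_def
      by (intro DERIV_diff DERIV_sum DERIV_cmult DERIV_along_line[OF Ck_on_pd[OF D(3)]] nz s)
    have eq: "F'' s = (\<Sum>i\<in>UNIV. \<Sum>j\<in>UNIV. v $ i * v $ j * pd j (pd i G) (?l s) - u $ i * u $ j * pd j (pd i G) (?k s))"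
      unfolding F''_def by (simp add: sum_distrib_left sum_subtractf mult_ac)
    have kl: "norm (?l s - ?k s) \<le> norm (R - P) + norm (v - u)"
    proof -
      have "?l s - ?k s = (R - P) + s *\<^sub>R (v - u)" by (simp add: algebra_simps)
      then have "norm (?l s - ?k s) \<le> norm (R - P) + norm (s *\<^sub>R (v - u))" using norm_triangle_ineq by metis
      also have "norm (s *\<^sub>R (v - u)) \<le> norm (v - u)" using s by (simp add: mult_left_le_one_le)
      finally show ?thesis by simp
    qed
    have "\<bar>v $ i * v $ j * pd j (pd i G) (?l s) - u $ i * u $ j * pd j (pd i G) (?k s)\<bar>
      \<le> B * (norm (v - u) * (norm v + norm u) + (norm (R - P) + norm (v - u)) * (norm u)\<^sup>2)" for i j
    proof -
      let ?g = "pd j (pd i G)"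
      have "v $ i * v $ j * ?g (?l s) - u $ i * u $ j * ?g (?k s)
        = ((v - u) $ i * v $ j + u $ i * (v - u) $ j) * ?g (?l s) + u $ i * u $ j * (?g (?l s) - ?g (?k s))"
        by (simp add: algebra_simps)
      also have "\<bar>\<dots>\<bar> \<le> \<bar>(v - u) $ i * v $ j + u $ i * (v - u) $ j\<bar> * \<bar>?g (?l s)\<bar> + \<bar>u $ i\<bar> * \<bar>u $ j\<bar> * \<bar>?g (?l s) - ?g (?k s)\<bar>"
        by (rule abs_sum_prods_le)
      also have "\<bar>(v - u) $ i * v $ j + u $ i * (v - u) $ j\<bar> * \<bar>?g (?l s)\<bar> \<le> (norm (v - u) * norm v + norm u * norm (v - u)) * B"
      proof (rule mult_mono)
        have "\<bar>(v - u) $ i * v $ j + u $ i * (v - u) $ j\<bar> \<le> \<bar>(v - u) $ i\<bar> * \<bar>v $ j\<bar> + \<bar>u $ i\<bar> * \<bar>(v - u) $ j\<bar>"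
          by (rule abs_sum_prods_le)
        also have "\<dots> \<le> norm (v - u) * norm v + norm u * norm (v - u)"
          by (intro add_mono mult_mono component_le_norm_cart) auto
        finally show "\<bar>(v - u) $ i * v $ j + u $ i * (v - u) $ j\<bar> \<le> norm (v - u) * norm v + norm u * norm (v - u)" .
        show "\<bar>?g (?l s)\<bar> \<le> B" using D(6) kA(2)[OF s] by blast
      qed auto
      also have "\<bar>u $ i\<bar> * \<bar>u $ j\<bar> * \<bar>?g (?l s) - ?g (?k s)\<bar> \<le> norm u * norm u * (B * (norm (R - P) + norm (v - u)))"
      proof (intro mult_mono component_le_norm_cart)
        have "\<bar>?g (?l s) - ?g (?k s)\<bar> \<le> B * norm (?l s - ?k s)"
          using D(9) closed_segment_sub[OF S k(2)[OF s] k(1)[OF s]] by blast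
        also have "\<dots> \<le> B * (norm (R - P) + norm (v - u))" using kl D(2) by (rule mult_left_mono)
        finally show "\<bar>?g (?l s) - ?g (?k s)\<bar> \<le> B * (norm (R - P) + norm (v - u))" .
      qed auto
      finally show ?thesis by (simp add: algebra_simps power2_eq_square)
    qed
    then have "\<bar>F'' s\<bar> \<le> CARD('d) * (CARD('d) * (B * (norm (v - u) * (norm v + norm u) + (norm (R - P) + norm (v - u)) * (norm u)\<^sup>2)))"
      unfolding eq by (intro abs_sum_card_le)
    then show "\<bar>F'' s\<bar> \<le> (real CARD('d))\<^sup>2 * B * (norm (v - u) * (norm v + norm u) + (norm (R - P) + norm (v - u)) * (norm u)\<^sup>2)"
      by (simp add: power2_eq_square mult_ac)
  qed
  moreover have "F 1 - F 0 - F' 0 = taylor1 G R r - taylor1 G P p"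
    by (simp add: F_def F'_def taylor1_def u_def v_def)
  ultimately show ?thesis by simp
qed

lemma taylor1_bound:
  fixes G :: "real^'d \<Rightarrow> real" and B :: real
  assumes GB: "C3_bound a b B G" and S: "convex S" "S \<subseteq> annulus a b" and pts: "P \<in> S" "p \<in> S"
  shows "\<bar>taylor1 G P p\<bar> \<le> (real CARD('d))\<^sup>2 * B * (norm (p - P))\<^sup>2"
proof -
  note D = C3_boundD[OF GB]
  let ?u = "p - P"
  let ?k = "\<lambda>s. P + s *\<^sub>R ?u"
  have kA: "?k s \<in> annulus a b" if "s \<in> {0..1}" for s
    using segment_point_in[OF S(1) pts that] S(2) by auto
  have nz: "?k s \<noteq> 0" if "s \<in> {0..1}" for s using kA[OF that] annulus_nonzero[OF _ D(1)] by auto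
  define F where "F s = G (?k s)" for s
  define F' where "F' s = (\<Sum>i\<in>UNIV. ?u $ i * pd i G (?k s))" for s
  define F'' where "F'' s = (\<Sum>i\<in>UNIV. ?u $ i * (\<Sum>j\<in>UNIV. ?u $ j * pd j (pd i G) (?k s)))" for s
  have "\<bar>F 1 - F 0 - F' 0\<bar> \<le> (real CARD('d))\<^sup>2 * B * (norm (p - P))\<^sup>2"
  proof (rule real_taylor_remainder)
    fix s :: real assume s: "s \<in> {0..1}"
    show "(F has_real_derivative F' s) (at s)"
      unfolding F_def F'_def by (intro DERIV_along_line[OF D(3)] nz s)
    show "(F' has_real_derivative F'' s) (at s)"
      unfolding F'_def F''_def
      by (intro DERIV_sum DERIV_cmult DERIV_along_line[OF Ck_on_pd[OF D(3)]] nz s)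
    have "\<bar>\<Sum>j\<in>UNIV. ?u $ j * pd j (pd i G) (?k s)\<bar> \<le> CARD('d) * (norm ?u * B)" for i
      by (rule abs_sum_card_le, unfold abs_mult)
        (intro mult_mono component_le_norm_cart D(6) kA s norm_ge_zero abs_ge_zero)
    then have "\<bar>?u $ i * (\<Sum>j\<in>UNIV. ?u $ j * pd j (pd i G) (?k s))\<bar> \<le> norm ?u * (CARD('d) * (norm ?u * B))" for i
      unfolding abs_mult by (intro mult_mono component_le_norm_cart norm_ge_zero abs_ge_zero)
    then have "\<bar>F'' s\<bar> \<le> CARD('d) * (norm ?u * (CARD('d) * (norm ?u * B)))"
      unfolding F''_def by (rule abs_sum_card_le)
    then show "\<bar>F'' s\<bar> \<le> (real CARD('d))\<^sup>2 * B * (norm (p - P))\<^sup>2" by (simp add: power2_eq_square mult_ac)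
  qed
  then show ?thesis by (simp add: F_def F'_def taylor1_def)
qed

text \<open>The zeroth-order analogue: the mean value theorem for the difference of \<open>G\<close> along two segments, run
  through simultaneously.\<close>

lemma difference_quadruple:
  fixes G :: "real^'d \<Rightarrow> real" and B :: real
  assumes GB: "C3_bound a b B G" and S: "convex S" "S \<subseteq> annulus a b"
    and pts: "P \<in> S" "p \<in> S" "R \<in> S" "r \<in> S"
  defines "u \<equiv> p - P" and "v \<equiv> r - R"
  shows "\<bar>(G r - G R) - (G p - G P)\<bar> \<le> CARD('d) * B * (norm (v - u) + (norm (R - P) + norm (v - u)) * norm u)"
proof -
  note D = C3_boundD[OF GB]
  let ?k = "\<lambda>s. P + s *\<^sub>R u" and ?l = "\<lambda>s. R + s *\<^sub>R v"
  have k: "?k s \<in> S" "?l s \<in> S" if "s \<in> {0..1}" for s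
    using segment_point_in[OF S(1)] pts that by (auto simp: u_def v_def)
  then have kA: "?k s \<in> annulus a b" "?l s \<in> annulus a b" if "s \<in> {0..1}" for s using that S(2) by auto
  have nz: "?k s \<noteq> 0" "?l s \<noteq> 0" if "s \<in> {0..1}" for s using kA[OF that] annulus_nonzero[OF _ D(1)] by auto
  define F where "F s = G (?l s) - G (?k s)" for s
  define F' where "F' s = (\<Sum>i\<in>UNIV. v $ i * pd i G (?l s)) - (\<Sum>i\<in>UNIV. u $ i * pd i G (?k s))" for s
  have dF: "(F has_real_derivative F' s) (at s)" if "s \<in> {0..1}" for s
    unfolding F_def F'_def by (intro DERIV_diff DERIV_along_line[OF D(3)] nz that)
  obtain s where s: "0 < s" "s < 1" "F 1 - F 0 = (1 - 0) * F' s"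
    using MVT2[of 0 1 F F'] dF by auto
  then have s01: "s \<in> {0..1}" by auto
  have kl: "norm (?l s - ?k s) \<le> norm (R - P) + norm (v - u)"
  proof -
    have "?l s - ?k s = (R - P) + s *\<^sub>R (v - u)" by (simp add: algebra_simps)
    then have "norm (?l s - ?k s) \<le> norm (R - P) + norm (s *\<^sub>R (v - u))" using norm_triangle_ineq by metis
    also have "norm (s *\<^sub>R (v - u)) \<le> norm (v - u)" using s by (simp add: mult_left_le_one_le)
    finally show ?thesis by simp
  qed
  have "\<bar>v $ i * pd i G (?l s) - u $ i * pd i G (?k s)\<bar>
      \<le> B * (norm (v - u) + (norm (R - P) + norm (v - u)) * norm u)" for i
  proof -
    let ?g = "pd i G"
    have "v $ i * ?g (?l s) - u $ i * ?g (?k s) = (v - u) $ i * ?g (?l s) + u $ i * (?g (?l s) - ?g (?k s))"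
      by (simp add: algebra_simps)
    also have "\<bar>\<dots>\<bar> \<le> \<bar>(v - u) $ i\<bar> * \<bar>?g (?l s)\<bar> + \<bar>u $ i\<bar> * \<bar>?g (?l s) - ?g (?k s)\<bar>"
      by (rule abs_sum_prods_le)
    also have "\<bar>(v - u) $ i\<bar> * \<bar>?g (?l s)\<bar> \<le> norm (v - u) * B"
      using D(5)[OF kA(2)[OF s01]] by (intro mult_mono component_le_norm_cart) auto
    also have "\<bar>u $ i\<bar> * \<bar>?g (?l s) - ?g (?k s)\<bar> \<le> norm u * (B * (norm (R - P) + norm (v - u)))"
    proof (intro mult_mono component_le_norm_cart)
      have "\<bar>?g (?l s) - ?g (?k s)\<bar> \<le> B * norm (?l s - ?k s)"
        using D(8) closed_segment_sub[OF S k(2)[OF s01] k(1)[OF s01]] by blast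
      also have "\<dots> \<le> B * (norm (R - P) + norm (v - u))" using kl D(2) by (rule mult_left_mono)
      finally show "\<bar>?g (?l s) - ?g (?k s)\<bar> \<le> B * (norm (R - P) + norm (v - u))" .
    qed auto
    finally show ?thesis by (simp add: algebra_simps)
  qed
  then have "\<bar>F' s\<bar> \<le> CARD('d) * (B * (norm (v - u) + (norm (R - P) + norm (v - u)) * norm u))"
    unfolding F'_def sum_subtractf[symmetric] by (rule abs_sum_card_le)
  moreover have "F 1 - F 0 = (G r - G R) - (G p - G P)" by (simp add: F_def u_def v_def)
  ultimately show ?thesis using s by (simp add: mult_ac)
qed

text \<open>The key to superconvergence: replacing a function on an interval by its mean value \<open>P\<close> inside a
  smooth nonlinearity costs, on average, only a second-order term, because the first-order Taylor term
  has integral zero.\<close>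

lemma jensen_defect_eq:
  fixes G :: "real^'d \<Rightarrow> real" and p :: "real \<Rightarrow> real^'d"
  assumes G: "Ck_on (Suc k) (- {0}) G" and ab: "\<alpha> \<le> \<beta>"
    and p: "continuous_on {\<alpha>..\<beta>} p" "\<And>\<rho>. \<rho> \<in> {\<alpha>..\<beta>} \<Longrightarrow> p \<rho> \<noteq> 0"
    and P: "integral {\<alpha>..\<beta>} p = (\<beta> - \<alpha>) *\<^sub>R P"
  shows "integral {\<alpha>..\<beta>} (\<lambda>\<rho>. G (p \<rho>)) - (\<beta> - \<alpha>) * G P = integral {\<alpha>..\<beta>} (\<lambda>\<rho>. taylor1 G P (p \<rho>))"
    "continuous_on {\<alpha>..\<beta>} (\<lambda>\<rho>. taylor1 G P (p \<rho>))"
proof -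
  have cG: "continuous_on {\<alpha>..\<beta>} (\<lambda>\<rho>. G (p \<rho>))"
    using Ck_on_continuous[OF G] p by (auto intro: continuous_on_compose2)
  then show "continuous_on {\<alpha>..\<beta>} (\<lambda>\<rho>. taylor1 G P (p \<rho>))"
    unfolding taylor1_def using p(1) by (intro continuous_intros) auto
  have int: "(p has_integral ((\<beta> - \<alpha>) *\<^sub>R P)) {\<alpha>..\<beta>}"
    using P integrable_integral[OF integrable_continuous_real[OF p(1)]] by simp
  have "((\<lambda>\<rho>. (\<Sum>i\<in>UNIV. (p \<rho> - P) $ i * pd i G P)) has_integral (\<Sum>i\<in>UNIV. 0 * pd i G P)) {\<alpha>..\<beta>}"
  proof (intro has_integral_sum has_integral_mult_left)
    fix i
    have "((\<lambda>\<rho>. p \<rho> - P) has_integral ((\<beta> - \<alpha>) *\<^sub>R P - (\<beta> - \<alpha>) *\<^sub>R P)) {\<alpha>..\<beta>}"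
      using int has_integral_const_real[of P \<alpha> \<beta>] ab by (intro has_integral_diff) auto
    from has_integral_linear[OF this bounded_linear_vec_nth[of i]]
    show "((\<lambda>\<rho>. (p \<rho> - P) $ i) has_integral 0) {\<alpha>..\<beta>}" by (simp add: comp_def)
  qed auto
  moreover have "((\<lambda>\<rho>. G (p \<rho>) - G P) has_integral (integral {\<alpha>..\<beta>} (\<lambda>\<rho>. G (p \<rho>)) - (\<beta> - \<alpha>) * G P)) {\<alpha>..\<beta>}"
    using integrable_integral[OF integrable_continuous_real[OF cG]] has_integral_const_real[of "G P" \<alpha> \<beta>] ab
    by (intro has_integral_diff) auto
  ultimately have "((\<lambda>\<rho>. taylor1 G P (p \<rho>)) has_integral
      (integral {\<alpha>..\<beta>} (\<lambda>\<rho>. G (p \<rho>)) - (\<beta> - \<alpha>) * G P - (\<Sum>i\<in>UNIV. 0 * pd i G P))) {\<alpha>..\<beta>}"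
    unfolding taylor1_def by (rule has_integral_diff[rotated])
  then show "integral {\<alpha>..\<beta>} (\<lambda>\<rho>. G (p \<rho>)) - (\<beta> - \<alpha>) * G P = integral {\<alpha>..\<beta>} (\<lambda>\<rho>. taylor1 G P (p \<rho>))"
    by (simp add: integral_unique)
qed

lemma integral_norm_bound:
  fixes f :: "real \<Rightarrow> 'a::euclidean_space"
  assumes "continuous_on {\<alpha>..\<beta>} f" "\<And>\<rho>. \<rho> \<in> {\<alpha>..\<beta>} \<Longrightarrow> norm (f \<rho>) \<le> C" "\<alpha> \<le> \<beta>"
  shows "norm (integral {\<alpha>..\<beta>} f) \<le> (\<beta> - \<alpha>) * C"
  using integral_bound[OF assms(3,1), of C] assms(2) by (simp add: mult.commute)

section \<open>The anisotropic energy density\<close>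

lemma grad_nth: "grad f p $ i = pd i f p"
  by (simp add: grad_def pd_def)

lemma has_derivative_grad:
  fixes f :: "real^'d \<Rightarrow> real"
  assumes "f differentiable (at p)"
  shows "(f has_derivative (\<lambda>v. grad f p \<bullet> v)) (at p)"
proof -
  have "frechet_derivative f (at p) = (\<lambda>v. grad f p \<bullet> v)"
    using frechet_derivative_pd[OF assms] by (auto simp: inner_vec_def grad_nth mult.commute)
  then show ?thesis using assms by (simp add: frechet_derivative_works)
qed

lemma grad_eqI:
  fixes f :: "real^'d \<Rightarrow> real"
  assumes "(f has_derivative (\<lambda>v. g \<bullet> v)) (at p)"
  shows "grad f p = g"
proof -
  have "frechet_derivative f (at p) = (\<lambda>v. g \<bullet> v)"
    using frechet_derivative_at[OF assms] by simp
  then show ?thesis by (simp add: grad_def vec_eq_iff inner_axis)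
qed

lemma has_derivative_grad_hessian:
  fixes f :: "real^'d \<Rightarrow> real"
  assumes f: "Ck_on (Suc (Suc k)) (- {0}) f" and p: "p \<noteq> 0"
  shows "(grad f has_derivative (\<lambda>v. hessian f p *v v)) (at p)"
    "hessian f p $ i $ j = pd j (pd i f) p"
proof -
  have d: "(pd i f has_derivative (\<lambda>v. \<Sum>j\<in>UNIV. v $ j * pd j (pd i f) p)) (at p)" for i
    using Ck_on_has_derivative_pd[OF Ck_on_pd[OF f]] p by simp
  have "(\<lambda>x. grad f x \<bullet> b) differentiable (at p)" if b: "b \<in> Basis" for b
  proof -
    obtain i where "b = axis i 1" using b by (auto simp: Basis_vec_def)
    then have "(\<lambda>x. grad f x \<bullet> b) = pd i f" by (auto simp: inner_axis grad_nth)
    then show ?thesis using d[of i] by (auto simp: differentiable_def)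
  qed
  then have "grad f differentiable (at p)"
    using differentiable_componentwise_within[of "grad f" p UNIV] by simp
  then show D: "(grad f has_derivative (\<lambda>v. hessian f p *v v)) (at p)"
    using jacobian_works unfolding hessian_def by blast
  have "((\<lambda>x. grad f x $ i) has_derivative (\<lambda>v. (hessian f p *v v) $ i)) (at p)"
    by (rule bounded_linear.has_derivative[OF bounded_linear_vec_nth D])
  then have "((\<lambda>x. pd i f x) has_derivative (\<lambda>v. (hessian f p *v v) $ i)) (at p)" by (simp only: grad_nth)
  from has_derivative_unique[OF this d[of i]]
  have "(hessian f p *v axis j 1) $ i = (\<Sum>k\<in>UNIV. axis j 1 $ k * pd k (pd i f) p)" by metis
  also have "\<dots> = pd j (pd i f) p"
    by (simp add: axis_def if_distrib[of "\<lambda>x. x * _"] cong: if_cong)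
  finally show "hessian f p $ i $ j = pd j (pd i f) p"
    by (simp add: matrix_vector_mult_basis column_def)
qed

lemma derivative_bound_imp_increment:
  fixes f f' :: "real \<Rightarrow> real"
  assumes X: "finite X" and c: "continuous_on {0..1} f"
    and d: "\<And>s. s \<in> {0<..<1} - X \<Longrightarrow> (f has_real_derivative f' s) (at s)"
    and b: "\<And>s. s \<in> {0<..<1} - X \<Longrightarrow> C \<le> f' s"
  shows "C \<le> f 1 - f 0"
proof -
  define g where "g s = (if s \<in> {0<..<1} - X then f' s else C)" for s
  have "(g has_integral (f 1 - f 0)) {0..1}"
    using d by (intro fundamental_theorem_of_calculus_interior_strong[OF X _ _ c])
      (auto simp: g_def has_real_derivative_iff_has_vector_derivative[symmetric])
  from has_integral_le[OF _ this, of "\<lambda>_. C" C] show ?thesis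
    using has_integral_const_real[of C 0 1] b by (auto simp: g_def)
qed

lemma outer_matvec: "outer a b *v z = (b \<bullet> z) *\<^sub>R a"
  by (simp add: vec_eq_iff outer_def matrix_vector_mult_def inner_vec_def sum_distrib_left mult_ac)

context
  fixes \<phi> :: "real^'d \<Rightarrow> real"
  assumes aniso: "anisotropy \<phi>"
begin

lemma phi_C4: "Ck_on (Suc (Suc (Suc (Suc 0)))) (- {0}) \<phi>"
  using aniso by (simp add: anisotropy_def numeral_eq_Suc del: Ck_on.simps)

lemma phi_hom: "\<phi> (l *\<^sub>R p) = \<bar>l\<bar> * \<phi> p"
  using aniso by (simp add: anisotropy_def)

lemma phi_pos: "p \<noteq> 0 \<Longrightarrow> 0 < \<phi> p"
  using aniso by (simp add: anisotropy_def)

lemma phi_zero: "\<phi> 0 = 0"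
  using phi_hom[of 0 0] by simp

lemma phi_deriv: "p \<noteq> 0 \<Longrightarrow> (\<phi> has_derivative (\<lambda>v. grad \<phi> p \<bullet> v)) (at p)"
  using phi_C4 by (intro has_derivative_grad) simp

lemma grad_phi_deriv: "p \<noteq> 0 \<Longrightarrow> (grad \<phi> has_derivative (\<lambda>v. hessian \<phi> p *v v)) (at p)"
  using has_derivative_grad_hessian(1)[OF phi_C4] .

text \<open>Differentiating the homogeneity relation in \<open>p\<close> shows that the gradient is homogeneous of degree
  \<open>0\<close>; differentiating it in the factor gives Euler's identity below.\<close>

lemma grad_phi_hom:
  assumes "p \<noteq> 0" "0 < l" shows "grad \<phi> (l *\<^sub>R p) = grad \<phi> p"
proof -
  have "((\<lambda>x. l *\<^sub>R x) has_derivative (\<lambda>v. l *\<^sub>R v)) (at p)" by (auto intro!: derivative_eq_intros)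
  from has_derivative_compose[OF this phi_deriv[of "l *\<^sub>R p"]] assms
  have "((\<lambda>x. l * \<phi> x) has_derivative (\<lambda>v. grad \<phi> (l *\<^sub>R p) \<bullet> (l *\<^sub>R v))) (at p)"
    by (simp add: phi_hom)
  from has_derivative_mult_right[OF this, of "inverse l"] assms
  have "(\<phi> has_derivative (\<lambda>v. grad \<phi> (l *\<^sub>R p) \<bullet> v)) (at p)" by (simp add: mult.assoc[symmetric])
  from grad_eqI[OF this] show ?thesis by simp
qed

lemma euler: "p \<noteq> 0 \<Longrightarrow> grad \<phi> p \<bullet> p = \<phi> p"
proof -
  assume p: "p \<noteq> 0"
  have "((\<lambda>s. s *\<^sub>R p) has_derivative (\<lambda>t. t *\<^sub>R p)) (at (1::real))" by (auto intro!: derivative_eq_intros)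
  from has_derivative_compose[OF this phi_deriv[of "1 *\<^sub>R p"]] p
  have "((\<lambda>s. \<bar>s\<bar> * \<phi> p) has_derivative (\<lambda>t. grad \<phi> p \<bullet> (t *\<^sub>R p))) (at 1)" by (simp add: phi_hom)
  from has_derivative_transform_within_open[OF this, of "{0<..}" "\<lambda>s. s * \<phi> p"]
  have "((\<lambda>s. s * \<phi> p) has_derivative (\<lambda>t. grad \<phi> p \<bullet> (t *\<^sub>R p))) (at 1)" by simp
  moreover have "((\<lambda>s. s * \<phi> p) has_derivative (\<lambda>t. t * \<phi> p)) (at 1)" by (auto intro!: derivative_eq_intros)
  ultimately have "(\<lambda>t. grad \<phi> p \<bullet> (t *\<^sub>R p)) = (\<lambda>t. t * \<phi> p)" by (rule has_derivative_unique)
  from fun_cong[OF this, of 1] show ?thesis by simp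
qed

text \<open>The gradient is constant along rays.\<close>

lemma hessian_phi_radial: "p \<noteq> 0 \<Longrightarrow> hessian \<phi> p *v p = 0"
proof -
  assume p: "p \<noteq> 0"
  have "((\<lambda>s. s *\<^sub>R p) has_derivative (\<lambda>t. t *\<^sub>R p)) (at (1::real))" by (auto intro!: derivative_eq_intros)
  from has_derivative_compose[OF this grad_phi_deriv[of "1 *\<^sub>R p"]] p
  have "((\<lambda>s. grad \<phi> (s *\<^sub>R p)) has_derivative (\<lambda>t. hessian \<phi> p *v (t *\<^sub>R p))) (at 1)" by simp
  from has_derivative_transform_within_open[OF this, of "{0<..}" "\<lambda>_. grad \<phi> p"]
  have "((\<lambda>_. grad \<phi> p) has_derivative (\<lambda>t. hessian \<phi> p *v (t *\<^sub>R p))) (at 1)"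
    using grad_phi_hom[OF p] by simp
  moreover have "((\<lambda>_::real. grad \<phi> p) has_derivative (\<lambda>t. 0)) (at 1)" by simp
  ultimately have "(\<lambda>t. hessian \<phi> p *v (t *\<^sub>R p)) = (\<lambda>t. 0)" by (rule has_derivative_unique)
  from fun_cong[OF this, of 1] show ?thesis by simp
qed

text \<open>The transposed radial identity, obtained by differentiating Euler's identity in direction \<open>v\<close>.\<close>

lemma hessian_phi_image: "p \<noteq> 0 \<Longrightarrow> (hessian \<phi> p *v v) \<bullet> p = 0"
proof -
  assume p: "p \<noteq> 0"
  have "((\<lambda>x. grad \<phi> x \<bullet> x) has_derivative (\<lambda>v. grad \<phi> p \<bullet> v + (hessian \<phi> p *v v) \<bullet> p)) (at p)"
    using has_derivative_inner[OF grad_phi_deriv[OF p] has_derivative_ident] by simp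
  from has_derivative_transform_within_open[OF this, of "- {0}" \<phi>] p
  have "(\<phi> has_derivative (\<lambda>v. grad \<phi> p \<bullet> v + (hessian \<phi> p *v v) \<bullet> p)) (at p)" using euler by auto
  from has_derivative_unique[OF this phi_deriv[OF p]] show ?thesis by (auto dest: fun_cong[of _ _ v])
qed

lemma Phi_C4: "Ck_on (Suc (Suc (Suc (Suc 0)))) (- {0}) (Phi \<phi>)"
proof -
  have "Ck_on (Suc (Suc (Suc (Suc 0)))) (- {0}) (\<lambda>p. \<phi> p * \<phi> p * (1/2))"
    by (intro Ck_on_mult phi_C4 Ck_on_const) auto
  then show ?thesis by (simp add: Phi_def[abs_def] power2_eq_square del: Ck_on.simps)
qed

lemma phi_le: obtains M where "0 < M" "\<And>p. \<phi> p \<le> M * norm p"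
proof -
  have "continuous_on (sphere 0 1) \<phi>"
    using aniso continuous_on_subset unfolding anisotropy_def by blast
  then have "bounded (\<phi> ` sphere 0 1)" by (simp add: compact_continuous_image compact_imp_bounded)
  then obtain M where M: "0 < M" "\<And>p. norm p = 1 \<Longrightarrow> \<bar>\<phi> p\<bar> \<le> M" by (auto simp: bounded_pos)
  have "\<phi> p \<le> M * norm p" for p
  proof (cases "p = 0")
    case False
    have "\<phi> p = norm p * \<phi> (sgn p)"
      using phi_hom[of "norm p" "sgn p"] False by (simp add: sgn_div_norm)
    then show ?thesis using M(2)[of "sgn p"] False by (simp add: norm_sgn mult_left_mono abs_le_iff mult.commute)
  qed (simp add: phi_zero)
  then show ?thesis using that M(1) by blast
qed

lemma Phi_deriv_nonzero: "p \<noteq> 0 \<Longrightarrow> (Phi \<phi> has_derivative (\<lambda>v. (\<phi> p *\<^sub>R grad \<phi> p) \<bullet> v)) (at p)"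
  unfolding Phi_def[abs_def]
  by (rule derivative_eq_intros phi_deriv refl | assumption)+ (auto simp: fun_eq_iff)

text \<open>\<open>\<Phi>\<close> is differentiable at the origin, where \<open>\<phi>\<close> is not, because \<open>\<Phi>\<close> is bounded by a multiple of $|p|^2$.\<close>

lemma Phi_deriv_zero: "(Phi \<phi> has_derivative (\<lambda>v. 0 \<bullet> v)) (at 0)"
proof -
  obtain M where M: "0 < M" "\<And>p. \<phi> p \<le> M * norm p" using phi_le by blast
  have P: "\<bar>Phi \<phi> p\<bar> \<le> M\<^sup>2 * (norm p)\<^sup>2" for p
  proof -
    have "0 \<le> \<phi> p" using aniso by (simp add: anisotropy_def)
    then have "(\<phi> p)\<^sup>2 \<le> (M * norm p)\<^sup>2" using M(2) by (intro power_mono)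
    also have "\<dots> \<le> 2 * (M\<^sup>2 * (norm p)\<^sup>2)" by (simp add: power_mult_distrib)
    finally show ?thesis by (simp add: Phi_def)
  qed
  show ?thesis
    unfolding has_derivative_at'
  proof (intro conjI allI impI)
    fix e :: real assume e: "0 < e"
    show "\<exists>d>0. \<forall>x'. 0 < norm (x' - 0) \<and> norm (x' - 0) < d \<longrightarrow>
        norm (Phi \<phi> x' - Phi \<phi> 0 - 0 \<bullet> (x' - 0)) / norm (x' - 0) < e"
    proof (intro exI[of _ "e / M\<^sup>2"] conjI allI impI)
      fix x :: "real^'d" assume x: "0 < norm (x - 0) \<and> norm (x - 0) < e / M\<^sup>2"
      have "\<bar>Phi \<phi> x\<bar> / norm x \<le> M\<^sup>2 * (norm x)\<^sup>2 / norm x" using P by (intro divide_right_mono) auto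
      also have "\<dots> = M\<^sup>2 * norm x" by (simp add: power2_eq_square)
      also have "\<dots> < e" using x M(1) by (simp add: pos_less_divide_eq mult.commute)
      finally show "norm (Phi \<phi> x - Phi \<phi> 0 - 0 \<bullet> (x - 0)) / norm (x - 0) < e"
        by (simp add: Phi_def phi_zero)
    qed (use e M in auto)
  qed (rule bounded_linear_inner_right)
qed

lemma grad_Phi_zero: "grad (Phi \<phi>) 0 = 0"
  by (rule grad_eqI[OF Phi_deriv_zero])

lemma grad_Phi_nonzero: "p \<noteq> 0 \<Longrightarrow> grad (Phi \<phi>) p = \<phi> p *\<^sub>R grad \<phi> p"
  by (rule grad_eqI[OF Phi_deriv_nonzero])

lemma Phi_deriv: "(Phi \<phi> has_derivative (\<lambda>v. grad (Phi \<phi>) p \<bullet> v)) (at p)"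
  using Phi_deriv_zero Phi_deriv_nonzero grad_Phi_zero grad_Phi_nonzero by (cases "p = 0") auto

lemma grad_Phi_deriv: "p \<noteq> 0 \<Longrightarrow> (grad (Phi \<phi>) has_derivative (\<lambda>v. hessian (Phi \<phi>) p *v v)) (at p)"
  using has_derivative_grad_hessian(1)[OF Phi_C4] .

lemma grad_Phi_hom: "0 < l \<Longrightarrow> grad (Phi \<phi>) (l *\<^sub>R p) = l *\<^sub>R grad (Phi \<phi>) p"
  by (cases "p = 0") (simp_all add: grad_Phi_zero grad_Phi_nonzero grad_phi_hom phi_hom)

lemma hessian_Phi_hom:
  assumes p: "p \<noteq> 0" and l: "0 < l" shows "hessian (Phi \<phi>) (l *\<^sub>R p) *v v = hessian (Phi \<phi>) p *v v"
proof -
  have "((\<lambda>x. l *\<^sub>R x) has_derivative (\<lambda>v. l *\<^sub>R v)) (at p)" by (auto intro!: derivative_eq_intros)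
  from has_derivative_compose[OF this grad_Phi_deriv[of "l *\<^sub>R p"]] assms
  have "((\<lambda>x. l *\<^sub>R grad (Phi \<phi>) x) has_derivative (\<lambda>v. hessian (Phi \<phi>) (l *\<^sub>R p) *v (l *\<^sub>R v))) (at p)"
    by (simp add: grad_Phi_hom)
  moreover have "((\<lambda>x. l *\<^sub>R grad (Phi \<phi>) x) has_derivative (\<lambda>v. l *\<^sub>R (hessian (Phi \<phi>) p *v v))) (at p)"
    by (rule has_derivative_scaleR_right[OF grad_Phi_deriv[OF p]])
  ultimately have "(\<lambda>v. hessian (Phi \<phi>) (l *\<^sub>R p) *v (l *\<^sub>R v)) = (\<lambda>v. l *\<^sub>R (hessian (Phi \<phi>) p *v v))"
    by (rule has_derivative_unique)
  from fun_cong[OF this, of v] l show ?thesis by (simp add: matrix_vector_mult_scaleR)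
qed

lemma hessian_Phi_eq:
  assumes p: "p \<noteq> 0"
  shows "hessian (Phi \<phi>) p *v v = (grad \<phi> p \<bullet> v) *\<^sub>R grad \<phi> p + \<phi> p *\<^sub>R (hessian \<phi> p *v v)"
proof -
  have "((\<lambda>x. \<phi> x *\<^sub>R grad \<phi> x) has_derivative
      (\<lambda>v. \<phi> p *\<^sub>R (hessian \<phi> p *v v) + (grad \<phi> p \<bullet> v) *\<^sub>R grad \<phi> p)) (at p)"
    by (rule has_derivative_scaleR[OF phi_deriv[OF p] grad_phi_deriv[OF p]])
  from has_derivative_transform_within_open[OF this, of "- {0}" "grad (Phi \<phi>)"] p
  have "(grad (Phi \<phi>) has_derivative
      (\<lambda>v. \<phi> p *\<^sub>R (hessian \<phi> p *v v) + (grad \<phi> p \<bullet> v) *\<^sub>R grad \<phi> p)) (at p)"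
    using grad_Phi_nonzero by auto
  from has_derivative_unique[OF grad_Phi_deriv[OF p] this] show ?thesis by (simp add: fun_eq_iff)
qed

text \<open>The Hessian of \<open>\<phi>\<close> degenerates in the radial direction, where the square of the gradient of \<open>\<phi>\<close>
  takes over by Euler's identity; in the tangential directions it is positive by assumption.\<close>

lemma hessian_Phi_pos:
  assumes p: "norm p = 1" and z: "z \<noteq> 0"
  shows "0 < (hessian (Phi \<phi>) p *v z) \<bullet> z"
proof -
  have p0: "p \<noteq> 0" using p by auto
  define y where "y = z - (z \<bullet> p) *\<^sub>R p"
  have zy: "z = (z \<bullet> p) *\<^sub>R p + y" by (simp add: y_def)
  have py: "p \<bullet> y = 0" using p by (simp add: y_def inner_diff_right inner_commute dot_square_norm)
  have "hessian \<phi> p *v z = hessian \<phi> p *v y"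
    by (subst zy) (simp add: matrix_vector_right_distrib matrix_vector_mult_scaleR hessian_phi_radial p0)
  moreover have "(hessian \<phi> p *v y) \<bullet> z = (hessian \<phi> p *v y) \<bullet> y"
    by (subst zy) (simp add: inner_add_right hessian_phi_image p0)
  ultimately have eq: "(hessian (Phi \<phi>) p *v z) \<bullet> z = (grad \<phi> p \<bullet> z)\<^sup>2 + \<phi> p * ((hessian \<phi> p *v y) \<bullet> y)"
    by (simp add: hessian_Phi_eq p0 inner_add_left power2_eq_square)
  show ?thesis
  proof (cases "y = 0")
    case True
    then have "z = (z \<bullet> p) *\<^sub>R p" using zy by simp
    then have "grad \<phi> p \<bullet> z = (z \<bullet> p) * \<phi> p" "z \<bullet> p \<noteq> 0" using euler[OF p0] z by (metis inner_scaleR_right, metis scaleR_zero_left)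
    then show ?thesis using phi_pos[OF p0] by (simp add: eq True)
  next
    case False
    have "norm (sgn y) = 1" "p \<bullet> sgn y = 0" using False py by (simp_all add: norm_sgn, simp add: sgn_div_norm)
    then have "0 < (hessian \<phi> p *v sgn y) \<bullet> sgn y"
      using aniso p unfolding anisotropy_def by blast
    also have "\<dots> = ((hessian \<phi> p *v y) \<bullet> y) / (norm y)\<^sup>2"
      by (simp add: sgn_div_norm matrix_vector_mult_scaleR power2_eq_square divide_inverse)
    finally have "0 < (hessian \<phi> p *v y) \<bullet> y" using False by (simp add: zero_less_divide_iff)
    then show ?thesis using phi_pos[OF p0] by (simp add: eq add_nonneg_pos)
  qed
qed

lemma hessian_Phi_continuous: "continuous_on (- {0}) (\<lambda>p. hessian (Phi \<phi>) p $ i $ j)"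
proof -
  have "continuous_on (- {0}) (pd j (pd i (Phi \<phi>)))"
    using Ck_on_continuous[OF Ck_on_pd[OF Ck_on_pd[OF Phi_C4]]] .
  then show ?thesis
    by (rule continuous_on_cong[THEN iffD1, rotated 2]) (auto simp: has_derivative_grad_hessian(2)[OF Phi_C4])
qed

text \<open>The Hessian of \<open>\<Phi>\<close> is homogeneous of degree \<open>0\<close>, so pointwise positivity and boundedness on the compact
  unit sphere are uniform on the whole punctured space.\<close>

lemma hessian_Phi_elliptic:
  obtains \<gamma> \<Gamma> where "0 < \<gamma>" "0 < \<Gamma>"
    "\<And>p z. p \<noteq> 0 \<Longrightarrow> \<gamma> * (norm z)\<^sup>2 \<le> (hessian (Phi \<phi>) p *v z) \<bullet> z"
    "\<And>p z. p \<noteq> 0 \<Longrightarrow> norm (hessian (Phi \<phi>) p *v z) \<le> \<Gamma> * norm z"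
proof -
  let ?S = "sphere 0 1 :: (real^'d) set"
  let ?H = "hessian (Phi \<phi>)"
  have ne: "?S \<noteq> {}" by simp
  have cS: "continuous_on ?S (\<lambda>p. ?H p $ i $ j)" for i j
    by (rule continuous_on_subset[OF hessian_Phi_continuous]) auto
  have "continuous_on (?S \<times> ?S) (\<lambda>x. \<Sum>i\<in>UNIV. (\<Sum>j\<in>UNIV. ?H (fst x) $ i $ j * snd x $ j) * snd x $ i)"
    by (intro continuous_intros continuous_on_compose2[OF cS continuous_on_fst]) auto
  then have "continuous_on (?S \<times> ?S) (\<lambda>x. (?H (fst x) *v snd x) \<bullet> snd x)"
    by (simp add: inner_vec_def matrix_vector_mult_def)
  moreover have "compact (?S \<times> ?S)" "?S \<times> ?S \<noteq> {}" using ne by (auto intro: compact_Times)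
  ultimately obtain x where x: "x \<in> ?S \<times> ?S"
    "\<And>y. y \<in> ?S \<times> ?S \<Longrightarrow> (?H (fst x) *v snd x) \<bullet> snd x \<le> (?H (fst y) *v snd y) \<bullet> snd y"
    using continuous_attains_inf[of "?S \<times> ?S" "\<lambda>x. (?H (fst x) *v snd x) \<bullet> snd x"] by blast
  define \<gamma> where "\<gamma> = (?H (fst x) *v snd x) \<bullet> snd x"
  have "norm (fst x) = 1" "norm (snd x) = 1" using x(1) by (auto simp: mem_Times_iff)
  then have \<gamma>: "0 < \<gamma>" unfolding \<gamma>_def by (intro hessian_Phi_pos) auto
  have \<gamma>b: "\<gamma> * (norm z)\<^sup>2 \<le> (?H p *v z) \<bullet> z" if p: "p \<noteq> 0" for p z
  proof (cases "z = 0")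
    case False
    have "\<gamma> \<le> (?H (sgn p) *v sgn z) \<bullet> sgn z"
      using x(2)[of "(sgn p, sgn z)"] p False by (simp add: \<gamma>_def norm_sgn)
    also have "\<dots> = (?H p *v sgn z) \<bullet> sgn z"
      using hessian_Phi_hom[of "sgn p" "norm p" "sgn z"] p by (simp add: sgn_div_norm)
    also have "\<dots> = ((?H p *v z) \<bullet> z) / (norm z)\<^sup>2"
      by (simp add: sgn_div_norm matrix_vector_mult_scaleR power2_eq_square divide_inverse)
    finally show ?thesis using False by (simp add: pos_le_divide_eq)
  qed simp
  have "\<exists>B\<ge>0. \<forall>p\<in>annulus 1 1. \<bar>?H p $ i $ j\<bar> \<le> B" for i j
  proof -
    obtain B where "0 \<le> B" "\<And>p. p \<in> annulus 1 1 \<Longrightarrow> \<bar>pd j (pd i (Phi \<phi>)) p\<bar> \<le> B"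
      using C1_bounds_on_annulus[OF Ck_on_pd[OF Ck_on_pd[OF Phi_C4]], where a=1 and b=1] by (metis zero_less_one)
    then show ?thesis by (intro exI[of _ B]) (simp add: has_derivative_grad_hessian(2)[OF Phi_C4 annulus_nonzero[of _ 1 1]])
  qed
  then obtain B where B: "\<And>i j. 0 \<le> B i j" "\<And>i j p. p \<in> annulus 1 1 \<Longrightarrow> \<bar>?H p $ i $ j\<bar> \<le> B i j" by metis
  define b where "b = (\<Sum>i\<in>UNIV. \<Sum>j\<in>UNIV. B i j)"
  have Bb: "B i j \<le> b" for i j
  proof -
    have "B i j \<le> (\<Sum>j\<in>UNIV. B i j)" by (rule member_le_sum) (auto simp: B)
    also have "\<dots> \<le> b" unfolding b_def by (rule member_le_sum) (auto simp: B intro: sum_nonneg)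
    finally show ?thesis .
  qed
  have b0: "0 \<le> b" using Bb B(1) order_trans by blast
  have \<Gamma>b: "norm (?H p *v z) \<le> ((real CARD('d))\<^sup>2 * b + 1) * norm z" if p: "p \<noteq> 0" for p z
  proof -
    have "norm (?H (sgn p) *v z) \<le> (real CARD('d))\<^sup>2 * b * norm z"
      using p by (intro norm_matvec_le order_trans[OF B(2) Bb]) (simp add: annulus_def norm_sgn)
    moreover have "?H (sgn p) *v z = ?H p *v z"
      using hessian_Phi_hom[of "sgn p" "norm p" z] p by (simp add: sgn_div_norm)
    ultimately show ?thesis by (simp add: distrib_right add_increasing2)
  qed
  show ?thesis
    using b0 by (intro that[OF \<gamma> _ \<gamma>b \<Gamma>b]) (auto simp: add_nonneg_pos)
qed

text \<open>At the origin continuity follows from homogeneity of degree \<open>1\<close>.\<close>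

lemma grad_Phi_continuous: "continuous_on UNIV (grad (Phi \<phi>))"
proof -
  obtain B where B: "0 \<le> B" "\<And>i p. p \<in> annulus 1 1 \<Longrightarrow> \<bar>pd i (Phi \<phi>) p\<bar> \<le> B"
  proof -
    have "\<exists>B\<ge>0. \<forall>p\<in>annulus 1 1. \<bar>pd i (Phi \<phi>) p\<bar> \<le> B" for i
      using C1_bounds_on_annulus[OF Ck_on_pd[OF Phi_C4], where a=1 and b=1] by (metis zero_less_one)
    then obtain B where B: "\<And>i. 0 \<le> B i" "\<And>i p. p \<in> annulus 1 1 \<Longrightarrow> \<bar>pd i (Phi \<phi>) p\<bar> \<le> B i" by metis
    have "B i \<le> sum B UNIV" for i by (rule member_le_sum) (auto simp: B)
    then show ?thesis using B that[of "sum B UNIV"] by (meson order_trans sum_nonneg)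
  qed
  have bd: "norm (grad (Phi \<phi>) p) \<le> CARD('d) * B * norm p" for p
  proof (cases "p = 0")
    case False
    then have "norm (grad (Phi \<phi>) (sgn p)) \<le> CARD('d) * B"
      using B(2)[of "sgn p"] by (intro norm_vec_le) (auto simp: grad_nth annulus_def norm_sgn)
    moreover have "grad (Phi \<phi>) p = norm p *\<^sub>R grad (Phi \<phi>) (sgn p)"
      using grad_Phi_hom[of "norm p" "sgn p"] False by (simp add: sgn_div_norm)
    ultimately show ?thesis by (simp add: mult.commute mult_left_mono)
  qed (simp add: grad_Phi_zero)
  have "isCont (grad (Phi \<phi>)) p" for p
  proof (cases "p = 0")
    case True
    have "((\<lambda>p. CARD('d) * B * norm p) \<longlongrightarrow> 0) (at 0)" by (intro tendsto_eq_intros) auto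
    then have "(grad (Phi \<phi>) \<longlongrightarrow> 0) (at 0)"
      by (rule Lim_null_comparison[rotated]) (rule always_eventually, intro allI bd)
    then show ?thesis by (simp add: True isCont_def grad_Phi_zero)
  qed (rule has_derivative_continuous[OF grad_Phi_deriv])
  then show ?thesis by (simp add: continuous_at_imp_continuous_on)
qed

text \<open>Ellipticity of the Hessian is integrated along segments. A segment may pass through the origin,
  where the gradient of \<open>\<Phi>\<close> is continuous but not differentiable; one exceptional parameter is harmless.\<close>

lemma grad_Phi_increment:
  assumes "\<And>r. r \<noteq> 0 \<Longrightarrow> C \<le> (hessian (Phi \<phi>) r *v (p - q)) \<bullet> u" "p \<noteq> q"
  shows "C \<le> (grad (Phi \<phi>) p - grad (Phi \<phi>) q) \<bullet> u"
proof -
  let ?k = "\<lambda>s. q + s *\<^sub>R (p - q)"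
  have sub: "{s. ?k s = 0} \<subseteq> {s0}" if "?k s0 = 0" for s0
  proof
    fix s assume "s \<in> {s. ?k s = 0}"
    moreover have "(s - s0) *\<^sub>R (p - q) = ?k s - ?k s0" by (simp add: algebra_simps)
    ultimately have "(s - s0) *\<^sub>R (p - q) = 0" using that by simp
    then show "s \<in> {s0}" using assms(2) by simp
  qed
  have fin: "finite {s. ?k s = 0}"
  proof (cases "{s. ?k s = 0} = {}")
    case False
    then obtain s0 where "?k s0 = 0" by auto
    from finite_subset[OF sub[OF this]] show ?thesis by simp
  qed simp
  have "C \<le> grad (Phi \<phi>) (?k 1) \<bullet> u - grad (Phi \<phi>) (?k 0) \<bullet> u"
  proof (rule derivative_bound_imp_increment[OF fin])
    show "continuous_on {0..1} (\<lambda>s. grad (Phi \<phi>) (?k s) \<bullet> u)"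
      by (intro continuous_intros continuous_on_compose2[OF grad_Phi_continuous]) auto
    fix s assume "s \<in> {0<..<1} - {s. ?k s = 0}"
    then have nz: "?k s \<noteq> 0" by simp
    have "(?k has_derivative (\<lambda>t. t *\<^sub>R (p - q))) (at s)" by (auto intro!: derivative_eq_intros)
    from has_derivative_inner_left[OF has_derivative_compose[OF this grad_Phi_deriv[OF nz]], of u]
    show "((\<lambda>s. grad (Phi \<phi>) (?k s) \<bullet> u) has_real_derivative (hessian (Phi \<phi>) (?k s) *v (p - q)) \<bullet> u) (at s)"
      by (simp add: has_field_derivative_def matrix_vector_mult_scaleR mult_commute_abs)
    show "C \<le> (hessian (Phi \<phi>) (?k s) *v (p - q)) \<bullet> u" using assms(1)[OF nz] .
  qed
  then show ?thesis by (simp add: inner_diff_left)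
qed

text \<open>Ellipticity in integrated and in differential form. The bounds on the
  gradient hold globally, across the origin, so the scheme is solvable without knowledge of where the
  new tangents lie.\<close>

lemma grad_Phi_monotone_Lipschitz:
  obtains \<gamma> \<Gamma> where "0 < \<gamma>" "0 < \<Gamma>"
    "\<And>p q. \<gamma> * (norm (p - q))\<^sup>2 \<le> (grad (Phi \<phi>) p - grad (Phi \<phi>) q) \<bullet> (p - q)"
    "\<And>p q. norm (grad (Phi \<phi>) p - grad (Phi \<phi>) q) \<le> \<Gamma> * norm (p - q)"
    "\<And>p z. p \<noteq> 0 \<Longrightarrow> \<gamma> * (norm z)\<^sup>2 \<le> (hessian (Phi \<phi>) p *v z) \<bullet> z"
    "\<And>p z. p \<noteq> 0 \<Longrightarrow> norm (hessian (Phi \<phi>) p *v z) \<le> \<Gamma> * norm z"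
proof -
  obtain \<gamma> \<Gamma> where *: "0 < \<gamma>" "0 < \<Gamma>"
    "\<And>p z. p \<noteq> 0 \<Longrightarrow> \<gamma> * (norm z)\<^sup>2 \<le> (hessian (Phi \<phi>) p *v z) \<bullet> z"
    "\<And>p z. p \<noteq> 0 \<Longrightarrow> norm (hessian (Phi \<phi>) p *v z) \<le> \<Gamma> * norm z"
    by (rule hessian_Phi_elliptic) blast
  have mono: "\<gamma> * (norm (p - q))\<^sup>2 \<le> (grad (Phi \<phi>) p - grad (Phi \<phi>) q) \<bullet> (p - q)" for p q
    using grad_Phi_increment[of "\<gamma> * (norm (p - q))\<^sup>2" p q "p - q"] *(3) by (cases "p = q") auto
  have "norm (grad (Phi \<phi>) p - grad (Phi \<phi>) q) \<le> \<Gamma> * norm (p - q)" for p q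
  proof (cases "p = q")
    case False
    let ?d = "grad (Phi \<phi>) p - grad (Phi \<phi>) q"
    have "- (\<Gamma> * norm (p - q) * norm ?d) \<le> (hessian (Phi \<phi>) r *v (p - q)) \<bullet> (- ?d)" if "r \<noteq> 0" for r
    proof -
      have "(hessian (Phi \<phi>) r *v (p - q)) \<bullet> ?d \<le> norm (hessian (Phi \<phi>) r *v (p - q)) * norm ?d"
        by (rule norm_cauchy_schwarz)
      also have "\<dots> \<le> \<Gamma> * norm (p - q) * norm ?d" using *(4)[OF that] by (intro mult_right_mono) auto
      finally show ?thesis by (simp only: inner_minus_right neg_le_iff_le)
    qed
    then have "- (\<Gamma> * norm (p - q) * norm ?d) \<le> ?d \<bullet> (- ?d)" by (rule grad_Phi_increment[OF _ False])
    then have "(norm ?d)\<^sup>2 \<le> \<Gamma> * norm (p - q) * norm ?d"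
      by (simp only: power2_norm_eq_inner inner_minus_right neg_le_iff_le)
    then show ?thesis by (cases "norm ?d = 0") (use *(2) in \<open>auto simp: power2_eq_square\<close>)
  qed simp
  from that[OF *(1,2) mono this *(3,4)] show ?thesis .
qed

end

text \<open>The Bregman distance of \<open>P - e\<close> from \<open>P\<close>: the energy of the discrete tangent relative to the one of the
  exact tangent \<open>P\<close>, where \<open>e\<close> is the error of the tangent.\<close>

definition breg :: "(real^'d \<Rightarrow> real) \<Rightarrow> real^'d \<Rightarrow> real^'d \<Rightarrow> real" where
  "breg \<phi> P e = Phi \<phi> (P - e) - Phi \<phi> P + grad (Phi \<phi>) P \<bullet> e"

lemma breg_lower:
  assumes aniso: "anisotropy \<phi>"
    and mono: "\<And>p q. \<gamma> * (norm (p - q))\<^sup>2 \<le> (grad (Phi \<phi>) p - grad (Phi \<phi>) q) \<bullet> (p - q)"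
  shows "\<gamma> / 2 * (norm e)\<^sup>2 \<le> breg \<phi> P e"
proof -
  define g where "g s = Phi \<phi> (P - s *\<^sub>R e) + s * (grad (Phi \<phi>) P \<bullet> e) - \<gamma> * s\<^sup>2 / 2 * (norm e)\<^sup>2" for s
  define g' where "g' s = - (grad (Phi \<phi>) (P - s *\<^sub>R e) \<bullet> e) + grad (Phi \<phi>) P \<bullet> e - \<gamma> * s * (norm e)\<^sup>2" for s
  have d: "(g has_real_derivative g' s) (at s)" for s
  proof -
    have "((\<lambda>s. P - s *\<^sub>R e) has_derivative (\<lambda>t. - (t *\<^sub>R e))) (at s)" by (auto intro!: derivative_eq_intros)
    from has_derivative_compose[OF this Phi_deriv[OF aniso]]
    have "((\<lambda>s. Phi \<phi> (P - s *\<^sub>R e)) has_real_derivative - (grad (Phi \<phi>) (P - s *\<^sub>R e) \<bullet> e)) (at s)"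
      by (auto simp: has_field_derivative_def fun_eq_iff elim!: has_derivative_eq_rhs)
    then show ?thesis unfolding g_def g'_def by (auto intro!: derivative_eq_intros)
  qed
  have "0 \<le> g' s" if "0 \<le> s" for s
  proof (cases "s = 0")
    case False
    then have s: "0 < s" using that by simp
    have "\<gamma> * s\<^sup>2 * (norm e)\<^sup>2 \<le> s * ((grad (Phi \<phi>) P - grad (Phi \<phi>) (P - s *\<^sub>R e)) \<bullet> e)"
      using mono[of P "P - s *\<^sub>R e"] by (simp add: power_mult_distrib mult.assoc)
    then have "s * (\<gamma> * s * (norm e)\<^sup>2) \<le> s * ((grad (Phi \<phi>) P - grad (Phi \<phi>) (P - s *\<^sub>R e)) \<bullet> e)"
      by (simp add: power2_eq_square mult_ac)
    then show ?thesis using s by (simp add: g'_def inner_diff_left)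
  qed (simp add: g'_def)
  then have "g 0 \<le> g 1" using d by (intro DERIV_nonneg_imp_nondecreasing[of 0 1 g]) auto
  then show ?thesis by (simp add: g_def breg_def)
qed

lemma breg_nonneg:
  assumes "anisotropy \<phi>" shows "0 \<le> breg \<phi> P e"
proof -
  obtain \<gamma> where "0 < \<gamma>" and *: "\<And>p q. \<gamma> * (norm (p - q))\<^sup>2 \<le> (grad (Phi \<phi>) p - grad (Phi \<phi>) q) \<bullet> (p - q)"
    by (rule grad_Phi_monotone_Lipschitz[OF assms]) blast
  then have "0 \<le> \<gamma> / 2 * (norm e)\<^sup>2" by simp
  also have "\<dots> \<le> breg \<phi> P e" by (rule breg_lower[OF assms *])
  finally show ?thesis .
qed

text \<open>Convexity turns the discrete time derivative of the error, tested against the difference of the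
  two fluxes, into a difference of energies.\<close>

lemma breg_increment:
  assumes "anisotropy \<phi>"
  shows "breg \<phi> P e' - breg \<phi> P e \<le> (grad (Phi \<phi>) P - grad (Phi \<phi>) (P - e')) \<bullet> (e' - e)"
  using breg_nonneg[OF assms, of "P - e'" "e - e'"] by (simp add: breg_def algebra_simps)

lemma breg_upper:
  assumes "anisotropy \<phi>" and lip: "\<And>p q. norm (grad (Phi \<phi>) p - grad (Phi \<phi>) q) \<le> \<Gamma> * norm (p - q)"
  shows "breg \<phi> P e \<le> \<Gamma> * (norm e)\<^sup>2"
proof -
  have "breg \<phi> P e \<le> (grad (Phi \<phi>) P - grad (Phi \<phi>) (P - e)) \<bullet> e"
    using breg_nonneg[OF assms(1), of "P - e" "- e"] by (simp add: breg_def algebra_simps)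
  also have "\<dots> \<le> norm (grad (Phi \<phi>) P - grad (Phi \<phi>) (P - e)) * norm e" by (rule norm_cauchy_schwarz)
  also have "\<dots> \<le> \<Gamma> * norm e * norm e" using lip[of P "P - e"] by (intro mult_right_mono) auto
  finally show ?thesis by (simp add: power2_eq_square mult.assoc)
qed

text \<open>The distance is also a Taylor remainder, so its dependence on \<open>P\<close> is quadratic in \<open>e\<close>.\<close>

lemma breg_eq_taylor1: "breg \<phi> P e = taylor1 (Phi \<phi>) P (P - e)"
  by (simp add: breg_def taylor1_def inner_vec_def grad_nth sum_negf mult.commute)

section \<open>The matrix \<open>H\<close>\<close>

text \<open>Euler's identity once more: it gives \<open>w \<bullet> p = (|p| / \<phi>(p)) \<phi>(p) - |p| = 0\<close>.\<close>

lemma w_orthogonal: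
  assumes "anisotropy \<phi>" "p \<noteq> 0" shows "w_vec \<phi> p \<bullet> sgn p = 0"
proof -
  have "grad \<phi> p \<bullet> sgn p = \<phi> p / norm p" using euler[OF assms] by (simp add: sgn_div_norm divide_inverse)
  moreover have "sgn p \<bullet> sgn p = 1" using assms(2) by (simp add: dot_square_norm norm_sgn)
  ultimately show ?thesis using assms phi_pos[OF assms] by (simp add: w_vec_def inner_diff_left)
qed

text \<open>The coercivity constant of \<open>H\<close> at \<open>p\<close>.\<close>

definition H_lower :: "(real^'d \<Rightarrow> real) \<Rightarrow> (real^'d \<Rightarrow> real) \<Rightarrow> real^'d \<Rightarrow> real" where
  "H_lower \<phi> \<mu> p = hom0_ext \<mu> p * norm p * \<phi> p * inverse (1 + (norm (w_vec \<phi> p))\<^sup>2)"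

text \<open>Although \<open>H\<close> is not symmetric, its quadratic form is coercive: as \<open>w\<close> is orthogonal to the tangent,
  the rank-two perturbation is at most $|w|^2/(1+|w|^2)$ times the identity.\<close>

lemma H_coercive:
  assumes "anisotropy \<phi>" "mobility \<mu>" "p \<noteq> 0"
  shows "H_lower \<phi> \<mu> p * (norm z)\<^sup>2 \<le> (Hmat \<phi> \<mu> p *v z) \<bullet> z" "0 < H_lower \<phi> \<mu> p"
proof -
  define w t \<alpha> where "w = w_vec \<phi> p" and "t = sgn p" and "\<alpha> = hom0_ext \<mu> p * norm p * \<phi> p"
  have wt: "w \<bullet> t = 0" using w_orthogonal[OF assms(1,3)] by (simp add: w_def t_def)
  have tt: "t \<bullet> t = 1" using assms(3) by (simp add: t_def dot_square_norm norm_sgn)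
  have \<alpha>: "0 < \<alpha>" using assms phi_pos[OF assms(1,3)]
    by (auto simp: \<alpha>_def hom0_ext_def mobility_def norm_sgn)
  define y where "y = z - (t \<bullet> z) *\<^sub>R t"
  have "w \<bullet> y = w \<bullet> z" by (simp add: y_def inner_diff_right wt)
  moreover have "(norm y)\<^sup>2 = (norm z)\<^sup>2 - (t \<bullet> z)\<^sup>2"
    unfolding power2_norm_eq_inner y_def
    by (simp add: inner_diff_left inner_diff_right tt inner_commute[of z t] power2_eq_square)
  moreover have "(w \<bullet> y)\<^sup>2 \<le> (norm w)\<^sup>2 * (norm y)\<^sup>2"
    using Cauchy_Schwarz_ineq[of w y] by (simp add: power2_norm_eq_inner)
  ultimately have "(w \<bullet> z)\<^sup>2 \<le> (norm w)\<^sup>2 * ((norm z)\<^sup>2 - (t \<bullet> z)\<^sup>2)" by (simp only:)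
  then have le: "(w \<bullet> z)\<^sup>2 + (norm w)\<^sup>2 * (t \<bullet> z)\<^sup>2 \<le> (norm w)\<^sup>2 * (norm z)\<^sup>2"
    by (simp add: right_diff_distrib)
  have pos: "0 < 1 + (norm w)\<^sup>2" by (simp add: add_pos_nonneg)
  have eq: "(Hmat \<phi> \<mu> p *v z) \<bullet> z = \<alpha> * ((norm z)\<^sup>2 - ((w \<bullet> z)\<^sup>2 + (norm w)\<^sup>2 * (t \<bullet> z)\<^sup>2) / (1 + (norm w)\<^sup>2))"
    unfolding Hmat_def Let_def w_def[symmetric] t_def[symmetric] \<alpha>_def[symmetric]
    by (simp add: matrix_vector_mult_add_rdistrib matrix_vector_mult_diff_rdistrib scaleR_matrix_vector_assoc[symmetric]
        outer_matvec inner_add_left inner_diff_left power2_norm_eq_inner power2_eq_square[of "_ \<bullet> _"] divide_inverse)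
      (simp add: algebra_simps)
  have "(norm z)\<^sup>2 / (1 + (norm w)\<^sup>2) \<le> (norm z)\<^sup>2 - ((w \<bullet> z)\<^sup>2 + (norm w)\<^sup>2 * (t \<bullet> z)\<^sup>2) / (1 + (norm w)\<^sup>2)"
  proof -
    have "(norm z)\<^sup>2 / (1 + (norm w)\<^sup>2) + ((w \<bullet> z)\<^sup>2 + (norm w)\<^sup>2 * (t \<bullet> z)\<^sup>2) / (1 + (norm w)\<^sup>2)
        \<le> ((norm z)\<^sup>2 + (norm w)\<^sup>2 * (norm z)\<^sup>2) / (1 + (norm w)\<^sup>2)"
      unfolding add_divide_distrib[symmetric] using le pos by (intro divide_right_mono) auto
    also have "\<dots> = (norm z)\<^sup>2 * (1 + (norm w)\<^sup>2) / (1 + (norm w)\<^sup>2)" by (simp add: algebra_simps)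
    also have "\<dots> = (norm z)\<^sup>2" using pos by simp
    finally show ?thesis by simp
  qed
  from mult_left_mono[OF this less_imp_le[OF \<alpha>]]
  show "H_lower \<phi> \<mu> p * (norm z)\<^sup>2 \<le> (Hmat \<phi> \<mu> p *v z) \<bullet> z"
    unfolding eq H_lower_def w_def[symmetric] \<alpha>_def[symmetric] by (simp add: divide_inverse mult_ac)
  show "0 < H_lower \<phi> \<mu> p"
    unfolding H_lower_def w_def[symmetric] \<alpha>_def[symmetric] using \<alpha> pos by simp
qed

lemma H_C3:
  fixes \<phi> \<mu> :: "real^'d \<Rightarrow> real"
  assumes "anisotropy \<phi>" "mobility \<mu>"
  shows "Ck_on 3 (- {0}) (\<lambda>p. Hmat \<phi> \<mu> p $ i $ j)" "Ck_on 3 (- {0}) (H_lower \<phi> \<mu>)"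
proof -
  have op: "open (- {0 :: real^'d})" by auto
  have \<phi>: "Ck_on 3 (- {0}) \<phi>" using Ck_on_SucD[OF phi_C4[OF assms(1)]] by (simp only: numeral_3_eq_3)
  have g: "Ck_on 3 (- {0}) (\<lambda>p. grad \<phi> p $ k)" for k
    using Ck_on_pd[OF phi_C4[OF assms(1)]] by (simp only: numeral_3_eq_3 grad_nth)
  have \<mu>: "Ck_on 3 (- {0}) (hom0_ext \<mu>)" using assms(2) by (simp add: mobility_def)
  have comp: "Ck_on 3 (- {0}) (\<lambda>p :: real^'d. p $ k)" for k
    by (rule Ck_on_bounded_linear[OF op bounded_linear_vec_nth])
  have inv: "Ck_on 3 (- {0}) (\<lambda>p :: real^'d. inverse (norm p))" "Ck_on 3 (- {0}) (\<lambda>p. inverse (\<phi> p))"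
    using phi_pos[OF assms(1)] by (intro Ck_on_inverse op Ck_on_norm \<phi>; force)+
  have t: "Ck_on 3 (- {0}) (\<lambda>p :: real^'d. sgn p $ k)" for k
    using Ck_on_mult[OF op inv(1) comp[of k]] by (simp add: sgn_div_norm)
  have w: "Ck_on 3 (- {0}) (\<lambda>p. w_vec \<phi> p $ k)" for k
    using Ck_on_diff[OF op Ck_on_mult[OF op Ck_on_mult[OF op Ck_on_norm inv(2)] g[of k]] t[of k]]
    by (simp add: w_vec_def divide_inverse)
  have w2: "Ck_on 3 (- {0}) (\<lambda>p. (norm (w_vec \<phi> p))\<^sup>2)"
  proof -
    have "Ck_on 3 (- {0}) (\<lambda>p. \<Sum>k\<in>UNIV. w_vec \<phi> p $ k * w_vec \<phi> p $ k)"
      by (intro Ck_on_sum Ck_on_mult op w)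
    then show ?thesis by (simp add: power2_norm_eq_inner inner_vec_def)
  qed
  have iw: "Ck_on 3 (- {0}) (\<lambda>p. inverse (1 + (norm (w_vec \<phi> p))\<^sup>2))"
    by (intro Ck_on_inverse Ck_on_add Ck_on_const w2 op) (simp add: add_pos_nonneg less_imp_neq[symmetric])
  show "Ck_on 3 (- {0}) (H_lower \<phi> \<mu>)"
    unfolding H_lower_def[abs_def] by (intro Ck_on_mult op \<mu> Ck_on_norm \<phi> iw)
  have "Ck_on 3 (- {0}) (\<lambda>p. hom0_ext \<mu> p * norm p * \<phi> p * ((mat 1 :: real^'d^'d) $ i $ j + inverse (1 + (norm (w_vec \<phi> p))\<^sup>2) *
      (w_vec \<phi> p $ i * (sgn p $ j - w_vec \<phi> p $ j) - sgn p $ i * (w_vec \<phi> p $ j + (norm (w_vec \<phi> p))\<^sup>2 * sgn p $ j))))"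
    by (intro Ck_on_mult Ck_on_add Ck_on_diff Ck_on_const op \<mu> Ck_on_norm \<phi> iw w t w2)
  then show "Ck_on 3 (- {0}) (\<lambda>p. Hmat \<phi> \<mu> p $ i $ j)"
    by (simp add: Hmat_def Let_def outer_def divide_inverse)
qed

lemma H_uniformly_coercive:
  fixes \<phi> \<mu> :: "real^'d \<Rightarrow> real"
  assumes "anisotropy \<phi>" "mobility \<mu>" "0 < a"
  obtains c1 where "0 < c1" "\<And>p z. p \<in> annulus a b \<Longrightarrow> c1 * (norm z)\<^sup>2 \<le> (Hmat \<phi> \<mu> p *v z) \<bullet> z"
proof (cases "annulus a b = ({} :: (real^'d) set)")
  case True
  then show ?thesis using that[of 1] by simp
next
  case False
  have "continuous_on (annulus a b) (H_lower \<phi> \<mu>)"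
    by (rule continuous_on_subset[OF Ck_on_continuous[OF H_C3(2)[OF assms(1,2)]]])
      (use annulus_nonzero[OF _ assms(3)] in auto)
  then obtain q where q: "q \<in> annulus a b" "\<And>p. p \<in> annulus a b \<Longrightarrow> H_lower \<phi> \<mu> q \<le> H_lower \<phi> \<mu> p"
    using continuous_attains_inf[OF compact_annulus False, of "H_lower \<phi> \<mu>"] by blast
  show ?thesis
  proof (rule that)
    show "0 < H_lower \<phi> \<mu> q" using H_coercive(2)[OF assms(1,2)] annulus_nonzero[OF q(1) assms(3)] .
    fix p z :: "real^'d" assume p: "p \<in> annulus a b"
    have "H_lower \<phi> \<mu> q * (norm z)\<^sup>2 \<le> H_lower \<phi> \<mu> p * (norm z)\<^sup>2" using q(2)[OF p] by (intro mult_right_mono) auto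
    also have "\<dots> \<le> (Hmat \<phi> \<mu> p *v z) \<bullet> z" using H_coercive(1)[OF assms(1,2) annulus_nonzero[OF p assms(3)]] .
    finally show "H_lower \<phi> \<mu> q * (norm z)\<^sup>2 \<le> (Hmat \<phi> \<mu> p *v z) \<bullet> z" .
  qed
qed

lemma finite_C3_bound:
  fixes g :: "'i::finite \<Rightarrow> real^'d \<Rightarrow> real"
  assumes "\<And>i. Ck_on 3 (- {0}) (g i)" "0 < a"
  obtains B where "\<And>i. C3_bound a b B (g i)"
proof -
  have "\<forall>i. \<exists>B. C3_bound a b B (g i)" using C3_bound_exists[OF assms] by blast
  then obtain B where B: "\<And>i. C3_bound a b (B i) (g i)" by metis
  then have "0 \<le> B i" for i by (simp add: C3_bound_def)
  then have "B i \<le> sum B UNIV" for i by (intro member_le_sum) auto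
  then show ?thesis using B C3_bound_mono that by blast
qed

section \<open>Pointwise regularity from Sobolev regularity\<close>

lemma LINT_Icc:
  fixes f :: "real \<Rightarrow> 'a::euclidean_space"
  assumes "continuous_on {a..b} f"
  shows "(LINT x|lebesgue_on {a..b}. f x) = integral {a..b} f" "integrable (lebesgue_on {a..b}) f"
  using lebesgue_integral_eq_integral[OF continuous_imp_integrable_real[OF assms]]
    continuous_imp_integrable_real[OF assms] by auto

lemma LINT_Ioo:
  fixes f :: "real \<Rightarrow> 'a::euclidean_space"
  assumes "continuous_on {a..b} f"
  shows "(LINT x|lebesgue_on {a<..<b}. f x) = integral {a..b} f" "integrable (lebesgue_on {a<..<b}) f"
proof -
  have "f absolutely_integrable_on {a<..<b}"
    by (rule set_integrable_subset[OF absolutely_integrable_continuous_real[OF assms]]) auto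
  then show "integrable (lebesgue_on {a<..<b}) f"
    by (simp add: absolutely_integrable_imp_integrable)
  then show "(LINT x|lebesgue_on {a<..<b}. f x) = integral {a..b} f"
    by (simp add: lebesgue_integral_eq_integral integral_open_interval_real)
qed

lemma abs_LINT_le:
  fixes f g :: "'a \<Rightarrow> real"
  assumes "integrable M g" "AE x in M. \<bar>f x\<bar> \<le> g x"
  shows "\<bar>integral\<^sup>L M f\<bar> \<le> integral\<^sup>L M g"
proof -
  have nn: "AE x in M. 0 \<le> g x" using assms(2) by eventually_elim auto
  have "integral\<^sup>L M f \<le> integral\<^sup>L M g"
    by (rule integral_mono_AE'[OF assms(1) _ nn]) (use assms(2) in eventually_elim, auto)
  moreover have "integral\<^sup>L M (\<lambda>x. - f x) \<le> integral\<^sup>L M g"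
    by (rule integral_mono_AE'[OF assms(1) _ nn]) (use assms(2) in eventually_elim, auto)
  ultimately show ?thesis by simp
qed

text \<open>Test functions are built as antiderivatives on the whole line, so that they can be translated.\<close>

lemma antiderivative_on_reals:
  fixes \<psi> :: "real \<Rightarrow> real"
  assumes "continuous_on UNIV \<psi>"
  shows "\<exists>\<Psi>. \<forall>x. (\<Psi> has_real_derivative \<psi> x) (at x)"
proof -
  define \<Psi> where "\<Psi> x = integral {0..x} \<psi> - integral {x..0} \<psi>" for x
  have c: "continuous_on {a..b} \<psi>" for a b using assms continuous_on_subset by blast
  then have i: "\<psi> integrable_on {a..b}" for a b by (rule integrable_continuous_real)
  have "(\<Psi> has_real_derivative \<psi> x) (at x)" for x
  proof -
    define N where "N = \<bar>x\<bar> + 1"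
    have N: "- N < x" "x < N" "0 < N" by (auto simp: N_def)
    have eq: "integral {- N..y} \<psi> - integral {- N..0} \<psi> = \<Psi> y" if "y \<in> {- N<..<N}" for y
    proof (cases "0 \<le> y")
      case True
      then show ?thesis using Henstock_Kurzweil_Integration.integral_combine[OF _ True i, of "-N"] N
        by (cases "y = 0") (auto simp: \<Psi>_def)
    next
      case False
      then show ?thesis using Henstock_Kurzweil_Integration.integral_combine[of "-N" y 0, OF _ _ i] that
        by (auto simp: \<Psi>_def)
    qed
    have "((\<lambda>y. integral {- N..y} \<psi>) has_real_derivative \<psi> x) (at x within {- N..N})"
      by (rule integral_has_real_derivative[OF c]) (use N in auto)
    then have "((\<lambda>y. integral {- N..y} \<psi>) has_real_derivative \<psi> x) (at x)"
      using N by (simp add: at_within_Icc_at)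
    then have "((\<lambda>y. integral {- N..y} \<psi> - integral {- N..0} \<psi>) has_real_derivative \<psi> x) (at x)"
      by (auto intro!: derivative_eq_intros)
    then show ?thesis
      by (rule has_field_derivative_transform_within_open[of _ _ _ "{- N<..<N}"]) (use N eq in auto)
  qed
  then show ?thesis by blast
qed

lemma integral_FTC:
  fixes F f :: "real \<Rightarrow> real"
  assumes "\<And>x. (F has_real_derivative f x) (at x)" "a \<le> b"
  shows "integral {a..b} f = F b - F a"
  using assms
  by (intro integral_unique fundamental_theorem_of_calculus)
    (auto simp: has_real_derivative_iff_has_vector_derivative[symmetric] intro: DERIV_subset)

lemma integral_shift_real:
  fixes f :: "real \<Rightarrow> real"
  assumes "continuous_on UNIV f"
  shows "integral {a..b} (\<lambda>x. f (x + c)) = integral {a + c..b + c} f"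
proof (cases "a \<le> b")
  case True
  obtain F where F: "\<And>x. (F has_real_derivative f x) (at x)" using antiderivative_on_reals[OF assms] by blast
  have "((\<lambda>x. F (x + c)) has_real_derivative f (x + c)) (at x)" for x
    using F[of "x + c"] DERIV_shift[of F "f (x + c)" x c] by simp
  then show ?thesis using True by (simp add: integral_FTC[OF F] integral_FTC[of "\<lambda>x. F (x + c)"])
qed simp

lemma integral_four:
  fixes f1 f2 f3 f4 :: "real \<Rightarrow> real"
  assumes "f1 integrable_on S" "f2 integrable_on S" "f3 integrable_on S" "f4 integrable_on S"
  shows "integral S (\<lambda>x. f1 x - f2 x - f3 x + f4 x) = integral S f1 - integral S f2 - integral S f3 + integral S f4"
  by (intro integral_unique has_integral_add has_integral_diff integrable_integral assms)

lemma integral_zero_outside: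
  fixes f :: "real \<Rightarrow> real"
  assumes "\<And>x. x \<notin> {a..b} \<Longrightarrow> f x = 0" "{a..b} \<subseteq> {c..d}"
  shows "integral {c..d} f = integral {a..b} f"
proof -
  have "(\<lambda>x. if x \<in> {a..b} then f x else 0) = f" using assms(1) by auto
  moreover have "{a..b} \<inter> {c..d} = {a..b}" using assms(2) by blast
  ultimately show ?thesis using integral_restrict_Int[of "{c..d}" "{a..b}" f] by (simp only:)
qed

lemma C1_differentiable_onI:
  fixes f :: "real \<Rightarrow> real"
  assumes "\<And>x. (f has_real_derivative f' x) (at x)" "continuous_on UNIV f'"
  shows "f C1_differentiable_on UNIV" "deriv f = f'"
  using assms DERIV_imp_deriv[OF assms(1)]
  by (auto simp: C1_differentiable_on_def has_real_derivative_iff_has_vector_derivative[symmetric])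

text \<open>A function with a bounded weak derivative is Lipschitz: test with the smoothed indicator function
  of \<open>(t, t + k)\<close>, whose derivative is a difference of two translates of a bump \<open>\<psi>\<close>. The bump is placed
  where the claimed inequality would fail.\<close>

lemma Lipschitz_of_weak_derivative:
  fixes F g :: "real \<Rightarrow> real"
  assumes F: "continuous_on {0..T} F"
    and weak: "\<And>\<zeta>. \<zeta> C1_differentiable_on UNIV \<Longrightarrow> \<exists>a b. 0 < a \<and> b < T \<and> (\<forall>t. t \<notin> {a..b} \<longrightarrow> \<zeta> t = 0) \<Longrightarrow>
      (LINT t|lebesgue_on {0<..<T}. deriv \<zeta> t * F t) = - (LINT t|lebesgue_on {0<..<T}. \<zeta> t * g t)"
    and g: "AE t in lebesgue_on {0<..<T}. \<bar>g t\<bar> \<le> K"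
    and st: "s \<in> {0..T}" "t \<in> {0..T}"
  shows "\<bar>F t - F s\<bar> \<le> K * \<bar>t - s\<bar>"
proof -
  have key: "integral {a..b} (\<lambda>t. \<psi> t * (F t - F (t + k))) \<le> K * (k * integral {a..b} \<psi>)"
       "- (integral {a..b} (\<lambda>t. \<psi> t * (F t - F (t + k)))) \<le> K * (k * integral {a..b} \<psi>)"
    if k: "0 < k" and ab: "0 < a" "a \<le> b" "b + k < T" and \<psi>: "continuous_on UNIV \<psi>" "\<And>t. 0 \<le> \<psi> t"
      "\<And>t. t \<notin> {a..b} \<Longrightarrow> \<psi> t = 0" for \<psi> :: "real \<Rightarrow> real" and a b k
  proof -
    obtain \<Psi> where \<Psi>: "\<And>x. (\<Psi> has_real_derivative \<psi> x) (at x)" using antiderivative_on_reals[OF \<psi>(1)] by blast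
    define \<zeta> where "\<zeta> t = \<Psi> t - \<Psi> (t - k)" for t
    define \<zeta>' where "\<zeta>' t = \<psi> t - \<psi> (t - k)" for t
    have \<Psi>s: "((\<lambda>t. \<Psi> (t - k)) has_real_derivative \<psi> (t - k)) (at t)" for t
      using \<Psi>[of "t - k"] DERIV_shift[of \<Psi> "\<psi> (t - k)" t "-k"] by simp
    have d: "(\<zeta> has_real_derivative \<zeta>' t) (at t)" for t
      unfolding \<zeta>_def \<zeta>'_def by (intro DERIV_diff \<Psi> \<Psi>s)
    have c': "continuous_on UNIV \<zeta>'"
      unfolding \<zeta>'_def by (intro continuous_intros \<psi>(1) continuous_on_compose2[OF \<psi>(1)]) auto
    have c\<zeta>: "continuous_on UNIV \<zeta>" using d by (meson DERIV_continuous continuous_at_imp_continuous_on)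
    have mono: "\<Psi> x \<le> \<Psi> y" if "x \<le> y" for x y
      using DERIV_nonneg_imp_nondecreasing[OF that] \<Psi> \<psi>(2) by blast
    then have \<zeta>0: "0 \<le> \<zeta> t" for t using k by (simp add: \<zeta>_def)
    have const: "\<Psi> x = \<Psi> y" if "x \<le> y" "\<And>z. x < z \<Longrightarrow> z < y \<Longrightarrow> z \<notin> {a..b}" for x y
    proof (cases "x = y")
      case False
      then have "x < y" using that(1) by simp
      then obtain z where z: "x < z" "z < y" "\<Psi> y - \<Psi> x = (y - x) * \<psi> z" using MVT2[of x y \<Psi> \<psi>] \<Psi> by blast
      have "\<psi> z = 0" using \<psi>(3) that(2)[OF z(1,2)] by blast
      then show ?thesis using z(3) by simp
    qed simp
    have supp: "\<zeta> t = 0" if "t \<notin> {a..b + k}" for t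
      using const[of "t - k" t] that k by (force simp: \<zeta>_def)
    have w: "(LINT t|lebesgue_on {0<..<T}. deriv \<zeta> t * F t) = - (LINT t|lebesgue_on {0<..<T}. \<zeta> t * g t)"
      using supp ab by (intro weak C1_differentiable_onI[OF d c'] exI[of _ a] exI[of _ "b + k"]) auto
    have "integral {0..T} (\<lambda>t. \<zeta>' t * f t) = integral {a..b} (\<lambda>t. \<psi> t * (f t - f (t + k)))"
      if f: "continuous_on {0..T} f" for f
    proof -
      \<comment> \<open>To shift the variable, \<open>f\<close> is extended continuously to the line.\<close>
      define f' where "f' t = f (max 0 (min T t))" for t
      have cf': "continuous_on UNIV f'"
        unfolding f'_def by (intro continuous_on_compose2[OF f] continuous_intros) (use ab k in auto)
      have eqf: "f' t = f t" if "t \<in> {0..T}" for t using that by (auto simp: f'_def min_def max_def)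
      have ci: "(\<lambda>t. \<psi> t * f' (t + c)) integrable_on {u..v}" "(\<lambda>t. \<psi> (t + c) * f' t) integrable_on {u..v}" for u v c
        by (intro integrable_continuous_real continuous_intros continuous_on_compose2[OF \<psi>(1)] continuous_on_compose2[OF cf']; simp)+
      have "integral {0..T} (\<lambda>t. \<zeta>' t * f t) = integral {0..T} (\<lambda>t. \<psi> t * f' t - \<psi> (t - k) * f' t)"
        by (rule integral_cong) (simp add: eqf \<zeta>'_def algebra_simps)
      also have "\<dots> = integral {0..T} (\<lambda>t. \<psi> t * f' t) - integral {0..T} (\<lambda>t. \<psi> (t - k) * f' t)"
        using ci(1)[where c=0] ci(2)[where c="-k"] by (intro Henstock_Kurzweil_Integration.integral_diff) auto
      also have "integral {0..T} (\<lambda>t. \<psi> t * f' t) = integral {a..b} (\<lambda>t. \<psi> t * f' t)"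
        using ab k \<psi>(3) by (intro integral_zero_outside) auto
      also have "integral {0..T} (\<lambda>t. \<psi> (t - k) * f' t) = integral {a + k..b + k} (\<lambda>t. \<psi> (t - k) * f' t)"
        using ab k by (intro integral_zero_outside) (auto intro!: \<psi>(3))
      also have "\<dots> = integral {a..b} (\<lambda>t. \<psi> t * f' (t + k))"
        using integral_shift_real[of "\<lambda>t. \<psi> (t - k) * f' t" a b k, symmetric]
        by (simp add: continuous_on_mult continuous_on_compose2[OF \<psi>(1)] cf' continuous_on_diff)
      also have "integral {a..b} (\<lambda>t. \<psi> t * f' t) - integral {a..b} (\<lambda>t. \<psi> t * f' (t + k))
          = integral {a..b} (\<lambda>t. \<psi> t * f' t - \<psi> t * f' (t + k))"
        using ci(1)[where c=0] ci(1) by (intro Henstock_Kurzweil_Integration.integral_diff[symmetric]) auto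
      also have "\<dots> = integral {a..b} (\<lambda>t. \<psi> t * (f t - f (t + k)))"
        using ab k by (intro integral_cong) (simp add: eqf right_diff_distrib)
      finally show ?thesis .
    qed
    note shift = this
    have "integral {0..T} \<zeta> = - integral {0..T} (\<lambda>t. \<zeta>' t * t)"
    proof -
      have "((\<lambda>t. \<zeta> t * t) has_real_derivative \<zeta>' t * t + \<zeta> t) (at t)" for t
        using d by (auto intro!: derivative_eq_intros)
      then have "integral {0..T} (\<lambda>t. \<zeta>' t * t + \<zeta> t) = \<zeta> T * T - \<zeta> 0 * 0"
        using ab k by (intro integral_FTC) auto
      moreover have "integral {0..T} (\<lambda>t. \<zeta>' t * t + \<zeta> t) = integral {0..T} (\<lambda>t. \<zeta>' t * t) + integral {0..T} \<zeta>"
        using c' c\<zeta> by (intro Henstock_Kurzweil_Integration.integral_add integrable_continuous_real continuous_intros)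
          (auto intro: continuous_on_subset)
      moreover have "\<zeta> T = 0" using ab k by (intro supp) auto
      ultimately show ?thesis by simp
    qed
    also have "integral {0..T} (\<lambda>t. \<zeta>' t * t) = integral {a..b} (\<lambda>t. \<psi> t * (t - (t + k)))"
      by (rule shift) (intro continuous_intros)
    also have "- \<dots> = k * integral {a..b} \<psi>" by (simp add: mult.commute)
    finally have int\<zeta>: "integral {0..T} \<zeta> = k * integral {a..b} \<psi>" .
    have c\<zeta>T: "continuous_on {0..T} (\<lambda>t. K * \<zeta> t)" using c\<zeta> by (intro continuous_intros) (auto intro: continuous_on_subset)
    have "AE t in lebesgue_on {0<..<T}. \<bar>\<zeta> t * g t\<bar> \<le> K * \<zeta> t"
      using g by eventually_elim (simp add: abs_mult \<zeta>0 mult.commute[of K] mult_left_mono)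
    from abs_LINT_le[OF LINT_Ioo(2)[OF c\<zeta>T] this, unfolded LINT_Ioo(1)[OF c\<zeta>T]]
    have "\<bar>LINT t|lebesgue_on {0<..<T}. \<zeta> t * g t\<bar> \<le> K * (k * integral {a..b} \<psi>)"
      by (simp add: int\<zeta>)
    moreover have "(LINT t|lebesgue_on {0<..<T}. deriv \<zeta> t * F t) = integral {a..b} (\<lambda>t. \<psi> t * (F t - F (t + k)))"
      unfolding C1_differentiable_onI(2)[OF d c'] shift[OF F, symmetric]
      by (rule LINT_Ioo(1)) (intro continuous_intros F continuous_on_subset[OF c'], auto)
    ultimately show "integral {a..b} (\<lambda>t. \<psi> t * (F t - F (t + k))) \<le> K * (k * integral {a..b} \<psi>)"
       "- (integral {a..b} (\<lambda>t. \<psi> t * (F t - F (t + k)))) \<le> K * (k * integral {a..b} \<psi>)"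
      using w by auto
  qed
  have one_sided: "\<sigma> * (F t - F (t + k)) \<le> K * k" if tk: "0 < t" "0 < k" "t + k < T" and \<sigma>: "\<sigma> = 1 \<or> \<sigma> = -1" for t k \<sigma>
  proof (rule ccontr)
    define D where "D s = \<sigma> * (F s - F (s + k)) - K * k" for s
    assume "\<not> ?thesis"
    then have Dt: "0 < D t" by (simp add: D_def)
    have cD: "continuous_on {0..T - k} D"
      unfolding D_def using tk by (intro continuous_intros continuous_on_compose2[OF F]) auto
    define r0 where "r0 = min t (T - k - t) / 2"
    have "r0 \<le> t / 2" "r0 \<le> (T - k - t) / 2" by (auto simp: r0_def)
    moreover have "0 < r0" using tk by (simp add: r0_def)
    ultimately have r0: "0 < r0" "{t - r0..t + r0} \<subseteq> {0<..<T - k}" using tk by auto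
    obtain e where e: "0 < e" "\<And>s. s \<in> {0..T - k} \<Longrightarrow> \<bar>s - t\<bar> < e \<Longrightarrow> \<bar>D s - D t\<bar> < D t"
      using cD[unfolded continuous_on_iff, rule_format, of t "D t"] Dt tk by (auto simp: dist_real_def)
    define r where "r = min r0 (e / 2)"
    have r: "0 < r" "r \<le> r0" "r < e" using r0 e by (auto simp: r_def)
    have Dpos: "0 < D s" if "s \<in> {t - r..t + r}" for s
    proof -
      have "s \<in> {t - r0..t + r0}" "\<bar>s - t\<bar> < e" using that r by auto
      then have "\<bar>D s - D t\<bar> < D t" using r0 e by (intro e(2)) auto
      then show ?thesis by auto
    qed
    define \<psi> where "\<psi> s = max 0 (r - \<bar>s - t\<bar>)" for s
    have \<psi>: "continuous_on UNIV \<psi>" "0 \<le> \<psi> s" "s \<notin> {t - r..t + r} \<Longrightarrow> \<psi> s = 0" for s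
      unfolding \<psi>_def by (intro continuous_intros) auto
    have ab: "0 < t - r" "t - r \<le> t + r" "t + r + k < T"
      using r r0(1) subsetD[OF r0(2), of "t - r0"] subsetD[OF r0(2), of "t + r0"] by auto
    have sub: "{t - r..t + r} \<subseteq> {0..T - k}" using ab by auto
    have c1: "continuous_on {t - r..t + r} \<psi>" using \<psi>(1) continuous_on_subset by blast
    have c2: "continuous_on {t - r..t + r} (\<lambda>s. F s - F (s + k))"
      using ab tk by (intro continuous_intros continuous_on_compose2[OF F]) auto
    have "integral {t - r..t + r} (\<lambda>s. \<psi> s * D s)
        = \<sigma> * integral {t - r..t + r} (\<lambda>s. \<psi> s * (F s - F (s + k))) - K * (k * integral {t - r..t + r} \<psi>)"
    proof -
      have "(\<lambda>s. \<psi> s * D s) = (\<lambda>s. \<sigma> * (\<psi> s * (F s - F (s + k))) - K * k * \<psi> s)"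
        by (auto simp: D_def algebra_simps)
      moreover have "integral {t - r..t + r} (\<lambda>s. \<sigma> * (\<psi> s * (F s - F (s + k))) - K * k * \<psi> s)
        = integral {t - r..t + r} (\<lambda>s. \<sigma> * (\<psi> s * (F s - F (s + k)))) - integral {t - r..t + r} (\<lambda>s. K * k * \<psi> s)"
        by (intro Henstock_Kurzweil_Integration.integral_diff integrable_continuous_real
            continuous_on_mult_left continuous_on_mult c1 c2)
      ultimately show ?thesis by simp
    qed
    also have "\<dots> \<le> 0" using key[OF tk(2) ab \<psi>] \<sigma> by auto
    finally have "integral {t - r..t + r} (\<lambda>s. \<psi> s * D s) \<le> 0" .
    moreover have nn: "0 \<le> \<psi> s * D s" if "s \<in> {t - r..t + r}" for s
      using \<psi>(2) Dpos[OF that] by simp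
    moreover have cc: "continuous_on {t - r..t + r} (\<lambda>s. \<psi> s * D s)"
      using c1 continuous_on_subset[OF cD sub] by (intro continuous_intros)
    moreover have "0 \<le> integral {t - r..t + r} (\<lambda>s. \<psi> s * D s)"
      using nn cc by (intro Henstock_Kurzweil_Integration.integral_nonneg integrable_continuous_real)
    ultimately have "\<psi> t * D t = 0" using integral_eq_0_iff[OF cc _ nn] r(1) by auto
    then show False using Dt r by (simp add: \<psi>_def)
  qed
  have interior: "\<bar>F v - F u\<bar> \<le> K * (v - u)" if "0 < u" "u \<le> v" "v < T" for u v
    using one_sided[of u "v - u" 1] one_sided[of u "v - u" "-1"] that by (cases "u = v") (auto simp: abs_le_iff)
  have closed: "\<bar>F v - F u\<bar> \<le> K * (v - u)" if uv: "0 \<le> u" "u < v" "v \<le> T" for u v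
  proof -
    \<comment> \<open>The end points of \<open>[0,T]\<close> are reached by moving \<open>u\<close> and \<open>v\<close> towards each other.\<close>
    define p where "p n = u + (v - u) / (real n + 3)" for n :: nat
    define q where "q n = v - (v - u) / (real n + 3)" for n :: nat
    have pq: "0 < p n" "p n \<le> q n" "q n < T" "p n \<in> {0..T}" "q n \<in> {0..T}" for n
    proof -
      define d where "d = (v - u) / (real n + 3)"
      have d: "0 < d" "d \<le> (v - u) / 2" using uv unfolding d_def by (simp, intro divide_left_mono, auto)
      have "p n = u + d" "q n = v - d" by (simp_all add: p_def q_def d_def)
      then show "0 < p n" "p n \<le> q n" "q n < T" "p n \<in> {0..T}" "q n \<in> {0..T}"
        using uv d by auto
    qed
    have z: "(\<lambda>n. (v - u) / (real n + 3)) \<longlonglongrightarrow> 0"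
      using LIMSEQ_ignore_initial_segment[OF lim_const_over_n[of "v - u"], of 3] by simp
    have "p \<longlonglongrightarrow> u + 0" "q \<longlonglongrightarrow> v - 0" unfolding p_def q_def by (intro tendsto_intros z)+
    then have p: "p \<longlonglongrightarrow> u" and q: "q \<longlonglongrightarrow> v" by simp_all
    have "(\<lambda>n. F (p n)) \<longlonglongrightarrow> F u" "(\<lambda>n. F (q n)) \<longlonglongrightarrow> F v"
      using uv by (auto intro!: continuous_on_tendsto_compose[OF F p] continuous_on_tendsto_compose[OF F q] always_eventually pq)
    then have "(\<lambda>n. \<bar>F (q n) - F (p n)\<bar>) \<longlonglongrightarrow> \<bar>F v - F u\<bar>" "(\<lambda>n. K * (q n - p n)) \<longlonglongrightarrow> K * (v - u)"
      using p q by (auto intro!: tendsto_intros)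
    then show ?thesis by (rule LIMSEQ_le) (use interior[OF pq(1-3)] in auto)
  qed
  show ?thesis using closed[of s t] closed[of t s] st by (cases s t rule: linorder_cases) (auto simp: abs_minus_commute)
qed

lemma periodic1_of_int: "periodic1 f \<Longrightarrow> f (x + of_int n) = f x"
proof (induction n rule: int_induct[of _ 0])
  case (step2 i)
  then show ?case unfolding periodic1_def by (metis diff_add_cancel of_int_diff of_int_1 add_diff_eq)
qed (auto simp: periodic1_def add.assoc[symmetric])

lemma integral_periodic_shift:
  fixes f :: "real \<Rightarrow> real"
  assumes f: "continuous_on UNIV f" and p: "periodic1 f"
  shows "integral {0..1} (\<lambda>x. f (x + c)) = integral {0..1} f"
proof -
  obtain F where F: "\<And>x. (F has_real_derivative f x) (at x)" using antiderivative_on_reals[OF f] by blast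
  have "((\<lambda>x. F (x + 1) - F x) has_real_derivative f (x + 1) - f x) (at x)" for x
    using DERIV_shift[of F "f (x + 1)" x 1] F by (intro DERIV_diff) auto
  then have "((\<lambda>x. F (x + 1) - F x) has_real_derivative 0) (at x)" for x using p by (simp add: periodic1_def)
  from DERIV_isconst_all[OF allI[OF this], of c 0]
  have "F (c + 1) - F c = F 1 - F 0" by simp
  then show ?thesis using integral_shift_real[OF f, of 0 1 c] by (simp add: integral_FTC[OF F] add.commute)
qed

text \<open>The same idea for second derivatives in space: if the second weak derivative is bounded, second
  differences of \<open>y\<close> are bounded. The test function is the second difference of an iterated
  antiderivative of \<open>\<psi>\<close>, the positive part of the amount by which the claim fails; it is periodic and
  nonnegative, although the antiderivative need be neither.\<close>

lemma second_difference_bound: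
  fixes y :: "real \<Rightarrow> real"
  assumes y: "continuous_on UNIV y" "periodic1 y" and kl: "0 \<le> k" "0 \<le> l"
    and weak: "\<And>\<eta> \<eta>1 \<eta>2. (\<And>x. (\<eta> has_real_derivative \<eta>1 x) (at x)) \<Longrightarrow> (\<And>x. (\<eta>1 has_real_derivative \<eta>2 x) (at x)) \<Longrightarrow>
      continuous_on UNIV \<eta>2 \<Longrightarrow> periodic1 \<eta> \<Longrightarrow> periodic1 \<eta>1 \<Longrightarrow> (\<And>x. 0 \<le> \<eta> x) \<Longrightarrow>
      integral {0..1} (\<lambda>x. \<eta>2 x * y x) \<le> K * integral {0..1} \<eta>"
  shows "y (a + k + l) - y (a + k) - y (a + l) + y a \<le> K * k * l"
proof -
  define D where "D x = y (x + k + l) - y (x + k) - y (x + l) + y x - K * k * l" for x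
  define \<psi> where "\<psi> x = max 0 (D x)" for x
  have cy: "continuous_on S (\<lambda>x. y (x + c))" for c S
    by (intro continuous_on_compose2[OF y(1)] continuous_intros) auto
  have cD: "continuous_on UNIV D"
    unfolding D_def add.assoc[of _ k l] by (intro continuous_intros cy y(1))
  then have c\<psi>: "continuous_on UNIV \<psi>" unfolding \<psi>_def by (intro continuous_intros)
  have pD: "periodic1 D" using y(2) by (simp add: periodic1_def D_def add.assoc add.left_commute[of 1] add.commute[of 1])
      (metis (no_types, opaque_lifting) add.assoc add.commute)
  then have p\<psi>: "periodic1 \<psi>" by (simp add: periodic1_def \<psi>_def)
  have \<psi>0: "0 \<le> \<psi> x" for x by (simp add: \<psi>_def)
  obtain P1 where P1: "\<And>x. (P1 has_real_derivative \<psi> x) (at x)" using antiderivative_on_reals[OF c\<psi>] by blast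
  then have cP1: "continuous_on UNIV P1" by (meson DERIV_continuous continuous_at_imp_continuous_on)
  obtain P2 where P2: "\<And>x. (P2 has_real_derivative P1 x) (at x)" using antiderivative_on_reals[OF cP1] by blast
  then have cP2: "continuous_on UNIV P2" by (meson DERIV_continuous continuous_at_imp_continuous_on)
  obtain P3 where P3: "\<And>x. (P3 has_real_derivative P2 x) (at x)" using antiderivative_on_reals[OF cP2] by blast
  define m where "m = P1 1 - P1 0"
  have sh: "((\<lambda>x. P (x + c)) has_real_derivative p (x + c)) (at x)"
    if "\<And>x. (P has_real_derivative p x) (at x)" for P p x and c :: real
    using DERIV_shift[of P "p (x + c)" x c] that by simp
  have const: "f x = f 0" if "\<And>x. (f has_real_derivative 0) (at x)" for f :: "real \<Rightarrow> real" and x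
    using DERIV_isconst_all[of f x 0] that by blast
  have P1p: "P1 (x + 1) - P1 x = m" for x
  proof -
    have "((\<lambda>x. P1 (x + 1) - P1 x) has_real_derivative \<psi> (x + 1) - \<psi> x) (at x)" for x
      by (intro DERIV_diff sh P1)
    then show ?thesis using const[of "\<lambda>x. P1 (x + 1) - P1 x" x] p\<psi> by (simp add: periodic1_def m_def)
  qed
  define c where "c = P2 1 - P2 0"
  have P2p: "P2 (x + 1) - P2 x = m * x + c" for x
  proof -
    have "((\<lambda>x. P2 (x + 1) - P2 x - m * x) has_real_derivative P1 (x + 1) - P1 x - m) (at x)" for x
      by (rule DERIV_diff[OF DERIV_diff[OF sh[OF P2] P2]]) (auto intro!: derivative_eq_intros)
    then show ?thesis using const[of "\<lambda>x. P2 (x + 1) - P2 x - m * x" x] P1p by (simp add: c_def)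
  qed
  define e where "e = P3 1 - P3 0"
  have P3p: "P3 (x + 1) - P3 x = m * x\<^sup>2 / 2 + c * x + e" for x
  proof -
    have "((\<lambda>x. P3 (x + 1) - P3 x - (m * x\<^sup>2 / 2 + c * x)) has_real_derivative P2 (x + 1) - P2 x - (m * x + c)) (at x)" for x
      by (rule DERIV_diff[OF DERIV_diff[OF sh[OF P3] P3]]) (auto intro!: derivative_eq_intros)
    then show ?thesis using const[of "\<lambda>x. P3 (x + 1) - P3 x - (m * x\<^sup>2 / 2 + c * x)" x] P2p by (simp add: e_def)
  qed
  define \<Delta> where "\<Delta> P x = P x - P (x + - k) - P (x + - l) + P (x + - (k + l))" for P :: "real \<Rightarrow> real" and x :: real
  have d\<Delta>: "(\<Delta> P has_real_derivative \<Delta> p x) (at x)" if "\<And>x. (P has_real_derivative p x) (at x)" for P p x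
    unfolding \<Delta>_def by (intro DERIV_add DERIV_diff sh that)
  have c\<Delta>: "continuous_on UNIV (\<Delta> f)" if "continuous_on UNIV f" for f
    unfolding \<Delta>_def by (intro continuous_intros that continuous_on_compose2[OF that]) auto
  have per1: "periodic1 (\<Delta> P1)"
    using P1p by (auto simp: periodic1_def \<Delta>_def algebra_simps)
      (smt (verit) P1p add.commute add_diff_eq diff_add_eq)
  have per2: "periodic1 (\<Delta> P2)"
  proof -
    have "\<Delta> P2 (x + 1) = \<Delta> P2 x" for x
      using P2p[of x] P2p[of "x + - k"] P2p[of "x + - l"] P2p[of "x + - (k + l)"]
      by (simp add: \<Delta>_def algebra_simps)
    then show ?thesis by (simp add: periodic1_def)
  qed
  have \<Delta>0: "0 \<le> \<Delta> P2 x" for x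
  proof -
    have "P1 u \<le> P1 v" if "u \<le> v" for u v using DERIV_nonneg_imp_nondecreasing[OF that] P1 \<psi>0 by blast
    then have "0 \<le> P1 u - P1 (u + - k)" for u using kl by simp
    moreover have "((\<lambda>u. P2 u - P2 (u + - k)) has_real_derivative P1 u - P1 (u + - k)) (at u)" for u
      by (intro DERIV_diff sh P2)
    ultimately have "P2 (x + - l) - P2 (x + - l + - k) \<le> P2 x - P2 (x + - k)"
      using kl(2) by (intro DERIV_nonneg_imp_nondecreasing[of "x + - l" x "\<lambda>u. P2 u - P2 (u + - k)"]) (simp, blast)
    then show ?thesis by (simp add: \<Delta>_def algebra_simps)
  qed
  have "integral {0..1} (\<lambda>x. \<Delta> \<psi> x * y x) \<le> K * integral {0..1} (\<Delta> P2)"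
    by (rule weak[OF d\<Delta>[OF P2] d\<Delta>[OF P1] c\<Delta>[OF c\<psi>] per2 per1 \<Delta>0])
  also have "integral {0..1} (\<Delta> P2) = \<Delta> P3 1 - \<Delta> P3 0" using d\<Delta>[OF P3] by (intro integral_FTC) auto
  also have "\<dots> = m * k * l"
  proof -
    have "\<Delta> P3 1 - \<Delta> P3 0 = (P3 (0 + 1) - P3 0) - (P3 (- k + 1) - P3 (- k)) - (P3 (- l + 1) - P3 (- l))
        + (P3 (- (k + l) + 1) - P3 (- (k + l)))"
      by (simp add: \<Delta>_def algebra_simps)
    also have "\<dots> = m * k * l" unfolding P3p by (simp add: power2_eq_square field_simps)
    finally show ?thesis .
  qed
  also have "m = integral {0..1} \<psi>" unfolding m_def by (rule integral_FTC[OF P1, symmetric]) simp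
  finally have le: "integral {0..1} (\<lambda>x. \<Delta> \<psi> x * y x) \<le> K * (integral {0..1} \<psi> * k * l)" .
  have ctm: "continuous_on UNIV (\<lambda>x. \<psi> x * y (x + s))" for s by (intro continuous_intros c\<psi> cy)
  have ctm': "continuous_on UNIV (\<lambda>x. \<psi> (x + - s) * y x)" for s
    by (intro continuous_intros y(1) continuous_on_compose2[OF c\<psi>]) auto
  have int: "f integrable_on {0..1}" if "continuous_on UNIV f" for f :: "real \<Rightarrow> real"
    using that by (meson continuous_on_subset integrable_continuous_real subset_UNIV)
  have shift: "integral {0..1} (\<lambda>x. \<psi> (x + - s) * y x) = integral {0..1} (\<lambda>x. \<psi> x * y (x + s))" for s
  proof -
    have "periodic1 (\<lambda>x. \<psi> x * y (x + s))"
      using p\<psi> y(2) by (simp add: periodic1_def) (metis add.assoc add.commute)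
    from integral_periodic_shift[OF ctm this, of "- s"] show ?thesis by simp
  qed
  have "integral {0..1} (\<lambda>x. \<Delta> \<psi> x * y x) = integral {0..1} (\<lambda>x. \<psi> x * y x - \<psi> (x + - k) * y x - \<psi> (x + - l) * y x + \<psi> (x + - (k + l)) * y x)"
    by (simp add: \<Delta>_def algebra_simps)
  also have "\<dots> = integral {0..1} (\<lambda>x. \<psi> x * y (x + 0)) - integral {0..1} (\<lambda>x. \<psi> x * y (x + k))
      - integral {0..1} (\<lambda>x. \<psi> x * y (x + l)) + integral {0..1} (\<lambda>x. \<psi> x * y (x + (k + l)))"
    unfolding shift[symmetric]
    using integral_four[OF int[OF ctm'[of 0]] int[OF ctm'[of k]] int[OF ctm'[of l]] int[OF ctm'[of "k + l"]]]
    by simp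
  also have "\<dots> = integral {0..1} (\<lambda>x. \<psi> x * y (x + 0) - \<psi> x * y (x + k) - \<psi> x * y (x + l) + \<psi> x * y (x + (k + l)))"
    by (rule integral_four[symmetric]) (intro int ctm)+
  also have "\<dots> = integral {0..1} (\<lambda>x. \<psi> x * D x + K * k * l * \<psi> x)"
    by (simp add: D_def algebra_simps)
  also have "\<dots> = integral {0..1} (\<lambda>x. \<psi> x * D x) + K * k * l * integral {0..1} \<psi>"
    using int[OF continuous_on_mult[OF c\<psi> cD]] int[OF continuous_on_mult_left[OF c\<psi>]]
    by (simp add: Henstock_Kurzweil_Integration.integral_add)
  finally have neg: "integral {0..1} (\<lambda>x. \<psi> x * D x) \<le> 0" using le by (simp add: mult_ac)
  have nn: "0 \<le> \<psi> x * D x" for x by (simp add: \<psi>_def max_def)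
  have cc: "continuous_on {0..1} (\<lambda>x. \<psi> x * D x)"
    using c\<psi> cD by (intro continuous_intros) (auto intro: continuous_on_subset)
  have "0 \<le> integral {0..1} (\<lambda>x. \<psi> x * D x)"
    using nn cc by (intro Henstock_Kurzweil_Integration.integral_nonneg integrable_continuous_real)
  then have "\<psi> x * D x = 0" if "x \<in> {0..1}" for x
    using integral_eq_0_iff[OF cc] nn neg that by auto
  from this[of "frac a"] have "\<psi> (frac a) * D (frac a) = 0" using frac_lt_1[of a] by simp
  then have "D (frac a) \<le> 0" by (cases "D (frac a) \<le> 0") (auto simp: \<psi>_def max_def)
  moreover have "D a = D (frac a)" using periodic1_of_int[OF pD, of "frac a" "\<lfloor>a\<rfloor>"] by (simp add: frac_def)
  ultimately show ?thesis by (simp add: D_def)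
qed

lemma AE_Ioo_imp_ex:
  fixes T :: real
  assumes "AE t in lebesgue_on {0<..<T}. P t" "0 < T" shows "\<exists>t\<in>{0<..<T}. P t"
proof (rule ccontr)
  assume "\<not> ?thesis"
  then have no: "\<not> P t" if "t \<in> {0<..<T}" for t using that by blast
  have "AE t in lebesgue_on {0<..<T}. \<bar>1::real\<bar> \<le> (\<lambda>_. 0) t"
    using assms(1) AE_space by eventually_elim (use no in simp)
  then have "\<bar>LINT t|lebesgue_on {0<..<T}. (1::real)\<bar> \<le> (LINT t|lebesgue_on {0<..<T}. (0::real))"
    by (intro abs_LINT_le) auto
  then show False using LINT_Ioo(1)[of 0 T "\<lambda>_. 1::real"] assms(2) by simp
qed

lemma norm_le_of_inner:
  fixes v :: "'a::euclidean_space"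
  assumes "\<And>e. norm e = 1 \<Longrightarrow> v \<bullet> e \<le> B" "0 \<le> B"
  shows "norm v \<le> B"
proof (cases "v = 0")
  case False
  have "v \<bullet> sgn v = norm v"
    using False by (simp add: sgn_div_norm power2_norm_eq_inner[symmetric] power2_eq_square)
  then show ?thesis using assms(1)[of "sgn v"] False by (simp add: norm_sgn)
qed (use assms in simp)

text \<open>One of the two steps of the second difference is sent to zero.\<close>

lemma derivative_Lipschitz_of_second_difference:
  fixes z z' :: "real \<Rightarrow> 'a::euclidean_space"
  assumes d: "\<And>\<rho>. (z has_vector_derivative z' \<rho>) (at \<rho>)" and K: "0 \<le> K"
    and sd: "\<And>e a k l. norm e = 1 \<Longrightarrow> 0 \<le> k \<Longrightarrow> 0 \<le> l \<Longrightarrow> (z (a + k + l) - z (a + k) - z (a + l) + z a) \<bullet> e \<le> K * k * l"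
  shows "norm (z' \<rho> - z' \<sigma>) \<le> K * \<bar>\<rho> - \<sigma>\<bar>"
proof -
  have ordered: "norm (z' (a + l) - z' a) \<le> K * l" if l: "0 \<le> l" for a l
  proof (rule norm_le_of_inner)
    fix e :: 'a assume e: "norm e = 1"
    define f where "f k = (z (a + l + k) - z (a + k)) \<bullet> e" for k
    have sh: "((\<lambda>k. z (c + k)) has_vector_derivative z' c) (at 0)" for c
    proof -
      have "((\<lambda>k. c + k) has_vector_derivative 1) (at (0::real))" by (auto intro!: derivative_eq_intros)
      from vector_diff_chain_at[OF this, of z "z' c"] d[of c] show ?thesis by (simp add: comp_def)
    qed
    have "((\<lambda>k. z (a + l + k) - z (a + k)) has_vector_derivative z' (a + l) - z' a) (at 0)"
      by (intro has_vector_derivative_diff sh)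
    from bounded_linear.has_vector_derivative[OF bounded_linear_inner_left this, of e]
    have "(f has_real_derivative (z' (a + l) - z' a) \<bullet> e) (at 0)"
      by (simp add: f_def[abs_def] has_real_derivative_iff_has_vector_derivative)
    then have "((\<lambda>h. (f (0 + h) - f 0) / h) \<longlongrightarrow> (z' (a + l) - z' a) \<bullet> e) (at 0)"
      by (simp add: DERIV_def)
    then have lim: "((\<lambda>h. (f (0 + h) - f 0) / h) \<longlongrightarrow> (z' (a + l) - z' a) \<bullet> e) (at_right 0)"
      by (rule tendsto_mono[rotated]) (simp add: at_le)
    show "(z' (a + l) - z' a) \<bullet> e \<le> K * l"
    proof (rule tendsto_upperbound[OF lim])
      have "(f (0 + h) - f 0) / h \<le> K * l" if h: "0 < h" for h
      proof -
        have "f (0 + h) - f 0 = (z (a + h + l) - z (a + h) - z (a + l) + z a) \<bullet> e"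
          by (simp add: f_def inner_diff_left inner_add_left add_ac)
        also have "\<dots> \<le> K * h * l" using sd[OF e _ l] h by simp
        finally show ?thesis using h by (simp add: pos_divide_le_eq mult_ac)
      qed
      then show "\<forall>\<^sub>F h in at_right 0. (f (0 + h) - f 0) / h \<le> K * l"
        by (auto simp: eventually_at_right_less intro: eventually_mono[OF eventually_at_right_less])
    qed simp
  qed (use K l in simp)
  show ?thesis
  proof (cases "\<sigma> \<le> \<rho>")
    case True
    then show ?thesis using ordered[of "\<rho> - \<sigma>" \<sigma>] by simp
  next
    case False
    then show ?thesis using ordered[of "\<sigma> - \<rho>" \<rho>] by (simp add: norm_minus_commute)
  qed
qed

text \<open>Each component of the derivative of a periodic function vanishes somewhere within a period, by Rolle's
  theorem.\<close>

lemma periodic_derivative_bound: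
  fixes z z' :: "real \<Rightarrow> 'a::euclidean_space"
  assumes d: "\<And>\<rho>. (z has_vector_derivative z' \<rho>) (at \<rho>)" and K: "0 \<le> K" and p: "periodic1 z"
    and lip: "\<And>\<rho> \<sigma>. norm (z' \<rho> - z' \<sigma>) \<le> K * \<bar>\<rho> - \<sigma>\<bar>"
  shows "norm (z' \<rho>) \<le> K"
proof (rule norm_le_of_inner)
  fix e :: 'a assume e: "norm e = 1"
  have D: "((\<lambda>\<rho>. z \<rho> \<bullet> e) has_real_derivative z' \<rho> \<bullet> e) (at \<rho>)" for \<rho>
    using bounded_linear.has_vector_derivative[OF bounded_linear_inner_left d, of e]
    by (simp add: has_real_derivative_iff_has_vector_derivative)
  obtain c where c: "\<rho> < c" "c < \<rho> + 1" "z (\<rho> + 1) \<bullet> e - z \<rho> \<bullet> e = (\<rho> + 1 - \<rho>) * (z' c \<bullet> e)"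
    using MVT2[of \<rho> "\<rho> + 1" "\<lambda>\<rho>. z \<rho> \<bullet> e" "\<lambda>\<rho>. z' \<rho> \<bullet> e"] D by auto
  then have "z' c \<bullet> e = 0" using p by (simp add: periodic1_def)
  then have "z' \<rho> \<bullet> e = (z' \<rho> - z' c) \<bullet> e" by (simp add: inner_diff_left)
  also have "\<dots> \<le> norm (z' \<rho> - z' c) * norm e" by (rule norm_cauchy_schwarz)
  also have "\<dots> \<le> K * \<bar>\<rho> - c\<bar>" using lip e by simp
  also have "\<dots> \<le> K * 1" using c K by (intro mult_left_mono) auto
  finally show "z' \<rho> \<bullet> e \<le> K" by simp
qed (rule K)

lemma vector_derivative_norm_le:
  fixes f :: "real \<Rightarrow> 'a::euclidean_space"
  assumes d: "(f has_vector_derivative D) (at t within {0..T})" and t: "t \<in> {0..T}" "0 < T"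
    and L: "\<And>s. s \<in> {0..T} \<Longrightarrow> norm (f s - f t) \<le> L * \<bar>s - t\<bar>" "0 \<le> L"
  shows "norm D \<le> L"
proof (rule norm_le_of_inner)
  fix e :: 'a assume e: "norm e = 1"
  have "((\<lambda>s. f s \<bullet> e) has_real_derivative D \<bullet> e) (at t within {0..T})"
    using bounded_linear.has_vector_derivative[OF bounded_linear_inner_left d, of e]
    by (simp add: has_real_derivative_iff_has_vector_derivative)
  then have lim: "((\<lambda>s. (f s \<bullet> e - f t \<bullet> e) / (s - t)) \<longlongrightarrow> D \<bullet> e) (at t within {0..T})"
    by (simp add: has_field_derivative_iff)
  have "t islimpt {0..T}" using t by (intro connected_imp_perfect) auto
  then have nt: "at t within {0..T} \<noteq> bot" by (simp add: trivial_limit_within)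
  have "(f s \<bullet> e - f t \<bullet> e) / (s - t) \<le> L" if s: "s \<in> {0..T}" "s \<noteq> t" for s
  proof -
    have "(f s \<bullet> e - f t \<bullet> e) / (s - t) \<le> \<bar>(f s - f t) \<bullet> e\<bar> / \<bar>s - t\<bar>"
      by (metis abs_divide abs_ge_self inner_diff_left)
    also have "\<dots> \<le> (L * \<bar>s - t\<bar>) / \<bar>s - t\<bar>"
      using Cauchy_Schwarz_ineq2[of "f s - f t" e] e L(1)[OF s(1)] by (intro divide_right_mono) auto
    finally show ?thesis using s by simp
  qed
  then show "D \<bullet> e \<le> L"
    by (intro tendsto_upperbound[OF lim _ nt]) (auto simp: eventually_at_filter)
qed (rule L(2))

lemma Linf_norm_lessD:
  assumes "f \<in> Linf" "Linf_norm f < C" shows "AE \<rho> in \<I>. norm (f \<rho>) \<le> C"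
proof -
  have "{C. AE \<rho> in \<I>. norm (f \<rho>) \<le> C} \<noteq> {}" using assms(1) by (auto simp: Linf_def)
  from cInf_lessD[OF this assms(2)[unfolded Linf_norm_def]]
  obtain C' where C': "AE \<rho> in \<I>. norm (f \<rho>) \<le> C'" "C' < C" by auto
  show ?thesis using C'(1) by eventually_elim (use C'(2) in simp)
qed

text \<open>Two integrations by parts move the derivatives from the test function to \<open>v\<close>. The norm is an infimum
  over representatives of the weak derivatives, which is approached only up to the summand \<open>1\<close>.\<close>

lemma W2inf_pairing:
  fixes v :: "real \<Rightarrow> 'a::euclidean_space"
  assumes v: "v \<in> W2inf" "W2inf_norm v \<le> C" and e: "norm e = 1"
    and \<eta>: "\<And>x. (\<eta> has_real_derivative \<eta>1 x) (at x)" "\<And>x. (\<eta>1 has_real_derivative \<eta>2 x) (at x)"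
      "continuous_on UNIV \<eta>2" "periodic1 \<eta>" "periodic1 \<eta>1" "\<And>x. 0 \<le> \<eta> x"
  shows "\<bar>LINT \<rho>|\<I>. v \<rho> \<bullet> (\<eta>2 \<rho> *\<^sub>R e)\<bar> \<le> (\<bar>C\<bar> + 1) * integral {0..1} \<eta>"
proof -
  let ?S = "{max (Linf_norm v) (max (Linf_norm g) (Linf_norm k)) | g k.
            g \<in> Linf \<and> k \<in> Linf \<and> has_weak_deriv v g \<and> has_weak_deriv g k}"
  have "?S \<noteq> {}" using v(1) by (auto simp: W2inf_def)
  moreover have "Inf ?S < \<bar>C\<bar> + 1" using v(2) by (simp add: W2inf_norm_def)
  ultimately have "\<exists>s\<in>?S. s < \<bar>C\<bar> + 1" by (rule cInf_lessD)
  then obtain g k where gk: "k \<in> Linf" "has_weak_deriv v g" "has_weak_deriv g k" "Linf_norm k < \<bar>C\<bar> + 1" by auto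
  have c1: "continuous_on UNIV \<eta>1" "continuous_on UNIV \<eta>"
    using \<eta>(1,2) by (meson DERIV_continuous continuous_at_imp_continuous_on)+
  have "(LINT \<rho>|\<I>. deriv \<eta>1 \<rho> *\<^sub>R v \<rho>) = - (LINT \<rho>|\<I>. \<eta>1 \<rho> *\<^sub>R g \<rho>)"
    using gk(2) C1_differentiable_onI(1)[OF \<eta>(2,3)] \<eta>(5) unfolding has_weak_deriv_def by blast
  moreover have "(LINT \<rho>|\<I>. deriv \<eta> \<rho> *\<^sub>R g \<rho>) = - (LINT \<rho>|\<I>. \<eta> \<rho> *\<^sub>R k \<rho>)"
    using gk(3) C1_differentiable_onI(1)[OF \<eta>(1) c1(1)] \<eta>(4) unfolding has_weak_deriv_def by blast
  ultimately have eq: "(LINT \<rho>|\<I>. \<eta>2 \<rho> *\<^sub>R v \<rho>) = (LINT \<rho>|\<I>. \<eta> \<rho> *\<^sub>R k \<rho>)"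
    by (simp add: C1_differentiable_onI(2)[OF \<eta>(2,3)] C1_differentiable_onI(2)[OF \<eta>(1) c1(1)])
  have int: "integrable \<I> (\<lambda>\<rho>. f \<rho> *\<^sub>R u \<rho>)" if f: "continuous_on UNIV f" and u: "integrable \<I> u"
    for f and u :: "real \<Rightarrow> 'a"
  proof -
    have cf: "continuous_on {0..1} f" using f continuous_on_subset by blast
    then have "bounded (f ` {0..1})" by (simp add: compact_continuous_image compact_imp_bounded)
    then obtain B where "\<forall>\<rho>\<in>{0..1}. \<bar>f \<rho>\<bar> \<le> B" by (auto simp: bounded_iff)
    then have B: "\<And>\<rho>. \<rho> \<in> {0..1} \<Longrightarrow> \<bar>f \<rho>\<bar> \<le> B" by blast
    have "integrable \<I> (\<lambda>\<rho>. B *\<^sub>R u \<rho>)" using u by simp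
    then show ?thesis
    proof (rule Bochner_Integration.integrable_bound)
      show "(\<lambda>\<rho>. f \<rho> *\<^sub>R u \<rho>) \<in> borel_measurable \<I>"
        using borel_measurable_integrable[OF u] borel_measurable_integrable[OF LINT_Icc(2)[OF cf]]
        by (rule borel_measurable_scaleR[rotated])
      show "AE \<rho> in \<I>. norm (f \<rho> *\<^sub>R u \<rho>) \<le> norm (B *\<^sub>R u \<rho>)"
        using B by (intro AE_I2) (simp, meson abs_ge_self mult_right_mono norm_ge_zero order_trans)
    qed
  qed
  have iv: "integrable \<I> v" "integrable \<I> k" using gk(2,3) by (auto simp: has_weak_deriv_def)
  have "(LINT \<rho>|\<I>. v \<rho> \<bullet> (\<eta>2 \<rho> *\<^sub>R e)) = (LINT \<rho>|\<I>. \<eta>2 \<rho> *\<^sub>R v \<rho>) \<bullet> e"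
    using int[OF \<eta>(3) iv(1)] by (simp add: integral_inner_left[symmetric])
  also have "\<dots> = (LINT \<rho>|\<I>. \<eta> \<rho> * (k \<rho> \<bullet> e))"
    unfolding eq using int[OF c1(2) iv(2)] by (simp add: integral_inner_left[symmetric])
  also have "\<bar>\<dots>\<bar> \<le> (LINT \<rho>|\<I>. (\<bar>C\<bar> + 1) * \<eta> \<rho>)"
  proof (rule abs_LINT_le)
    show "integrable \<I> (\<lambda>\<rho>. (\<bar>C\<bar> + 1) * \<eta> \<rho>)"
      by (intro LINT_Icc(2) continuous_intros continuous_on_subset[OF c1(2)]) auto
    show "AE \<rho> in \<I>. \<bar>\<eta> \<rho> * (k \<rho> \<bullet> e)\<bar> \<le> (\<bar>C\<bar> + 1) * \<eta> \<rho>"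
      using Linf_norm_lessD[OF gk(1,4)]
    proof eventually_elim
      case (elim \<rho>)
      have "\<bar>k \<rho> \<bullet> e\<bar> \<le> \<bar>C\<bar> + 1" using Cauchy_Schwarz_ineq2[of "k \<rho>" e] e elim by simp
      then show ?case using \<eta>(6)[of \<rho>] by (simp add: abs_mult mult.commute[of _ "\<eta> \<rho>"] mult_left_mono)
    qed
  qed
  also have "\<dots> = (\<bar>C\<bar> + 1) * integral {0..1} \<eta>"
    using LINT_Icc(1)[of 0 1 "\<lambda>\<rho>. (\<bar>C\<bar> + 1) * \<eta> \<rho>"] c1(2)
    by (auto intro: continuous_on_subset continuous_on_mult_left)
  finally show ?thesis .
qed

lemma Linf_pairing:
  fixes z \<eta> :: "real \<Rightarrow> 'a::euclidean_space"
  assumes z: "z \<in> Linf" "Linf_norm z \<le> C" and \<eta>: "continuous_on {0..1} \<eta>"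
  shows "\<bar>LINT \<rho>|\<I>. z \<rho> \<bullet> \<eta> \<rho>\<bar> \<le> (\<bar>C\<bar> + 1) * integral {0..1} (\<lambda>\<rho>. norm (\<eta> \<rho>))"
proof -
  have c: "continuous_on {0..1} (\<lambda>\<rho>. (\<bar>C\<bar> + 1) * norm (\<eta> \<rho>))" by (intro continuous_intros \<eta>)
  have "AE \<rho> in \<I>. norm (z \<rho>) \<le> \<bar>C\<bar> + 1" using z by (intro Linf_norm_lessD) auto
  then have "AE \<rho> in \<I>. \<bar>z \<rho> \<bullet> \<eta> \<rho>\<bar> \<le> (\<bar>C\<bar> + 1) * norm (\<eta> \<rho>)"
  proof eventually_elim
    case (elim \<rho>)
    show ?case using Cauchy_Schwarz_ineq2[of "z \<rho>" "\<eta> \<rho>"] mult_right_mono[OF elim norm_ge_zero[of "\<eta> \<rho>"]] by simp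
  qed
  from abs_LINT_le[OF LINT_Icc(2)[OF c] this, unfolded LINT_Icc(1)[OF c]] show ?thesis by simp
qed

lemma pairing_continuous:
  fixes x :: "real \<Rightarrow> real \<Rightarrow> 'a::euclidean_space"
  assumes x: "continuous_on (UNIV \<times> {0..T}) (\<lambda>(\<rho>, t). x \<rho> t)" and \<eta>: "continuous_on {0..1} \<eta>"
  shows "continuous_on {0..T} (\<lambda>t. LINT \<rho>|\<I>. x \<rho> t \<bullet> \<eta> \<rho>)"
    "t \<in> {0..T} \<Longrightarrow> continuous_on S (\<lambda>\<rho>. x \<rho> t)"
    "t \<in> {0..T} \<Longrightarrow> (LINT \<rho>|\<I>. x \<rho> t \<bullet> \<eta> \<rho>) = integral {0..1} (\<lambda>\<rho>. x \<rho> t \<bullet> \<eta> \<rho>)"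
proof -
  have cx: "continuous_on S (\<lambda>\<rho>. x \<rho> t)" if "t \<in> {0..T}" for t S
  proof -
    have "continuous_on S (\<lambda>\<rho>. (\<rho>, t))" by (intro continuous_intros)
    moreover have "(\<lambda>\<rho>. (\<rho>, t)) ` S \<subseteq> UNIV \<times> {0..T}" using that by auto
    ultimately have "continuous_on S (\<lambda>\<rho>. (\<lambda>(\<rho>, t). x \<rho> t) (\<rho>, t))" by (rule continuous_on_compose2[OF x])
    then show ?thesis by simp
  qed
  then show "t \<in> {0..T} \<Longrightarrow> continuous_on S (\<lambda>\<rho>. x \<rho> t)" .
  have eq: "(LINT \<rho>|\<I>. x \<rho> t \<bullet> \<eta> \<rho>) = integral {0..1} (\<lambda>\<rho>. x \<rho> t \<bullet> \<eta> \<rho>)" if "t \<in> {0..T}" for t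
    by (intro LINT_Icc(1) continuous_intros cx that \<eta>)
  then show "t \<in> {0..T} \<Longrightarrow> (LINT \<rho>|\<I>. x \<rho> t \<bullet> \<eta> \<rho>) = integral {0..1} (\<lambda>\<rho>. x \<rho> t \<bullet> \<eta> \<rho>)" .
  have "continuous_on ({0..T} \<times> cbox 0 1) (\<lambda>(t, \<rho>). x \<rho> t \<bullet> \<eta> \<rho>)"
  proof -
    have "continuous_on ({0..T} \<times> cbox 0 1) (\<lambda>s. (\<lambda>(\<rho>, t). x \<rho> t) (snd s, fst s) \<bullet> \<eta> (snd s))"
      by (intro continuous_intros continuous_on_compose2[OF x] continuous_on_compose2[OF \<eta>]) auto
    then show ?thesis by (simp add: case_prod_beta)
  qed
  from integral_continuous_on_param[OF this]
  show "continuous_on {0..T} (\<lambda>t. LINT \<rho>|\<I>. x \<rho> t \<bullet> \<eta> \<rho>)"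
    by (rule continuous_on_cong[THEN iffD1, rotated 2]) (auto simp: eq)
qed

text \<open>The regularity of the solution in the form in which it is used: Lipschitz bounds that hold at every point.
  The second one, on mixed increments of the space derivative, stands for the boundedness of the mixed
  derivative $x_{t\rho\rho}$.\<close>

definition regular :: "real \<Rightarrow> real \<Rightarrow> (real \<Rightarrow> real \<Rightarrow> 'a::euclidean_space) \<Rightarrow> bool" where
  "regular K T x \<longleftrightarrow> 0 \<le> K \<and> (\<forall>\<rho>\<in>{0..1}. \<forall>\<sigma>\<in>{0..1}. \<forall>t\<in>{0..T}. \<forall>s\<in>{0..T}.
     norm (d_rho (\<lambda>\<sigma>. x \<sigma> t) \<rho> - d_rho (\<lambda>\<sigma>. x \<sigma> t) \<sigma>) \<le> K * \<bar>\<rho> - \<sigma>\<bar> \<and>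
     norm ((d_rho (\<lambda>\<sigma>. x \<sigma> t) \<rho> - d_rho (\<lambda>\<sigma>. x \<sigma> s) \<rho>) - (d_rho (\<lambda>\<sigma>. x \<sigma> t) \<sigma> - d_rho (\<lambda>\<sigma>. x \<sigma> s) \<sigma>))
       \<le> K * \<bar>t - s\<bar> * \<bar>\<rho> - \<sigma>\<bar> \<and>
     norm (d_rho (\<lambda>\<sigma>. x \<sigma> t) \<rho> - d_rho (\<lambda>\<sigma>. x \<sigma> s) \<rho>) \<le> K * \<bar>t - s\<bar> \<and>
     norm (d_t T x \<rho> t) \<le> K \<and>
     norm (d_t T x \<rho> t - d_t T x \<sigma> t) \<le> K * \<bar>\<rho> - \<sigma>\<bar> \<and>
     norm (d_t T x \<rho> t - d_t T x \<rho> s) \<le> K * \<bar>t - s\<bar>)"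

text \<open>The Bochner--Sobolev hypotheses are statements about functions of time with values in function spaces, up to
  null sets. Pairing with a fixed function of space turns them into weak differentiability of real
  functions of time; pointwise statements are recovered by choosing the function of space according to
  where the claimed inequality would fail. Second differences in space give the Lipschitz bounds on
  the space derivative; the remaining bounds follow by periodicity and by passing to difference
  quotients in time.\<close>

lemma regularity:
  fixes x :: "real \<Rightarrow> real \<Rightarrow> 'a::euclidean_space"
  assumes T: "0 < T" and C1: "C1_space_time T x"
    and W: "Bochner_W1inf T W2inf W2inf_norm (\<lambda>t \<rho>. x \<rho> t)"
    and Z: "has_weak_time_deriv T (\<lambda>t \<rho>. d_t T x \<rho> t) z" "Bochner_Linf T Linf Linf_norm z"
  obtains K where "regular K T x"
proof -
  define xr where "xr \<rho> t = d_rho (\<lambda>\<sigma>. x \<sigma> t) \<rho>" for \<rho> t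
  define xt where "xt \<rho> t = d_t T x \<rho> t" for \<rho> t
  have per: "periodic1 (\<lambda>\<rho>. x \<rho> t)" if "t \<in> {0..T}" for t using C1 that by (auto simp: C1_space_time_def)
  have cx: "continuous_on (UNIV \<times> {0..T}) (\<lambda>(\<rho>, t). x \<rho> t)"
    and cxt: "continuous_on (UNIV \<times> {0..T}) (\<lambda>(\<rho>, t). xt \<rho> t)"
    using C1 by (auto simp: C1_space_time_def xt_def)
  have dr: "((\<lambda>\<sigma>. x \<sigma> t) has_vector_derivative xr \<rho> t) (at \<rho>)" if "t \<in> {0..T}" for \<rho> t
    using C1 that by (auto simp: C1_space_time_def xr_def d_rho_def vector_derivative_works[symmetric])
  have dt: "(x \<rho> has_vector_derivative xt \<rho> t) (at t within {0..T})" if "t \<in> {0..T}" for \<rho> t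
    using C1 that by (auto simp: C1_space_time_def xt_def d_t_def vector_derivative_works[symmetric])
  obtain v where v: "Bochner_Linf T W2inf W2inf_norm v" "has_weak_time_deriv T (\<lambda>t \<rho>. x \<rho> t) v"
    using W by (auto simp: Bochner_W1inf_def)
  obtain C where C: "AE t in lebesgue_on {0<..<T}. W2inf_norm (v t) \<le> C" using v(1) by (auto simp: Bochner_Linf_def)
  have vW: "AE t in lebesgue_on {0<..<T}. v t \<in> W2inf" using v(1) by (auto simp: Bochner_Linf_def)
  obtain C' where "AE t in lebesgue_on {0<..<T}. W2inf_norm (\<lambda>\<rho>. x \<rho> t) \<le> C'" "AE t in lebesgue_on {0<..<T}. (\<lambda>\<rho>. x \<rho> t) \<in> W2inf"
    using W by (auto simp: Bochner_W1inf_def Bochner_Linf_def)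
  then have "AE t in lebesgue_on {0<..<T}. W2inf_norm (\<lambda>\<rho>. x \<rho> t) \<le> C' \<and> (\<lambda>\<rho>. x \<rho> t) \<in> W2inf" by eventually_elim simp
  then obtain t0 where t0: "t0 \<in> {0<..<T}" "W2inf_norm (\<lambda>\<rho>. x \<rho> t0) \<le> C'" "(\<lambda>\<rho>. x \<rho> t0) \<in> W2inf"
    using AE_Ioo_imp_ex[OF _ T] by blast
  obtain C'' where C'': "AE t in lebesgue_on {0<..<T}. Linf_norm (z t) \<le> C''" using Z(2) by (auto simp: Bochner_Linf_def)
  have zL: "AE t in lebesgue_on {0<..<T}. z t \<in> Linf" using Z(2) by (auto simp: Bochner_Linf_def)
  define K1 K2 K3 where "K1 = \<bar>C\<bar> + 1" and "K2 = \<bar>C'\<bar> + 1" and "K3 = \<bar>C''\<bar> + 1"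
  have K0: "0 \<le> K1" "0 \<le> K2" "0 \<le> K3" by (auto simp: K1_def K2_def K3_def)
  \<comment> \<open>The increment in time has second weak space derivatives of size \<open>|t - s|\<close>.\<close>
  have sd1: "((x (a + k + l) t - x (a + k + l) s) - (x (a + k) t - x (a + k) s) - (x (a + l) t - x (a + l) s) + (x a t - x a s)) \<bullet> e
      \<le> K1 * \<bar>t - s\<bar> * k * l"
    if e: "norm e = 1" and kl: "0 \<le> k" "0 \<le> l" and ts: "t \<in> {0..T}" "s \<in> {0..T}" for e a k l t s
  proof -
    have "(\<lambda>\<rho>. (x \<rho> t - x \<rho> s) \<bullet> e) (a + k + l) - (\<lambda>\<rho>. (x \<rho> t - x \<rho> s) \<bullet> e) (a + k)
        - (\<lambda>\<rho>. (x \<rho> t - x \<rho> s) \<bullet> e) (a + l) + (\<lambda>\<rho>. (x \<rho> t - x \<rho> s) \<bullet> e) a \<le> K1 * \<bar>t - s\<bar> * k * l"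
    proof (rule second_difference_bound[OF _ _ kl])
      show "continuous_on UNIV (\<lambda>\<rho>. (x \<rho> t - x \<rho> s) \<bullet> e)"
        using ts by (intro continuous_intros pairing_continuous(2)[OF cx continuous_on_const[of _ 0]])
      show "periodic1 (\<lambda>\<rho>. (x \<rho> t - x \<rho> s) \<bullet> e)" using per ts by (simp add: periodic1_def)
      fix \<eta> \<eta>1 \<eta>2 :: "real \<Rightarrow> real"
      assume \<eta>: "\<And>x. (\<eta> has_real_derivative \<eta>1 x) (at x)" "\<And>x. (\<eta>1 has_real_derivative \<eta>2 x) (at x)"
        "continuous_on UNIV \<eta>2" "periodic1 \<eta>" "periodic1 \<eta>1" "\<And>x. 0 \<le> \<eta> x"
      have c2: "continuous_on {0..1} (\<lambda>\<rho>. \<eta>2 \<rho> *\<^sub>R e)"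
        by (intro continuous_intros continuous_on_subset[OF \<eta>(3)]) auto
      define F where "F t = (LINT \<rho>|\<I>. x \<rho> t \<bullet> (\<eta>2 \<rho> *\<^sub>R e))" for t
      have "\<bar>F t - F s\<bar> \<le> (K1 * integral {0..1} \<eta>) * \<bar>t - s\<bar>"
      proof (rule Lipschitz_of_weak_derivative[where g = "\<lambda>t. LINT \<rho>|\<I>. v t \<rho> \<bullet> (\<eta>2 \<rho> *\<^sub>R e)"])
        show "continuous_on {0..T} F" unfolding F_def by (rule pairing_continuous(1)[OF cx c2])
        show "(LINT t|lebesgue_on {0<..<T}. deriv \<zeta> t * F t)
            = - (LINT t|lebesgue_on {0<..<T}. \<zeta> t * (LINT \<rho>|\<I>. v t \<rho> \<bullet> (\<eta>2 \<rho> *\<^sub>R e)))"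
          if "\<zeta> C1_differentiable_on UNIV" "\<exists>a b. 0 < a \<and> b < T \<and> (\<forall>t. t \<notin> {a..b} \<longrightarrow> \<zeta> t = 0)" for \<zeta>
          unfolding F_def
          using v(2)[unfolded has_weak_time_deriv_def, rule_format, of \<zeta> "\<lambda>\<rho>. \<eta>2 \<rho> *\<^sub>R e"] that c2 by blast
        show "AE t in lebesgue_on {0<..<T}. \<bar>LINT \<rho>|\<I>. v t \<rho> \<bullet> (\<eta>2 \<rho> *\<^sub>R e)\<bar> \<le> K1 * integral {0..1} \<eta>"
          using C vW unfolding K1_def by eventually_elim (rule W2inf_pairing[OF _ _ e \<eta>])
      qed (use ts in auto)
      moreover have "integral {0..1} (\<lambda>\<rho>. \<eta>2 \<rho> * ((x \<rho> t - x \<rho> s) \<bullet> e)) = F t - F s"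
      proof -
        have "(\<lambda>\<rho>. x \<rho> r \<bullet> (\<eta>2 \<rho> *\<^sub>R e)) integrable_on {0..1}" if "r \<in> {0..T}" for r
          by (intro integrable_continuous_real continuous_intros pairing_continuous(2)[OF cx c2] that c2)
        from Henstock_Kurzweil_Integration.integral_diff[OF this[OF ts(1)] this[OF ts(2)]]
        show ?thesis unfolding F_def pairing_continuous(3)[OF cx c2 ts(1)] pairing_continuous(3)[OF cx c2 ts(2)]
          by (simp add: inner_diff_left right_diff_distrib)
      qed
      ultimately show "integral {0..1} (\<lambda>\<rho>. \<eta>2 \<rho> * ((x \<rho> t - x \<rho> s) \<bullet> e)) \<le> K1 * \<bar>t - s\<bar> * integral {0..1} \<eta>"
        by (simp add: mult_ac)
    qed
    then show ?thesis by (simp add: inner_diff_left inner_add_left)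
  qed
  \<comment> \<open>At one time the space regularity is available; the bound on increments carries it to all times.\<close>
  have t0': "t0 \<in> {0..T}" using t0 by auto
  have sd2: "(x (a + k + l) t0 - x (a + k) t0 - x (a + l) t0 + x a t0) \<bullet> e \<le> K2 * k * l"
    if e: "norm e = 1" and kl: "0 \<le> k" "0 \<le> l" for e a k l
  proof -
    have "(\<lambda>\<rho>. x \<rho> t0 \<bullet> e) (a + k + l) - (\<lambda>\<rho>. x \<rho> t0 \<bullet> e) (a + k) - (\<lambda>\<rho>. x \<rho> t0 \<bullet> e) (a + l) + (\<lambda>\<rho>. x \<rho> t0 \<bullet> e) a \<le> K2 * k * l"
    proof (rule second_difference_bound[OF _ _ kl])
      show "continuous_on UNIV (\<lambda>\<rho>. x \<rho> t0 \<bullet> e)"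
        using t0' by (intro continuous_intros pairing_continuous(2)[OF cx continuous_on_const[of _ 0]])
      show "periodic1 (\<lambda>\<rho>. x \<rho> t0 \<bullet> e)" using per[OF t0'] by (simp add: periodic1_def)
      fix \<eta> \<eta>1 \<eta>2 :: "real \<Rightarrow> real"
      assume \<eta>: "\<And>x. (\<eta> has_real_derivative \<eta>1 x) (at x)" "\<And>x. (\<eta>1 has_real_derivative \<eta>2 x) (at x)"
        "continuous_on UNIV \<eta>2" "periodic1 \<eta>" "periodic1 \<eta>1" "\<And>x. 0 \<le> \<eta> x"
      have c2: "continuous_on {0..1} (\<lambda>\<rho>. \<eta>2 \<rho> *\<^sub>R e)"
        by (intro continuous_intros continuous_on_subset[OF \<eta>(3)]) auto
      show "integral {0..1} (\<lambda>\<rho>. \<eta>2 \<rho> * (x \<rho> t0 \<bullet> e)) \<le> K2 * integral {0..1} \<eta>"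
        using W2inf_pairing[OF t0(3,2) e \<eta>] unfolding pairing_continuous(3)[OF cx c2 t0'] K2_def by simp
    qed
    then show ?thesis by (simp add: inner_diff_left inner_add_left)
  qed
  have d1: "((\<lambda>\<sigma>. x \<sigma> t - x \<sigma> s) has_vector_derivative (xr \<rho> t - xr \<rho> s)) (at \<rho>)"
    if "t \<in> {0..T}" "s \<in> {0..T}" for t s \<rho>
    using dr that by (intro has_vector_derivative_diff)
  have R2: "norm ((xr \<rho> t - xr \<rho> s) - (xr \<sigma> t - xr \<sigma> s)) \<le> K1 * \<bar>t - s\<bar> * \<bar>\<rho> - \<sigma>\<bar>"
    if "t \<in> {0..T}" "s \<in> {0..T}" for t s \<rho> \<sigma>
    by (rule derivative_Lipschitz_of_second_difference[OF d1[OF that]]) (use K0 sd1 that in auto)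
  have R0: "norm (xr \<rho> t0 - xr \<sigma> t0) \<le> K2 * \<bar>\<rho> - \<sigma>\<bar>" for \<rho> \<sigma>
    by (rule derivative_Lipschitz_of_second_difference[OF dr[OF t0']]) (use K0 sd2 in auto)
  have R1: "norm (xr \<rho> t - xr \<sigma> t) \<le> (K2 + K1 * T) * \<bar>\<rho> - \<sigma>\<bar>" if t: "t \<in> {0..T}" for t \<rho> \<sigma>
  proof -
    have "xr \<rho> t - xr \<sigma> t = (xr \<rho> t0 - xr \<sigma> t0) + ((xr \<rho> t - xr \<rho> t0) - (xr \<sigma> t - xr \<sigma> t0))" by simp
    also have "norm \<dots> \<le> K2 * \<bar>\<rho> - \<sigma>\<bar> + K1 * \<bar>t - t0\<bar> * \<bar>\<rho> - \<sigma>\<bar>"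
      by (rule norm_triangle_le) (intro add_mono R0 R2 t t0')
    also have "K1 * \<bar>t - t0\<bar> * \<bar>\<rho> - \<sigma>\<bar> \<le> K1 * T * \<bar>\<rho> - \<sigma>\<bar>"
      using t t0' K0 by (intro mult_right_mono mult_left_mono) auto
    finally show ?thesis by (simp add: distrib_right)
  qed
  have R3: "norm (xr \<rho> t - xr \<rho> s) \<le> K1 * \<bar>t - s\<bar>" if "t \<in> {0..T}" "s \<in> {0..T}" for t s \<rho>
  proof (rule periodic_derivative_bound[OF d1[OF that]])
    show "periodic1 (\<lambda>\<sigma>. x \<sigma> t - x \<sigma> s)" using per that by (simp add: periodic1_def)
  qed (use K0 R2 that in auto)
  have inc: "norm ((x \<rho> t - x \<rho> s) - (x \<sigma> t - x \<sigma> s)) \<le> K1 * \<bar>t - s\<bar> * \<bar>\<rho> - \<sigma>\<bar>"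
    if "t \<in> {0..T}" "s \<in> {0..T}" for t s \<rho> \<sigma>
  proof -
    have "norm ((\<lambda>\<rho>. x \<rho> t - x \<rho> s) \<rho> - (\<lambda>\<rho>. x \<rho> t - x \<rho> s) \<sigma>) \<le> K1 * \<bar>t - s\<bar> * norm (\<rho> - \<sigma>)"
    proof (rule differentiable_bound[where S = UNIV and f' = "\<lambda>\<rho> h. h *\<^sub>R (xr \<rho> t - xr \<rho> s)"])
      show "((\<lambda>\<rho>. x \<rho> t - x \<rho> s) has_derivative (\<lambda>h. h *\<^sub>R (xr \<rho> t - xr \<rho> s))) (at \<rho> within UNIV)" for \<rho>
        using d1[OF that] by (simp add: has_vector_derivative_def)
      show "onorm (\<lambda>h. h *\<^sub>R (xr \<rho> t - xr \<rho> s)) \<le> K1 * \<bar>t - s\<bar>" for \<rho>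
        using R3[OF that, of \<rho>] by (intro onorm_le) (simp add: mult.commute[of _ "\<bar>_\<bar>"] mult_left_mono)
    qed auto
    then show ?thesis by simp
  qed
  have R5: "norm (xt \<rho> t - xt \<sigma> t) \<le> K1 * \<bar>\<rho> - \<sigma>\<bar>" if t: "t \<in> {0..T}" for t \<rho> \<sigma>
  proof (rule vector_derivative_norm_le[OF has_vector_derivative_diff[OF dt[OF t] dt[OF t]] t T])
    show "norm ((x \<rho> s - x \<sigma> s) - (x \<rho> t - x \<sigma> t)) \<le> K1 * \<bar>\<rho> - \<sigma>\<bar> * \<bar>s - t\<bar>" if "s \<in> {0..T}" for s
      using inc[OF that t, of \<rho> \<sigma>] by (simp add: algebra_simps)
  qed (use K0 in simp)
  \<comment> \<open>The time derivative is tested with its own increment \<open>y\<close>, multiplied by the excess \<open>m\<close> over the claimed bound.\<close>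
  have R6: "norm (xt \<rho> t - xt \<rho> s) \<le> K3 * \<bar>t - s\<bar>" if ts: "t \<in> {0..T}" "s \<in> {0..T}" and \<rho>: "\<rho> \<in> {0..1}" for t s \<rho>
  proof -
    define L where "L = K3 * \<bar>t - s\<bar>"
    define y where "y \<rho> = xt \<rho> t - xt \<rho> s" for \<rho>
    define m where "m \<rho> = max 0 (norm (y \<rho>) - L)" for \<rho>
    define \<eta> where "\<eta> \<rho> = m \<rho> *\<^sub>R y \<rho>" for \<rho>
    have cy: "continuous_on {0..1} y"
      unfolding y_def using ts by (intro continuous_intros pairing_continuous(2)[OF cxt continuous_on_const[of _ 0]])
    have cm: "continuous_on {0..1} m" unfolding m_def by (intro continuous_intros cy)
    have c\<eta>: "continuous_on {0..1} \<eta>" unfolding \<eta>_def by (intro continuous_intros cm cy)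
    have m0: "0 \<le> m \<rho>" for \<rho> by (simp add: m_def)
    define F where "F t = (LINT \<rho>|\<I>. xt \<rho> t \<bullet> \<eta> \<rho>)" for t
    have "\<bar>F t - F s\<bar> \<le> (K3 * integral {0..1} (\<lambda>\<rho>. norm (\<eta> \<rho>))) * \<bar>t - s\<bar>"
    proof (rule Lipschitz_of_weak_derivative[where g = "\<lambda>t. LINT \<rho>|\<I>. z t \<rho> \<bullet> \<eta> \<rho>"])
      show "continuous_on {0..T} F" unfolding F_def by (rule pairing_continuous(1)[OF cxt c\<eta>])
      show "(LINT t|lebesgue_on {0<..<T}. deriv \<zeta> t * F t) = - (LINT t|lebesgue_on {0<..<T}. \<zeta> t * (LINT \<rho>|\<I>. z t \<rho> \<bullet> \<eta> \<rho>))"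
        if "\<zeta> C1_differentiable_on UNIV" "\<exists>a b. 0 < a \<and> b < T \<and> (\<forall>t. t \<notin> {a..b} \<longrightarrow> \<zeta> t = 0)" for \<zeta>
        unfolding F_def xt_def
        using Z(1)[unfolded has_weak_time_deriv_def, rule_format, of \<zeta> \<eta>] that c\<eta> by blast
      show "AE t in lebesgue_on {0<..<T}. \<bar>LINT \<rho>|\<I>. z t \<rho> \<bullet> \<eta> \<rho>\<bar> \<le> K3 * integral {0..1} (\<lambda>\<rho>. norm (\<eta> \<rho>))"
        using C'' zL unfolding K3_def by eventually_elim (rule Linf_pairing[OF _ _ c\<eta>])
    qed (use ts in auto)
    moreover have "integral {0..1} (\<lambda>\<rho>. y \<rho> \<bullet> \<eta> \<rho>) = F t - F s"
    proof -
      have "(\<lambda>\<rho>. xt \<rho> r \<bullet> \<eta> \<rho>) integrable_on {0..1}" if "r \<in> {0..T}" for r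
        by (intro integrable_continuous_real continuous_intros pairing_continuous(2)[OF cxt c\<eta>] that c\<eta>)
      from Henstock_Kurzweil_Integration.integral_diff[OF this[OF ts(1)] this[OF ts(2)]]
      show ?thesis unfolding F_def pairing_continuous(3)[OF cxt c\<eta> ts(1)] pairing_continuous(3)[OF cxt c\<eta> ts(2)]
        by (simp add: inner_diff_left y_def)
    qed
    ultimately have le: "integral {0..1} (\<lambda>\<rho>. y \<rho> \<bullet> \<eta> \<rho>) \<le> L * integral {0..1} (\<lambda>\<rho>. norm (\<eta> \<rho>))"
      by (simp add: L_def mult_ac)
    define f where "f \<rho> = y \<rho> \<bullet> \<eta> \<rho> - L * norm (\<eta> \<rho>)" for \<rho>
    have feq: "f \<rho> = m \<rho> * norm (y \<rho>) * (norm (y \<rho>) - L)" for \<rho>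
      using m0[of \<rho>] by (simp add: f_def \<eta>_def power2_norm_eq_inner[symmetric] power2_eq_square algebra_simps)
    have f0: "0 \<le> f \<rho>" for \<rho> unfolding feq by (cases "L \<le> norm (y \<rho>)") (auto simp: m_def)
    have cf: "continuous_on {0..1} f" unfolding f_def by (intro continuous_intros cy c\<eta>)
    have "integral {0..1} f = integral {0..1} (\<lambda>\<rho>. y \<rho> \<bullet> \<eta> \<rho>) - integral {0..1} (\<lambda>\<rho>. L * norm (\<eta> \<rho>))"
      unfolding f_def by (intro Henstock_Kurzweil_Integration.integral_diff integrable_continuous_real continuous_intros cy c\<eta>)
    then have "integral {0..1} f \<le> 0" using le by simp
    moreover have "0 \<le> integral {0..1} f"
      using f0 cf by (intro Henstock_Kurzweil_Integration.integral_nonneg integrable_continuous_real)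
    ultimately have "f \<rho> = 0" using integral_eq_0_iff[OF cf] f0 \<rho> by auto
    moreover have "0 \<le> L" using K0 by (simp add: L_def)
    ultimately have "norm (y \<rho>) \<le> L" unfolding feq by (auto simp: m_def max_def split: if_splits)
    then show ?thesis by (simp add: y_def L_def)
  qed
  have "compact (({0..1} :: real set) \<times> {0..T})" by (intro compact_Times compact_Icc)
  moreover have "continuous_on ({0..1} \<times> {0..T}) (\<lambda>(\<rho>, t). xt \<rho> t)" by (rule continuous_on_subset[OF cxt]) auto
  ultimately have "bounded ((\<lambda>(\<rho>, t). xt \<rho> t) ` ({0..1} \<times> {0..T}))"
    by (intro compact_imp_bounded compact_continuous_image)
  then obtain B where "\<forall>y\<in>(\<lambda>(\<rho>, t). xt \<rho> t) ` ({0..1} \<times> {0..T}). norm y \<le> B" by (auto simp: bounded_iff)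
  then have B: "norm (xt \<rho> t) \<le> B" if "\<rho> \<in> {0..1}" "t \<in> {0..T}" for \<rho> t using that by force
  define K where "K = K1 + K2 + K1 * T + K3 + \<bar>B\<bar>"
  have KK: "K1 \<le> K" "K2 + K1 * T \<le> K" "K3 \<le> K" "B \<le> K" "0 \<le> K"
    using K0 mult_nonneg_nonneg[OF K0(1) less_imp_le[OF T]] abs_ge_self[of B] unfolding K_def by linarith+
  have up: "a \<le> A * c \<Longrightarrow> A \<le> K \<Longrightarrow> 0 \<le> c \<Longrightarrow> a \<le> K * c" for a A c :: real
    by (meson mult_right_mono order_trans)
  have "regular K T x"
    unfolding regular_def xr_def[symmetric] xt_def[symmetric]
  proof (intro conjI ballI)
    fix \<rho> \<sigma> t s assume *: "\<rho> \<in> {0..1::real}" "\<sigma> \<in> {0..1::real}" "t \<in> {0..T}" "s \<in> {0..T}"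
    show "norm (xr \<rho> t - xr \<sigma> t) \<le> K * \<bar>\<rho> - \<sigma>\<bar>" by (rule up[OF R1[OF *(3)] KK(2)]) simp
    show "norm ((xr \<rho> t - xr \<rho> s) - (xr \<sigma> t - xr \<sigma> s)) \<le> K * \<bar>t - s\<bar> * \<bar>\<rho> - \<sigma>\<bar>"
      using up[OF R2[OF *(3,4), unfolded mult.assoc] KK(1)] by (simp add: mult.assoc)
    show "norm (xr \<rho> t - xr \<rho> s) \<le> K * \<bar>t - s\<bar>" by (rule up[OF R3[OF *(3,4)] KK(1)]) simp
    show "norm (xt \<rho> t) \<le> K" using B[OF *(1,3)] KK(4) by simp
    show "norm (xt \<rho> t - xt \<sigma> t) \<le> K * \<bar>\<rho> - \<sigma>\<bar>" by (rule up[OF R5[OF *(3)] KK(1)]) simp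
    show "norm (xt \<rho> t - xt \<rho> s) \<le> K * \<bar>t - s\<bar>" by (rule up[OF R6[OF *(3,4,1)] KK(3)]) simp
  qed (rule KK(5))
  then show ?thesis by (rule that)
qed

section \<open>Piecewise affine functions and their nodal values\<close>

text \<open>Elements are numbered from \<open>0\<close>: element \<open>j\<close> is the interval from \<open>q j\<close> to \<open>q (Suc j)\<close>. A piecewise affine
  function is represented by its nodal values \<open>u 0, \<dots>, u J\<close> with \<open>u J = u 0\<close>, and on an element by the
  midpoint value together with the slope or the jump.\<close>

definition hh :: "(nat \<Rightarrow> real) \<Rightarrow> nat \<Rightarrow> real" where
  "hh q j = q (Suc j) - q j"

definition slope :: "(nat \<Rightarrow> real) \<Rightarrow> (nat \<Rightarrow> 'a::real_vector) \<Rightarrow> nat \<Rightarrow> 'a" where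
  "slope q u j = (u (Suc j) - u j) /\<^sub>R hh q j"

definition mid :: "(nat \<Rightarrow> 'a::real_vector) \<Rightarrow> nat \<Rightarrow> 'a" where
  "mid u j = (u j + u (Suc j)) /\<^sub>R 2"

definition jump :: "(nat \<Rightarrow> 'a::real_vector) \<Rightarrow> nat \<Rightarrow> 'a" where
  "jump u j = u (Suc j) - u j"

definition emid :: "(nat \<Rightarrow> real) \<Rightarrow> nat \<Rightarrow> real" where
  "emid q j = (q j + q (Suc j)) / 2"

text \<open>The mean value over an element of \<open>B u \<bullet> v\<close> for affine \<open>u\<close>, \<open>v\<close> and a constant matrix \<open>B\<close>.\<close>

definition mprod :: "real^'d^'d \<Rightarrow> (nat \<Rightarrow> real^'d) \<Rightarrow> (nat \<Rightarrow> real^'d) \<Rightarrow> nat \<Rightarrow> real" where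
  "mprod B u v j = (B *v mid u j) \<bullet> mid v j + (B *v jump u j) \<bullet> jump v j / 12"

lemma mesh_less: "mesh J q \<Longrightarrow> j < J \<Longrightarrow> q j < q (Suc j)"
  unfolding mesh_def by (metis Suc_leI atLeastAtMost_iff diff_Suc_1 le_add1 plus_1_eq_Suc)

lemma mesh_ends: "mesh J q \<Longrightarrow> q 0 = 0" "mesh J q \<Longrightarrow> q J = 1" "mesh J q \<Longrightarrow> 0 < J"
  by (auto simp: mesh_def)

lemma mesh_mono: "mesh J q \<Longrightarrow> i \<le> j \<Longrightarrow> j \<le> J \<Longrightarrow> q i \<le> q j"
proof (induction j)
  case (Suc n)
  then show ?case using mesh_less[of J q n] by (cases "i = Suc n") auto
qed simp

lemma mesh_range: "mesh J q \<Longrightarrow> j \<le> J \<Longrightarrow> q j \<in> {0..1}"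
  using mesh_mono[of J q 0 j] mesh_mono[of J q j J] mesh_ends[of J q] by auto

lemma mesh_elem_sub: "mesh J q \<Longrightarrow> j < J \<Longrightarrow> {q j..q (Suc j)} \<subseteq> {0..1}"
  using mesh_range[of J q j] mesh_range[of J q "Suc j"] by auto

lemma mesh_cover:
  assumes "mesh J q" "\<rho> \<in> {0..1}" shows "\<exists>j<J. \<rho> \<in> {q j..q (Suc j)}"
proof -
  have "\<rho> \<in> {q 0..q n} \<Longrightarrow> 0 < n \<Longrightarrow> \<exists>j<n. \<rho> \<in> {q j..q (Suc j)}" for n
  proof (induction n)
    case (Suc n)
    show ?case
    proof (cases "n = 0 \<or> q n \<le> \<rho>")
      case False
      then have "\<exists>j<n. \<rho> \<in> {q j..q (Suc j)}" using Suc by auto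
      then show ?thesis using less_SucI by blast
    qed (use Suc.prems in auto)
  qed simp
  from this[of J] show ?thesis using assms(2) mesh_ends[OF assms(1)] by simp
qed

lemma hh_pos: "mesh J q \<Longrightarrow> j < J \<Longrightarrow> 0 < hh q j"
  using mesh_less by (simp add: hh_def)

lemma sum_hh: "mesh J q \<Longrightarrow> (\<Sum>j<J. hh q j) = 1"
  by (simp add: hh_def sum_lessThan_telescope mesh_ends)

lemma hh_le_mesh_size: "mesh J q \<Longrightarrow> j < J \<Longrightarrow> hh q j \<le> mesh_size J q"
  unfolding mesh_size_def hh_def by (rule Max_ge) (auto intro!: image_eqI[where x="Suc j"])

lemma mesh_size_le_hh: "mesh J q \<Longrightarrow> quasi_uniform c J q \<Longrightarrow> j < J \<Longrightarrow> mesh_size J q \<le> c * hh q j"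
  unfolding quasi_uniform_def hh_def by (metis Suc_leI atLeastAtMost_iff diff_Suc_1 le_add1 plus_1_eq_Suc)

lemma jump_slope: "mesh J q \<Longrightarrow> j < J \<Longrightarrow> jump u j = hh q j *\<^sub>R slope q u j"
  using hh_pos[of J q j] by (simp add: jump_def slope_def)

lemma mid_diff: "mid (\<lambda>j. u j - v j) j = mid u j - mid v j"
  by (simp add: mid_def algebra_simps)

lemma jump_diff: "jump (\<lambda>j. u j - v j) j = jump u j - jump v j"
  by (simp add: jump_def)

lemma slope_diff: "slope q (\<lambda>j. u j - v j) j = slope q u j - slope q v j"
  by (simp add: slope_def algebra_simps)

text \<open>All integrals over the period are computed elementwise. The integrands involve derivatives of piecewise
  affine functions, which are undefined at the nodes, so agreement with a continuous function is asked
  only inside the elements.\<close>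

lemma LINT_mesh:
  fixes f :: "real \<Rightarrow> 'a::euclidean_space"
  assumes m: "mesh J q" and g: "\<And>j. j < J \<Longrightarrow> continuous_on {q j..q (Suc j)} (g j)"
    and fg: "\<And>j \<rho>. j < J \<Longrightarrow> \<rho> \<in> {q j<..<q (Suc j)} \<Longrightarrow> f \<rho> = g j \<rho>"
  shows "integrable \<I> f" "(LINT \<rho>|\<I>. f \<rho>) = (\<Sum>j<J. integral {q j..q (Suc j)} (g j))"
proof -
  have elem: "f absolutely_integrable_on {q j..q (Suc j)}" "integral {q j..q (Suc j)} f = integral {q j..q (Suc j)} (g j)"
    if j: "j < J" for j
  proof -
    show "f absolutely_integrable_on {q j..q (Suc j)}"
      by (rule absolutely_integrable_spike[OF absolutely_integrable_continuous_real[OF g[OF j]], of "{q j, q (Suc j)}"])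
        (use fg[OF j] in auto)
    show "integral {q j..q (Suc j)} f = integral {q j..q (Suc j)} (g j)"
      by (rule integral_spike[of "{q j, q (Suc j)}"]) (use fg[OF j] in auto)
  qed
  have "f absolutely_integrable_on {q 0..q n} \<and> integral {q 0..q n} f = (\<Sum>j<n. integral {q j..q (Suc j)} (g j))"
    if "n \<le> J" for n
    using that
  proof (induction n)
    case 0
    have "f absolutely_integrable_on {q 0..q 0}" by (rule absolutely_integrable_continuous_real) simp
    then show ?case by simp
  next
    case (Suc n)
    have le: "q 0 \<le> q n" "q n \<le> q (Suc n)" using mesh_mono[OF m] Suc.prems by auto
    then have un: "{q 0..q (Suc n)} = {q 0..q n} \<union> {q n..q (Suc n)}" by auto
    have ai: "f absolutely_integrable_on {q 0..q (Suc n)}"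
      unfolding un using Suc elem(1)[of n] by (intro set_integrable_Un) auto
    then have "f integrable_on {q 0..q (Suc n)}" using set_lebesgue_integral_eq_integral(1) by blast
    from Henstock_Kurzweil_Integration.integral_combine[OF le this] ai
    show ?case using Suc elem(2)[of n] by auto
  qed
  from this[of J] have *: "f absolutely_integrable_on {0..1}" "integral {0..1} f = (\<Sum>j<J. integral {q j..q (Suc j)} (g j))"
    using mesh_ends[OF m] by auto
  show "integrable \<I> f" using *(1) by (simp add: absolutely_integrable_imp_integrable)
  then show "(LINT \<rho>|\<I>. f \<rho>) = (\<Sum>j<J. integral {q j..q (Suc j)} (g j))"
    by (simp add: lebesgue_integral_eq_integral *(2))
qed

lemma Vh_nodal_periodic: "mesh J q \<Longrightarrow> f \<in> Vh J q \<Longrightarrow> f (q J) = f (q 0)"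
  using mesh_ends[of J q] unfolding Vh_def periodic1_def by (metis (mono_tags, lifting) add_0 mem_Collect_eq)

lemma Vh_affine:
  assumes m: "mesh J q" and f: "f \<in> Vh J q" and j: "j < J" and \<rho>: "\<rho> \<in> {q j..q (Suc j)}"
  shows "f \<rho> = mid (\<lambda>j. f (q j)) j + (\<rho> - emid q j) *\<^sub>R slope q (\<lambda>j. f (q j)) j"
proof -
  have "Suc j \<in> {1..J}" using j by auto
  then have "\<exists>a b. \<forall>\<rho>\<in>{q (Suc j - 1)..q (Suc j)}. f \<rho> = a + \<rho> *\<^sub>R b" using f unfolding Vh_def by blast
  then obtain a b where ab: "\<And>\<rho>. \<rho> \<in> {q j..q (Suc j)} \<Longrightarrow> f \<rho> = a + \<rho> *\<^sub>R b" by auto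
  have e: "f (q j) = a + q j *\<^sub>R b" "f (q (Suc j)) = a + q (Suc j) *\<^sub>R b" using mesh_less[OF m j] by (auto intro!: ab)
  have s: "slope q (\<lambda>j. f (q j)) j = b"
    using mesh_less[OF m j] by (simp add: slope_def e hh_def scaleR_diff_left[symmetric])
  have em: "2 * emid q j = q j + q (Suc j)" by (simp add: emid_def)
  have "2 *\<^sub>R (a + emid q j *\<^sub>R b) = (a + a) + (2 * emid q j) *\<^sub>R b"
    by (simp add: scaleR_add_right scaleR_2[of a])
  also have "\<dots> = f (q j) + f (q (Suc j))" unfolding em e by (simp add: scaleR_add_left)
  finally have "f (q j) + f (q (Suc j)) = 2 *\<^sub>R (a + emid q j *\<^sub>R b)" ..
  then have "mid (\<lambda>j. f (q j)) j = a + emid q j *\<^sub>R b" unfolding mid_def by (simp only: scaleR_scaleR) simp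
  then show ?thesis using ab[OF \<rho>] by (simp add: s algebra_simps)
qed

lemma Vh_d_rho:
  assumes m: "mesh J q" and f: "f \<in> Vh J q" and j: "j < J" and \<rho>: "\<rho> \<in> {q j<..<q (Suc j)}"
  shows "(f has_vector_derivative slope q (\<lambda>j. f (q j)) j) (at \<rho>)" "d_rho f \<rho> = slope q (\<lambda>j. f (q j)) j"
proof -
  have "((\<lambda>\<rho>. mid (\<lambda>j. f (q j)) j + (\<rho> - emid q j) *\<^sub>R slope q (\<lambda>j. f (q j)) j) has_vector_derivative slope q (\<lambda>j. f (q j)) j) (at \<rho>)"
    by (auto intro!: derivative_eq_intros)
  then show d: "(f has_vector_derivative slope q (\<lambda>j. f (q j)) j) (at \<rho>)"
    by (rule has_vector_derivative_transform_within_open[of _ _ _ "{q j<..<q (Suc j)}"])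
      (use \<rho> Vh_affine[OF m f j] in auto)
  show "d_rho f \<rho> = slope q (\<lambda>j. f (q j)) j" unfolding d_rho_def by (rule vector_derivative_at[OF d])
qed

lemma Vh_eqI:
  assumes m: "mesh J q" and f: "f \<in> Vh J q" and g: "g \<in> Vh J q" and eq: "\<And>j. j < J \<Longrightarrow> f (q j) = g (q j)"
  shows "f = g"
proof
  fix \<rho> :: real
  have eq': "f (q j) = g (q j)" if "j \<le> J" for j
    using eq[of j] eq[of 0] that Vh_nodal_periodic[OF m f] Vh_nodal_periodic[OF m g] mesh_ends(3)[OF m]
    by (cases "j = J") auto
  have "frac \<rho> \<in> {0..1}" using frac_lt_1[of \<rho>] by simp
  then obtain j where j: "j < J" "frac \<rho> \<in> {q j..q (Suc j)}" using mesh_cover[OF m] by blast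
  then have "f (frac \<rho>) = g (frac \<rho>)"
    using Vh_affine[OF m f j] Vh_affine[OF m g j] eq' by (simp add: mid_def slope_def)
  moreover have "f \<rho> = f (frac \<rho>)" "g \<rho> = g (frac \<rho>)"
    using periodic1_of_int[of f "frac \<rho>" "\<lfloor>\<rho>\<rfloor>"] periodic1_of_int[of g "frac \<rho>" "\<lfloor>\<rho>\<rfloor>"] f g
    by (auto simp: Vh_def frac_def)
  ultimately show "f \<rho> = g \<rho>" by simp
qed

lemma periodic_extension:
  fixes b :: "real \<Rightarrow> 'a::real_normed_vector"
  assumes c: "continuous_on UNIV b" and b: "b 1 = b 0"
  shows "continuous_on UNIV (\<lambda>\<rho>. b (frac \<rho>))" "periodic1 (\<lambda>\<rho>. b (frac \<rho>))"
    "\<rho> \<in> {0..1} \<Longrightarrow> b (frac \<rho>) = b \<rho>"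
proof -
  have piece: "b (frac \<rho>) = b (\<rho> - of_int n)" if "\<rho> \<in> {of_int n..of_int n + 1}" for \<rho> n
  proof (cases "\<rho> = of_int n + 1")
    case True
    then have "frac \<rho> = 0" and n: "\<rho> - of_int n = 1" by (auto simp: frac_def)
    then have "b (frac \<rho>) = b 0" by (simp only:)
    then show ?thesis using b n by simp
  next
    case False
    then have "\<lfloor>\<rho>\<rfloor> = n" using that by (intro floor_unique) auto
    then show ?thesis by (simp add: frac_def)
  qed
  have pc: "continuous_on {of_int n..of_int n + 1} (\<lambda>\<rho>. b (frac \<rho>))" for n
  proof -
    have "continuous_on {of_int n..of_int n + 1} (\<lambda>\<rho>. b (\<rho> - of_int n))"
      by (intro continuous_on_compose2[OF c] continuous_intros) auto
    then show ?thesis by (rule continuous_on_cong[THEN iffD1, rotated 2]) (auto simp: piece)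
  qed
  have "isCont (\<lambda>\<rho>. b (frac \<rho>)) \<rho>" for \<rho>
  proof -
    define n where "n = \<lfloor>\<rho>\<rfloor>"
    have "continuous_on ({of_int (n - 1)..of_int (n - 1) + 1} \<union> {of_int n..of_int n + 1}) (\<lambda>\<rho>. b (frac \<rho>))"
      by (intro continuous_on_closed_Un pc) auto
    then have "continuous_on {of_int n - 1<..<of_int n + 1} (\<lambda>\<rho>. b (frac \<rho>))"
      by (rule continuous_on_subset) auto
    moreover have "\<rho> \<in> {of_int n - 1<..<of_int n + 1}" unfolding n_def greaterThanLessThan_iff using floor_correct[of \<rho>] by linarith
    ultimately show ?thesis by (simp add: continuous_on_eq_continuous_at)
  qed
  then show "continuous_on UNIV (\<lambda>\<rho>. b (frac \<rho>))" by (simp add: continuous_at_imp_continuous_on)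
  show "periodic1 (\<lambda>\<rho>. b (frac \<rho>))" by (simp add: periodic1_def frac_def)
  show "\<rho> \<in> {0..1} \<Longrightarrow> b (frac \<rho>) = b \<rho>" using piece[of \<rho> 0] by simp
qed

text \<open>The interpolant is assembled from ramps, each of which rises from \<open>0\<close> to \<open>1\<close> across one element, and then
  extended periodically.\<close>

lemma Vh_exists:
  fixes u :: "nat \<Rightarrow> 'a::real_normed_vector"
  assumes m: "mesh J q" and u: "u J = u 0"
  shows "\<exists>f\<in>Vh J q. \<forall>j\<le>J. f (q j) = u j"
proof -
  define cl where "cl j \<rho> = min 1 (max 0 ((\<rho> - q j) / hh q j))" for j \<rho>
  define b where "b \<rho> = u 0 + (\<Sum>j<J. cl j \<rho> *\<^sub>R jump u j)" for \<rho>
  have cb: "continuous_on UNIV b" unfolding b_def cl_def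
    by (intro continuous_intros) (use hh_pos[OF m] in force)
  have be: "b \<rho> = u k + ((\<rho> - q k) / hh q k) *\<^sub>R jump u k" if k: "k < J" and \<rho>: "\<rho> \<in> {q k..q (Suc k)}" for k \<rho>
  proof -
    have "cl j \<rho> *\<^sub>R jump u j = (if j < k then jump u j else 0) + (if j = k then ((\<rho> - q k) / hh q k) *\<^sub>R jump u k else 0)"
      if j: "j < J" for j
    proof -
      consider "j < k" | "j = k" | "k < j" by linarith
      then show ?thesis
      proof cases
        case 1
        then have "q (Suc j) \<le> \<rho>" using mesh_mono[OF m, of "Suc j" k] k \<rho> by auto
        then have "1 \<le> (\<rho> - q j) / hh q j" using hh_pos[OF m j] by (simp add: le_divide_eq hh_def)
        then show ?thesis using 1 by (simp add: cl_def)
      next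
        case 2
        then have "0 \<le> (\<rho> - q j) / hh q j" "(\<rho> - q j) / hh q j \<le> 1" using hh_pos[OF m j] \<rho> by (simp_all add: hh_def)
        then show ?thesis using 2 by (simp add: cl_def)
      next
        case 3
        then have "\<rho> \<le> q j" using mesh_mono[OF m, of "Suc k" j] j \<rho> by auto
        then have "(\<rho> - q j) / hh q j \<le> 0" using hh_pos[OF m j] by (simp add: divide_nonpos_pos)
        then show ?thesis using 3 by (simp add: cl_def)
      qed
    qed
    then have "b \<rho> = u 0 + ((\<Sum>j<J. if j < k then jump u j else 0) + (\<Sum>j<J. if j = k then ((\<rho> - q k) / hh q k) *\<^sub>R jump u k else 0))"
      unfolding b_def sum.distrib[symmetric] by (intro arg_cong2[where f="(+)"] sum.cong) auto
    also have "(\<Sum>j<J. if j < k then jump u j else 0) = (\<Sum>j<k. jump u j)"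
      using k by (intro sum.mono_neutral_cong_right) auto
    also have "\<dots> = u k - u 0" by (simp add: jump_def sum_lessThan_telescope)
    also have "(\<Sum>j<J. if j = k then ((\<rho> - q k) / hh q k) *\<^sub>R jump u k else 0) = ((\<rho> - q k) / hh q k) *\<^sub>R jump u k"
      using k by simp
    finally show ?thesis by simp
  qed
  have bn: "b (q j) = u j" if "j \<le> J" for j
  proof (cases "j = J")
    case True
    then obtain k where k: "J = Suc k" using mesh_ends(3)[OF m] by (cases J) auto
    have "b (q (Suc k)) = u k + ((q (Suc k) - q k) / hh q k) *\<^sub>R jump u k" using k mesh_less[OF m, of k] by (intro be) auto
    then show ?thesis using True k hh_pos[OF m, of k] by (simp add: hh_def jump_def)
  next
    case False
    then show ?thesis using that mesh_less[OF m, of j] be[of j "q j"] by auto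
  qed
  have b10: "b 1 = b 0" using bn[of J] bn[of 0] mesh_ends[OF m] u by simp
  note pe = periodic_extension[OF cb b10]
  have "(\<lambda>\<rho>. b (frac \<rho>)) \<in> Vh J q"
    unfolding Vh_def
  proof (intro CollectI conjI ballI pe)
    fix j assume "j \<in> {1..J}"
    then obtain k where k: "j = Suc k" "k < J" by (cases j) auto
    show "\<exists>a c. \<forall>\<rho>\<in>{q (j - 1)..q j}. b (frac \<rho>) = a + \<rho> *\<^sub>R c"
    proof (intro exI ballI)
      fix \<rho> assume \<rho>: "\<rho> \<in> {q (j - 1)..q j}"
      then have "b (frac \<rho>) = b \<rho>" using mesh_elem_sub[OF m k(2)] k by (intro pe(3)) auto
      also have "\<dots> = (u k - (q k / hh q k) *\<^sub>R jump u k) + \<rho> *\<^sub>R (jump u k /\<^sub>R hh q k)"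
        using be[OF k(2), of \<rho>] \<rho> k by (simp add: left_diff_distrib scaleR_diff_left divide_inverse)
      finally show "b (frac \<rho>) = (u k - (q k / hh q k) *\<^sub>R jump u k) + \<rho> *\<^sub>R (jump u k /\<^sub>R hh q k)" .
    qed
  qed
  moreover have "b (frac (q j)) = u j" if "j \<le> J" for j using pe(3)[OF mesh_range[OF m that]] bn[OF that] by simp
  ultimately show ?thesis by (intro bexI[of _ "\<lambda>\<rho>. b (frac \<rho>)"] allI impI)
qed

text \<open>About the midpoint the terms that are linear in the variable integrate to zero; the second moment of an
  interval of length \<open>h\<close> is \<open>h\<^sup>3 / 12\<close>.\<close>

lemma affine_product_integral:
  fixes B :: "real^'d^'d"
  assumes "a \<le> b"
  shows "integral {a..b} (\<lambda>\<rho>. (B *v (u + (\<rho> - (a + b) / 2) *\<^sub>R s)) \<bullet> (v + (\<rho> - (a + b) / 2) *\<^sub>R t))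
    = (b - a) * ((B *v u) \<bullet> v + (b - a)\<^sup>2 / 12 * ((B *v s) \<bullet> t))"
proof -
  define c where "c = (a + b) / 2"
  define X Y Z where "X = (B *v u) \<bullet> v" and "Y = (B *v u) \<bullet> t + (B *v s) \<bullet> v" and "Z = (B *v s) \<bullet> t"
  define F where "F \<rho> = X * \<rho> + Y * (\<rho> - c)\<^sup>2 / 2 + Z * (\<rho> - c) ^ 3 / 3" for \<rho>
  have "(F has_real_derivative (B *v (u + (\<rho> - c) *\<^sub>R s)) \<bullet> (v + (\<rho> - c) *\<^sub>R t)) (at \<rho>)" for \<rho>
  proof -
    have "(F has_real_derivative X + Y * (\<rho> - c) + Z * (\<rho> - c)\<^sup>2) (at \<rho>)"
      unfolding F_def by (auto intro!: derivative_eq_intros simp: power2_eq_square)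
    moreover have "X + Y * (\<rho> - c) + Z * (\<rho> - c)\<^sup>2 = (B *v (u + (\<rho> - c) *\<^sub>R s)) \<bullet> (v + (\<rho> - c) *\<^sub>R t)"
      by (simp add: X_def Y_def Z_def matrix_vector_right_distrib matrix_vector_mult_scaleR inner_add_left inner_add_right
          power2_eq_square algebra_simps)
    ultimately show ?thesis by simp
  qed
  from integral_FTC[OF this assms] have "integral {a..b} (\<lambda>\<rho>. (B *v (u + (\<rho> - c) *\<^sub>R s)) \<bullet> (v + (\<rho> - c) *\<^sub>R t)) = F b - F a" .
  also have "\<dots> = (b - a) * (X + (b - a)\<^sup>2 / 12 * Z)"
    by (simp add: F_def c_def power2_eq_square power3_eq_cube field_simps)
  finally show ?thesis by (simp add: c_def X_def Z_def)
qed

lemma LINT_mass: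
  fixes B :: "nat \<Rightarrow> real^'d^'d"
  assumes m: "mesh J q" and f: "f \<in> Vh J q" and g: "g \<in> Vh J q" and \<eta>: "\<eta> \<in> Vh J q"
    and A: "\<And>j \<rho>. j < J \<Longrightarrow> \<rho> \<in> {q j<..<q (Suc j)} \<Longrightarrow> A \<rho> = B j"
  shows "(LINT \<rho>|\<I>. (A \<rho> *v (f \<rho> - g \<rho>)) \<bullet> \<eta> \<rho>)
    = (\<Sum>j<J. hh q j * mprod (B j) (\<lambda>j. f (q j) - g (q j)) (\<lambda>j. \<eta> (q j)) j)"
proof -
  define w where "w j = f (q j) - g (q j)" for j
  define v where "v j = \<eta> (q j)" for j
  define G where "G j \<rho> = (B j *v (mid w j + (\<rho> - emid q j) *\<^sub>R slope q w j)) \<bullet> (mid v j + (\<rho> - emid q j) *\<^sub>R slope q v j)" for j \<rho>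
  have "(LINT \<rho>|\<I>. (A \<rho> *v (f \<rho> - g \<rho>)) \<bullet> \<eta> \<rho>) = (\<Sum>j<J. integral {q j..q (Suc j)} (G j))"
  proof (rule LINT_mesh(2)[OF m])
    show "continuous_on {q j..q (Suc j)} (G j)" for j
      unfolding G_def by (intro continuous_intros bounded_linear.continuous_on[OF matrix_vector_mul_bounded_linear])
    fix j \<rho> assume j: "j < J" and \<rho>: "\<rho> \<in> {q j<..<q (Suc j)}"
    then have \<rho>': "\<rho> \<in> {q j..q (Suc j)}" by auto
    have "f \<rho> - g \<rho> = mid w j + (\<rho> - emid q j) *\<^sub>R slope q w j"
      using Vh_affine[OF m f j \<rho>'] Vh_affine[OF m g j \<rho>'] 
      by (simp add: w_def[abs_def] mid_diff slope_diff scaleR_diff_right)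
    then show "(A \<rho> *v (f \<rho> - g \<rho>)) \<bullet> \<eta> \<rho> = G j \<rho>"
      using A[OF j \<rho>] Vh_affine[OF m \<eta> j \<rho>'] by (simp add: G_def v_def[abs_def])
  qed
  also have "\<dots> = (\<Sum>j<J. hh q j * mprod (B j) w v j)"
  proof (rule sum.cong[OF refl])
    fix j assume "j \<in> {..<J}"
    then have j: "j < J" by simp
    have "integral {q j..q (Suc j)} (G j) = hh q j * ((B j *v mid w j) \<bullet> mid v j + (hh q j)\<^sup>2 / 12 * ((B j *v slope q w j) \<bullet> slope q v j))"
      unfolding G_def emid_def hh_def using mesh_less[OF m j] by (intro affine_product_integral) auto
    then show "integral {q j..q (Suc j)} (G j) = hh q j * mprod (B j) w v j"
      by (simp add: mprod_def jump_slope[OF m j] matrix_vector_mult_scaleR power2_eq_square)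
  qed
  finally show ?thesis by (simp add: w_def[abs_def] v_def[abs_def])
qed

lemma LINT_stiff:
  fixes F :: "nat \<Rightarrow> real^'d"
  assumes m: "mesh J q" and \<eta>: "\<eta> \<in> Vh J q"
    and A: "\<And>j \<rho>. j < J \<Longrightarrow> \<rho> \<in> {q j<..<q (Suc j)} \<Longrightarrow> A \<rho> = F j"
  shows "(LINT \<rho>|\<I>. A \<rho> \<bullet> d_rho \<eta> \<rho>) = (\<Sum>j<J. hh q j * (F j \<bullet> slope q (\<lambda>j. \<eta> (q j)) j))"
proof -
  have "(LINT \<rho>|\<I>. A \<rho> \<bullet> d_rho \<eta> \<rho>) = (\<Sum>j<J. integral {q j..q (Suc j)} (\<lambda>_. F j \<bullet> slope q (\<lambda>j. \<eta> (q j)) j))"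
    by (rule LINT_mesh(2)[OF m]) (auto simp: A Vh_d_rho(2)[OF m \<eta>])
  also have "\<dots> = (\<Sum>j<J. hh q j * (F j \<bullet> slope q (\<lambda>j. \<eta> (q j)) j))"
    using less_imp_le[OF mesh_less[OF m]] by (intro sum.cong) (auto simp: hh_def)
  finally show ?thesis .
qed

text \<open>Discrete functions are admissible test functions in the continuous problem.\<close>

lemma Vh_H1:
  fixes f :: "real \<Rightarrow> real^'d"
  assumes m: "mesh J q" and f: "f \<in> Vh J q"
  shows "H1_with_deriv f (d_rho f)"
proof -
  define s where "s j = slope q (\<lambda>j. f (q j)) j" for j
  have cf: "continuous_on S f" for S using f continuous_on_subset unfolding Vh_def by blast
  have d: "d_rho f \<rho> = s j" if "j < J" "\<rho> \<in> {q j<..<q (Suc j)}" for j \<rho>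
    using Vh_d_rho(2)[OF m f that] by (simp add: s_def)
  have i1: "integrable \<I> f" "integrable \<I> (\<lambda>\<rho>. (norm (f \<rho>))\<^sup>2)"
    by (intro LINT_Icc(2) continuous_intros cf)+
  have i2: "integrable \<I> (d_rho f)" "integrable \<I> (\<lambda>\<rho>. (norm (d_rho f \<rho>))\<^sup>2)"
    by (rule LINT_mesh(1)[OF m, where g="\<lambda>j _. s j"]; auto simp: d)
      (rule LINT_mesh(1)[OF m, where g="\<lambda>j _. (norm (s j))\<^sup>2"]; auto simp: d)
  have "(LINT \<rho>|\<I>. deriv \<zeta> \<rho> *\<^sub>R f \<rho>) = - (LINT \<rho>|\<I>. \<zeta> \<rho> *\<^sub>R d_rho f \<rho>)"
    if \<zeta>: "\<zeta> C1_differentiable_on UNIV" "periodic1 \<zeta>" for \<zeta> :: "real \<Rightarrow> real"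
  proof -
    obtain D where D: "\<And>x. (\<zeta> has_real_derivative D x) (at x)" "continuous_on UNIV D"
      using \<zeta>(1) by (auto simp: C1_differentiable_on_def has_real_derivative_iff_has_vector_derivative)
    have dD: "deriv \<zeta> = D" using DERIV_imp_deriv[OF D(1)] by auto
    have c\<zeta>: "continuous_on S \<zeta>" for S using D(1) by (meson DERIV_continuous continuous_at_imp_continuous_on)
    have cD: "continuous_on S D" for S using D(2) continuous_on_subset by blast
    have c1: "continuous_on {q j..q (Suc j)} (\<lambda>\<rho>. D \<rho> *\<^sub>R f \<rho>)" for j by (intro continuous_intros cD cf)
    have c2: "continuous_on {q j..q (Suc j)} (\<lambda>\<rho>. \<zeta> \<rho> *\<^sub>R s j)" for j by (intro continuous_intros c\<zeta>)
    have "(LINT \<rho>|\<I>. deriv \<zeta> \<rho> *\<^sub>R f \<rho>) + (LINT \<rho>|\<I>. \<zeta> \<rho> *\<^sub>R d_rho f \<rho>)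
      = (\<Sum>j<J. integral {q j..q (Suc j)} (\<lambda>\<rho>. D \<rho> *\<^sub>R f \<rho>)) + (\<Sum>j<J. integral {q j..q (Suc j)} (\<lambda>\<rho>. \<zeta> \<rho> *\<^sub>R s j))"
      unfolding dD using LINT_mesh(2)[OF m c1, of "\<lambda>\<rho>. D \<rho> *\<^sub>R f \<rho>"] LINT_mesh(2)[OF m c2, of "\<lambda>\<rho>. \<zeta> \<rho> *\<^sub>R d_rho f \<rho>"]
      by (simp add: d)
    also have "\<dots> = (\<Sum>j<J. \<zeta> (q (Suc j)) *\<^sub>R f (q (Suc j)) - \<zeta> (q j) *\<^sub>R f (q j))"
      unfolding sum.distrib[symmetric]
    proof (rule sum.cong[OF refl])
      fix j assume "j \<in> {..<J}"
      then have j: "j < J" by simp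
      have "integral {q j..q (Suc j)} (\<lambda>\<rho>. D \<rho> *\<^sub>R f \<rho>) + integral {q j..q (Suc j)} (\<lambda>\<rho>. \<zeta> \<rho> *\<^sub>R s j)
        = integral {q j..q (Suc j)} (\<lambda>\<rho>. D \<rho> *\<^sub>R f \<rho> + \<zeta> \<rho> *\<^sub>R s j)"
        by (intro Henstock_Kurzweil_Integration.integral_add[symmetric] integrable_continuous_real c1 c2)
      also have "((\<lambda>\<rho>. D \<rho> *\<^sub>R f \<rho> + \<zeta> \<rho> *\<^sub>R s j) has_integral (\<zeta> (q (Suc j)) *\<^sub>R f (q (Suc j)) - \<zeta> (q j) *\<^sub>R f (q j))) {q j..q (Suc j)}"
      proof (rule fundamental_theorem_of_calculus_interior)
        show "continuous_on {q j..q (Suc j)} (\<lambda>\<rho>. \<zeta> \<rho> *\<^sub>R f \<rho>)" by (intro continuous_intros c\<zeta> cf)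
        show "((\<lambda>\<rho>. \<zeta> \<rho> *\<^sub>R f \<rho>) has_vector_derivative D \<rho> *\<^sub>R f \<rho> + \<zeta> \<rho> *\<^sub>R s j) (at \<rho>)" if "\<rho> \<in> {q j<..<q (Suc j)}" for \<rho>
          using has_vector_derivative_scaleR[OF D(1) Vh_d_rho(1)[OF m f j that]] by (simp add: s_def add.commute)
      qed (use mesh_less[OF m j] in auto)
      then have "integral {q j..q (Suc j)} (\<lambda>\<rho>. D \<rho> *\<^sub>R f \<rho> + \<zeta> \<rho> *\<^sub>R s j) = \<zeta> (q (Suc j)) *\<^sub>R f (q (Suc j)) - \<zeta> (q j) *\<^sub>R f (q j)"
        by (rule integral_unique)
      finally show "integral {q j..q (Suc j)} (\<lambda>\<rho>. D \<rho> *\<^sub>R f \<rho>) + integral {q j..q (Suc j)} (\<lambda>\<rho>. \<zeta> \<rho> *\<^sub>R s j)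
        = \<zeta> (q (Suc j)) *\<^sub>R f (q (Suc j)) - \<zeta> (q j) *\<^sub>R f (q j)" .
    qed
    also have "\<dots> = \<zeta> (q J) *\<^sub>R f (q J) - \<zeta> (q 0) *\<^sub>R f (q 0)" by (rule sum_lessThan_telescope)
    also have "\<dots> = 0"
      using Vh_nodal_periodic[OF m f] \<zeta>(2) mesh_ends[OF m] unfolding periodic1_def by (metis add_0 diff_self)
    finally show ?thesis by (simp add: eq_neg_iff_add_eq_0)
  qed
  then show ?thesis
    using i1 i2 by (auto simp: H1_with_deriv_def L2_def has_weak_deriv_def)
qed

lemma LINT_square_le:
  fixes w :: "real \<Rightarrow> 'a::euclidean_space"
  assumes m: "mesh J q" and g: "\<And>j. j < J \<Longrightarrow> continuous_on {q j..q (Suc j)} (g j)"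
    and fg: "\<And>j \<rho>. j < J \<Longrightarrow> \<rho> \<in> {q j<..<q (Suc j)} \<Longrightarrow> w \<rho> = g j \<rho>"
    and C: "\<And>j \<rho>. j < J \<Longrightarrow> \<rho> \<in> {q j..q (Suc j)} \<Longrightarrow> (norm (g j \<rho>))\<^sup>2 \<le> C j"
  shows "(L2_norm w)\<^sup>2 \<le> (\<Sum>j<J. hh q j * C j)"
proof -
  have cg: "continuous_on {q j..q (Suc j)} (\<lambda>\<rho>. (norm (g j \<rho>))\<^sup>2)" if "j < J" for j by (intro continuous_intros g that)
  have "(L2_norm w)\<^sup>2 = (LINT \<rho>|\<I>. (norm (w \<rho>))\<^sup>2)"
    unfolding L2_norm_def by (rule real_sqrt_pow2) (simp add: integral_nonneg_AE)
  also have "\<dots> = (\<Sum>j<J. integral {q j..q (Suc j)} (\<lambda>\<rho>. (norm (g j \<rho>))\<^sup>2))"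
    by (rule LINT_mesh(2)[OF m cg]) (auto simp: fg)
  also have "\<dots> \<le> (\<Sum>j<J. hh q j * C j)"
  proof (rule sum_mono)
    fix j assume "j \<in> {..<J}"
    then have j: "j < J" by simp
    have "integral {q j..q (Suc j)} (\<lambda>\<rho>. (norm (g j \<rho>))\<^sup>2) \<le> integral {q j..q (Suc j)} (\<lambda>_. C j)"
      using C[OF j] by (intro integral_le integrable_continuous_real cg j) auto
    then show "integral {q j..q (Suc j)} (\<lambda>\<rho>. (norm (g j \<rho>))\<^sup>2) \<le> hh q j * C j"
      using mesh_less[OF m j] by (simp add: hh_def)
  qed
  finally show ?thesis .
qed

section \<open>Solvability of monotone systems for nodal values\<close>

text \<open>The nodal vectors form no type, as their number varies, so completeness is established by hand for
  the metric space of vectors with \<open>J\<close> free components; the fixed-point theorem for contractions then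
  applies to a damped residual map, since the residual is strongly monotone and Lipschitz.\<close>

definition nodal :: "nat \<Rightarrow> (nat \<Rightarrow> 'a::zero) set" where
  "nodal J = {u. u J = u 0 \<and> (\<forall>j>J. u j = 0)}"

definition ndist :: "nat \<Rightarrow> (nat \<Rightarrow> 'a::real_normed_vector) \<Rightarrow> (nat \<Rightarrow> 'a) \<Rightarrow> real" where
  "ndist J u v = L2_set (\<lambda>j. norm (u j - v j)) {..<J}"

lemma norm_le_ndist: "j < J \<Longrightarrow> norm (u j - v j) \<le> ndist J u v"
  unfolding ndist_def by (rule member_le_L2_set) auto

lemma nodal_eqI: "u \<in> nodal J \<Longrightarrow> v \<in> nodal J \<Longrightarrow> 0 < J \<Longrightarrow> (\<And>j. j < J \<Longrightarrow> u j = v j) \<Longrightarrow> u = v"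
  unfolding nodal_def by (rule ext) (metis (mono_tags, lifting) linorder_neqE_nat mem_Collect_eq)

lemma nodal_metric:
  assumes "0 < J"
  shows "Metric_space (nodal J :: (nat \<Rightarrow> 'a::real_normed_vector) set) (ndist J)"
proof
  fix u v w :: "nat \<Rightarrow> 'a"
  show "0 \<le> ndist J u v" by (simp add: ndist_def)
  show "ndist J u v = ndist J v u" by (simp add: ndist_def norm_minus_commute)
  show "ndist J u v = 0 \<longleftrightarrow> u = v" if "u \<in> nodal J" "v \<in> nodal J"
    using nodal_eqI[OF that assms] by (auto simp: ndist_def L2_set_eq_0_iff)
  have "ndist J u w \<le> L2_set (\<lambda>j. norm (u j - v j) + norm (v j - w j)) {..<J}"
    unfolding ndist_def by (rule L2_set_mono) (auto simp: norm_diff_triangle_ineq norm_triangle_sub intro: norm_diff_triangle_le)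
  also have "\<dots> \<le> ndist J u v + ndist J v w" unfolding ndist_def by (rule L2_set_triangle_ineq)
  finally show "ndist J u w \<le> ndist J u v + ndist J v w" .
qed

lemma nodal_complete:
  assumes J: "0 < J"
  shows "Metric_space.mcomplete (nodal J :: (nat \<Rightarrow> 'a::banach) set) (ndist J)"
proof -
  interpret Metric_space "nodal J :: (nat \<Rightarrow> 'a) set" "ndist J" by (rule nodal_metric[OF J])
  show ?thesis
    unfolding mcomplete_def
  proof (intro allI impI)
    fix \<sigma> assume \<sigma>: "MCauchy \<sigma>"
    have mem: "\<sigma> n \<in> nodal J" for n using \<sigma> by (auto simp: MCauchy_def)
    have "Cauchy (\<lambda>n. \<sigma> n j)" if j: "j < J" for j
      unfolding Cauchy_def
    proof (intro allI impI)
      fix e :: real assume "0 < e"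
      then obtain N where "\<And>n n'. N \<le> n \<Longrightarrow> N \<le> n' \<Longrightarrow> ndist J (\<sigma> n) (\<sigma> n') < e"
        using \<sigma> unfolding MCauchy_def by meson
      then show "\<exists>N. \<forall>m\<ge>N. \<forall>n\<ge>N. dist (\<sigma> m j) (\<sigma> n j) < e"
        using norm_le_ndist[OF j] by (metis dist_norm le_less_trans)
    qed
    then have "\<exists>l. (\<lambda>n. \<sigma> n j) \<longlonglongrightarrow> l" if "j < J" for j
      using that by (simp add: Cauchy_convergent_iff convergent_def)
    then obtain l where l: "\<And>j. j < J \<Longrightarrow> (\<lambda>n. \<sigma> n j) \<longlonglongrightarrow> l j" by metis
    define u where "u j = (if j < J then l j else if j = J then l 0 else 0)" for j
    have u: "u \<in> nodal J" using J by (auto simp: u_def nodal_def)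
    have "(\<lambda>n. \<Sum>j<J. norm (\<sigma> n j - u j)) \<longlonglongrightarrow> (\<Sum>j<J. norm (u j - u j))"
      by (intro tendsto_intros) (use l in \<open>simp add: u_def\<close>)
    then have lim: "(\<lambda>n. \<Sum>j<J. norm (\<sigma> n j - u j)) \<longlonglongrightarrow> 0" by simp
    have "limitin mtopology \<sigma> u sequentially"
      unfolding limit_metric_sequentially
    proof (intro conjI u allI impI)
      fix e :: real assume "0 < e"
      from order_tendstoD(2)[OF lim this] obtain N where N: "\<And>n. N \<le> n \<Longrightarrow> (\<Sum>j<J. norm (\<sigma> n j - u j)) < e"
        by (auto simp: eventually_sequentially)
      have "ndist J (\<sigma> n) u \<le> (\<Sum>j<J. norm (\<sigma> n j - u j))" for n
        unfolding ndist_def by (rule L2_set_le_sum) auto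
      then show "\<exists>N. \<forall>n\<ge>N. \<sigma> n \<in> nodal J \<and> ndist J (\<sigma> n) u < e" using N mem by (meson le_less_trans)
    qed
    then show "\<exists>x. limitin mtopology \<sigma> x sequentially" by blast
  qed
qed

text \<open>Zarantonello's argument: with the step size \<open>\<tau> = \<gamma> / L'\<^sup>2\<close>, where \<open>L'\<close> is a Lipschitz constant of
  the whole map \<open>F\<close>, the map \<open>u \<mapsto> u - \<tau> F(u)\<close> contracts, because
  $|u - w - \tau(Fu - Fw)|^2 \le (1 - 2\tau\gamma + \tau^2 L'^2)\,|u - w|^2$.\<close>

lemma monotone_Lipschitz_zero:
  fixes F :: "(nat \<Rightarrow> 'a::euclidean_space) \<Rightarrow> nat \<Rightarrow> 'a"
  assumes J: "0 < J" and \<gamma>: "0 < \<gamma>" and L: "0 \<le> L"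
    and lip: "\<And>u w j. u \<in> nodal J \<Longrightarrow> w \<in> nodal J \<Longrightarrow> j < J \<Longrightarrow> norm (F u j - F w j) \<le> L * ndist J u w"
    and mono: "\<And>u w. u \<in> nodal J \<Longrightarrow> w \<in> nodal J \<Longrightarrow>
      \<gamma> * (ndist J u w)\<^sup>2 \<le> (\<Sum>j<J. (F u j - F w j) \<bullet> (u j - w j))"
  shows "\<exists>u\<in>nodal J. \<forall>j<J. F u j = 0"
proof -
  interpret Metric_space "nodal J :: (nat \<Rightarrow> 'a) set" "ndist J" by (rule nodal_metric[OF J])
  define L' where "L' = real J * L + \<gamma>"
  have L': "\<gamma> \<le> L'" "0 < L'" using \<gamma> L by (auto simp: L'_def add_nonneg_pos)
  define \<tau> where "\<tau> = \<gamma> / L'\<^sup>2"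
  have \<tau>: "0 < \<tau>" using \<gamma> L' by (simp add: \<tau>_def)
  define T where "T u j = (if j < J then u j - \<tau> *\<^sub>R F u j else if j = J then u 0 - \<tau> *\<^sub>R F u 0 else 0)" for u j
  have Tm: "T u \<in> nodal J" for u using J by (auto simp: T_def nodal_def)
  have sq: "(ndist J u w)\<^sup>2 = (\<Sum>j<J. (norm (u j - w j))\<^sup>2)" for u w :: "nat \<Rightarrow> 'a"
    unfolding ndist_def L2_set_def by (simp add: sum_nonneg)
  define k where "k = sqrt (1 - \<gamma>\<^sup>2 / L'\<^sup>2)"
  have "\<gamma>\<^sup>2 \<le> L'\<^sup>2" using L' \<gamma> by (simp add: power_mono)
  then have k01: "0 \<le> 1 - \<gamma>\<^sup>2 / L'\<^sup>2" using L' by simp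
  have k1: "k < 1" using \<gamma> L' unfolding k_def by (subst real_sqrt_lt_1_iff) simp
  have con: "ndist J (T u) (T w) \<le> k * ndist J u w" if uw: "u \<in> nodal J" "w \<in> nodal J" for u w
  proof -
    define N where "N = ndist J u w"
    define S where "S = (\<Sum>j<J. (F u j - F w j) \<bullet> (u j - w j))"
    have N0: "0 \<le> N" by (simp add: N_def)
    have Fsq: "(\<Sum>j<J. (norm (F u j - F w j))\<^sup>2) \<le> L'\<^sup>2 * N\<^sup>2"
    proof -
      have "(\<Sum>j<J. (norm (F u j - F w j))\<^sup>2) \<le> (\<Sum>j<J. (L * N)\<^sup>2)"
        using lip[OF uw] by (intro sum_mono power_mono) (auto simp: N_def)
      also have "\<dots> = real J * (L\<^sup>2 * N\<^sup>2)" by (simp add: power_mult_distrib)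
      also have "\<dots> \<le> (real J)\<^sup>2 * (L\<^sup>2 * N\<^sup>2)"
        using J by (intro mult_right_mono) (auto simp: power2_eq_square)
      also have "\<dots> = (real J * L)\<^sup>2 * N\<^sup>2" by (simp add: power_mult_distrib)
      also have "\<dots> \<le> L'\<^sup>2 * N\<^sup>2"
        using L \<gamma> by (intro mult_right_mono power_mono) (auto simp: L'_def)
      finally show ?thesis .
    qed
    have "(ndist J (T u) (T w))\<^sup>2 = (\<Sum>j<J. (norm ((u j - w j) - \<tau> *\<^sub>R (F u j - F w j)))\<^sup>2)"
      unfolding sq by (intro sum.cong) (auto simp: T_def algebra_simps)
    also have "\<dots> = (\<Sum>j<J. (norm (u j - w j))\<^sup>2 - 2 * \<tau> * ((F u j - F w j) \<bullet> (u j - w j)) + \<tau>\<^sup>2 * (norm (F u j - F w j))\<^sup>2)"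
    proof (intro sum.cong refl)
      have "(norm (a - \<tau> *\<^sub>R b))\<^sup>2 = (norm a)\<^sup>2 - 2 * \<tau> * (b \<bullet> a) + \<tau>\<^sup>2 * (norm b)\<^sup>2" for a b :: 'a
        unfolding power2_norm_eq_inner
        by (simp add: inner_diff_left inner_diff_right inner_commute[of a b] power2_eq_square[of \<tau>] algebra_simps)
      then show "(norm ((u j - w j) - \<tau> *\<^sub>R (F u j - F w j)))\<^sup>2
        = (norm (u j - w j))\<^sup>2 - 2 * \<tau> * ((F u j - F w j) \<bullet> (u j - w j)) + \<tau>\<^sup>2 * (norm (F u j - F w j))\<^sup>2" for j .
    qed
    also have "\<dots> = N\<^sup>2 - 2 * \<tau> * S + \<tau>\<^sup>2 * (\<Sum>j<J. (norm (F u j - F w j))\<^sup>2)"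
      by (simp add: sum.distrib sum_subtractf sum_distrib_left N_def sq S_def)
    also have "\<dots> \<le> N\<^sup>2 - 2 * \<tau> * (\<gamma> * N\<^sup>2) + \<tau>\<^sup>2 * (L'\<^sup>2 * N\<^sup>2)"
    proof -
      have "2 * \<tau> * (\<gamma> * N\<^sup>2) \<le> 2 * \<tau> * S" using mono[OF uw] \<tau> by (simp add: N_def S_def)
      moreover have "\<tau>\<^sup>2 * (\<Sum>j<J. (norm (F u j - F w j))\<^sup>2) \<le> \<tau>\<^sup>2 * (L'\<^sup>2 * N\<^sup>2)" using Fsq by (rule mult_left_mono) simp
      ultimately show ?thesis by linarith
    qed
    also have "\<dots> = (1 - \<gamma>\<^sup>2 / L'\<^sup>2) * N\<^sup>2"
      using L'(2) by (simp add: \<tau>_def power2_eq_square field_simps)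
    also have "\<dots> = (k * N)\<^sup>2" using k01 by (simp add: k_def power_mult_distrib)
    finally have "ndist J (T u) (T w) \<le> k * N"
      by (rule power2_le_imp_le) (intro mult_nonneg_nonneg N0, unfold k_def, rule real_sqrt_ge_zero[OF k01])
    then show ?thesis by (simp add: N_def)
  qed
  have "nodal J \<noteq> ({} :: (nat \<Rightarrow> 'a) set)" using Tm by blast
  then obtain u where u: "u \<in> nodal J" "T u = u"
    using Banach_fixedpoint_thm[OF nodal_complete[OF J] _ _ k1, of T] con Tm by blast
  have "F u j = 0" if "j < J" for j
    using fun_cong[OF u(2), of j] that \<tau> by (simp add: T_def)
  then show ?thesis using u(1) by blast
qed

lemma sum_shift_periodic:
  fixes f :: "nat \<Rightarrow> nat \<Rightarrow> real"
  assumes "0 < J" "\<And>e. f e J = f e 0"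
  shows "(\<Sum>e<J. f e (Suc e)) = (\<Sum>j<J. f (if j = 0 then J - 1 else j - 1) j)"
proof -
  obtain n where n: "J = Suc n" using assms(1) by (cases J) auto
  have "(\<Sum>j<J. f (if j = 0 then J - 1 else j - 1) j) = f n 0 + (\<Sum>j<n. f j (Suc j))"
    unfolding n sum.lessThan_Suc_shift by simp
  then show ?thesis using assms(2)[of n] by (simp add: n)
qed

text \<open>Both the scheme and the projection of the initial value are systems of this shape. Summation by parts
  along the closed polygon collects the coefficient of each nodal test value.\<close>

lemma variational_solvable:
  fixes \<alpha> \<beta> :: "(nat \<Rightarrow> 'a::euclidean_space) \<Rightarrow> nat \<Rightarrow> 'a"
  assumes J: "0 < J" and \<gamma>: "0 < \<gamma>" and L: "0 \<le> L"
    and lip: "\<And>u w e. e < J \<Longrightarrow> norm (\<alpha> u e - \<alpha> w e) \<le> L * (norm (mid u e - mid w e) + norm (jump u e - jump w e))"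
      "\<And>u w e. e < J \<Longrightarrow> norm (\<beta> u e - \<beta> w e) \<le> L * (norm (mid u e - mid w e) + norm (jump u e - jump w e))"
    and mono: "\<And>u w. u J = u 0 \<Longrightarrow> w J = w 0 \<Longrightarrow> \<gamma> * (\<Sum>j<J. (norm (u j - w j))\<^sup>2) \<le>
      (\<Sum>e<J. (\<alpha> u e - \<alpha> w e) \<bullet> mid (\<lambda>j. u j - w j) e + (\<beta> u e - \<beta> w e) \<bullet> jump (\<lambda>j. u j - w j) e)"
  shows "\<exists>u. u J = u 0 \<and> (\<forall>v. v J = v 0 \<longrightarrow> (\<Sum>e<J. \<alpha> u e \<bullet> mid v e + \<beta> u e \<bullet> jump v e) = 0)"
proof -
  define pr where "pr j = (if j = 0 then J - 1 else j - 1)" for j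
  define F where "F u j = (\<alpha> u j /\<^sub>R 2 - \<beta> u j) + (\<alpha> u (pr j) /\<^sub>R 2 + \<beta> u (pr j))" for u j
  have prJ: "j < J \<Longrightarrow> pr j < J" for j by (auto simp: pr_def)
  have by_parts: "(\<Sum>e<J. a e \<bullet> mid v e + b e \<bullet> jump v e)
      = (\<Sum>j<J. ((a j /\<^sub>R 2 - b j) + (a (pr j) /\<^sub>R 2 + b (pr j))) \<bullet> v j)" if "v J = v 0" for a b v :: "nat \<Rightarrow> 'a"
  proof -
    have "(\<Sum>e<J. a e \<bullet> mid v e + b e \<bullet> jump v e) = (\<Sum>e<J. (a e /\<^sub>R 2 - b e) \<bullet> v e) + (\<Sum>e<J. (a e /\<^sub>R 2 + b e) \<bullet> v (Suc e))"
      unfolding sum.distrib[symmetric]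
      by (intro sum.cong refl) (simp add: mid_def jump_def inner_add_left inner_diff_left inner_add_right inner_diff_right algebra_simps)
    also have "(\<Sum>e<J. (a e /\<^sub>R 2 + b e) \<bullet> v (Suc e)) = (\<Sum>j<J. (a (pr j) /\<^sub>R 2 + b (pr j)) \<bullet> v j)"
      unfolding pr_def using that by (intro sum_shift_periodic[OF J, of "\<lambda>e i. (a e /\<^sub>R 2 + b e) \<bullet> v i"]) simp
    finally show ?thesis by (simp add: sum.distrib inner_add_left)
  qed
  have "\<exists>u\<in>nodal J. \<forall>j<J. F u j = 0"
  proof (rule monotone_Lipschitz_zero[OF J \<gamma>])
    show "0 \<le> 12 * L" using L by simp
    fix u w :: "nat \<Rightarrow> 'a" assume uw: "u \<in> nodal J" "w \<in> nodal J"
    have per: "u J = u 0" "w J = w 0" using uw by (auto simp: nodal_def)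
    define N where "N = ndist J u w"
    have nn: "norm (u j - w j) \<le> N" if "j \<le> J" for j
      using norm_le_ndist[of j J u w] norm_le_ndist[of 0 J u w] per J that by (cases "j = J") (auto simp: N_def)
    have mj: "norm (mid u e - mid w e) + norm (jump u e - jump w e) \<le> 3 * N" if "e < J" for e
    proof -
      have "mid u e - mid w e = ((u e - w e) + (u (Suc e) - w (Suc e))) /\<^sub>R 2" by (simp add: mid_def algebra_simps)
      then have "norm (mid u e - mid w e) = norm ((u e - w e) + (u (Suc e) - w (Suc e))) / 2" by simp
      moreover have "norm ((u e - w e) + (u (Suc e) - w (Suc e))) \<le> norm (u e - w e) + norm (u (Suc e) - w (Suc e))"
        by (rule norm_triangle_ineq)
      moreover have "jump u e - jump w e = (u (Suc e) - w (Suc e)) - (u e - w e)" by (simp add: jump_def)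
      then have "norm (jump u e - jump w e) \<le> norm (u (Suc e) - w (Suc e)) + norm (u e - w e)" by (metis norm_triangle_ineq4)
      ultimately show ?thesis using nn[of e] nn[of "Suc e"] that by simp
    qed
    have ab: "norm (\<alpha> u e - \<alpha> w e) \<le> 3 * (L * N)" "norm (\<beta> u e - \<beta> w e) \<le> 3 * (L * N)" if "e < J" for e
      using order_trans[OF lip(1)[OF that] mult_left_mono[OF mj[OF that] L]]
        order_trans[OF lip(2)[OF that] mult_left_mono[OF mj[OF that] L]] by (simp_all add: mult_ac)
    show "norm (F u j - F w j) \<le> 12 * L * ndist J u w" if j: "j < J" for j
    proof -
      have "F u j - F w j = (\<alpha> u j - \<alpha> w j) /\<^sub>R 2 - (\<beta> u j - \<beta> w j) + ((\<alpha> u (pr j) - \<alpha> w (pr j)) /\<^sub>R 2 + (\<beta> u (pr j) - \<beta> w (pr j)))"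
        by (simp add: F_def algebra_simps)
      also have "norm \<dots> \<le> (norm (\<alpha> u j - \<alpha> w j) / 2 + norm (\<beta> u j - \<beta> w j)) + (norm (\<alpha> u (pr j) - \<alpha> w (pr j)) / 2 + norm (\<beta> u (pr j) - \<beta> w (pr j)))"
        by (intro norm_triangle_mono norm_triangle_le norm_triangle_le_diff) auto
      also have "\<dots> \<le> 12 * L * N" using ab[OF j] ab[OF prJ[OF j]] mult_nonneg_nonneg[OF L, of N] by (simp add: N_def ndist_def)
      finally show ?thesis by (simp add: N_def)
    qed
    have "(ndist J u w)\<^sup>2 = (\<Sum>j<J. (norm (u j - w j))\<^sup>2)"
      unfolding ndist_def L2_set_def by (simp add: sum_nonneg)
    moreover have "(\<Sum>j<J. (F u j - F w j) \<bullet> (u j - w j))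
      = (\<Sum>e<J. (\<alpha> u e - \<alpha> w e) \<bullet> mid (\<lambda>j. u j - w j) e + (\<beta> u e - \<beta> w e) \<bullet> jump (\<lambda>j. u j - w j) e)"
      using by_parts[of "\<lambda>j. u j - w j" "\<lambda>e. \<alpha> u e - \<alpha> w e" "\<lambda>e. \<beta> u e - \<beta> w e"] per
      by (simp add: F_def algebra_simps)
    ultimately show "\<gamma> * (ndist J u w)\<^sup>2 \<le> (\<Sum>j<J. (F u j - F w j) \<bullet> (u j - w j))" using mono[OF per] by simp
  qed
  then obtain u where u: "u \<in> nodal J" "\<And>j. j < J \<Longrightarrow> F u j = 0" by blast
  have "(\<Sum>e<J. \<alpha> u e \<bullet> mid v e + \<beta> u e \<bullet> jump v e) = 0" if "v J = v 0" for v
    using by_parts[OF that, of "\<alpha> u" "\<beta> u"] u(2) by (simp add: F_def)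
  then show ?thesis using u(1) by (auto simp: nodal_def)
qed

section \<open>Consistency of the nodal interpolant\<close>

lemma continuous_on_matvec:
  fixes M :: "real \<Rightarrow> real^'d^'d"
  assumes "\<And>i j. continuous_on S (\<lambda>\<rho>. M \<rho> $ i $ j)" "continuous_on S y"
  shows "continuous_on S (\<lambda>\<rho>. M \<rho> *v y \<rho>)"
  unfolding matrix_vector_mult_def
  by (intro continuous_on_vec_lambda continuous_on_sum continuous_on_mult assms continuous_on_component)

lemma integral_mean_bound:
  fixes f :: "real \<Rightarrow> 'a::euclidean_space"
  assumes "a < b" "continuous_on {a..b} f" "integral {a..b} f = (b - a) *\<^sub>R P"
    "\<And>\<sigma>. \<sigma> \<in> {a..b} \<Longrightarrow> norm (f \<sigma> - y) \<le> M"
  shows "norm (P - y) \<le> M"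
proof -
  have "integral {a..b} (\<lambda>\<sigma>. f \<sigma> - y) = (b - a) *\<^sub>R (P - y)"
    using assms(1-3) by (simp add: Henstock_Kurzweil_Integration.integral_diff integrable_continuous_real scaleR_diff_right)
  moreover have "norm (integral {a..b} (\<lambda>\<sigma>. f \<sigma> - y)) \<le> (b - a) * M"
    using assms by (intro integral_norm_bound continuous_intros) auto
  ultimately have "(b - a) * norm (P - y) \<le> (b - a) * M" using assms(1) by simp
  then show ?thesis using assms(1) by simp
qed

lemma integral_vec_nth:
  fixes f :: "real \<Rightarrow> real^'d"
  assumes "continuous_on {a..b} f" shows "integral {a..b} f $ i = integral {a..b} (\<lambda>\<rho>. f \<rho> $ i)"
  using integral_linear[OF integrable_continuous_real[OF assms] bounded_linear_vec_nth[of i]] by (simp add: comp_def)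

text \<open>The data of the problem with the constants that they determine. All exact and all discrete tangents are
  shown to stay within \<open>c0 / 2\<close> of exact ones, that is, in the annulus with radii \<open>c0 / 2\<close> and \<open>C0 + c0 / 2\<close>.
  There \<open>B\<close> bounds all nonlinearities and their derivatives, and \<open>c1\<close> is the coercivity constant of \<open>H\<close>;
  \<open>K\<close> measures the regularity of the solution.\<close>

locale flow =
  fixes \<phi> \<mu> :: "real^'d \<Rightarrow> real" and x :: "real \<Rightarrow> real \<Rightarrow> real^'d" and x0 :: "real \<Rightarrow> real^'d"
    and T c0 C0 K B c1 \<gamma> \<Gamma> :: real
  assumes aniso: "anisotropy \<phi>" and mob: "mobility \<mu>" and T: "0 < T" and c0: "0 < c0"
    and C1: "C1_space_time T x" and sol: "weak_solution \<phi> \<mu> T x0 x" and reg: "regular K T x"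
    and xr_range: "\<And>\<rho> t. t \<in> {0..T} \<Longrightarrow> c0 \<le> norm (d_rho (\<lambda>\<sigma>. x \<sigma> t) \<rho>) \<and> norm (d_rho (\<lambda>\<sigma>. x \<sigma> t) \<rho>) \<le> C0"
    and BG: "\<And>i. C3_bound (c0 / 2) (C0 + c0 / 2) B (\<lambda>p. grad (Phi \<phi>) p $ i)"
    and BH: "\<And>i j. C3_bound (c0 / 2) (C0 + c0 / 2) B (\<lambda>p. Hmat \<phi> \<mu> p $ i $ j)"
    and BP: "C3_bound (c0 / 2) (C0 + c0 / 2) B (Phi \<phi>)"
    and c1: "0 < c1" "\<And>p z. p \<in> annulus (c0 / 2) (C0 + c0 / 2) \<Longrightarrow> c1 * (norm z)\<^sup>2 \<le> (Hmat \<phi> \<mu> p *v z) \<bullet> z"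
    and \<gamma>: "0 < \<gamma>" and \<Gamma>: "0 < \<Gamma>"
    and G_mono: "\<And>p q. \<gamma> * (norm (p - q))\<^sup>2 \<le> (grad (Phi \<phi>) p - grad (Phi \<phi>) q) \<bullet> (p - q)"
    and G_Lip: "\<And>p q. norm (grad (Phi \<phi>) p - grad (Phi \<phi>) q) \<le> \<Gamma> * norm (p - q)"
    and hess_mono: "\<And>p z. p \<noteq> 0 \<Longrightarrow> \<gamma> * (norm z)\<^sup>2 \<le> (hessian (Phi \<phi>) p *v z) \<bullet> z"
    and hess_Lip: "\<And>p z. p \<noteq> 0 \<Longrightarrow> norm (hessian (Phi \<phi>) p *v z) \<le> \<Gamma> * norm z"
begin

abbreviation "G \<equiv> grad (Phi \<phi>)"
abbreviation "H \<equiv> Hmat \<phi> \<mu>"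

text \<open>The exact tangent and velocity, and the tangent \<open>P\<close> of the nodal interpolant.\<close>

definition xr :: "real \<Rightarrow> real \<Rightarrow> real^'d" where "xr \<rho> t = d_rho (\<lambda>\<sigma>. x \<sigma> t) \<rho>"
definition xt :: "real \<Rightarrow> real \<Rightarrow> real^'d" where "xt \<rho> t = d_t T x \<rho> t"
definition P :: "(nat \<Rightarrow> real) \<Rightarrow> nat \<Rightarrow> real \<Rightarrow> real^'d" where
  "P q j t = slope q (\<lambda>j. x (q j) t) j"

lemma K0: "0 \<le> K" and B0: "0 \<le> B"
  using reg BP by (auto simp: regular_def C3_bound_def)

lemma xr_Lip: "\<rho> \<in> {0..1} \<Longrightarrow> \<sigma> \<in> {0..1} \<Longrightarrow> t \<in> {0..T} \<Longrightarrow> norm (xr \<rho> t - xr \<sigma> t) \<le> K * \<bar>\<rho> - \<sigma>\<bar>"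
  and xr_inc_Lip: "\<rho> \<in> {0..1} \<Longrightarrow> \<sigma> \<in> {0..1} \<Longrightarrow> t \<in> {0..T} \<Longrightarrow> s \<in> {0..T} \<Longrightarrow>
    norm ((xr \<rho> t - xr \<rho> s) - (xr \<sigma> t - xr \<sigma> s)) \<le> K * \<bar>t - s\<bar> * \<bar>\<rho> - \<sigma>\<bar>"
  and xr_inc: "\<rho> \<in> {0..1} \<Longrightarrow> t \<in> {0..T} \<Longrightarrow> s \<in> {0..T} \<Longrightarrow> norm (xr \<rho> t - xr \<rho> s) \<le> K * \<bar>t - s\<bar>"
  and xt_bound: "\<rho> \<in> {0..1} \<Longrightarrow> t \<in> {0..T} \<Longrightarrow> norm (xt \<rho> t) \<le> K"
  and xt_Lip: "\<rho> \<in> {0..1} \<Longrightarrow> \<sigma> \<in> {0..1} \<Longrightarrow> t \<in> {0..T} \<Longrightarrow> norm (xt \<rho> t - xt \<sigma> t) \<le> K * \<bar>\<rho> - \<sigma>\<bar>"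
  and xt_inc: "\<rho> \<in> {0..1} \<Longrightarrow> t \<in> {0..T} \<Longrightarrow> s \<in> {0..T} \<Longrightarrow> norm (xt \<rho> t - xt \<rho> s) \<le> K * \<bar>t - s\<bar>"
  using reg unfolding regular_def xr_def[symmetric] xt_def[symmetric] by blast+

lemma xr_deriv: "t \<in> {0..T} \<Longrightarrow> ((\<lambda>\<sigma>. x \<sigma> t) has_vector_derivative xr \<rho> t) (at \<rho>)"
  using C1 by (auto simp: C1_space_time_def xr_def d_rho_def vector_derivative_works[symmetric])

lemma xt_deriv: "t \<in> {0..T} \<Longrightarrow> (x \<rho> has_vector_derivative xt \<rho> t) (at t within {0..T})"
  using C1 by (auto simp: C1_space_time_def xt_def d_t_def vector_derivative_works[symmetric])

lemma xr_cont: "t \<in> {0..T} \<Longrightarrow> continuous_on S (\<lambda>\<rho>. xr \<rho> t)"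
  and xt_cont: "t \<in> {0..T} \<Longrightarrow> continuous_on S (\<lambda>\<rho>. xt \<rho> t)"
  and x_cont: "t \<in> {0..T} \<Longrightarrow> continuous_on S (\<lambda>\<rho>. x \<rho> t)"
  using C1 pairing_continuous(2)[OF _ continuous_on_const[of _ 0]]
  unfolding C1_space_time_def xr_def xt_def by blast+

lemma xr_nz: "t \<in> {0..T} \<Longrightarrow> xr \<rho> t \<noteq> 0"
  using xr_range[of t \<rho>] c0 by (auto simp: xr_def)

lemma H_comp_cont: "continuous_on (- {0}) (\<lambda>p. H p $ i $ j)"
  using BH[of i j] Ck_on_continuous unfolding C3_bound_def by blast

lemma Gxr_cont: "t \<in> {0..T} \<Longrightarrow> continuous_on S (\<lambda>\<rho>. G (xr \<rho> t))"
  by (rule continuous_on_compose2[OF grad_Phi_continuous[OF aniso] xr_cont]) auto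

lemma Hxr_cont: "t \<in> {0..T} \<Longrightarrow> continuous_on S (\<lambda>\<rho>. H (xr \<rho> t) $ i $ j)"
  by (rule continuous_on_compose2[OF H_comp_cont xr_cont]) (auto simp: xr_nz)

lemma xr_integral:
  assumes "t \<in> {0..T}" "a \<le> b" shows "integral {a..b} (\<lambda>\<rho>. xr \<rho> t) = x b t - x a t"
  by (rule integral_unique[OF fundamental_theorem_of_calculus[OF assms(2)
          has_vector_derivative_at_within[OF xr_deriv[OF assms(1)]]]])

context
  fixes J q assumes m: "mesh J q"
begin

text \<open>The fact that is special to one space dimension: the tangent of the nodal interpolant is the mean
  value of the exact tangent over the element.\<close>

lemma P_integral:
  assumes "j < J" "t \<in> {0..T}"
  shows "integral {q j..q (Suc j)} (\<lambda>\<rho>. xr \<rho> t) = (q (Suc j) - q j) *\<^sub>R P q j t"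
  using mesh_less[OF m assms(1)] xr_integral[OF assms(2) less_imp_le[OF mesh_less[OF m assms(1)]]]
  by (simp add: P_def slope_def hh_def)

lemma P_near:
  assumes j: "j < J" and t: "t \<in> {0..T}" and \<rho>: "\<rho> \<in> {q j..q (Suc j)}"
  shows "norm (P q j t - xr \<rho> t) \<le> K * hh q j"
proof (rule integral_mean_bound[OF mesh_less[OF m j] xr_cont[OF t] P_integral[OF j t]])
  fix \<sigma> assume \<sigma>: "\<sigma> \<in> {q j..q (Suc j)}"
  have "norm (xr \<sigma> t - xr \<rho> t) \<le> K * \<bar>\<sigma> - \<rho>\<bar>"
    using mesh_elem_sub[OF m j] \<rho> \<sigma> t by (intro xr_Lip) auto
  also have "\<dots> \<le> K * hh q j" using \<rho> \<sigma> K0 by (intro mult_left_mono) (auto simp: hh_def)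
  finally show "norm (xr \<sigma> t - xr \<rho> t) \<le> K * hh q j" .
qed

lemma P_inc_integral:
  assumes "j < J" "t \<in> {0..T}" "s \<in> {0..T}"
  shows "integral {q j..q (Suc j)} (\<lambda>\<rho>. xr \<rho> t - xr \<rho> s) = (q (Suc j) - q j) *\<^sub>R (P q j t - P q j s)"
  using P_integral assms
  by (simp add: Henstock_Kurzweil_Integration.integral_diff integrable_continuous_real xr_cont scaleR_diff_right)

lemma P_inc:
  assumes j: "j < J" and t: "t \<in> {0..T}" "s \<in> {0..T}"
  shows "norm (P q j t - P q j s) \<le> K * \<bar>t - s\<bar>"
proof -
  have "norm ((P q j t - P q j s) - 0) \<le> K * \<bar>t - s\<bar>"
    using mesh_elem_sub[OF m j] t
    by (intro integral_mean_bound[OF mesh_less[OF m j] _ P_inc_integral[OF j t]] continuous_intros xr_cont)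
      (auto intro!: xr_inc)
  then show ?thesis by simp
qed

lemma P_inc_near:
  assumes j: "j < J" and t: "t \<in> {0..T}" "s \<in> {0..T}" and \<rho>: "\<rho> \<in> {q j..q (Suc j)}"
  shows "norm ((P q j t - P q j s) - (xr \<rho> t - xr \<rho> s)) \<le> K * \<bar>t - s\<bar> * hh q j"
proof (rule integral_mean_bound[OF mesh_less[OF m j] _ P_inc_integral[OF j t]])
  show "continuous_on {q j..q (Suc j)} (\<lambda>\<rho>. xr \<rho> t - xr \<rho> s)" by (intro continuous_intros xr_cont t)
  fix \<sigma> assume \<sigma>: "\<sigma> \<in> {q j..q (Suc j)}"
  have "norm ((xr \<sigma> t - xr \<sigma> s) - (xr \<rho> t - xr \<rho> s)) \<le> K * \<bar>t - s\<bar> * \<bar>\<sigma> - \<rho>\<bar>"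
    using mesh_elem_sub[OF m j] \<rho> \<sigma> t by (intro xr_inc_Lip) auto
  also have "\<dots> \<le> K * \<bar>t - s\<bar> * hh q j" using \<rho> \<sigma> K0 by (intro mult_left_mono) (auto simp: hh_def)
  finally show "norm ((xr \<sigma> t - xr \<sigma> s) - (xr \<rho> t - xr \<rho> s)) \<le> K * \<bar>t - s\<bar> * hh q j" .
qed

text \<open>The interpolation error vanishes at the node \<open>q j\<close> and its derivative is of the order of the mesh size, as
  \<open>P\<close> is a mean value. The second part needs the mixed increments of the space derivative.\<close>

lemma interpolation_error:
  assumes j: "j < J" and t: "t \<in> {0..T}" and \<rho>: "\<rho> \<in> {q j..q (Suc j)}"
  shows "norm (x \<rho> t - (mid (\<lambda>j. x (q j) t) j + (\<rho> - emid q j) *\<^sub>R P q j t)) \<le> K * (hh q j)\<^sup>2"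
    and "s \<in> {0..T} \<Longrightarrow> norm ((x \<rho> t - x \<rho> s) - (mid (\<lambda>j. x (q j) t - x (q j) s) j + (\<rho> - emid q j) *\<^sub>R (P q j t - P q j s)))
      \<le> K * \<bar>t - s\<bar> * (hh q j)\<^sup>2"
proof -
  have nodes: "mid (\<lambda>j. x (q j) t) j + (\<rho> - emid q j) *\<^sub>R P q j t = x (q j) t + (\<rho> - q j) *\<^sub>R P q j t" for t
  proof -
    have "x (q (Suc j)) t = x (q j) t + hh q j *\<^sub>R P q j t"
      using hh_pos[OF m j] by (simp add: P_def slope_def)
    then have "mid (\<lambda>j. x (q j) t) j = (2 *\<^sub>R (x (q j) t + (hh q j / 2) *\<^sub>R P q j t)) /\<^sub>R 2"
      by (simp add: mid_def scaleR_add_right scaleR_2 add_ac)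
    then have "mid (\<lambda>j. x (q j) t) j = x (q j) t + (hh q j / 2) *\<^sub>R P q j t" by simp
    moreover have "hh q j / 2 + (\<rho> - emid q j) = \<rho> - q j" by (simp add: hh_def emid_def field_simps)
    ultimately show ?thesis by (simp add: add.assoc scaleR_add_left[symmetric])
  qed
  have le: "\<rho> - q j \<le> hh q j" "0 \<le> \<rho> - q j" using \<rho> by (auto simp: hh_def)
  have sub: "{q j..\<rho>} \<subseteq> {q j..q (Suc j)}" using \<rho> by auto
  have "integral {q j..\<rho>} (\<lambda>\<sigma>. xr \<sigma> t - P q j t) = x \<rho> t - (x (q j) t + (\<rho> - q j) *\<^sub>R P q j t)"
    using \<rho> t by (simp add: Henstock_Kurzweil_Integration.integral_diff integrable_continuous_real xr_cont xr_integral)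
  moreover have "norm (integral {q j..\<rho>} (\<lambda>\<sigma>. xr \<sigma> t - P q j t)) \<le> (\<rho> - q j) * (K * hh q j)"
    using P_near[OF j t] sub \<rho> by (intro integral_norm_bound continuous_intros xr_cont t) (auto simp: norm_minus_commute)
  moreover have "(\<rho> - q j) * (K * hh q j) \<le> hh q j * (K * hh q j)"
    using le K0 by (intro mult_right_mono) auto
  ultimately show "norm (x \<rho> t - (mid (\<lambda>j. x (q j) t) j + (\<rho> - emid q j) *\<^sub>R P q j t)) \<le> K * (hh q j)\<^sup>2"
    unfolding nodes by (simp add: power2_eq_square mult_ac)
  show "norm ((x \<rho> t - x \<rho> s) - (mid (\<lambda>j. x (q j) t - x (q j) s) j + (\<rho> - emid q j) *\<^sub>R (P q j t - P q j s)))
      \<le> K * \<bar>t - s\<bar> * (hh q j)\<^sup>2" if s: "s \<in> {0..T}"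
  proof -
    have "integral {q j..\<rho>} (\<lambda>\<sigma>. (xr \<sigma> t - xr \<sigma> s) - (P q j t - P q j s))
      = (x \<rho> t - x \<rho> s) - ((x (q j) t + (\<rho> - q j) *\<^sub>R P q j t) - (x (q j) s + (\<rho> - q j) *\<^sub>R P q j s))"
      using \<rho> t s by (simp add: Henstock_Kurzweil_Integration.integral_diff integrable_diff integrable_continuous_real xr_cont xr_integral scaleR_diff_right)
    moreover have "norm (integral {q j..\<rho>} (\<lambda>\<sigma>. (xr \<sigma> t - xr \<sigma> s) - (P q j t - P q j s))) \<le> (\<rho> - q j) * (K * \<bar>t - s\<bar> * hh q j)"
    proof (rule integral_norm_bound)
      show "continuous_on {q j..\<rho>} (\<lambda>\<sigma>. (xr \<sigma> t - xr \<sigma> s) - (P q j t - P q j s))" by (intro continuous_intros xr_cont t s)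
      show "norm ((xr \<sigma> t - xr \<sigma> s) - (P q j t - P q j s)) \<le> K * \<bar>t - s\<bar> * hh q j" if "\<sigma> \<in> {q j..\<rho>}" for \<sigma>
        using P_inc_near[OF j t s, of \<sigma>] that sub by (subst norm_minus_commute) auto
    qed (use \<rho> in auto)
    moreover have "(\<rho> - q j) * (K * \<bar>t - s\<bar> * hh q j) \<le> hh q j * (K * \<bar>t - s\<bar> * hh q j)"
      using le K0 hh_pos[OF m j] by (intro mult_right_mono) auto
    moreover have "mid (\<lambda>j. x (q j) t - x (q j) s) j + (\<rho> - emid q j) *\<^sub>R (P q j t - P q j s)
      = (x (q j) t + (\<rho> - q j) *\<^sub>R P q j t) - (x (q j) s + (\<rho> - q j) *\<^sub>R P q j s)"
      unfolding mid_diff nodes[symmetric] by (simp add: scaleR_diff_right)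
    ultimately show ?thesis by (simp add: power2_eq_square mult_ac)
  qed
qed

end

text \<open>The annulus is not convex, but Taylor expansions run along segments. All tangents that are compared on
  one element therefore have to lie in one ball, which the conditions on the mesh size and on the time
  step guarantee.\<close>

lemma ball_in_annulus:
  assumes "t \<in> {0..T}" shows "cball (xr \<rho> t) (c0 / 2) \<subseteq> annulus (c0 / 2) (C0 + c0 / 2)"
proof
  fix p assume "p \<in> cball (xr \<rho> t) (c0 / 2)"
  then have d: "norm (xr \<rho> t - p) \<le> c0 / 2" by (simp add: dist_norm)
  have "norm (xr \<rho> t) \<le> norm p + norm (xr \<rho> t - p)" using norm_triangle_sub[of "xr \<rho> t" p] by simp
  moreover have "norm p \<le> norm (xr \<rho> t) + norm (xr \<rho> t - p)"
    using norm_triangle_sub[of p "xr \<rho> t"] by (simp add: norm_minus_commute)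
  ultimately show "p \<in> annulus (c0 / 2) (C0 + c0 / 2)" using d xr_range[OF assms, of \<rho>] by (auto simp: annulus_def xr_def)
qed

lemma points_in_ball:
  assumes m: "mesh J q" and j: "j < J" and t: "t \<in> {0..T}" "s \<in> {0..T}" and \<rho>: "\<rho> \<in> {q j..q (Suc j)}"
    and small: "K * hh q j \<le> c0 / 8" "K * \<bar>t - s\<bar> \<le> c0 / 8"
  shows "xr \<rho> s \<in> cball (xr (q j) t) (c0 / 4)" "P q j s \<in> cball (xr (q j) t) (c0 / 4)"
proof -
  have qj: "q j \<in> {q j..q (Suc j)}" using mesh_less[OF m j] by simp
  then have q01: "q j \<in> {0..1}" using mesh_elem_sub[OF m j] by auto
  have \<rho>01: "\<rho> \<in> {0..1}" using mesh_elem_sub[OF m j] \<rho> by auto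
  have a: "norm (xr (q j) t - xr (q j) s) \<le> c0 / 8" using xr_inc[OF q01 t] small(2) by linarith
  have "norm (xr (q j) s - xr \<rho> s) \<le> K * \<bar>q j - \<rho>\<bar>" by (rule xr_Lip[OF q01 \<rho>01 t(2)])
  also have "\<dots> \<le> K * hh q j" using \<rho> K0 by (intro mult_left_mono) (auto simp: hh_def)
  finally have b: "norm (xr (q j) s - xr \<rho> s) \<le> c0 / 8" using small(1) by linarith
  have c: "norm (xr (q j) s - P q j s) \<le> c0 / 8" using P_near[OF m j t(2) qj] small(1) by (simp add: norm_minus_commute)
  show "xr \<rho> s \<in> cball (xr (q j) t) (c0 / 4)"
    using norm_diff_triangle_le[OF a b] by (simp add: dist_norm)
  show "P q j s \<in> cball (xr (q j) t) (c0 / 4)"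
    using norm_diff_triangle_le[OF a c] by (simp add: dist_norm)
qed

lemma quarter_ball: "cball (p :: real^'d) (c0 / 4) \<subseteq> cball p (c0 / 2)"
  using c0 by auto

lemma H_diff:
  assumes "convex S" "S \<subseteq> annulus (c0 / 2) (C0 + c0 / 2)" "k \<in> S" "k' \<in> S"
  shows "norm ((H k - H k') *v z) \<le> (real CARD('d))\<^sup>2 * (B * norm (k - k')) * norm z"
  by (rule norm_matvec_le) (use C3_boundD(7)[OF BH closed_segment_sub[OF assms]] in simp)

lemma H_bound: "k \<in> annulus (c0 / 2) (C0 + c0 / 2) \<Longrightarrow> norm (H k *v z) \<le> (real CARD('d))\<^sup>2 * B * norm z"
  by (rule norm_matvec_le) (rule C3_boundD(4)[OF BH])

text \<open>The part of the residual that is paired with the derivative of the test function: the Jensen defect of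
  the flux, and the first moment of the error committed in the coefficient \<open>H\<close>. The test function will be the
  time increment of the error, and the mass term does not control the derivative of that. This part
  is therefore summed by parts in time, which is why its increments in time are estimated as well.\<close>

definition A :: "(nat \<Rightarrow> real) \<Rightarrow> nat \<Rightarrow> real \<Rightarrow> real^'d" where
  "A q j t = (1 / hh q j) *\<^sub>R ((hh q j *\<^sub>R G (P q j t) - integral {q j..q (Suc j)} (\<lambda>\<rho>. G (xr \<rho> t)))
     + integral {q j..q (Suc j)} (\<lambda>\<rho>. (\<rho> - emid q j) *\<^sub>R ((H (P q j t) - H (xr \<rho> t)) *v xt \<rho> t)))"

lemma defect_cont:
  assumes "t \<in> {0..T}"
  shows "continuous_on S (\<lambda>\<rho>. (H p - H (xr \<rho> t)) *v xt \<rho> t)" "continuous_on S (\<lambda>\<rho>. (H p - H (xr \<rho> t)) *v y)"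
  by (intro continuous_on_matvec xt_cont assms continuous_on_const; simp; intro continuous_intros Hxr_cont assms)+

context
  fixes J q j assumes m: "mesh J q" and j: "j < J" and small: "K * hh q j \<le> c0 / 8"
begin

lemma elem_facts: "q j < q (Suc j)" "0 < hh q j" "hh q j \<le> 1" "{q j..q (Suc j)} \<subseteq> {0..1}"
  "\<rho> \<in> {q j..q (Suc j)} \<Longrightarrow> \<bar>\<rho> - emid q j\<bar> \<le> hh q j"
  using mesh_less[OF m j] hh_pos[OF m j] mesh_elem_sub[OF m j]
  by (auto simp: hh_def emid_def abs_le_iff field_simps)

lemma G_defect:
  assumes t: "t \<in> {0..T}"
  shows "(hh q j *\<^sub>R G (P q j t) - integral {q j..q (Suc j)} (\<lambda>\<rho>. G (xr \<rho> t))) $ i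
    = - integral {q j..q (Suc j)} (\<lambda>\<rho>. taylor1 (\<lambda>p. G p $ i) (P q j t) (xr \<rho> t))"
    "continuous_on {q j..q (Suc j)} (\<lambda>\<rho>. taylor1 (\<lambda>p. G p $ i) (P q j t) (xr \<rho> t))"
proof -
  note jd = jensen_defect_eq[OF C3_boundD(3)[OF BG[of i]] less_imp_le[OF elem_facts(1)] xr_cont[OF t] xr_nz[OF t] P_integral[OF m j t]]
  show "(hh q j *\<^sub>R G (P q j t) - integral {q j..q (Suc j)} (\<lambda>\<rho>. G (xr \<rho> t))) $ i
    = - integral {q j..q (Suc j)} (\<lambda>\<rho>. taylor1 (\<lambda>p. G p $ i) (P q j t) (xr \<rho> t))"
    using jd(1) by (simp add: integral_vec_nth[OF Gxr_cont[OF t]] hh_def)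
  show "continuous_on {q j..q (Suc j)} (\<lambda>\<rho>. taylor1 (\<lambda>p. G p $ i) (P q j t) (xr \<rho> t))" by (rule jd(2))
qed

lemma half_ball:
  assumes "t \<in> {0..T}" "s \<in> {0..T}" "K * \<bar>t - s\<bar> \<le> c0 / 8" "\<rho> \<in> {q j..q (Suc j)}"
  shows "xr \<rho> s \<in> cball (xr (q j) t) (c0 / 2)" "P q j s \<in> cball (xr (q j) t) (c0 / 2)"
  using points_in_ball[OF m j assms(1,2,4) small assms(3)] quarter_ball by blast+

text \<open>The defect of the flux is a Taylor remainder, hence quadratic in the mesh size; in the second term one
  factor comes from \<open>\<rho> - emid q j\<close> and the other one from the distance of \<open>P\<close> to the exact tangent.\<close>

lemma A_bound:
  assumes t: "t \<in> {0..T}"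
  shows "norm (A q j t) \<le> ((real CARD('d)) * ((real CARD('d))\<^sup>2 * B * K\<^sup>2) + (real CARD('d))\<^sup>2 * B * K\<^sup>2) * (hh q j)\<^sup>2"
proof -
  let ?I = "{q j..q (Suc j)}" and ?h = "hh q j"
  define S where "S = cball (xr (q j) t) (c0 / 2)"
  have S: "convex S" "S \<subseteq> annulus (c0 / 2) (C0 + c0 / 2)" using ball_in_annulus[OF t] by (auto simp: S_def)
  have tt: "K * \<bar>t - t\<bar> \<le> c0 / 8" using c0 by simp
  have inS: "xr \<rho> t \<in> S" "P q j t \<in> S" if "\<rho> \<in> ?I" for \<rho>
    using half_ball[OF t t tt that] by (auto simp: S_def)
  define g where "g = ?h *\<^sub>R G (P q j t) - integral ?I (\<lambda>\<rho>. G (xr \<rho> t))"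
  define k where "k = integral ?I (\<lambda>\<rho>. (\<rho> - emid q j) *\<^sub>R ((H (P q j t) - H (xr \<rho> t)) *v xt \<rho> t))"
  have near: "norm (xr \<rho> t - P q j t) \<le> K * ?h" if "\<rho> \<in> ?I" for \<rho>
    using P_near[OF m j t that] by (simp add: norm_minus_commute)
  have "\<bar>g $ i\<bar> \<le> ?h * ((real CARD('d))\<^sup>2 * B * (K * ?h)\<^sup>2)" for i
  proof -
    have "norm (integral ?I (\<lambda>\<rho>. taylor1 (\<lambda>p. G p $ i) (P q j t) (xr \<rho> t))) \<le> (q (Suc j) - q j) * ((real CARD('d))\<^sup>2 * B * (K * ?h)\<^sup>2)"
    proof (rule integral_norm_bound[OF G_defect(2)[OF t]])
      fix \<rho> assume \<rho>: "\<rho> \<in> ?I"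
      have "\<bar>taylor1 (\<lambda>p. G p $ i) (P q j t) (xr \<rho> t)\<bar> \<le> (real CARD('d))\<^sup>2 * B * (norm (xr \<rho> t - P q j t))\<^sup>2"
        using taylor1_bound[OF BG S inS(2)[OF \<rho>] inS(1)[OF \<rho>]] by simp
      also have "\<dots> \<le> (real CARD('d))\<^sup>2 * B * (K * ?h)\<^sup>2" using near[OF \<rho>] B0 by (intro mult_left_mono power_mono) auto
      finally show "norm (taylor1 (\<lambda>p. G p $ i) (P q j t) (xr \<rho> t)) \<le> (real CARD('d))\<^sup>2 * B * (K * ?h)\<^sup>2" by simp
    qed (use elem_facts(1) in simp)
    then show ?thesis unfolding g_def G_defect(1)[OF t] by (simp add: hh_def)
  qed
  then have g: "norm g \<le> ?h * ((real CARD('d)) * ((real CARD('d))\<^sup>2 * B * K\<^sup>2) * ?h\<^sup>2)"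
    using norm_vec_le[of g "?h * ((real CARD('d))\<^sup>2 * B * (K * ?h)\<^sup>2)"] by (simp add: power_mult_distrib mult_ac)
  have "norm k \<le> (q (Suc j) - q j) * (?h * ((real CARD('d))\<^sup>2 * (B * (K * ?h)) * K))"
    unfolding k_def
  proof (rule integral_norm_bound)
    show "continuous_on ?I (\<lambda>\<rho>. (\<rho> - emid q j) *\<^sub>R ((H (P q j t) - H (xr \<rho> t)) *v xt \<rho> t))"
      by (intro continuous_intros defect_cont t)
    fix \<rho> assume \<rho>: "\<rho> \<in> ?I"
    have "norm ((H (P q j t) - H (xr \<rho> t)) *v xt \<rho> t) \<le> (real CARD('d))\<^sup>2 * (B * norm (P q j t - xr \<rho> t)) * norm (xt \<rho> t)"
      by (rule H_diff[OF S inS(2)[OF \<rho>] inS(1)[OF \<rho>]])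
    also have "\<dots> \<le> (real CARD('d))\<^sup>2 * (B * (K * ?h)) * K"
      using P_near[OF m j t \<rho>] xt_bound[OF _ t, of \<rho>] \<rho> elem_facts(4) B0 K0 elem_facts(2)
      by (intro mult_mono mult_nonneg_nonneg) auto
    finally show "norm ((\<rho> - emid q j) *\<^sub>R ((H (P q j t) - H (xr \<rho> t)) *v xt \<rho> t)) \<le> ?h * ((real CARD('d))\<^sup>2 * (B * (K * ?h)) * K)"
      unfolding norm_scaleR using elem_facts(5)[OF \<rho>] elem_facts(2) by (intro mult_mono) auto
  qed (use elem_facts(1) in simp)
  then have k: "norm k \<le> ?h * ((real CARD('d))\<^sup>2 * B * K\<^sup>2 * ?h\<^sup>2)" by (simp add: hh_def power2_eq_square mult_ac)
  have "norm (A q j t) = norm (g + k) / ?h" using elem_facts(2) by (simp add: A_def g_def k_def)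
  also have "\<dots> \<le> (norm g + norm k) / ?h" using elem_facts(2) by (intro divide_right_mono norm_triangle_ineq) auto
  also have "\<dots> \<le> (?h * ((real CARD('d)) * ((real CARD('d))\<^sup>2 * B * K\<^sup>2) * ?h\<^sup>2) + ?h * ((real CARD('d))\<^sup>2 * B * K\<^sup>2 * ?h\<^sup>2)) / ?h"
    using elem_facts(2) g k by (intro divide_right_mono add_mono) auto
  also have "\<dots> = ((real CARD('d)) * ((real CARD('d))\<^sup>2 * B * K\<^sup>2) + (real CARD('d))\<^sup>2 * B * K\<^sup>2) * ?h\<^sup>2"
    using elem_facts(2) by (simp add: add_divide_distrib distrib_right)
  finally show ?thesis .
qed

text \<open>Every quantity in the definition of \<open>A\<close> is Lipschitz in time, and the differences between \<open>P\<close> and the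
  exact tangent change in time at a rate of the order of the mesh size.\<close>

lemma A_increment:
  assumes t: "t \<in> {0..T}" "s \<in> {0..T}" and ts: "K * \<bar>t - s\<bar> \<le> c0 / 8"
  shows "norm (A q j t - A q j s) \<le>
    ((real CARD('d)) * ((real CARD('d))\<^sup>2 * B * (2 * K\<^sup>2 + 2 * K ^ 3)) + ((real CARD('d))\<^sup>2 * ((real CARD('d)) * B * (K + 2 * K\<^sup>2)) * K + (real CARD('d))\<^sup>2 * B * K\<^sup>2)) * \<bar>t - s\<bar> * (hh q j)\<^sup>2"
proof -
  let ?I = "{q j..q (Suc j)}" and ?h = "hh q j" and ?d = "\<bar>t - s\<bar>"
  define S where "S = cball (xr (q j) t) (c0 / 2)"
  have S: "convex S" "S \<subseteq> annulus (c0 / 2) (C0 + c0 / 2)" using ball_in_annulus[OF t(1)] by (auto simp: S_def)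
  have tt: "K * \<bar>t - t\<bar> \<le> c0 / 8" using c0 by simp
  have inS: "xr \<rho> t \<in> S" "P q j t \<in> S" "xr \<rho> s \<in> S" "P q j s \<in> S" if "\<rho> \<in> ?I" for \<rho>
    using half_ball[OF t(1) t(1) tt that] half_ball[OF t ts that] by (auto simp: S_def)
  define g where "g t = ?h *\<^sub>R G (P q j t) - integral ?I (\<lambda>\<rho>. G (xr \<rho> t))" for t
  define kk where "kk t \<rho> = (\<rho> - emid q j) *\<^sub>R ((H (P q j t) - H (xr \<rho> t)) *v xt \<rho> t)" for t \<rho>
  have near: "norm (xr \<rho> r - P q j r) \<le> K * ?h" if "\<rho> \<in> ?I" "r \<in> {0..T}" for \<rho> r
    using P_near[OF m j that(2,1)] by (simp add: norm_minus_commute)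
  have near2: "norm ((xr \<rho> t - P q j t) - (xr \<rho> s - P q j s)) \<le> K * ?d * ?h" if "\<rho> \<in> ?I" for \<rho>
  proof -
    have "(xr \<rho> t - P q j t) - (xr \<rho> s - P q j s) = - ((P q j t - P q j s) - (xr \<rho> t - xr \<rho> s))" by simp
    then show ?thesis using P_inc_near[OF m j t that] by (simp only: norm_minus_cancel)
  qed
  note Pi = P_inc[OF m j t]
  have h1: "?h \<le> 1" "0 < ?h" using elem_facts by auto
  have dh: "K * ?d * ?h \<le> K * ?d" using h1 K0 by (intro mult_right_le_one_le) auto
  have "\<bar>g t $ i - g s $ i\<bar> \<le> ?h * ((real CARD('d))\<^sup>2 * B * (2 * K\<^sup>2 + 2 * K ^ 3) * ?d * ?h\<^sup>2)" for i
  proof -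
    let ?\<tau> = "\<lambda>r \<rho>. taylor1 (\<lambda>p. G p $ i) (P q j r) (xr \<rho> r)"
    have "norm (integral ?I (\<lambda>\<rho>. ?\<tau> t \<rho> - ?\<tau> s \<rho>)) \<le> (q (Suc j) - q j) * ((real CARD('d))\<^sup>2 * B * ((2 * K\<^sup>2 + 2 * K ^ 3) * ?d * ?h\<^sup>2))"
    proof (rule integral_norm_bound)
      show "continuous_on ?I (\<lambda>\<rho>. ?\<tau> t \<rho> - ?\<tau> s \<rho>)" by (intro continuous_intros G_defect(2) t)
      fix \<rho> assume \<rho>: "\<rho> \<in> ?I"
      have "\<bar>?\<tau> t \<rho> - ?\<tau> s \<rho>\<bar> \<le> (real CARD('d))\<^sup>2 * B * (norm ((xr \<rho> t - P q j t) - (xr \<rho> s - P q j s)) * (norm (xr \<rho> t - P q j t) + norm (xr \<rho> s - P q j s))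
          + (norm (P q j t - P q j s) + norm ((xr \<rho> t - P q j t) - (xr \<rho> s - P q j s))) * (norm (xr \<rho> s - P q j s))\<^sup>2)"
        using taylor1_difference[OF BG S inS(4)[OF \<rho>] inS(3)[OF \<rho>] inS(2)[OF \<rho>] inS(1)[OF \<rho>]] by simp
      also have "\<dots> \<le> (real CARD('d))\<^sup>2 * B * (K * ?d * ?h * (K * ?h + K * ?h) + (K * ?d + K * ?d) * (K * ?h)\<^sup>2)"
        using near[OF \<rho>] t near2[OF \<rho>] Pi order_trans[OF near2[OF \<rho>] dh] B0 K0 h1
        by (intro mult_left_mono add_mono mult_mono power_mono) auto
      also have "\<dots> = (real CARD('d))\<^sup>2 * B * ((2 * K\<^sup>2 + 2 * K ^ 3) * ?d * ?h\<^sup>2)"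
        by (simp add: power2_eq_square power3_eq_cube algebra_simps)
      finally show "norm (?\<tau> t \<rho> - ?\<tau> s \<rho>) \<le> (real CARD('d))\<^sup>2 * B * ((2 * K\<^sup>2 + 2 * K ^ 3) * ?d * ?h\<^sup>2)" by simp
    qed (use elem_facts(1) in simp)
    moreover have "g t $ i - g s $ i = - integral ?I (\<lambda>\<rho>. ?\<tau> t \<rho> - ?\<tau> s \<rho>)"
      unfolding g_def G_defect(1)[OF t(1)] G_defect(1)[OF t(2)]
      using Henstock_Kurzweil_Integration.integral_diff[OF integrable_continuous_real[OF G_defect(2)[OF t(1), of i]]
          integrable_continuous_real[OF G_defect(2)[OF t(2), of i]]] by simp
    ultimately show ?thesis by (simp add: hh_def mult_ac)
  qed
  then have g: "norm (g t - g s) \<le> ?h * ((real CARD('d)) * ((real CARD('d))\<^sup>2 * B * (2 * K\<^sup>2 + 2 * K ^ 3)) * ?d * ?h\<^sup>2)"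
    using norm_vec_le[of "g t - g s" "?h * ((real CARD('d))\<^sup>2 * B * (2 * K\<^sup>2 + 2 * K ^ 3) * ?d * ?h\<^sup>2)"]
    by (simp add: mult_ac)
  have kc: "continuous_on ?I (kk r)" if "r \<in> {0..T}" for r
    unfolding kk_def by (intro continuous_intros defect_cont that)
  define M1 where "M1 = (real CARD('d))\<^sup>2 * ((real CARD('d)) * B * (K + 2 * K\<^sup>2)) * K + (real CARD('d))\<^sup>2 * B * K\<^sup>2"
  have "norm (integral ?I (\<lambda>\<rho>. kk t \<rho> - kk s \<rho>)) \<le> (q (Suc j) - q j) * (?h * (M1 * ?d * ?h))"
  proof (rule integral_norm_bound)
    show "continuous_on ?I (\<lambda>\<rho>. kk t \<rho> - kk s \<rho>)" by (intro continuous_intros kc t)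
    fix \<rho> assume \<rho>: "\<rho> \<in> ?I"
    have \<rho>01: "\<rho> \<in> {0..1}" using \<rho> elem_facts(4) by auto
    define M where "M = (H (P q j t) - H (xr \<rho> t)) - (H (P q j s) - H (xr \<rho> s))"
    have "\<bar>M $ i $ l\<bar> \<le> (real CARD('d)) * B * (K + 2 * K\<^sup>2) * ?d * ?h" for i l
    proof -
      have "\<bar>M $ i $ l\<bar> = \<bar>(H (xr \<rho> t) $ i $ l - H (P q j t) $ i $ l) - (H (xr \<rho> s) $ i $ l - H (P q j s) $ i $ l)\<bar>"
        by (simp add: M_def)
      also have "\<dots> \<le> (real CARD('d)) * B * (norm ((xr \<rho> t - P q j t) - (xr \<rho> s - P q j s))
          + (norm (P q j t - P q j s) + norm ((xr \<rho> t - P q j t) - (xr \<rho> s - P q j s))) * norm (xr \<rho> s - P q j s))"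
        by (rule difference_quadruple[OF BH S inS(4)[OF \<rho>] inS(3)[OF \<rho>] inS(2)[OF \<rho>] inS(1)[OF \<rho>]])
      also have "\<dots> \<le> (real CARD('d)) * B * (K * ?d * ?h + (K * ?d + K * ?d) * (K * ?h))"
        using near[OF \<rho>] t near2[OF \<rho>] Pi order_trans[OF near2[OF \<rho>] dh] B0 K0 h1
        by (intro mult_left_mono add_mono mult_mono) auto
      also have "\<dots> = (real CARD('d)) * B * (K + 2 * K\<^sup>2) * ?d * ?h" by (simp add: power2_eq_square algebra_simps)
      finally show ?thesis .
    qed
    then have "norm (M *v xt \<rho> t) \<le> (real CARD('d))\<^sup>2 * ((real CARD('d)) * B * (K + 2 * K\<^sup>2) * ?d * ?h) * norm (xt \<rho> t)" by (rule norm_matvec_le)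
    also have "\<dots> \<le> (real CARD('d))\<^sup>2 * ((real CARD('d)) * B * (K + 2 * K\<^sup>2) * ?d * ?h) * K"
      using xt_bound[OF \<rho>01 t(1)] B0 K0 h1 by (intro mult_left_mono) auto
    finally have 1: "norm (M *v xt \<rho> t) \<le> (real CARD('d))\<^sup>2 * ((real CARD('d)) * B * (K + 2 * K\<^sup>2)) * K * ?d * ?h" by (simp add: mult_ac)
    have "norm ((H (P q j s) - H (xr \<rho> s)) *v (xt \<rho> t - xt \<rho> s)) \<le> (real CARD('d))\<^sup>2 * (B * norm (P q j s - xr \<rho> s)) * norm (xt \<rho> t - xt \<rho> s)"
      by (rule H_diff[OF S inS(4)[OF \<rho>] inS(3)[OF \<rho>]])
    also have "\<dots> \<le> (real CARD('d))\<^sup>2 * (B * (K * ?h)) * (K * ?d)"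
      using P_near[OF m j t(2) \<rho>] xt_inc[OF \<rho>01 t] B0 K0 h1
      by (intro mult_mono mult_nonneg_nonneg) auto
    also have "\<dots> = (real CARD('d))\<^sup>2 * B * K\<^sup>2 * ?d * ?h" by (simp add: power2_eq_square mult_ac)
    finally have 2: "norm ((H (P q j s) - H (xr \<rho> s)) *v (xt \<rho> t - xt \<rho> s)) \<le> (real CARD('d))\<^sup>2 * B * K\<^sup>2 * ?d * ?h" .
    have "kk t \<rho> - kk s \<rho> = (\<rho> - emid q j) *\<^sub>R (M *v xt \<rho> t + (H (P q j s) - H (xr \<rho> s)) *v (xt \<rho> t - xt \<rho> s))"
      by (simp add: kk_def M_def matrix_vector_mult_diff_rdistrib matrix_vector_mult_diff_distrib algebra_simps)
    also have "norm \<dots> \<le> ?h * ((real CARD('d))\<^sup>2 * ((real CARD('d)) * B * (K + 2 * K\<^sup>2)) * K * ?d * ?h + (real CARD('d))\<^sup>2 * B * K\<^sup>2 * ?d * ?h)"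
      unfolding norm_scaleR using elem_facts(5)[OF \<rho>] h1 norm_triangle_mono[OF 1 2] by (intro mult_mono) auto
    also have "\<dots> = ?h * (M1 * ?d * ?h)" by (simp add: M1_def algebra_simps)
    finally show "norm (kk t \<rho> - kk s \<rho>) \<le> ?h * (M1 * ?d * ?h)" .
  qed (use elem_facts(1) in simp)
  moreover have "integral ?I (kk t) - integral ?I (kk s) = integral ?I (\<lambda>\<rho>. kk t \<rho> - kk s \<rho>)"
    by (rule Henstock_Kurzweil_Integration.integral_diff[symmetric]; rule integrable_continuous_real[OF kc]; fact)
  ultimately have k: "norm (integral ?I (kk t) - integral ?I (kk s)) \<le> ?h * (M1 * ?d * ?h\<^sup>2)"
    by (simp add: hh_def power2_eq_square mult_ac)
  have "A q j t - A q j s = (1 / ?h) *\<^sub>R ((g t - g s) + (integral ?I (kk t) - integral ?I (kk s)))"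
  proof -
    have "A q j r = (1 / ?h) *\<^sub>R (g r + integral ?I (kk r))" for r by (simp only: A_def g_def kk_def[abs_def])
    then show ?thesis by (simp add: algebra_simps)
  qed
  also have "norm \<dots> = norm ((g t - g s) + (integral ?I (kk t) - integral ?I (kk s))) / ?h" using h1 by simp
  also have "\<dots> \<le> (?h * ((real CARD('d)) * ((real CARD('d))\<^sup>2 * B * (2 * K\<^sup>2 + 2 * K ^ 3)) * ?d * ?h\<^sup>2) + ?h * (M1 * ?d * ?h\<^sup>2)) / ?h"
    using h1 norm_triangle_mono[OF g k] by (intro divide_right_mono) auto
  also have "\<dots> = ((real CARD('d)) * ((real CARD('d))\<^sup>2 * B * (2 * K\<^sup>2 + 2 * K ^ 3)) + M1) * ?d * ?h\<^sup>2"
    using h1 by (simp add: add_divide_distrib distrib_right)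
  finally show ?thesis by (simp add: M1_def)
qed

text \<open>Inserting the nodal interpolant into one step of the scheme leaves two errors besides \<open>A\<close>. The first one,
  \<open>Z\<close>, consists of the difference quotient in time, the interpolation error of the time increment and
  the freezing of \<open>H\<close> at the old time level. The second one, \<open>E\<close>, comes from evaluating \<open>H\<close> at \<open>P\<close> instead of the
  exact tangent; pointwise it is only of first order in the mesh size, but its mean value is of second
  order, and its first moment is part of \<open>A\<close>.\<close>

lemma element_residual:
  assumes t: "t \<in> {0..T}" "t + \<Delta>t \<in> {0..T}" and dt: "0 < \<Delta>t" "K * \<Delta>t \<le> c0 / 8"
  shows "\<bar>hh q j * (1 / \<Delta>t * mprod (H (P q j t)) (\<lambda>j. x (q j) (t + \<Delta>t) - x (q j) t) v j + G (P q j (t + \<Delta>t)) \<bullet> slope q v j)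
      - integral {q j..q (Suc j)} (\<lambda>\<rho>. (H (xr \<rho> (t + \<Delta>t)) *v xt \<rho> (t + \<Delta>t)) \<bullet> (mid v j + (\<rho> - emid q j) *\<^sub>R slope q v j)
          + G (xr \<rho> (t + \<Delta>t)) \<bullet> slope q v j)
      - hh q j * (A q j (t + \<Delta>t) \<bullet> slope q v j)\<bar>
    \<le> hh q j * (((real CARD('d))\<^sup>2 * B * (K + K\<^sup>2) + (real CARD('d)) * ((real CARD('d)) * ((real CARD('d))\<^sup>2 * B * K\<^sup>2 * K)) + (real CARD('d))\<^sup>2 * B * K\<^sup>2) * ((hh q j)\<^sup>2 + \<Delta>t) * (norm (mid v j) + norm (jump v j)))"
proof -
  let ?I = "{q j..q (Suc j)}" and ?h = "hh q j"
  define t' where "t' = t + \<Delta>t"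
  have t': "t' \<in> {0..T}" using t by (simp add: t'_def)
  have dt': "K * \<bar>t - t'\<bar> \<le> c0 / 8" "\<bar>t' - t\<bar> = \<Delta>t" "\<bar>t - t'\<bar> = \<Delta>t" using dt by (auto simp: t'_def)
  define S where "S = cball (xr (q j) t) (c0 / 2)"
  have S: "convex S" "S \<subseteq> annulus (c0 / 2) (C0 + c0 / 2)" using ball_in_annulus[OF t(1)] by (auto simp: S_def)
  have tt: "K * \<bar>t - t\<bar> \<le> c0 / 8" using c0 by simp
  have inS: "P q j t \<in> S" "xr \<rho> t' \<in> S" "P q j t' \<in> S" if "\<rho> \<in> ?I" for \<rho>
    using half_ball[OF t(1) t(1) tt that] half_ball[OF t(1) t' dt'(1) that] by (auto simp: S_def)
  have h1: "?h \<le> 1" "0 < ?h" "q j \<in> ?I" using elem_facts by auto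
  define w where "w = (\<lambda>j. x (q j) t' - x (q j) t)"
  define \<eta> where "\<eta> \<rho> = mid v j + (\<rho> - emid q j) *\<^sub>R slope q v j" for \<rho>
  define D where "D \<rho> = mid w j + (\<rho> - emid q j) *\<^sub>R slope q w j" for \<rho>
  have sw: "slope q w j = P q j t' - P q j t" by (simp add: w_def slope_diff P_def)
  have \<eta>n: "norm (\<eta> \<rho>) \<le> norm (mid v j) + norm (jump v j)" if "\<rho> \<in> ?I" for \<rho>
  proof -
    have "norm (\<eta> \<rho>) \<le> norm (mid v j) + \<bar>\<rho> - emid q j\<bar> * norm (slope q v j)"
      unfolding \<eta>_def using norm_triangle_ineq[of "mid v j" "(\<rho> - emid q j) *\<^sub>R slope q v j"] by simp
    also have "\<bar>\<rho> - emid q j\<bar> * norm (slope q v j) \<le> ?h * norm (slope q v j)"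
      using elem_facts(5)[OF that] by (rule mult_right_mono) simp
    also have "?h * norm (slope q v j) = norm (jump v j)" using h1 by (simp add: jump_slope[OF m j])
    finally show ?thesis by simp
  qed
  define Z where "Z = (\<lambda>\<rho>. (1 / \<Delta>t) *\<^sub>R (H (P q j t) *v D \<rho>) - H (P q j t') *v xt \<rho> t')"
  define E where "E = (\<lambda>\<rho>. (H (P q j t') - H (xr \<rho> t')) *v xt \<rho> t')"
  define e where "e = (\<lambda>\<rho>. (\<rho> - emid q j) *\<^sub>R ((H (P q j t') - H (xr \<rho> t')) *v xt \<rho> t'))"
  have c\<eta>: "continuous_on ?I \<eta>" unfolding \<eta>_def by (intro continuous_intros)
  have cD: "continuous_on ?I D" unfolding D_def by (intro continuous_intros)
  have cZ: "continuous_on ?I Z" unfolding Z_def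
    by (intro continuous_intros continuous_on_matvec continuous_on_const cD xt_cont t')
  have cE: "continuous_on ?I E" unfolding E_def by (rule defect_cont[OF t'])
  have ce: "continuous_on ?I e" unfolding e_def by (intro continuous_intros defect_cont t')
  have cHx: "continuous_on ?I (\<lambda>\<rho>. H (xr \<rho> t') *v xt \<rho> t')" by (intro continuous_on_matvec Hxr_cont xt_cont t')
  have mp: "?h * mprod (H (P q j t)) w v j = integral ?I (\<lambda>\<rho>. (H (P q j t) *v D \<rho>) \<bullet> \<eta> \<rho>)"
  proof -
    have "integral ?I (\<lambda>\<rho>. (H (P q j t) *v D \<rho>) \<bullet> \<eta> \<rho>)
      = ?h * ((H (P q j t) *v mid w j) \<bullet> mid v j + ?h\<^sup>2 / 12 * ((H (P q j t) *v slope q w j) \<bullet> slope q v j))"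
      unfolding D_def \<eta>_def emid_def hh_def using elem_facts(1) by (intro affine_product_integral) auto
    then show ?thesis by (simp add: mprod_def jump_slope[OF m j] matrix_vector_mult_scaleR power2_eq_square)
  qed
  have Ai: "?h * (A q j t' \<bullet> slope q v j) = (?h *\<^sub>R G (P q j t')) \<bullet> slope q v j - integral ?I (\<lambda>\<rho>. G (xr \<rho> t')) \<bullet> slope q v j + integral ?I e \<bullet> slope q v j"
    using h1 by (simp add: A_def e_def inner_add_left inner_diff_left)
  have i1: "integral ?I (\<lambda>\<rho>. G (xr \<rho> t')) \<bullet> slope q v j = integral ?I (\<lambda>\<rho>. G (xr \<rho> t') \<bullet> slope q v j)"
    using integral_linear[OF integrable_continuous_real[OF Gxr_cont[OF t']] bounded_linear_inner_left] by (simp add: comp_def)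
  have i2: "integral ?I e \<bullet> slope q v j = integral ?I (\<lambda>\<rho>. e \<rho> \<bullet> slope q v j)"
    using integral_linear[OF integrable_continuous_real[OF ce] bounded_linear_inner_left] by (simp add: comp_def)
  have i3: "integral ?I E \<bullet> mid v j = integral ?I (\<lambda>\<rho>. E \<rho> \<bullet> mid v j)"
    using integral_linear[OF integrable_continuous_real[OF cE] bounded_linear_inner_left] by (simp add: comp_def)
  have "?h * (1 / \<Delta>t * mprod (H (P q j t)) w v j + G (P q j t') \<bullet> slope q v j)
      - integral ?I (\<lambda>\<rho>. (H (xr \<rho> t') *v xt \<rho> t') \<bullet> \<eta> \<rho> + G (xr \<rho> t') \<bullet> slope q v j)
      - ?h * (A q j t' \<bullet> slope q v j) = integral ?I (\<lambda>\<rho>. Z \<rho> \<bullet> \<eta> \<rho>) + integral ?I E \<bullet> mid v j"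
  proof -
    have a1: "(\<lambda>\<rho>. 1 / \<Delta>t * ((H (P q j t) *v D \<rho>) \<bullet> \<eta> \<rho>)) integrable_on ?I"
      by (intro integrable_continuous_real continuous_intros continuous_on_matvec continuous_on_const cD c\<eta>)
    have a2: "(\<lambda>\<rho>. (H (xr \<rho> t') *v xt \<rho> t') \<bullet> \<eta> \<rho>) integrable_on ?I"
      by (intro integrable_continuous_real continuous_intros cHx c\<eta>)
    have a3: "(\<lambda>\<rho>. G (xr \<rho> t') \<bullet> slope q v j) integrable_on ?I"
      by (intro integrable_continuous_real continuous_intros Gxr_cont t')
    have a4: "(\<lambda>\<rho>. e \<rho> \<bullet> slope q v j) integrable_on ?I"
      by (intro integrable_continuous_real continuous_intros ce)
    have pt: "Z \<rho> \<bullet> \<eta> \<rho> + E \<rho> \<bullet> mid v j = 1 / \<Delta>t * ((H (P q j t) *v D \<rho>) \<bullet> \<eta> \<rho>) - (H (xr \<rho> t') *v xt \<rho> t') \<bullet> \<eta> \<rho> - e \<rho> \<bullet> slope q v j" for \<rho>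
      by (simp add: Z_def E_def e_def \<eta>_def inner_diff_left inner_add_right matrix_vector_mult_diff_rdistrib algebra_simps)
    have "integral ?I (\<lambda>\<rho>. Z \<rho> \<bullet> \<eta> \<rho>) + integral ?I E \<bullet> mid v j = integral ?I (\<lambda>\<rho>. Z \<rho> \<bullet> \<eta> \<rho> + E \<rho> \<bullet> mid v j)"
      unfolding i3 by (intro Henstock_Kurzweil_Integration.integral_add[symmetric] integrable_continuous_real continuous_intros cZ cE c\<eta>)
    also have "\<dots> = integral ?I (\<lambda>\<rho>. 1 / \<Delta>t * ((H (P q j t) *v D \<rho>) \<bullet> \<eta> \<rho>)) - integral ?I (\<lambda>\<rho>. (H (xr \<rho> t') *v xt \<rho> t') \<bullet> \<eta> \<rho>)
        - integral ?I (\<lambda>\<rho>. e \<rho> \<bullet> slope q v j)"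
      unfolding pt using a1 a2 a4 by (simp add: Henstock_Kurzweil_Integration.integral_diff integrable_diff)
    also have "integral ?I (\<lambda>\<rho>. 1 / \<Delta>t * ((H (P q j t) *v D \<rho>) \<bullet> \<eta> \<rho>)) = ?h * (1 / \<Delta>t * mprod (H (P q j t)) w v j)"
      using mp by (simp add: mult.left_commute)
    finally show ?thesis
      unfolding Ai i1 i2 using a2 a3 by (simp add: Henstock_Kurzweil_Integration.integral_add distrib_left)
  qed
  moreover have "\<bar>integral ?I (\<lambda>\<rho>. Z \<rho> \<bullet> \<eta> \<rho>)\<bar> \<le> ?h * (((real CARD('d))\<^sup>2 * B * (K + K\<^sup>2)) * (?h\<^sup>2 + \<Delta>t) * (norm (mid v j) + norm (jump v j)))"
  proof -
    have "norm (integral ?I (\<lambda>\<rho>. Z \<rho> \<bullet> \<eta> \<rho>)) \<le> (q (Suc j) - q j) * (((real CARD('d))\<^sup>2 * B * (K + K\<^sup>2)) * (?h\<^sup>2 + \<Delta>t) * (norm (mid v j) + norm (jump v j)))"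
    proof (rule integral_norm_bound)
      show "continuous_on ?I (\<lambda>\<rho>. Z \<rho> \<bullet> \<eta> \<rho>)" by (intro continuous_intros cZ c\<eta>)
      fix \<rho> assume \<rho>: "\<rho> \<in> ?I"
      have \<rho>01: "\<rho> \<in> {0..1}" using \<rho> elem_facts(4) by auto
      have d1: "norm ((x \<rho> t' - x \<rho> t) - D \<rho>) \<le> K * \<Delta>t * ?h\<^sup>2"
        using interpolation_error(2)[OF m j t' \<rho> t(1)] dt'(2) by (simp add: D_def sw) (simp add: w_def)
      have d2: "norm ((x \<rho> t' - x \<rho> t) - \<Delta>t *\<^sub>R xt \<rho> t') \<le> K * \<Delta>t * \<Delta>t"
      proof -
        have "norm ((x \<rho> t' - t' *\<^sub>R xt \<rho> t') - (x \<rho> t - t *\<^sub>R xt \<rho> t')) \<le> (K * \<Delta>t) * norm (t' - t)"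
        proof (rule differentiable_bound[where S = "{t..t'}" and f = "\<lambda>r. x \<rho> r - r *\<^sub>R xt \<rho> t'" and f' = "\<lambda>r h. h *\<^sub>R (xt \<rho> r - xt \<rho> t')"])
          fix r assume r: "r \<in> {t..t'}"
          then have r': "r \<in> {0..T}" using t t' by auto
          have "(x \<rho> has_vector_derivative xt \<rho> r) (at r within {t..t'})"
            by (rule has_vector_derivative_within_subset[OF xt_deriv[OF r']]) (use t t' in auto)
          then show "((\<lambda>r. x \<rho> r - r *\<^sub>R xt \<rho> t') has_derivative (\<lambda>h. h *\<^sub>R (xt \<rho> r - xt \<rho> t'))) (at r within {t..t'})"
            unfolding has_vector_derivative_def
            by (auto intro!: derivative_eq_intros simp: scaleR_diff_right)
          show "onorm (\<lambda>h. h *\<^sub>R (xt \<rho> r - xt \<rho> t')) \<le> K * \<Delta>t"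
          proof (rule onorm_le)
            fix h :: real
            have "norm (xt \<rho> r - xt \<rho> t') \<le> K * \<bar>r - t'\<bar>" by (rule xt_inc[OF \<rho>01 r' t'])
            also have "\<dots> \<le> K * \<Delta>t" using r K0 by (intro mult_left_mono) (auto simp: t'_def)
            finally show "norm (h *\<^sub>R (xt \<rho> r - xt \<rho> t')) \<le> K * \<Delta>t * norm h"
              by (simp add: mult.commute[of _ "\<bar>h\<bar>"] mult_left_mono)
          qed
        qed (use dt t'_def in auto)
        moreover have "(x \<rho> t' - t' *\<^sub>R xt \<rho> t') - (x \<rho> t - t *\<^sub>R xt \<rho> t') = (x \<rho> t' - x \<rho> t) - \<Delta>t *\<^sub>R xt \<rho> t'"
          by (simp add: t'_def algebra_simps)
        moreover have "K * \<Delta>t * norm (t' - t) = K * \<Delta>t * \<Delta>t" using dt by (simp add: t'_def)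
        ultimately show ?thesis by (simp only:)
      qed
      have "norm (D \<rho> - \<Delta>t *\<^sub>R xt \<rho> t') \<le> K * \<Delta>t * ?h\<^sup>2 + K * \<Delta>t * \<Delta>t"
        using norm_diff_triangle_le[OF d1[unfolded norm_minus_commute[of _ "D \<rho>"]] d2] .
      then have d3: "norm ((1 / \<Delta>t) *\<^sub>R D \<rho> - xt \<rho> t') \<le> K * (?h\<^sup>2 + \<Delta>t)"
      proof -
        have "(1 / \<Delta>t) *\<^sub>R D \<rho> - xt \<rho> t' = (1 / \<Delta>t) *\<^sub>R (D \<rho> - \<Delta>t *\<^sub>R xt \<rho> t')" using dt by (simp add: scaleR_diff_right)
        then have "norm ((1 / \<Delta>t) *\<^sub>R D \<rho> - xt \<rho> t') = norm (D \<rho> - \<Delta>t *\<^sub>R xt \<rho> t') / \<Delta>t" using dt by simp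
        also have "\<dots> \<le> (K * \<Delta>t * ?h\<^sup>2 + K * \<Delta>t * \<Delta>t) / \<Delta>t"
          using dt \<open>norm (D \<rho> - \<Delta>t *\<^sub>R xt \<rho> t') \<le> _\<close> by (intro divide_right_mono) auto
        also have "\<dots> = K * (?h\<^sup>2 + \<Delta>t)" using dt by (simp add: add_divide_distrib distrib_left)
        finally show ?thesis .
      qed
      have "Z \<rho> = H (P q j t) *v ((1 / \<Delta>t) *\<^sub>R D \<rho> - xt \<rho> t') + (H (P q j t) - H (P q j t')) *v xt \<rho> t'"
        by (simp add: Z_def matrix_vector_mult_diff_distrib matrix_vector_mult_diff_rdistrib matrix_vector_mult_scaleR)
      moreover have "norm (H (P q j t) *v ((1 / \<Delta>t) *\<^sub>R D \<rho> - xt \<rho> t')) \<le> (real CARD('d))\<^sup>2 * B * (K * (?h\<^sup>2 + \<Delta>t))"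
        using H_bound[of "P q j t"] inS(1)[OF \<rho>] S(2) d3 B0 by (meson mult_left_mono mult_nonneg_nonneg order_trans subsetD zero_le_power2)
      moreover have "norm ((H (P q j t) - H (P q j t')) *v xt \<rho> t') \<le> (real CARD('d))\<^sup>2 * (B * (K * \<Delta>t)) * K"
      proof -
        have "norm ((H (P q j t) - H (P q j t')) *v xt \<rho> t') \<le> (real CARD('d))\<^sup>2 * (B * norm (P q j t - P q j t')) * norm (xt \<rho> t')"
          by (rule H_diff[OF S inS(1)[OF \<rho>] inS(3)[OF \<rho>]])
        also have "\<dots> \<le> (real CARD('d))\<^sup>2 * (B * (K * \<Delta>t)) * K"
          using P_inc[OF m j t(1) t'] dt'(3) xt_bound[OF \<rho>01 t'] B0 K0 dt by (intro mult_mono mult_nonneg_nonneg) auto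
        finally show ?thesis .
      qed
      ultimately have "norm (Z \<rho>) \<le> (real CARD('d))\<^sup>2 * B * (K * (?h\<^sup>2 + \<Delta>t)) + (real CARD('d))\<^sup>2 * (B * (K * \<Delta>t)) * K"
        using norm_triangle_mono by metis
      also have "\<dots> \<le> (real CARD('d))\<^sup>2 * B * (K * (?h\<^sup>2 + \<Delta>t)) + (real CARD('d))\<^sup>2 * B * K\<^sup>2 * (?h\<^sup>2 + \<Delta>t)"
      proof -
        have "(real CARD('d))\<^sup>2 * B * K\<^sup>2 * \<Delta>t \<le> (real CARD('d))\<^sup>2 * B * K\<^sup>2 * (?h\<^sup>2 + \<Delta>t)" using B0 by (intro mult_left_mono) auto
        then show ?thesis by (simp add: power2_eq_square mult_ac)
      qed
      finally have Zn: "norm (Z \<rho>) \<le> (real CARD('d))\<^sup>2 * B * (K + K\<^sup>2) * (?h\<^sup>2 + \<Delta>t)" by (simp add: algebra_simps)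
      have "norm (Z \<rho> \<bullet> \<eta> \<rho>) \<le> norm (Z \<rho>) * norm (\<eta> \<rho>)" by (simp add: Cauchy_Schwarz_ineq2)
      also have "\<dots> \<le> ((real CARD('d))\<^sup>2 * B * (K + K\<^sup>2) * (?h\<^sup>2 + \<Delta>t)) * (norm (mid v j) + norm (jump v j))"
        using Zn \<eta>n[OF \<rho>] B0 K0 dt by (intro mult_mono mult_nonneg_nonneg add_nonneg_nonneg) auto
      finally show "norm (Z \<rho> \<bullet> \<eta> \<rho>) \<le> ((real CARD('d))\<^sup>2 * B * (K + K\<^sup>2)) * (?h\<^sup>2 + \<Delta>t) * (norm (mid v j) + norm (jump v j))" .
    qed (use elem_facts(1) in simp)
    then show ?thesis by (simp add: hh_def)
  qed
  moreover have "\<bar>integral ?I E \<bullet> mid v j\<bar> \<le> ?h * (((real CARD('d)) * ((real CARD('d)) * ((real CARD('d))\<^sup>2 * B * K\<^sup>2 * K)) + (real CARD('d))\<^sup>2 * B * K\<^sup>2) * ?h\<^sup>2 * norm (mid v j))"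
  proof -
    \<comment> \<open>With the velocity frozen at a node, \<open>E\<close> is a Jensen defect; the rest is a product of two first-order terms.\<close>
    define y where "y = xt (q j) t'"
    have q01: "q j \<in> {0..1}" using h1(3) elem_facts(4) by auto
    have yn: "norm y \<le> K" unfolding y_def by (rule xt_bound[OF q01 t'])
    define E1 where "E1 = (\<lambda>\<rho>. (H (P q j t') - H (xr \<rho> t')) *v y)"
    define E2 where "E2 = (\<lambda>\<rho>. (H (P q j t') - H (xr \<rho> t')) *v (xt \<rho> t' - y))"
    have c1: "continuous_on ?I E1" unfolding E1_def by (rule defect_cont[OF t'])
    have "E = (\<lambda>\<rho>. E1 \<rho> + E2 \<rho>)"
      by (simp add: E_def E1_def E2_def fun_eq_iff matrix_vector_mult_diff_distrib)
    moreover have c2: "continuous_on ?I E2"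
    proof -
      have "E2 = (\<lambda>\<rho>. E \<rho> - E1 \<rho>)" by (simp add: E_def E1_def E2_def fun_eq_iff matrix_vector_mult_diff_distrib)
      then show ?thesis using continuous_on_diff[OF cE c1] by simp
    qed
    ultimately have split: "integral ?I E = integral ?I E1 + integral ?I E2"
      using c1 c2 by (simp add: Henstock_Kurzweil_Integration.integral_add integrable_continuous_real)
    have "\<bar>integral ?I E1 $ i\<bar> \<le> (real CARD('d)) * (K * (?h * ((real CARD('d))\<^sup>2 * B * (K * ?h)\<^sup>2)))" for i
    proof -
      have one: "\<bar>integral ?I (\<lambda>\<rho>. (H (P q j t') $ i $ l - H (xr \<rho> t') $ i $ l) * y $ l)\<bar> \<le> K * (?h * ((real CARD('d))\<^sup>2 * B * (K * ?h)\<^sup>2))" for l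
      proof -
        let ?g = "\<lambda>p. H p $ i $ l"
        note jd = jensen_defect_eq[OF C3_boundD(3)[OF BH[of i l]] less_imp_le[OF elem_facts(1)] xr_cont[OF t'] xr_nz[OF t'] P_integral[OF m j t']]
        have "norm (integral ?I (\<lambda>\<rho>. taylor1 ?g (P q j t') (xr \<rho> t'))) \<le> (q (Suc j) - q j) * ((real CARD('d))\<^sup>2 * B * (K * ?h)\<^sup>2)"
        proof (rule integral_norm_bound[OF jd(2)])
          fix \<rho> assume \<rho>: "\<rho> \<in> ?I"
          have "\<bar>taylor1 ?g (P q j t') (xr \<rho> t')\<bar> \<le> (real CARD('d))\<^sup>2 * B * (norm (xr \<rho> t' - P q j t'))\<^sup>2"
            using taylor1_bound[OF BH S inS(3)[OF \<rho>] inS(2)[OF \<rho>]] by simp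
          also have "\<dots> \<le> (real CARD('d))\<^sup>2 * B * (K * ?h)\<^sup>2"
            using P_near[OF m j t' \<rho>] B0 by (intro mult_left_mono power_mono) (auto simp: norm_minus_commute)
          finally show "norm (taylor1 ?g (P q j t') (xr \<rho> t')) \<le> (real CARD('d))\<^sup>2 * B * (K * ?h)\<^sup>2" by simp
        qed (use elem_facts(1) in simp)
        then have le: "\<bar>integral ?I (\<lambda>\<rho>. ?g (xr \<rho> t')) - ?h * ?g (P q j t')\<bar> \<le> ?h * ((real CARD('d))\<^sup>2 * B * (K * ?h)\<^sup>2)"
          unfolding jd(1)[symmetric] by (simp add: hh_def)
        have "integral ?I (\<lambda>\<rho>. ?g (P q j t') - ?g (xr \<rho> t')) = ?h * ?g (P q j t') - integral ?I (\<lambda>\<rho>. ?g (xr \<rho> t'))"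
          using Henstock_Kurzweil_Integration.integral_diff[OF integrable_continuous_real[OF continuous_on_const]
              integrable_continuous_real[OF Hxr_cont[OF t', of _ i l]], of "q j" "q (Suc j)" "?g (P q j t')"] elem_facts(1)
          by (simp add: hh_def)
        then have "integral ?I (\<lambda>\<rho>. (?g (P q j t') - ?g (xr \<rho> t')) * y $ l) = (?h * ?g (P q j t') - integral ?I (\<lambda>\<rho>. ?g (xr \<rho> t'))) * y $ l"
          by simp
        from arg_cong[OF this, of abs] have "\<bar>integral ?I (\<lambda>\<rho>. (?g (P q j t') - ?g (xr \<rho> t')) * y $ l)\<bar> = \<bar>y $ l\<bar> * \<bar>integral ?I (\<lambda>\<rho>. ?g (xr \<rho> t')) - ?h * ?g (P q j t')\<bar>"
          by (simp only: abs_mult abs_minus_commute[of "?h * ?g (P q j t')"] mult.commute[of "\<bar>y $ l\<bar>"])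
        also have "\<dots> \<le> K * (?h * ((real CARD('d))\<^sup>2 * B * (K * ?h)\<^sup>2))"
          using le component_le_norm_cart[of y l] yn K0 by (intro mult_mono) auto
        finally show ?thesis .
      qed
      have "integral ?I E1 $ i = integral ?I (\<lambda>\<rho>. \<Sum>l\<in>UNIV. (H (P q j t') $ i $ l - H (xr \<rho> t') $ i $ l) * y $ l)"
        unfolding integral_vec_nth[OF c1] by (simp add: E1_def matrix_vector_mult_def)
      also have "\<dots> = (\<Sum>l\<in>UNIV. integral ?I (\<lambda>\<rho>. (H (P q j t') $ i $ l - H (xr \<rho> t') $ i $ l) * y $ l))"
        by (intro integral_sum integrable_continuous_real continuous_intros Hxr_cont t') auto
      also have "\<bar>\<dots>\<bar> \<le> (real CARD('d)) * (K * (?h * ((real CARD('d))\<^sup>2 * B * (K * ?h)\<^sup>2)))" using one by (intro abs_sum_card_le)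
      finally show ?thesis .
    qed
    from norm_vec_le[OF this] have n1: "norm (integral ?I E1) \<le> ?h * ((real CARD('d)) * ((real CARD('d)) * ((real CARD('d))\<^sup>2 * B * K\<^sup>2 * K)) * ?h\<^sup>2)"
      by (simp add: power2_eq_square mult_ac)
    have "norm (integral ?I E2) \<le> (q (Suc j) - q j) * ((real CARD('d))\<^sup>2 * (B * (K * ?h)) * (K * ?h))"
    proof (rule integral_norm_bound[OF c2])
      fix \<rho> assume \<rho>: "\<rho> \<in> ?I"
      have \<rho>01: "\<rho> \<in> {0..1}" using \<rho> elem_facts(4) by auto
      have yd: "norm (xt \<rho> t' - y) \<le> K * ?h"
      proof -
        have "norm (xt \<rho> t' - y) \<le> K * \<bar>\<rho> - q j\<bar>" unfolding y_def by (rule xt_Lip[OF \<rho>01 q01 t'])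
        also have "\<dots> \<le> K * ?h" using \<rho> K0 by (intro mult_left_mono) (auto simp: hh_def)
        finally show ?thesis .
      qed
      have "norm (E2 \<rho>) \<le> (real CARD('d))\<^sup>2 * (B * norm (P q j t' - xr \<rho> t')) * norm (xt \<rho> t' - y)"
        unfolding E2_def by (rule H_diff[OF S inS(3)[OF \<rho>] inS(2)[OF \<rho>]])
      also have "\<dots> \<le> (real CARD('d))\<^sup>2 * (B * (K * ?h)) * (K * ?h)"
        using P_near[OF m j t' \<rho>] yd B0 K0 h1 by (intro mult_mono mult_nonneg_nonneg) auto
      finally show "norm (E2 \<rho>) \<le> (real CARD('d))\<^sup>2 * (B * (K * ?h)) * (K * ?h)" .
    qed (use elem_facts(1) in simp)
    then have n2: "norm (integral ?I E2) \<le> ?h * ((real CARD('d))\<^sup>2 * B * K\<^sup>2 * ?h\<^sup>2)" by (simp add: hh_def power2_eq_square mult_ac)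
    have "\<bar>integral ?I E \<bullet> mid v j\<bar> \<le> norm (integral ?I E) * norm (mid v j)" by (rule Cauchy_Schwarz_ineq2)
    also have "\<dots> \<le> (?h * ((real CARD('d)) * ((real CARD('d)) * ((real CARD('d))\<^sup>2 * B * K\<^sup>2 * K)) * ?h\<^sup>2) + ?h * ((real CARD('d))\<^sup>2 * B * K\<^sup>2 * ?h\<^sup>2)) * norm (mid v j)"
      unfolding split using norm_triangle_mono[OF n1 n2] by (rule mult_right_mono) simp
    finally show ?thesis by (simp add: algebra_simps)
  qed
  moreover have "?h * (((real CARD('d)) * ((real CARD('d)) * ((real CARD('d))\<^sup>2 * B * K\<^sup>2 * K)) + (real CARD('d))\<^sup>2 * B * K\<^sup>2) * ?h\<^sup>2 * norm (mid v j))
      \<le> ?h * (((real CARD('d)) * ((real CARD('d)) * ((real CARD('d))\<^sup>2 * B * K\<^sup>2 * K)) + (real CARD('d))\<^sup>2 * B * K\<^sup>2) * (?h\<^sup>2 + \<Delta>t) * (norm (mid v j) + norm (jump v j)))"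
    using h1 dt B0 K0 by (intro mult_left_mono mult_mono mult_nonneg_nonneg add_nonneg_nonneg) auto
  ultimately have "\<bar>?h * (1 / \<Delta>t * mprod (H (P q j t)) w v j + G (P q j t') \<bullet> slope q v j)
      - integral ?I (\<lambda>\<rho>. (H (xr \<rho> t') *v xt \<rho> t') \<bullet> \<eta> \<rho> + G (xr \<rho> t') \<bullet> slope q v j)
      - ?h * (A q j t' \<bullet> slope q v j)\<bar>
    \<le> ?h * (((real CARD('d))\<^sup>2 * B * (K + K\<^sup>2)) * (?h\<^sup>2 + \<Delta>t) * (norm (mid v j) + norm (jump v j)))
      + ?h * (((real CARD('d)) * ((real CARD('d)) * ((real CARD('d))\<^sup>2 * B * K\<^sup>2 * K)) + (real CARD('d))\<^sup>2 * B * K\<^sup>2) * (?h\<^sup>2 + \<Delta>t) * (norm (mid v j) + norm (jump v j)))"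
    by linarith
  also have "\<dots> = ?h * (((real CARD('d))\<^sup>2 * B * (K + K\<^sup>2) + (real CARD('d)) * ((real CARD('d)) * ((real CARD('d))\<^sup>2 * B * K\<^sup>2 * K)) + (real CARD('d))\<^sup>2 * B * K\<^sup>2) * (?h\<^sup>2 + \<Delta>t) * (norm (mid v j) + norm (jump v j)))"
    by (simp add: algebra_simps)
  finally show ?thesis unfolding t'_def w_def \<eta>_def .
qed

end

lemma weak_elementwise:
  assumes m: "mesh J q" and t: "t \<in> {0<..T}" and v: "v J = v 0"
  shows "(\<Sum>j<J. integral {q j..q (Suc j)} (\<lambda>\<rho>. (H (xr \<rho> t) *v xt \<rho> t) \<bullet> (mid v j + (\<rho> - emid q j) *\<^sub>R slope q v j)
          + G (xr \<rho> t) \<bullet> slope q v j)) = 0"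
proof -
  have t': "t \<in> {0..T}" using t by auto
  obtain f where f: "f \<in> Vh J q" "\<And>j. j \<le> J \<Longrightarrow> f (q j) = v j" using Vh_exists[OF m v] by blast
  have ms: "mid (\<lambda>j. f (q j)) j = mid v j" "slope q (\<lambda>j. f (q j)) j = slope q v j" if "j < J" for j
    using f(2)[of j] f(2)[of "Suc j"] that by (simp_all add: mid_def slope_def)
  have cH: "continuous_on S (\<lambda>\<rho>. H (xr \<rho> t) *v xt \<rho> t)" for S by (intro continuous_on_matvec Hxr_cont xt_cont t')
  have c1: "continuous_on {q j..q (Suc j)} (\<lambda>\<rho>. (H (xr \<rho> t) *v xt \<rho> t) \<bullet> (mid v j + (\<rho> - emid q j) *\<^sub>R slope q v j))" for j
    by (intro continuous_intros cH)
  have c2: "continuous_on {q j..q (Suc j)} (\<lambda>\<rho>. G (xr \<rho> t) \<bullet> slope q v j)" for j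
    by (intro continuous_intros Gxr_cont t')
  have "(LINT \<rho>|\<I>. (H (xr \<rho> t) *v xt \<rho> t) \<bullet> f \<rho>) + (LINT \<rho>|\<I>. G (xr \<rho> t) \<bullet> d_rho f \<rho>) = 0"
    using sol t Vh_H1[OF m f(1)] unfolding weak_solution_def xr_def xt_def by blast
  moreover have "(LINT \<rho>|\<I>. (H (xr \<rho> t) *v xt \<rho> t) \<bullet> f \<rho>)
      = (\<Sum>j<J. integral {q j..q (Suc j)} (\<lambda>\<rho>. (H (xr \<rho> t) *v xt \<rho> t) \<bullet> (mid v j + (\<rho> - emid q j) *\<^sub>R slope q v j)))"
    by (rule LINT_mesh(2)[OF m c1]) (auto simp: Vh_affine[OF m f(1)] ms)
  moreover have "(LINT \<rho>|\<I>. G (xr \<rho> t) \<bullet> d_rho f \<rho>) = (\<Sum>j<J. integral {q j..q (Suc j)} (\<lambda>\<rho>. G (xr \<rho> t) \<bullet> slope q v j))"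
    by (rule LINT_mesh(2)[OF m c2]) (auto simp: Vh_d_rho(2)[OF m f(1)] ms)
  ultimately show ?thesis
    by (simp add: Henstock_Kurzweil_Integration.integral_add integrable_continuous_real c1 c2 sum.distrib)
qed

end

section \<open>Energy estimate for one time step\<close>

text \<open>The mean value over an element of the squared norm of an affine function.\<close>

definition nn :: "(nat \<Rightarrow> 'a::real_normed_vector) \<Rightarrow> nat \<Rightarrow> real" where
  "nn v j = (norm (mid v j))\<^sup>2 + (norm (jump v j))\<^sup>2 / 12"

lemma nn_nonneg: "0 \<le> nn v j"
  by (simp add: nn_def)

lemma mid_add: "mid (\<lambda>j. u j + v j) j = mid u j + mid v j"
  by (simp add: mid_def algebra_simps)

lemma jump_add: "jump (\<lambda>j. u j + v j) j = jump u j + jump v j"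
  by (simp add: jump_def)

lemma mprod_diff_left: "mprod B (\<lambda>j. u j - w j) v j = mprod B u v j - mprod B w v j"
  by (simp add: mprod_def mid_diff jump_diff matrix_vector_mult_diff_distrib inner_diff_left diff_divide_distrib)

lemma mprod_mat_diff: "mprod (B - B') u v j = mprod B u v j - mprod B' u v j"
  by (simp add: mprod_def matrix_vector_mult_diff_rdistrib inner_diff_left diff_divide_distrib)

lemma mprod_coercive:
  assumes "\<And>z. c * (norm z)\<^sup>2 \<le> (B *v z) \<bullet> z" shows "c * nn v j \<le> mprod B v v j"
  using assms[of "mid v j"] assms[of "jump v j"] by (simp add: mprod_def nn_def distrib_left)

lemma norm_sum_square_le: "(norm (mid v j) + norm (jump v j))\<^sup>2 \<le> 24 * nn v j"
proof -
  have "24 * (a\<^sup>2 + b\<^sup>2 / 12) - (a + b)\<^sup>2 = (a - b)\<^sup>2 + 22 * a\<^sup>2" for a b :: real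
    by (simp add: power2_eq_square algebra_simps)
  from this[of "norm (mid v j)" "norm (jump v j)"] show ?thesis
    unfolding nn_def by (smt (verit) zero_le_power2)
qed

lemma node_le_nn: "(norm (v j))\<^sup>2 \<le> 6 * nn v j"
proof -
  have "v j = mid v j - jump v j /\<^sub>R 2"
  proof -
    have "2 *\<^sub>R (mid v j - jump v j /\<^sub>R 2) = 2 *\<^sub>R v j"
      by (simp add: mid_def jump_def scaleR_diff_right scaleR_2[of "v j"])
    then show ?thesis by simp
  qed
  then have "norm (v j) \<le> norm (mid v j) + norm (jump v j) / 2"
    by (metis norm_triangle_ineq4 norm_scaleR abs_inverse abs_numeral divide_inverse mult.commute)
  then have "(norm (v j))\<^sup>2 \<le> (norm (mid v j) + norm (jump v j) / 2)\<^sup>2" by (intro power_mono) auto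
  also have "\<dots> \<le> 6 * nn v j"
  proof -
    have "6 * (a\<^sup>2 + b\<^sup>2 / 12) - (a + b / 2)\<^sup>2 = (a - b / 2)\<^sup>2 + 4 * a\<^sup>2" for a b :: real
      by (simp add: power2_eq_square algebra_simps)
    from this[of "norm (mid v j)" "norm (jump v j)"] show ?thesis
      unfolding nn_def by (smt (verit) zero_le_power2)
  qed
  finally show ?thesis .
qed

lemma young_weighted:
  fixes a b k :: real assumes "0 < k" shows "a * b \<le> k / 2 * a\<^sup>2 + b\<^sup>2 / (2 * k)"
proof -
  have "0 \<le> (k * a - b)\<^sup>2 / (2 * k)" using assms by simp
  also have "\<dots> = k / 2 * a\<^sup>2 + b\<^sup>2 / (2 * k) - a * b"
    using assms by (simp add: power2_eq_square field_simps)
  finally show ?thesis by simp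
qed

lemma young_norm:
  assumes "0 < \<tau>" shows "(norm (a + b))\<^sup>2 \<le> (1 + \<tau>) * (norm a)\<^sup>2 + (1 + 1 / \<tau>) * (norm b)\<^sup>2"
proof -
  have "(norm (a + b))\<^sup>2 \<le> (norm a + norm b)\<^sup>2" by (intro power_mono norm_triangle_ineq) simp
  also have "\<dots> = (norm a)\<^sup>2 + 2 * (norm a * norm b) + (norm b)\<^sup>2" by (simp add: power2_sum)
  also have "norm a * norm b \<le> \<tau> / 2 * (norm a)\<^sup>2 + (norm b)\<^sup>2 / (2 * \<tau>)" by (rule young_weighted[OF assms])
  finally show ?thesis using assms by (simp add: field_simps)
qed

lemma nn_add_le:
  assumes "0 < \<tau>" shows "nn (\<lambda>j. u j + v j) j \<le> (1 + \<tau>) * nn u j + (1 + 1 / \<tau>) * nn v j"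
proof -
  have "a + b / 12 \<le> s * (c + d / 12) + t * (e + f / 12)" if "a \<le> s * c + t * e" "b \<le> s * d + t * f"
    for a b c d e f s t :: real
    using that divide_right_mono[OF that(2), of 12] by (simp add: distrib_left add_divide_distrib)
  from this[OF young_norm[OF assms, of "mid u j" "mid v j"] young_norm[OF assms, of "jump u j" "jump v j"]]
  show ?thesis unfolding nn_def mid_add jump_add .
qed

text \<open>Products with the time increment of the error, of size \<open>s\<close>, are absorbed into half of the coercive mass
  term \<open>c / \<tau> * n\<close>, where \<open>\<tau>\<close> is the time step. What remains carries the factor \<open>\<tau>\<close> and can be summed over the time
  steps. The constant \<open>24\<close> is the one in \<open>norm_sum_square_le\<close>.\<close>

lemma young_split:
  fixes s e y :: real
  assumes "0 < c" "0 < \<tau>" "s\<^sup>2 \<le> 24 * n" "0 \<le> n"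
  shows "(a * e + C * y) * s \<le> c / (2 * \<tau>) * n + 24 * \<tau> / c * (a\<^sup>2 * e\<^sup>2 + C\<^sup>2 * y\<^sup>2)"
proof -
  define k where "k = c / (24 * \<tau>)"
  have k: "0 < k" using assms by (simp add: k_def)
  have "(a * e + C * y) * s = s * (a * e + C * y)" by (rule mult.commute)
  also have "\<dots> \<le> k / 2 * s\<^sup>2 + (a * e + C * y)\<^sup>2 / (2 * k)" by (rule young_weighted[OF k])
  also have "k / 2 * s\<^sup>2 \<le> k / 2 * (24 * n)" using assms(3) k by (intro mult_left_mono) auto
  also have "k / 2 * (24 * n) = c / (2 * \<tau>) * n" by (simp add: k_def)
  also have "(a * e + C * y)\<^sup>2 \<le> 2 * (a\<^sup>2 * e\<^sup>2 + C\<^sup>2 * y\<^sup>2)"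
    using sum_squares_bound[of "a * e" "C * y"] by (simp add: power2_sum power_mult_distrib)
  then have "(a * e + C * y)\<^sup>2 / (2 * k) \<le> 2 * (a\<^sup>2 * e\<^sup>2 + C\<^sup>2 * y\<^sup>2) / (2 * k)"
    using k by (intro divide_right_mono) auto
  also have "2 * (a\<^sup>2 * e\<^sup>2 + C\<^sup>2 * y\<^sup>2) / (2 * k) = 24 * \<tau> / c * (a\<^sup>2 * e\<^sup>2 + C\<^sup>2 * y\<^sup>2)"
    using assms by (simp add: k_def field_simps)
  finally show ?thesis by simp
qed

context flow
begin

text \<open>The constants of \<open>A_bound\<close>, \<open>A_increment\<close> and \<open>element_residual\<close>, merged into one.\<close>

definition C_flux :: real where
  "C_flux = (real CARD('d)) * ((real CARD('d))\<^sup>2 * B * K\<^sup>2) + (real CARD('d))\<^sup>2 * B * K\<^sup>2"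
definition C_increment :: real where
  "C_increment = (real CARD('d)) * ((real CARD('d))\<^sup>2 * B * (2 * K\<^sup>2 + 2 * K ^ 3)) + ((real CARD('d))\<^sup>2 * ((real CARD('d)) * B * (K + 2 * K\<^sup>2)) * K + (real CARD('d))\<^sup>2 * B * K\<^sup>2)"
definition C_residual :: real where
  "C_residual = (real CARD('d))\<^sup>2 * B * (K + K\<^sup>2) + (real CARD('d)) * ((real CARD('d)) * ((real CARD('d))\<^sup>2 * B * K\<^sup>2 * K)) + (real CARD('d))\<^sup>2 * B * K\<^sup>2"
definition C :: real where "C = C_flux + C_increment + C_residual"

lemma C_bounds: "C_flux \<le> C" "C_increment \<le> C" "C_residual \<le> C" and C0': "0 \<le> C"
proof -
  have "0 \<le> C_flux" "0 \<le> C_increment" "0 \<le> C_residual"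
    using K0 B0 by (auto simp: C_flux_def C_increment_def C_residual_def)
  then show "C_flux \<le> C" "C_increment \<le> C" "C_residual \<le> C" "0 \<le> C" by (auto simp: C_def)
qed

lemma A_le:
  assumes "mesh J q" "j < J" "K * hh q j \<le> c0 / 8" "t \<in> {0..T}"
  shows "norm (A q j t) \<le> C * (hh q j)\<^sup>2"
  by (rule order_trans[OF A_bound[OF assms, folded C_flux_def]]) (intro mult_right_mono C_bounds, simp)

lemma A_inc:
  assumes "mesh J q" "j < J" "K * hh q j \<le> c0 / 8" "t \<in> {0..T}" "s \<in> {0..T}" "K * \<bar>t - s\<bar> \<le> c0 / 8"
  shows "norm (A q j t - A q j s) \<le> C * \<bar>t - s\<bar> * (hh q j)\<^sup>2"
  by (rule order_trans[OF A_increment[OF assms, folded C_increment_def]]) (intro mult_right_mono C_bounds; simp)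

lemma residual:
  assumes a: "mesh J q" "j < J" "K * hh q j \<le> c0 / 8" "t \<in> {0..T}" "t + \<Delta>t \<in> {0..T}" "0 < \<Delta>t" "K * \<Delta>t \<le> c0 / 8"
  shows "\<bar>hh q j * (1 / \<Delta>t * mprod (H (P q j t)) (\<lambda>j. x (q j) (t + \<Delta>t) - x (q j) t) v j + G (P q j (t + \<Delta>t)) \<bullet> slope q v j)
      - integral {q j..q (Suc j)} (\<lambda>\<rho>. (H (xr \<rho> (t + \<Delta>t)) *v xt \<rho> (t + \<Delta>t)) \<bullet> (mid v j + (\<rho> - emid q j) *\<^sub>R slope q v j)
          + G (xr \<rho> (t + \<Delta>t)) \<bullet> slope q v j)
      - hh q j * (A q j (t + \<Delta>t) \<bullet> slope q v j)\<bar>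
      \<le> hh q j * (C * ((hh q j)\<^sup>2 + \<Delta>t) * (norm (mid v j) + norm (jump v j)))"
  by (rule order_trans[OF element_residual[OF a, folded C_residual_def]])
    (use a hh_pos[OF a(1,2)] in \<open>intro mult_left_mono mult_right_mono C_bounds add_nonneg_nonneg norm_ge_zero; simp\<close>)

text \<open>One step of the scheme in terms of nodal values. Its integrals are evaluated exactly, as tangents are
  constant and test functions affine on each element.\<close>

definition step_eq :: "nat \<Rightarrow> (nat \<Rightarrow> real) \<Rightarrow> real \<Rightarrow> (nat \<Rightarrow> real^'d) \<Rightarrow> (nat \<Rightarrow> real^'d) \<Rightarrow> bool" where
  "step_eq J q \<Delta>t u u' \<longleftrightarrow> (\<forall>v. v J = v 0 \<longrightarrow>
     (\<Sum>j<J. hh q j * (1 / \<Delta>t * mprod (H (slope q u j)) (\<lambda>j. u' j - u j) v j + G (slope q u' j) \<bullet> slope q v j)) = 0)"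

definition err :: "(nat \<Rightarrow> real) \<Rightarrow> (nat \<Rightarrow> real^'d) \<Rightarrow> real \<Rightarrow> nat \<Rightarrow> real^'d" where
  "err q u t = (\<lambda>j. x (q j) t - u j)"

lemma slope_err: "slope q (err q u t) j = P q j t - slope q u j"
  by (simp add: err_def slope_diff P_def)

lemma x_periodic: "t \<in> {0..T} \<Longrightarrow> mesh J q \<Longrightarrow> x (q J) t = x (q 0) t"
  using C1 mesh_ends[of J q] unfolding C1_space_time_def periodic1_def by (metis add_0)

lemma node_increment:
  assumes \<rho>: "\<rho> \<in> {0..1}" and t: "t \<in> {0..T}" "s \<in> {0..T}"
  shows "norm (x \<rho> t - x \<rho> s) \<le> K * \<bar>t - s\<bar>"
proof -
  have "norm (x \<rho> t - x \<rho> s) \<le> K * norm (t - s)"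
  proof (rule differentiable_bound[where S = "{0..T}" and f' = "\<lambda>r h. h *\<^sub>R xt \<rho> r"])
    fix r assume r: "r \<in> {0..T}"
    show "(x \<rho> has_derivative (\<lambda>h. h *\<^sub>R xt \<rho> r)) (at r within {0..T})"
      using xt_deriv[OF r, of \<rho>] by (simp add: has_vector_derivative_def)
    show "onorm (\<lambda>h. h *\<^sub>R xt \<rho> r) \<le> K"
      by (rule onorm_le) (simp add: mult.commute[of K] mult_left_mono xt_bound[OF \<rho> r])
  qed (use t in auto)
  then show ?thesis by simp
qed

text \<open>As \<open>H\<close> is not symmetric, a step is not the Euler--Lagrange system of a functional, but it is strongly
  monotone in the new iterate: the old tangents lie where \<open>H\<close> is coercive, and the gradient of \<open>\<Phi>\<close> is
  monotone everywhere. The constants may depend on the mesh and on the time step.\<close>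

lemma step_solvable:
  assumes m: "mesh J q" and dt: "0 < \<Delta>t" and u: "\<And>j. j < J \<Longrightarrow> slope q u j \<in> annulus (c0 / 2) (C0 + c0 / 2)"
  shows "\<exists>u'. u' J = u' 0 \<and> step_eq J q \<Delta>t u u'"
proof -
  have J: "0 < J" by (rule mesh_ends(3)[OF m])
  define \<eta> where "\<eta> = Min (hh q ` {..<J})"
  have \<eta>: "0 < \<eta>" "\<And>j. j < J \<Longrightarrow> \<eta> \<le> hh q j"
    using J hh_pos[OF m] by (auto simp: \<eta>_def Min_gr_iff lessThan_empty_iff)
  have h1: "hh q j \<le> 1" if "j < J" for j using mesh_elem_sub[OF m that] mesh_less[OF m that] by (auto simp: hh_def)
  let ?B = "\<lambda>j. H (slope q u j)"
  define \<alpha> where "\<alpha> w j = (hh q j / \<Delta>t) *\<^sub>R (?B j *v (mid w j - mid u j))" for w j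
  define \<beta> where "\<beta> w j = (hh q j / \<Delta>t / 12) *\<^sub>R (?B j *v (jump w j - jump u j)) + G (slope q w j)" for w j
  define L where "L = (real CARD('d))\<^sup>2 * B / \<Delta>t + \<Gamma> / \<eta>"
  have L: "0 \<le> (real CARD('d))\<^sup>2 * B / \<Delta>t" "0 \<le> \<Gamma> / \<eta>" using B0 dt \<Gamma> \<eta> by auto
  have Bn: "norm ((hh q e / \<Delta>t) *\<^sub>R (?B e *v z)) \<le> (real CARD('d))\<^sup>2 * B / \<Delta>t * norm z" if e: "e < J" for e z
  proof -
    have "norm ((hh q e / \<Delta>t) *\<^sub>R (?B e *v z)) = hh q e / \<Delta>t * norm (?B e *v z)" using hh_pos[OF m e] dt by simp
    also have "\<dots> \<le> 1 / \<Delta>t * ((real CARD('d))\<^sup>2 * B * norm z)"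
      using h1[OF e] hh_pos[OF m e] dt H_bound[OF u[OF e]] by (intro mult_mono divide_right_mono) auto
    finally show ?thesis by simp
  qed
  have slope_jump': "slope q w j - slope q w' j = (jump w j - jump w' j) /\<^sub>R hh q j" for w w' :: "nat \<Rightarrow> real^'d" and j
    by (simp add: slope_def jump_def scaleR_diff_right)
  have "\<exists>w. w J = w 0 \<and> (\<forall>v. v J = v 0 \<longrightarrow> (\<Sum>e<J. \<alpha> w e \<bullet> mid v e + \<beta> w e \<bullet> jump v e) = 0)"
  proof (rule variational_solvable[OF J])
    show "0 < c1 * \<eta> / (6 * \<Delta>t)" using c1 \<eta> dt by simp
    show "0 \<le> L" using L by (simp add: L_def)
    fix w w' :: "nat \<Rightarrow> real^'d"
    show "norm (\<alpha> w e - \<alpha> w' e) \<le> L * (norm (mid w e - mid w' e) + norm (jump w e - jump w' e))" if e: "e < J" for e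
    proof -
      have "\<alpha> w e - \<alpha> w' e = (hh q e / \<Delta>t) *\<^sub>R (?B e *v (mid w e - mid w' e))"
        unfolding \<alpha>_def scaleR_diff_right[symmetric] matrix_vector_mult_diff_distrib[symmetric] by simp
      then have "norm (\<alpha> w e - \<alpha> w' e) \<le> (real CARD('d))\<^sup>2 * B / \<Delta>t * norm (mid w e - mid w' e)" using Bn[OF e] by simp
      also have "\<dots> \<le> L * (norm (mid w e - mid w' e) + norm (jump w e - jump w' e))"
        using L by (intro mult_mono) (auto simp: L_def)
      finally show ?thesis .
    qed
    show "norm (\<beta> w e - \<beta> w' e) \<le> L * (norm (mid w e - mid w' e) + norm (jump w e - jump w' e))" if e: "e < J" for e
    proof -
      have eq: "\<beta> w e - \<beta> w' e = (1 / 12) *\<^sub>R ((hh q e / \<Delta>t) *\<^sub>R (?B e *v (jump w e - jump w' e))) + (G (slope q w e) - G (slope q w' e))"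
      proof -
        have "?B e *v (jump w e - jump w' e) = ?B e *v (jump w e - jump u e) - ?B e *v (jump w' e - jump u e)"
          unfolding matrix_vector_mult_diff_distrib[symmetric] by simp
        then show ?thesis by (simp add: \<beta>_def scaleR_diff_right mult.commute[of \<Delta>t])
      qed
      have "norm (G (slope q w e) - G (slope q w' e)) \<le> \<Gamma> * (norm (jump w e - jump w' e) / hh q e)"
        using G_Lip[of "slope q w e" "slope q w' e"] hh_pos[OF m e] by (simp add: slope_jump' divide_inverse mult.commute)
      also have "\<dots> \<le> \<Gamma> * (norm (jump w e - jump w' e) / \<eta>)"
        using \<eta> \<eta>(2)[OF e] \<Gamma> by (intro mult_left_mono divide_left_mono) auto
      finally have 1: "norm (G (slope q w e) - G (slope q w' e)) \<le> \<Gamma> / \<eta> * norm (jump w e - jump w' e)" by simp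
      have "norm ((1 / 12) *\<^sub>R ((hh q e / \<Delta>t) *\<^sub>R (?B e *v (jump w e - jump w' e)))) \<le> norm ((hh q e / \<Delta>t) *\<^sub>R (?B e *v (jump w e - jump w' e)))"
        unfolding norm_scaleR[of "1 / 12"] by (rule mult_left_le_one_le) auto
      also have "\<dots> \<le> (real CARD('d))\<^sup>2 * B / \<Delta>t * norm (jump w e - jump w' e)" by (rule Bn[OF e])
      finally have "norm (\<beta> w e - \<beta> w' e) \<le> (real CARD('d))\<^sup>2 * B / \<Delta>t * norm (jump w e - jump w' e) + \<Gamma> / \<eta> * norm (jump w e - jump w' e)"
        unfolding eq using 1 by (rule norm_triangle_mono)
      also have "\<dots> = L * norm (jump w e - jump w' e)" by (simp add: L_def distrib_right)
      also have "\<dots> \<le> L * (norm (mid w e - mid w' e) + norm (jump w e - jump w' e))"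
        using L by (intro mult_left_mono) (auto simp: L_def)
      finally show ?thesis .
    qed
    let ?z = "\<lambda>j. w j - w' j"
    have el: "c1 * \<eta> / (6 * \<Delta>t) * (norm (?z e))\<^sup>2 \<le> (\<alpha> w e - \<alpha> w' e) \<bullet> mid ?z e + (\<beta> w e - \<beta> w' e) \<bullet> jump ?z e" if e: "e < J" for e
    proof -
      have a: "\<alpha> w e - \<alpha> w' e = (hh q e / \<Delta>t) *\<^sub>R (?B e *v mid ?z e)"
        unfolding \<alpha>_def scaleR_diff_right[symmetric] matrix_vector_mult_diff_distrib[symmetric] by (simp add: mid_diff)
      have b: "\<beta> w e - \<beta> w' e = (hh q e / \<Delta>t / 12) *\<^sub>R (?B e *v jump ?z e) + (G (slope q w e) - G (slope q w' e))"
      proof -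
        have "?B e *v jump ?z e = ?B e *v (jump w e - jump u e) - ?B e *v (jump w' e - jump u e)"
          unfolding matrix_vector_mult_diff_distrib[symmetric] by (simp add: jump_diff)
        then show ?thesis by (simp add: \<beta>_def scaleR_diff_right)
      qed
      have "(G (slope q w e) - G (slope q w' e)) \<bullet> jump ?z e = hh q e * ((G (slope q w e) - G (slope q w' e)) \<bullet> (slope q w e - slope q w' e))"
        by (simp add: jump_slope[OF m e] slope_diff)
      also have "\<dots> \<ge> 0"
        using hh_pos[OF m e] order_trans[OF _ G_mono[of "slope q w e" "slope q w' e"], of 0] \<gamma> by simp
      finally have c: "0 \<le> (G (slope q w e) - G (slope q w' e)) \<bullet> jump ?z e" .
      have "c1 * \<eta> / (6 * \<Delta>t) * (norm (?z e))\<^sup>2 \<le> c1 * \<eta> / (6 * \<Delta>t) * (6 * nn ?z e)"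
        using c1 \<eta> dt node_le_nn[of ?z e] by (intro mult_left_mono) auto
      also have "\<dots> = \<eta> / \<Delta>t * (c1 * nn ?z e)" by (simp add: field_simps)
      also have "\<dots> \<le> hh q e / \<Delta>t * mprod (?B e) ?z ?z e"
        using \<eta>(1) \<eta>(2)[OF e] dt c1(1) mprod_coercive[OF c1(2)[OF u[OF e]]] nn_nonneg[of ?z e]
        by (intro mult_mono divide_right_mono) auto
      also have "\<dots> \<le> (\<alpha> w e - \<alpha> w' e) \<bullet> mid ?z e + (\<beta> w e - \<beta> w' e) \<bullet> jump ?z e"
        unfolding a b using c by (simp add: mprod_def inner_add_left algebra_simps)
      finally show ?thesis .
    qed
    show "c1 * \<eta> / (6 * \<Delta>t) * (\<Sum>j<J. (norm (w j - w' j))\<^sup>2)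
        \<le> (\<Sum>e<J. (\<alpha> w e - \<alpha> w' e) \<bullet> mid ?z e + (\<beta> w e - \<beta> w' e) \<bullet> jump ?z e)"
      unfolding sum_distrib_left using el by (intro sum_mono) auto
  qed
  then obtain w where w: "w J = w 0" "\<And>v. v J = v 0 \<Longrightarrow> (\<Sum>e<J. \<alpha> w e \<bullet> mid v e + \<beta> w e \<bullet> jump v e) = 0" by blast
  have "(\<Sum>j<J. hh q j * (1 / \<Delta>t * mprod (?B j) (\<lambda>j. w j - u j) v j + G (slope q w j) \<bullet> slope q v j))
      = (\<Sum>e<J. \<alpha> w e \<bullet> mid v e + \<beta> w e \<bullet> jump v e)" for v
  proof (rule sum.cong[OF refl])
    fix j assume "j \<in> {..<J}"
    then have j: "j < J" by simp
    have "hh q j * (G (slope q w j) \<bullet> slope q v j) = G (slope q w j) \<bullet> jump v j" by (simp add: jump_slope[OF m j])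
    then show "hh q j * (1 / \<Delta>t * mprod (?B j) (\<lambda>j. w j - u j) v j + G (slope q w j) \<bullet> slope q v j)
      = \<alpha> w j \<bullet> mid v j + \<beta> w j \<bullet> jump v j"
      by (simp add: \<alpha>_def \<beta>_def mprod_def mid_diff jump_diff inner_add_left diff_divide_distrib algebra_simps)
  qed
  note eq = this
  have "step_eq J q \<Delta>t u w" unfolding step_eq_def eq using w(2) by blast
  then show ?thesis using w(1) by blast
qed

lemma step_unique:
  assumes m: "mesh J q" and dt: "0 < \<Delta>t" and u: "\<And>j. j < J \<Longrightarrow> slope q u j \<in> annulus (c0 / 2) (C0 + c0 / 2)"
    and w: "w J = w 0" "step_eq J q \<Delta>t u w" and w': "w' J = w' 0" "step_eq J q \<Delta>t u w'" and j: "j < J"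
  shows "w j = w' j"
proof -
  let ?z = "\<lambda>j. w j - w' j"
  let ?B = "\<lambda>j. H (slope q u j)"
  have "(\<Sum>j<J. hh q j * (1 / \<Delta>t * mprod (?B j) (\<lambda>j. w j - u j) ?z j + G (slope q w j) \<bullet> slope q ?z j))
      - (\<Sum>j<J. hh q j * (1 / \<Delta>t * mprod (?B j) (\<lambda>j. w' j - u j) ?z j + G (slope q w' j) \<bullet> slope q ?z j)) = 0"
    using w w' by (simp add: step_eq_def)
  then have "(\<Sum>j<J. hh q j * (1 / \<Delta>t * mprod (?B j) ?z ?z j + (G (slope q w j) - G (slope q w' j)) \<bullet> (slope q w j - slope q w' j))) = 0"
    unfolding sum_subtractf[symmetric] by (simp add: mprod_diff_left[of _ _ _ ?z] slope_diff inner_diff_left algebra_simps)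
  moreover have pos: "hh q j * (c1 / \<Delta>t * nn ?z j)
      \<le> hh q j * (1 / \<Delta>t * mprod (?B j) ?z ?z j + (G (slope q w j) - G (slope q w' j)) \<bullet> (slope q w j - slope q w' j))"
    if j: "j < J" for j
  proof (rule mult_left_mono)
    have "c1 / \<Delta>t * nn ?z j \<le> 1 / \<Delta>t * mprod (?B j) ?z ?z j"
      using mprod_coercive[OF c1(2)[OF u[OF j]], of ?z j] dt by (simp add: divide_right_mono)
    moreover have "0 \<le> (G (slope q w j) - G (slope q w' j)) \<bullet> (slope q w j - slope q w' j)"
      using order_trans[OF _ G_mono[of "slope q w j" "slope q w' j"], of 0] \<gamma> by simp
    ultimately show "c1 / \<Delta>t * nn ?z j \<le> 1 / \<Delta>t * mprod (?B j) ?z ?z j + (G (slope q w j) - G (slope q w' j)) \<bullet> (slope q w j - slope q w' j)"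
      by simp
  qed (use hh_pos[OF m j] in simp)
  ultimately have "(\<Sum>j<J. hh q j * (c1 / \<Delta>t * nn ?z j)) \<le> 0"
  proof -
    assume zero: "(\<Sum>j<J. hh q j * (1 / \<Delta>t * mprod (?B j) ?z ?z j + (G (slope q w j) - G (slope q w' j)) \<bullet> (slope q w j - slope q w' j))) = 0"
      and le: "\<And>j. j < J \<Longrightarrow> hh q j * (c1 / \<Delta>t * nn ?z j)
      \<le> hh q j * (1 / \<Delta>t * mprod (?B j) ?z ?z j + (G (slope q w j) - G (slope q w' j)) \<bullet> (slope q w j - slope q w' j))"
    have "(\<Sum>j<J. hh q j * (c1 / \<Delta>t * nn ?z j)) \<le>
      (\<Sum>j<J. hh q j * (1 / \<Delta>t * mprod (?B j) ?z ?z j + (G (slope q w j) - G (slope q w' j)) \<bullet> (slope q w j - slope q w' j)))"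
      using le by (intro sum_mono) simp
    then show ?thesis unfolding zero .
  qed
  moreover have n0: "0 \<le> hh q j * (c1 / \<Delta>t * nn ?z j)" if "j < J" for j
    using hh_pos[OF m that] c1(1) dt nn_nonneg[of ?z j] by simp
  ultimately have "(\<Sum>j<J. hh q j * (c1 / \<Delta>t * nn ?z j)) = 0" by (intro antisym sum_nonneg) auto
  then have "hh q j * (c1 / \<Delta>t * nn ?z j) = 0" using sum_nonneg_eq_0_iff[of "{..<J}" "\<lambda>j. hh q j * (c1 / \<Delta>t * nn ?z j)"] n0 j by auto
  then have "nn ?z j = 0" using hh_pos[OF m j] c1(1) dt by simp
  then show ?thesis using node_le_nn[of ?z j] by simp
qed

text \<open>Summation of the residuals of the elements: the terms of the continuous problem add up to its weak
  form, tested with a discrete function, which vanishes.\<close>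

lemma consistency:
  assumes m: "mesh J q" and small: "K * mesh_size J q \<le> c0 / 8" and t: "t \<in> {0..T}" "t + \<Delta>t \<in> {0..T}"
    and dt: "0 < \<Delta>t" "K * \<Delta>t \<le> c0 / 8" and v: "v J = v 0"
  shows "(\<Sum>j<J. hh q j * (1 / \<Delta>t * mprod (H (P q j t)) (\<lambda>j. x (q j) (t + \<Delta>t) - x (q j) t) v j + G (P q j (t + \<Delta>t)) \<bullet> slope q v j))
    \<le> (\<Sum>j<J. hh q j * (A q j (t + \<Delta>t) \<bullet> slope q v j + C * ((mesh_size J q)\<^sup>2 + \<Delta>t) * (norm (mid v j) + norm (jump v j))))"
proof -
  let ?L = "\<lambda>j. hh q j * (1 / \<Delta>t * mprod (H (P q j t)) (\<lambda>j. x (q j) (t + \<Delta>t) - x (q j) t) v j + G (P q j (t + \<Delta>t)) \<bullet> slope q v j)"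
  let ?W = "\<lambda>j. integral {q j..q (Suc j)} (\<lambda>\<rho>. (H (xr \<rho> (t + \<Delta>t)) *v xt \<rho> (t + \<Delta>t)) \<bullet> (mid v j + (\<rho> - emid q j) *\<^sub>R slope q v j)
          + G (xr \<rho> (t + \<Delta>t)) \<bullet> slope q v j)"
  let ?R = "\<lambda>j. hh q j * (A q j (t + \<Delta>t) \<bullet> slope q v j + C * ((mesh_size J q)\<^sup>2 + \<Delta>t) * (norm (mid v j) + norm (jump v j)))"
  have "?L j - ?W j \<le> ?R j" if j: "j < J" for j
  proof -
    have hj: "hh q j \<le> mesh_size J q" "0 < hh q j" using hh_le_mesh_size[OF m j] hh_pos[OF m j] by auto
    have "K * hh q j \<le> c0 / 8" using mult_left_mono[OF hj(1) K0] small by linarith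
    from residual[OF m j this t dt, of v]
    have "?L j - ?W j \<le> hh q j * (A q j (t + \<Delta>t) \<bullet> slope q v j) + hh q j * (C * ((hh q j)\<^sup>2 + \<Delta>t) * (norm (mid v j) + norm (jump v j)))"
      by linarith
    also have "hh q j * (C * ((hh q j)\<^sup>2 + \<Delta>t) * (norm (mid v j) + norm (jump v j)))
        \<le> hh q j * (C * ((mesh_size J q)\<^sup>2 + \<Delta>t) * (norm (mid v j) + norm (jump v j)))"
      using hj C0' dt by (intro mult_left_mono mult_right_mono add_right_mono power_mono) auto
    finally show ?thesis by (simp add: distrib_left)
  qed
  then have "(\<Sum>j<J. ?L j - ?W j) \<le> (\<Sum>j<J. ?R j)" by (intro sum_mono) auto
  moreover have "(\<Sum>j<J. ?W j) = 0" using t dt by (intro weak_elementwise[OF m _ v]) auto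
  ultimately show ?thesis by (simp add: sum_subtractf)
qed

definition \<kappa> :: real where "\<kappa> = C\<^sup>2 / \<gamma>"
definition \<beta> :: real where "\<beta> = c1 / (2 * (1 + T))"

text \<open>The error is measured by the relative energy, corrected by the part of the residual that is summed by
  parts in time. The summand with \<open>\<kappa>\<close> keeps the corrected energy nonnegative, and the summand with \<open>\<beta>\<close> adds
  control of the error itself, whose mean value the tangents do not see. The choice of \<open>\<beta>\<close> lets
  half of the mass term absorb the growth of this summand within one step.\<close>

definition Sj :: "(nat \<Rightarrow> real) \<Rightarrow> real \<Rightarrow> (nat \<Rightarrow> real^'d) \<Rightarrow> real \<Rightarrow> nat \<Rightarrow> real" where
  "Sj q h u t j = breg \<phi> (P q j t) (slope q (err q u t) j) - A q j t \<bullet> slope q (err q u t) j + \<kappa> * h ^ 4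
     + \<beta> * nn (err q u t) j"

definition S :: "nat \<Rightarrow> (nat \<Rightarrow> real) \<Rightarrow> (nat \<Rightarrow> real^'d) \<Rightarrow> real \<Rightarrow> real" where
  "S J q u t = (\<Sum>j<J. hh q j * Sj q (mesh_size J q) u t j)"

lemma \<beta>_pos: "0 < \<beta>"
  using c1 T by (simp add: \<beta>_def)

lemma small_elem: "mesh J q \<Longrightarrow> j < J \<Longrightarrow> K * mesh_size J q \<le> c0 / 8 \<Longrightarrow> K * hh q j \<le> c0 / 8"
  using hh_le_mesh_size[of J q j] mult_left_mono[OF _ K0] by (meson order_trans)

lemma A_small:
  assumes "mesh J q" "j < J" "K * mesh_size J q \<le> c0 / 8" "t \<in> {0..T}"
  shows "norm (A q j t) \<le> C * (mesh_size J q)\<^sup>2"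
proof -
  have "norm (A q j t) \<le> C * (hh q j)\<^sup>2" by (rule A_le[OF assms(1,2) small_elem[OF assms(1-3)] assms(4)])
  also have "\<dots> \<le> C * (mesh_size J q)\<^sup>2"
    using hh_le_mesh_size[OF assms(1,2)] hh_pos[OF assms(1,2)] C0' by (intro mult_left_mono power_mono) auto
  finally show ?thesis .
qed

lemma Sj_lower:
  assumes "mesh J q" "j < J" "K * mesh_size J q \<le> c0 / 8" "t \<in> {0..T}"
  shows "\<gamma> / 4 * (norm (slope q (err q u t) j))\<^sup>2 + \<beta> * nn (err q u t) j \<le> Sj q (mesh_size J q) u t j"
proof -
  let ?e = "slope q (err q u t) j" and ?h = "mesh_size J q"
  have "A q j t \<bullet> ?e \<le> norm (A q j t) * norm ?e" by (rule norm_cauchy_schwarz)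
  also have "\<dots> \<le> (C * ?h\<^sup>2) * norm ?e" by (intro mult_right_mono A_small assms) simp
  also have "\<dots> = norm ?e * (C * ?h\<^sup>2)" by simp
  also have "\<dots> \<le> (\<gamma> / 2) / 2 * (norm ?e)\<^sup>2 + (C * ?h\<^sup>2)\<^sup>2 / (2 * (\<gamma> / 2))" using \<gamma> by (intro young_weighted) simp
  also have "(C * ?h\<^sup>2)\<^sup>2 / (2 * (\<gamma> / 2)) = \<kappa> * ?h ^ 4" by (simp add: \<kappa>_def power_mult_distrib)
  finally have "A q j t \<bullet> ?e \<le> \<gamma> / 4 * (norm ?e)\<^sup>2 + \<kappa> * ?h ^ 4" by simp
  moreover have "\<gamma> / 2 * (norm ?e)\<^sup>2 \<le> breg \<phi> (P q j t) ?e" by (rule breg_lower[OF aniso G_mono])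
  ultimately show ?thesis unfolding Sj_def by simp
qed

lemma Sj_upper:
  assumes "mesh J q" "j < J" "K * mesh_size J q \<le> c0 / 8" "t \<in> {0..T}"
  shows "Sj q (mesh_size J q) u t j \<le> (\<Gamma> + C) * (norm (slope q (err q u t) j))\<^sup>2 + (C + \<kappa>) * (mesh_size J q) ^ 4 + \<beta> * nn (err q u t) j"
proof -
  let ?e = "slope q (err q u t) j" and ?h = "mesh_size J q"
  have "- (A q j t \<bullet> ?e) \<le> norm (A q j t) * norm ?e"
    using norm_cauchy_schwarz[of "A q j t" "- ?e"] by simp
  also have "\<dots> \<le> (C * ?h\<^sup>2) * norm ?e" by (intro mult_right_mono A_small assms) simp
  also have "\<dots> = C * (norm ?e * ?h\<^sup>2)" by simp
  also have "\<dots> \<le> C * ((norm ?e)\<^sup>2 + (?h\<^sup>2)\<^sup>2)"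
  proof (rule mult_left_mono[OF _ C0'])
    show "norm ?e * ?h\<^sup>2 \<le> (norm ?e)\<^sup>2 + (?h\<^sup>2)\<^sup>2"
      using sum_squares_bound[of "norm ?e" "?h\<^sup>2"] zero_le_power2[of "norm ?e"] zero_le_power2[of "?h\<^sup>2"]
        mult_nonneg_nonneg[OF norm_ge_zero[of ?e] zero_le_power2[of ?h]] by linarith
  qed
  finally have "- (A q j t \<bullet> ?e) \<le> C * (norm ?e)\<^sup>2 + C * ?h ^ 4" by (simp add: distrib_left)
  moreover have "breg \<phi> (P q j t) ?e \<le> \<Gamma> * (norm ?e)\<^sup>2" by (rule breg_upper[OF aniso G_Lip])
  ultimately show ?thesis unfolding Sj_def by (simp add: distrib_right)
qed

text \<open>The property that is propagated from step to step: it keeps the discrete tangents in the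
  annulus.\<close>

definition near_exact :: "nat \<Rightarrow> (nat \<Rightarrow> real) \<Rightarrow> (nat \<Rightarrow> real^'d) \<Rightarrow> real \<Rightarrow> bool" where
  "near_exact J q u t \<longleftrightarrow> (\<forall>j<J. norm (slope q (err q u t) j) \<le> c0 / 4)"

lemma near_exact_ball:
  assumes m: "mesh J q" and small: "K * mesh_size J q \<le> c0 / 8" and t: "t \<in> {0..T}" "s \<in> {0..T}" "K * \<bar>t - s\<bar> \<le> c0 / 8"
    and j: "j < J" and e: "norm e \<le> c0 / 4"
  shows "P q j s \<in> cball (xr (q j) t) (c0 / 2)" "P q j s - e \<in> cball (xr (q j) t) (c0 / 2)"
proof -
  have "q j \<in> {q j..q (Suc j)}" using mesh_less[OF m j] by simp
  from points_in_ball(2)[OF m j t(1,2) this small_elem[OF m j small] t(3)]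
  have P: "norm (xr (q j) t - P q j s) \<le> c0 / 4" by (simp add: dist_norm)
  then show "P q j s \<in> cball (xr (q j) t) (c0 / 2)" using c0 by (simp add: dist_norm)
  have "norm (xr (q j) t - (P q j s - e)) \<le> norm (xr (q j) t - P q j s) + norm e"
    using norm_triangle_ineq[of "xr (q j) t - P q j s" e] by (simp add: algebra_simps)
  then show "P q j s - e \<in> cball (xr (q j) t) (c0 / 2)" using P e by (simp add: dist_norm)
qed

lemma near_exact_slope:
  assumes "mesh J q" "K * mesh_size J q \<le> c0 / 8" "t \<in> {0..T}" "near_exact J q u t" "j < J"
  shows "slope q u j \<in> annulus (c0 / 2) (C0 + c0 / 2)"
proof -
  have "norm (slope q (err q u t) j) \<le> c0 / 4" using assms(4,5) by (simp add: near_exact_def)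
  from near_exact_ball(2)[OF assms(1,2,3,3) _ assms(5) this]
  have "P q j t - slope q (err q u t) j \<in> cball (xr (q j) t) (c0 / 2)" using c0 by simp
  then show ?thesis using ball_in_annulus[OF assms(3), of "q j"] by (auto simp: slope_err)
qed

text \<open>Within one step the energy grows by the factor \<open>1 + M3 * \<Delta>t\<close>, and \<open>M4 * \<Delta>t\<close> multiplies the square of the
  consistency error; \<open>M1\<close> and \<open>M2\<close> are the parts of them that stem from the coefficients and from Young's inequality.\<close>

definition M1 :: real where
  "M1 = (real CARD('d))\<^sup>2 * B * K + 24 / c1 * (2 * (real CARD('d))\<^sup>2 * B * K)\<^sup>2"
definition M2 :: real where "M2 = 24 / c1 * C\<^sup>2"
definition M3 :: real where "M3 = (M1 + C) * (4 / \<gamma>) + 1"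
definition M4 :: real where "M4 = M2 + C"

lemma M_nonneg: "0 \<le> M1" "0 \<le> M2" "0 \<le> M3" "0 \<le> M4"
  using K0 B0 c1 C0' \<gamma> by (auto simp: M1_def M2_def M3_def M4_def intro!: add_nonneg_nonneg mult_nonneg_nonneg)

text \<open>The bookkeeping of one element and one time step, with the nonlinear terms as atoms: \<open>S\<close> and \<open>S'\<close> are the
  old and the new energy, \<open>a1\<close>, \<open>a2\<close> and \<open>G1\<close>, \<open>G2\<close> the mass terms and the fluxes of the exact and of the discrete
  equation, and \<open>N\<close> is half of the coercive term.\<close>

lemma energy_balance:
  fixes S :: real
  assumes "a4 \<le> E1" "N2 \<le> a3" "E1 + E2 \<le> N + (D1 + D2)" "b' - b \<le> G1 - G2" "b \<le> b0 + D3" "- a \<le> D4 + D5"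
    "n' \<le> n + D6 + N" "S' - S = b' - b0 - X - a + n' - n" "a1 - a2 = a3 - a4" "D3 + D1 + D4 + D6 \<le> D7" "N2 = N + N"
  shows "S' - S - (D7 + D2 + D5) \<le> (a1 + G1) - (a2 + G2) - (X + E2)"
  using assms by linarith

text \<open>The difference of the exact and the discrete equation is tested with the time increment \<open>d\<close> of the error.
  The mass term yields \<open>c1 / \<Delta>t * nn d\<close> up to the error in the coefficient \<open>H\<close>, the fluxes yield the increment of
  the relative energy by convexity, and the residual \<open>A\<close> yields the increment of its correction. The
  remaining terms are of size \<open>\<Delta>t\<close> times the old energy or the square of the consistency error.\<close>

lemma energy_step:
  assumes m: "mesh J q" and small: "K * mesh_size J q \<le> c0 / 8" and t: "t \<in> {0..T}" "t + \<Delta>t \<in> {0..T}"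
    and dt: "0 < \<Delta>t" "K * \<Delta>t \<le> c0 / 8" and u: "u J = u 0" and u': "u' J = u' 0"
    and ne: "near_exact J q u t" and step: "step_eq J q \<Delta>t u u'"
  shows "S J q u' (t + \<Delta>t) \<le> (1 + M3 * \<Delta>t) * S J q u t + M4 * \<Delta>t * ((mesh_size J q)\<^sup>2 + \<Delta>t)\<^sup>2"
proof -
  define t' where "t' = t + \<Delta>t"
  define h where "h = mesh_size J q"
  define y where "y = h\<^sup>2 + \<Delta>t"
  have t': "t' \<in> {0..T}" "\<bar>t' - t\<bar> = \<Delta>t" "\<bar>t - t'\<bar> = \<Delta>t" using t dt by (auto simp: t'_def)
  have tt: "K * \<bar>t - t\<bar> \<le> c0 / 8" "K * \<bar>t - t'\<bar> \<le> c0 / 8" "K * \<bar>t' - t\<bar> \<le> c0 / 8" using c0 dt t' by auto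
  define d where "d = (\<lambda>j. err q u' t' j - err q u t j)"
  define w where "w = (\<lambda>j. x (q j) t' - x (q j) t)"
  define e where "e j = slope q (err q u t) j" for j
  define e' where "e' j = slope q (err q u' t') j" for j
  define s where "s j = norm (mid d j) + norm (jump d j)" for j
  have dper: "d J = d 0" using x_periodic[OF t(1) m] x_periodic[OF t'(1) m] u u' by (simp add: d_def err_def)
  have sd: "slope q d j = e' j - e j" for j by (simp add: d_def slope_diff e_def e'_def)
  have uu: "(\<lambda>j. u' j - u j) = (\<lambda>j. w j - d j)" by (auto simp: d_def w_def err_def)
  let ?p = "\<lambda>j. slope q u j"
  have su': "slope q u' j = P q j t' - e' j" for j by (simp add: e'_def slope_err)
  have n0: "0 \<le> (real CARD('d))\<^sup>2 * B" using B0 by simp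
  have eq1: "(\<Sum>j<J. hh q j * (1 / \<Delta>t * mprod (H (?p j)) (\<lambda>j. w j - d j) d j + G (P q j t' - e' j) \<bullet> (e' j - e j))) = 0"
    using step dper unfolding step_eq_def uu su' sd[symmetric] by blast
  have eq2: "(\<Sum>j<J. hh q j * (1 / \<Delta>t * mprod (H (P q j t)) w d j + G (P q j t') \<bullet> (e' j - e j)))
    \<le> (\<Sum>j<J. hh q j * (A q j t' \<bullet> (e' j - e j) + C * y * s j))"
    using consistency[OF m small t dt dper] unfolding t'_def[symmetric] w_def[symmetric] sd y_def h_def s_def .
  have elem: "hh q j * Sj q h u' t' j - hh q j * Sj q h u t j - hh q j * (\<Delta>t * (M3 * Sj q h u t j + M4 * y\<^sup>2))
    \<le> hh q j * (1 / \<Delta>t * mprod (H (P q j t)) w d j + G (P q j t') \<bullet> (e' j - e j))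
      - hh q j * (1 / \<Delta>t * mprod (H (?p j)) (\<lambda>j. w j - d j) d j + G (P q j t' - e' j) \<bullet> (e' j - e j))
      - hh q j * (A q j t' \<bullet> (e' j - e j) + C * y * s j)" if j: "j < J" for j
  proof -
    have hj: "0 < hh q j" by (rule hh_pos[OF m j])
    have ej: "norm (e j) \<le> c0 / 4" using ne j by (simp add: near_exact_def e_def)
    have pj: "?p j = P q j t - e j" by (simp add: e_def slope_err)
    define Q where "Q = cball (xr (q j) t) (c0 / 2)"
    have Q: "convex Q" "Q \<subseteq> annulus (c0 / 2) (C0 + c0 / 2)" using ball_in_annulus[OF t(1)] by (auto simp: Q_def)
    note b1 = near_exact_ball[OF m small t(1) t(1) tt(1) j ej, folded Q_def]
    note b2 = near_exact_ball[OF m small t(1) t'(1) tt(2) j ej, folded Q_def]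
    have node: "norm (w i) \<le> K * \<Delta>t" if "i \<le> J" for i
      using node_increment[OF mesh_range[OF m that] t'(1) t(1)] t'(2) by (simp add: w_def)
    have wm: "norm (mid w j) \<le> 2 * K * \<Delta>t" "norm (jump w j) \<le> 2 * K * \<Delta>t"
    proof -
      have "norm (mid w j) = norm (w j + w (Suc j)) / 2" by (simp add: mid_def)
      also have "\<dots> \<le> (norm (w j) + norm (w (Suc j))) / 2" by (intro divide_right_mono norm_triangle_ineq) simp
      also have "\<dots> \<le> 2 * K * \<Delta>t" using node[of j] node[of "Suc j"] j mult_nonneg_nonneg[OF K0 less_imp_le[OF dt(1)]] by auto
      finally show "norm (mid w j) \<le> 2 * K * \<Delta>t" .
      show "norm (jump w j) \<le> 2 * K * \<Delta>t"
        using norm_triangle_ineq4[of "w (Suc j)" "w j"] node[of j] node[of "Suc j"] j by (simp add: jump_def)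
    qed
    \<comment> \<open>The discrete equation has \<open>H\<close> at the discrete tangent, the consistency estimate at the interpolated one.\<close>
    have Hdiff: "norm ((H (?p j) - H (P q j t)) *v z) \<le> (real CARD('d))\<^sup>2 * (B * norm (e j)) * norm z" for z
      using H_diff[OF Q b1(2) b1(1), of z] by (simp add: pj)
    have "mprod (H (?p j) - H (P q j t)) w d j \<le> ((real CARD('d))\<^sup>2 * (B * norm (e j)) * (2 * K * \<Delta>t)) * s j"
    proof -
      have one: "\<bar>((H (?p j) - H (P q j t)) *v a) \<bullet> b\<bar> \<le> ((real CARD('d))\<^sup>2 * (B * norm (e j)) * (2 * K * \<Delta>t)) * norm b"
        if "norm a \<le> 2 * K * \<Delta>t" for a b
      proof -
        have "\<bar>((H (?p j) - H (P q j t)) *v a) \<bullet> b\<bar> \<le> norm ((H (?p j) - H (P q j t)) *v a) * norm b" by (rule Cauchy_Schwarz_ineq2)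
        also have "\<dots> \<le> ((real CARD('d))\<^sup>2 * (B * norm (e j)) * norm a) * norm b" by (intro mult_right_mono Hdiff) simp
        also have "\<dots> \<le> ((real CARD('d))\<^sup>2 * (B * norm (e j)) * (2 * K * \<Delta>t)) * norm b"
          using that B0 by (intro mult_right_mono mult_left_mono) auto
        finally show ?thesis .
      qed
      have "((H (?p j) - H (P q j t)) *v mid w j) \<bullet> mid d j \<le> ((real CARD('d))\<^sup>2 * (B * norm (e j)) * (2 * K * \<Delta>t)) * norm (mid d j)"
        using one[OF wm(1), of "mid d j"] by (rule abs_le_D1)
      moreover have "((H (?p j) - H (P q j t)) *v jump w j) \<bullet> jump d j / 12 \<le> ((real CARD('d))\<^sup>2 * (B * norm (e j)) * (2 * K * \<Delta>t)) * norm (jump d j)"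
      proof -
        have "0 \<le> ((real CARD('d))\<^sup>2 * (B * norm (e j)) * (2 * K * \<Delta>t)) * norm (jump d j)"
          using B0 K0 dt by (intro mult_nonneg_nonneg) auto
        then show ?thesis using abs_le_D1[OF one[OF wm(2), of "jump d j"]] by linarith
      qed
      ultimately show ?thesis by (simp add: mprod_def s_def distrib_left)
    qed
    then have "1 / \<Delta>t * mprod (H (?p j) - H (P q j t)) w d j \<le> 1 / \<Delta>t * (((real CARD('d))\<^sup>2 * (B * norm (e j)) * (2 * K * \<Delta>t)) * s j)"
      using dt by (intro mult_left_mono) auto
    also have "\<dots> = (2 * (real CARD('d))\<^sup>2 * B * K) * norm (e j) * s j" using dt by simp
    finally have f1: "1 / \<Delta>t * mprod (H (?p j) - H (P q j t)) w d j \<le> (2 * (real CARD('d))\<^sup>2 * B * K) * norm (e j) * s j" .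
    have "c1 * nn d j \<le> mprod (H (?p j)) d d j"
      by (rule mprod_coercive[OF c1(2)[OF near_exact_slope[OF m small t(1) ne j]]])
    then have f2: "c1 / \<Delta>t * nn d j \<le> 1 / \<Delta>t * mprod (H (?p j)) d d j" using dt by (simp add: divide_right_mono)
    have "((2 * (real CARD('d))\<^sup>2 * B * K) * norm (e j) + C * y) * s j
      \<le> c1 / (2 * \<Delta>t) * nn d j + 24 * \<Delta>t / c1 * ((2 * (real CARD('d))\<^sup>2 * B * K)\<^sup>2 * (norm (e j))\<^sup>2 + C\<^sup>2 * y\<^sup>2)"
      unfolding s_def by (rule young_split[OF c1(1) dt(1) norm_sum_square_le nn_nonneg])
    then have f3: "(2 * (real CARD('d))\<^sup>2 * B * K) * norm (e j) * s j + C * y * s j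
      \<le> c1 / (2 * \<Delta>t) * nn d j + \<Delta>t * (24 / c1 * (2 * (real CARD('d))\<^sup>2 * B * K)\<^sup>2 * (norm (e j))\<^sup>2 + M2 * y\<^sup>2)"
      by (simp add: M2_def algebra_simps)
    have f4: "breg \<phi> (P q j t') (e' j) - breg \<phi> (P q j t') (e j) \<le> (G (P q j t') - G (P q j t' - e' j)) \<bullet> (e' j - e j)"
      by (rule breg_increment[OF aniso])
    have f5: "breg \<phi> (P q j t') (e j) \<le> breg \<phi> (P q j t) (e j) + \<Delta>t * ((real CARD('d))\<^sup>2 * B * K * (norm (e j))\<^sup>2)"
    proof -
      have "\<bar>taylor1 (Phi \<phi>) (P q j t') (P q j t' - e j) - taylor1 (Phi \<phi>) (P q j t) (P q j t - e j)\<bar>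
        \<le> (real CARD('d))\<^sup>2 * B * (norm (P q j t' - P q j t) * (norm (e j))\<^sup>2)"
        using taylor1_difference[OF BP Q b1(1,2) b2(1,2)] by simp
      also have "\<dots> \<le> (real CARD('d))\<^sup>2 * B * ((K * \<Delta>t) * (norm (e j))\<^sup>2)"
        using P_inc[OF m j t'(1) t(1)] t'(2) n0 by (intro mult_left_mono mult_right_mono) auto
      finally show ?thesis by (simp add: breg_eq_taylor1 mult_ac)
    qed
    have f6: "- ((A q j t' - A q j t) \<bullet> e j) \<le> \<Delta>t * (C * (norm (e j))\<^sup>2 + C * y\<^sup>2)"
    proof -
      have "- ((A q j t' - A q j t) \<bullet> e j) \<le> norm (A q j t' - A q j t) * norm (e j)"
        using norm_cauchy_schwarz[of "A q j t' - A q j t" "- e j"] by simp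
      also have "\<dots> \<le> (C * \<Delta>t * (hh q j)\<^sup>2) * norm (e j)"
        using A_inc[OF m j small_elem[OF m j small] t'(1) t(1) tt(3)] t'(2) by (intro mult_right_mono) auto
      also have "\<dots> \<le> (C * \<Delta>t * y) * norm (e j)"
      proof -
        have "(hh q j)\<^sup>2 \<le> h\<^sup>2" using hh_le_mesh_size[OF m j] hj by (intro power_mono) (auto simp: h_def)
        then show ?thesis using C0' dt by (intro mult_right_mono mult_left_mono) (auto simp: y_def)
      qed
      also have "\<dots> = C * \<Delta>t * (norm (e j) * y)" by simp
      also have "\<dots> \<le> C * \<Delta>t * ((norm (e j))\<^sup>2 + y\<^sup>2)"
      proof (rule mult_left_mono)
        show "norm (e j) * y \<le> (norm (e j))\<^sup>2 + y\<^sup>2"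
        proof -
          have "0 \<le> y" using dt by (simp add: y_def)
          from mult_nonneg_nonneg[OF norm_ge_zero[of "e j"] this] sum_squares_bound[of "norm (e j)" y]
          show ?thesis by linarith
        qed
      qed (use C0' dt in simp)
      finally show ?thesis by (simp add: algebra_simps)
    qed
    have f7: "\<beta> * nn (err q u' t') j \<le> \<beta> * nn (err q u t) j + \<Delta>t * (\<beta> * nn (err q u t) j) + c1 / (2 * \<Delta>t) * nn d j"
    proof -
      have "err q u' t' = (\<lambda>j. err q u t j + d j)" by (auto simp: d_def)
      then have "nn (err q u' t') j \<le> (1 + \<Delta>t) * nn (err q u t) j + (1 + 1 / \<Delta>t) * nn d j" 
        using nn_add_le[OF dt(1), of "err q u t" d j] by (simp only:)
      then have "\<beta> * nn (err q u' t') j \<le> \<beta> * ((1 + \<Delta>t) * nn (err q u t) j + (1 + 1 / \<Delta>t) * nn d j)"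
        using \<beta>_pos by (intro mult_left_mono) auto
      also have "\<dots> = \<beta> * nn (err q u t) j + \<Delta>t * (\<beta> * nn (err q u t) j) + \<beta> * (1 + 1 / \<Delta>t) * nn d j" by (simp add: algebra_simps)
      also have "\<beta> * (1 + 1 / \<Delta>t) \<le> c1 / (2 * \<Delta>t)"
      proof -
        have "\<Delta>t \<le> T" using t by auto
        have "1 + T \<noteq> 0" using T by simp
        then have b: "\<beta> * (1 + T) = c1 / 2"
          unfolding \<beta>_def times_divide_eq_left by (rule mult_divide_mult_cancel_right)
        have "\<beta> * (1 + 1 / \<Delta>t) = \<beta> * (1 + \<Delta>t) / \<Delta>t" using dt by (simp add: field_simps)
        also have "\<dots> \<le> \<beta> * (1 + T) / \<Delta>t"
          using \<open>\<Delta>t \<le> T\<close> \<beta>_pos dt by (intro divide_right_mono mult_left_mono) auto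
        finally show ?thesis unfolding b by simp
      qed
      then have "\<beta> * (1 + 1 / \<Delta>t) * nn d j \<le> c1 / (2 * \<Delta>t) * nn d j" by (rule mult_right_mono[OF _ nn_nonneg])
      finally show ?thesis by simp
    qed
    have f8: "(M1 + C) * (norm (e j))\<^sup>2 + \<beta> * nn (err q u t) j \<le> M3 * Sj q h u t j"
    proof -
      have lo: "\<gamma> / 4 * (norm (e j))\<^sup>2 + \<beta> * nn (err q u t) j \<le> Sj q h u t j"
        using Sj_lower[OF m j small t(1), of u] by (simp add: e_def h_def)
      have p: "0 \<le> \<gamma> / 4 * (norm (e j))\<^sup>2" "0 \<le> \<beta> * nn (err q u t) j" using \<gamma> \<beta>_pos nn_nonneg[of "err q u t" j] by auto
      have "(M1 + C) * (norm (e j))\<^sup>2 = (M1 + C) * (4 / \<gamma>) * (\<gamma> / 4 * (norm (e j))\<^sup>2)" using \<gamma> by simp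
      also have "\<dots> \<le> (M1 + C) * (4 / \<gamma>) * Sj q h u t j"
        using M_nonneg C0' \<gamma> lo p by (intro mult_left_mono) auto
      finally show ?thesis using lo p by (simp add: M3_def distrib_right)
    qed
    have f9: "Sj q h u' t' j - Sj q h u t j
      = breg \<phi> (P q j t') (e' j) - breg \<phi> (P q j t) (e j) - A q j t' \<bullet> (e' j - e j) - (A q j t' - A q j t) \<bullet> e j
        + \<beta> * nn (err q u' t') j - \<beta> * nn (err q u t) j"
      by (simp add: Sj_def e_def e'_def inner_diff_left inner_diff_right)
    have f10: "mprod (H (P q j t)) w d j - mprod (H (?p j)) (\<lambda>j. w j - d j) d j = mprod (H (?p j)) d d j - mprod (H (?p j) - H (P q j t)) w d j"
      by (simp add: mprod_diff_left mprod_mat_diff)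
    have f11: "1 / \<Delta>t * mprod (H (P q j t)) w d j - 1 / \<Delta>t * mprod (H (?p j)) (\<lambda>j. w j - d j) d j
        = 1 / \<Delta>t * mprod (H (?p j)) d d j - 1 / \<Delta>t * mprod (H (?p j) - H (P q j t)) w d j"
      unfolding right_diff_distrib[symmetric] f10 ..
    have f12: "\<Delta>t * ((M1 + C) * (norm (e j))\<^sup>2 + \<beta> * nn (err q u t) j) \<le> \<Delta>t * (M3 * Sj q h u t j)"
      using f8 dt by (intro mult_left_mono) auto
    have f13: "c1 / \<Delta>t * nn d j = c1 / (2 * \<Delta>t) * nn d j + c1 / (2 * \<Delta>t) * nn d j" using dt by (simp add: field_simps)
    have "Sj q h u' t' j - Sj q h u t j - \<Delta>t * (M3 * Sj q h u t j + M4 * y\<^sup>2)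
      \<le> (1 / \<Delta>t * mprod (H (P q j t)) w d j + G (P q j t') \<bullet> (e' j - e j))
      - (1 / \<Delta>t * mprod (H (?p j)) (\<lambda>j. w j - d j) d j + G (P q j t' - e' j) \<bullet> (e' j - e j))
      - (A q j t' \<bullet> (e' j - e j) + C * y * s j)"
    proof -
      have g1: "\<Delta>t * ((M1 + C) * (norm (e j))\<^sup>2 + \<beta> * nn (err q u t) j)
        = \<Delta>t * ((real CARD('d))\<^sup>2 * B * K * (norm (e j))\<^sup>2) + \<Delta>t * (24 / c1 * (2 * (real CARD('d))\<^sup>2 * B * K)\<^sup>2 * (norm (e j))\<^sup>2)
          + \<Delta>t * (C * (norm (e j))\<^sup>2) + \<Delta>t * (\<beta> * nn (err q u t) j)"
        unfolding M1_def by (simp only: distrib_left distrib_right)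
      have g2: "\<Delta>t * (M3 * Sj q h u t j + M4 * y\<^sup>2) = \<Delta>t * (M3 * Sj q h u t j) + \<Delta>t * (M2 * y\<^sup>2) + \<Delta>t * (C * y\<^sup>2)"
        unfolding M4_def by (simp only: distrib_left distrib_right)
      have g3: "\<Delta>t * (24 / c1 * (2 * (real CARD('d))\<^sup>2 * B * K)\<^sup>2 * (norm (e j))\<^sup>2 + M2 * y\<^sup>2)
        = \<Delta>t * (24 / c1 * (2 * (real CARD('d))\<^sup>2 * B * K)\<^sup>2 * (norm (e j))\<^sup>2) + \<Delta>t * (M2 * y\<^sup>2)"
        by (simp only: distrib_left)
      have g4: "\<Delta>t * (C * (norm (e j))\<^sup>2 + C * y\<^sup>2) = \<Delta>t * (C * (norm (e j))\<^sup>2) + \<Delta>t * (C * y\<^sup>2)" by (simp only: distrib_left)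
      have g5: "(G (P q j t') - G (P q j t' - e' j)) \<bullet> (e' j - e j) = G (P q j t') \<bullet> (e' j - e j) - G (P q j t' - e' j) \<bullet> (e' j - e j)"
        by (rule inner_diff_left)
      show ?thesis
        unfolding g2 by (rule energy_balance[OF f1 f2 f3[unfolded g3] f4[unfolded g5] f5 f6[unfolded g4] f7 f9 f11 f12[unfolded g1] f13])
    qed
    from mult_left_mono[OF this less_imp_le[OF hj]] show ?thesis by (simp only: right_diff_distrib)
  qed
  have "(\<Sum>j<J. hh q j * Sj q h u' t' j - hh q j * Sj q h u t j - hh q j * (\<Delta>t * (M3 * Sj q h u t j + M4 * y\<^sup>2)))
    \<le> (\<Sum>j<J. hh q j * (1 / \<Delta>t * mprod (H (P q j t)) w d j + G (P q j t') \<bullet> (e' j - e j))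
      - hh q j * (1 / \<Delta>t * mprod (H (?p j)) (\<lambda>j. w j - d j) d j + G (P q j t' - e' j) \<bullet> (e' j - e j))
      - hh q j * (A q j t' \<bullet> (e' j - e j) + C * y * s j))"
    using elem by (intro sum_mono) auto
  also have "\<dots> \<le> 0" unfolding sum_subtractf using eq1 eq2 by linarith
  finally have "(\<Sum>j<J. hh q j * Sj q h u' t' j) - (\<Sum>j<J. hh q j * Sj q h u t j)
      - (\<Sum>j<J. hh q j * (\<Delta>t * (M3 * Sj q h u t j + M4 * y\<^sup>2))) \<le> 0"
    unfolding sum_subtractf .
  moreover have "(\<Sum>j<J. hh q j * (\<Delta>t * (M3 * Sj q h u t j + M4 * y\<^sup>2)))
      = M3 * \<Delta>t * (\<Sum>j<J. hh q j * Sj q h u t j) + M4 * \<Delta>t * y\<^sup>2 * (\<Sum>j<J. hh q j)"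
    unfolding sum_distrib_left sum.distrib[symmetric] by (intro sum.cong refl) (simp add: algebra_simps)
  ultimately show ?thesis
    unfolding S_def t'_def[symmetric] h_def[symmetric] y_def[symmetric] sum_hh[OF m] by (simp add: distrib_right)
qed

end

section \<open>The projection of the initial value\<close>

context flow
begin

lemma elem_cong:
  assumes "\<And>j. j \<le> J \<Longrightarrow> v j = w j" "j < J"
  shows "mid v j = mid w j" "jump v j = jump w j" "slope q v j = slope q w j"
  using assms(1)[of j] assms(1)[of "Suc j"] assms(2) by (simp_all add: mid_def jump_def slope_def)

abbreviation "Hess \<equiv> hessian (Phi \<phi>)"

lemma hess_entry: "p \<noteq> 0 \<Longrightarrow> Hess p $ i $ j = pd j (pd i (Phi \<phi>)) p"
  using has_derivative_grad_hessian(2)[OF Phi_C4[OF aniso]] .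

lemma zero_T: "0 \<in> {0..T}"
  using T by simp

lemma Hess_cont: "continuous_on X (\<lambda>\<rho>. Hess (xr \<rho> 0) $ i $ j)"
  by (rule continuous_on_compose2[OF hessian_Phi_continuous[OF aniso] xr_cont[OF zero_T]]) (auto simp: xr_nz[OF zero_T])

lemma Hess_matvec_cont: "continuous_on X y \<Longrightarrow> continuous_on X (\<lambda>\<rho>. Hess (xr \<rho> 0) *v y \<rho>)"
  by (rule continuous_on_matvec[OF Hess_cont])

text \<open>The residual in the equation that defines the projection of the initial value, for nodal values.\<close>

definition Q_form :: "nat \<Rightarrow> (nat \<Rightarrow> real) \<Rightarrow> (nat \<Rightarrow> real^'d) \<Rightarrow> (nat \<Rightarrow> real^'d) \<Rightarrow> real" where
  "Q_form J q u v = (\<Sum>j<J. integral {q j..q (Suc j)} (\<lambda>\<rho>. (Hess (xr \<rho> 0) *v (slope q u j - xr \<rho> 0)) \<bullet> slope q v j)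
     + integral {q j..q (Suc j)} (\<lambda>\<rho>. ((mid u j + (\<rho> - emid q j) *\<^sub>R slope q u j) - x \<rho> 0) \<bullet> (mid v j + (\<rho> - emid q j) *\<^sub>R slope q v j)))"

lemma Q_form_cong: "(\<And>j. j \<le> J \<Longrightarrow> u j = u' j) \<Longrightarrow> (\<And>j. j \<le> J \<Longrightarrow> v j = v' j) \<Longrightarrow> Q_form J q u v = Q_form J q u' v'"
  unfolding Q_form_def by (intro sum.cong refl) (simp add: elem_cong[of J u u'] elem_cong[of J v v'])

definition Hint :: "(nat \<Rightarrow> real) \<Rightarrow> nat \<Rightarrow> real^'d \<Rightarrow> real^'d" where
  "Hint q j z = integral {q j..q (Suc j)} (\<lambda>\<rho>. Hess (xr \<rho> 0) *v z)"

lemma Hint_diff: "Hint q j (z - z') = Hint q j z - Hint q j z'"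
  unfolding Hint_def matrix_vector_mult_diff_distrib
  by (intro Henstock_Kurzweil_Integration.integral_diff integrable_continuous_real Hess_matvec_cont continuous_on_const)

lemma Hint_bounds:
  assumes m: "mesh J q" and j: "j < J"
  shows "norm (Hint q j z) \<le> hh q j * (\<Gamma> * norm z)" "hh q j * (\<gamma> * (norm z)\<^sup>2) \<le> Hint q j z \<bullet> z"
proof -
  have le: "q j \<le> q (Suc j)" using mesh_less[OF m j] by simp
  have c: "continuous_on {q j..q (Suc j)} (\<lambda>\<rho>. Hess (xr \<rho> 0) *v z)" by (rule Hess_matvec_cont) simp
  have "norm (Hint q j z) \<le> (q (Suc j) - q j) * (\<Gamma> * norm z)"
    unfolding Hint_def by (rule integral_norm_bound[OF c _ le]) (rule hess_Lip[OF xr_nz[OF zero_T]])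
  then show "norm (Hint q j z) \<le> hh q j * (\<Gamma> * norm z)" by (simp add: hh_def)
  have "Hint q j z \<bullet> z = integral {q j..q (Suc j)} (\<lambda>\<rho>. (Hess (xr \<rho> 0) *v z) \<bullet> z)"
    unfolding Hint_def using integral_linear[OF integrable_continuous_real[OF c] bounded_linear_inner_left[of z]] by (simp add: comp_def)
  moreover have "integral {q j..q (Suc j)} (\<lambda>_. \<gamma> * (norm z)\<^sup>2) \<le> integral {q j..q (Suc j)} (\<lambda>\<rho>. (Hess (xr \<rho> 0) *v z) \<bullet> z)"
    by (intro integral_le integrable_continuous_real continuous_intros c hess_mono[OF xr_nz[OF zero_T]])
  ultimately show "hh q j * (\<gamma> * (norm z)\<^sup>2) \<le> Hint q j z \<bullet> z" using le by (simp add: hh_def mult.left_commute)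
qed

lemma mprod_id: "mprod (mat 1) v v j = nn v j"
  by (simp add: mprod_def nn_def power2_norm_eq_inner)

text \<open>The equation is brought into the shape of the abstract solvability theorem: in contrast to the mass
  term, the weight in the first term varies within the element and is integrated out.\<close>

lemma Q_form_split:
  assumes m: "mesh J q" and j: "j < J"
  shows "integral {q j..q (Suc j)} (\<lambda>\<rho>. (Hess (xr \<rho> 0) *v (slope q u j - xr \<rho> 0)) \<bullet> slope q v j)
     + integral {q j..q (Suc j)} (\<lambda>\<rho>. ((mid u j + (\<rho> - emid q j) *\<^sub>R slope q u j) - x \<rho> 0) \<bullet> (mid v j + (\<rho> - emid q j) *\<^sub>R slope q v j))
   = (Hint q j (slope q u j) - integral {q j..q (Suc j)} (\<lambda>\<rho>. Hess (xr \<rho> 0) *v xr \<rho> 0)) \<bullet> slope q v j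
     + hh q j * mprod (mat 1) u v j
     - integral {q j..q (Suc j)} (\<lambda>\<rho>. x \<rho> 0) \<bullet> mid v j
     - integral {q j..q (Suc j)} (\<lambda>\<rho>. (\<rho> - emid q j) *\<^sub>R x \<rho> 0) \<bullet> slope q v j"
proof -
  let ?I = "{q j..q (Suc j)}"
  have cx: "continuous_on ?I (\<lambda>\<rho>. x \<rho> 0)" by (rule x_cont[OF zero_T])
  have lin: "integral ?I f \<bullet> z = integral ?I (\<lambda>\<rho>. f \<rho> \<bullet> z)" if "continuous_on ?I f" for f :: "real \<Rightarrow> real^'d" and z
    using integral_linear[OF integrable_continuous_real[OF that] bounded_linear_inner_left[of z]] by (simp add: comp_def)
  have cH: "continuous_on ?I (\<lambda>\<rho>. Hess (xr \<rho> 0) *v z)" for z by (rule Hess_matvec_cont) simp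
  have cHx: "continuous_on ?I (\<lambda>\<rho>. Hess (xr \<rho> 0) *v xr \<rho> 0)" by (rule Hess_matvec_cont[OF xr_cont[OF zero_T]])
  have 1: "integral ?I (\<lambda>\<rho>. (Hess (xr \<rho> 0) *v (slope q u j - xr \<rho> 0)) \<bullet> slope q v j)
      = (Hint q j (slope q u j) - integral ?I (\<lambda>\<rho>. Hess (xr \<rho> 0) *v xr \<rho> 0)) \<bullet> slope q v j"
  proof -
    have "integral ?I (\<lambda>\<rho>. (Hess (xr \<rho> 0) *v (slope q u j - xr \<rho> 0)) \<bullet> slope q v j)
      = integral ?I (\<lambda>\<rho>. Hess (xr \<rho> 0) *v slope q u j - Hess (xr \<rho> 0) *v xr \<rho> 0) \<bullet> slope q v j"
      by (subst lin) (auto intro: continuous_on_diff cH cHx simp: matrix_vector_mult_diff_distrib)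
    also have "integral ?I (\<lambda>\<rho>. Hess (xr \<rho> 0) *v slope q u j - Hess (xr \<rho> 0) *v xr \<rho> 0)
      = Hint q j (slope q u j) - integral ?I (\<lambda>\<rho>. Hess (xr \<rho> 0) *v xr \<rho> 0)"
      unfolding Hint_def by (intro Henstock_Kurzweil_Integration.integral_diff integrable_continuous_real cH cHx)
    finally show ?thesis .
  qed
  have a: "integral ?I (\<lambda>\<rho>. (mid u j + (\<rho> - emid q j) *\<^sub>R slope q u j) \<bullet> (mid v j + (\<rho> - emid q j) *\<^sub>R slope q v j))
    = hh q j * mprod (mat 1) u v j"
  proof -
    have "integral ?I (\<lambda>\<rho>. (mat 1 *v (mid u j + (\<rho> - (q j + q (Suc j)) / 2) *\<^sub>R slope q u j)) \<bullet> (mid v j + (\<rho> - (q j + q (Suc j)) / 2) *\<^sub>R slope q v j))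
      = (q (Suc j) - q j) * ((mat 1 *v mid u j) \<bullet> mid v j + (q (Suc j) - q j)\<^sup>2 / 12 * ((mat 1 *v slope q u j) \<bullet> slope q v j))"
      using mesh_less[OF m j] by (intro affine_product_integral) simp
    then show ?thesis
      by (simp add: mprod_def jump_slope[OF m j] power2_eq_square emid_def hh_def)
  qed
  have b: "integral ?I (\<lambda>\<rho>. x \<rho> 0 \<bullet> (mid v j + (\<rho> - emid q j) *\<^sub>R slope q v j))
    = integral ?I (\<lambda>\<rho>. x \<rho> 0) \<bullet> mid v j + integral ?I (\<lambda>\<rho>. (\<rho> - emid q j) *\<^sub>R x \<rho> 0) \<bullet> slope q v j"
  proof -
    have c2: "continuous_on ?I (\<lambda>\<rho>. (\<rho> - emid q j) *\<^sub>R x \<rho> 0)" by (intro continuous_intros cx)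
    have "integral ?I (\<lambda>\<rho>. x \<rho> 0 \<bullet> (mid v j + (\<rho> - emid q j) *\<^sub>R slope q v j))
      = integral ?I (\<lambda>\<rho>. x \<rho> 0 \<bullet> mid v j + ((\<rho> - emid q j) *\<^sub>R x \<rho> 0) \<bullet> slope q v j)"
      by (simp add: inner_add_right)
    also have "\<dots> = integral ?I (\<lambda>\<rho>. x \<rho> 0 \<bullet> mid v j) + integral ?I (\<lambda>\<rho>. ((\<rho> - emid q j) *\<^sub>R x \<rho> 0) \<bullet> slope q v j)"
      by (intro Henstock_Kurzweil_Integration.integral_add integrable_continuous_real continuous_on_inner continuous_on_const cx c2)
    finally show ?thesis unfolding lin[OF cx] lin[OF c2] .
  qed
  have "integral ?I (\<lambda>\<rho>. ((mid u j + (\<rho> - emid q j) *\<^sub>R slope q u j) - x \<rho> 0) \<bullet> (mid v j + (\<rho> - emid q j) *\<^sub>R slope q v j))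
    = integral ?I (\<lambda>\<rho>. (mid u j + (\<rho> - emid q j) *\<^sub>R slope q u j) \<bullet> (mid v j + (\<rho> - emid q j) *\<^sub>R slope q v j))
      - integral ?I (\<lambda>\<rho>. x \<rho> 0 \<bullet> (mid v j + (\<rho> - emid q j) *\<^sub>R slope q v j))"
    unfolding inner_diff_left by (intro Henstock_Kurzweil_Integration.integral_diff integrable_continuous_real continuous_intros cx)
  then show ?thesis unfolding 1 a b by simp
qed

lemma projection_solvable:
  assumes m: "mesh J q"
  shows "\<exists>u. u J = u 0 \<and> (\<forall>v. v J = v 0 \<longrightarrow> Q_form J q u v = 0)"
proof -
  have J: "0 < J" by (rule mesh_ends(3)[OF m])
  define \<eta> where "\<eta> = Min (hh q ` {..<J})"
  have \<eta>: "0 < \<eta>" "\<And>j. j < J \<Longrightarrow> \<eta> \<le> hh q j"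
    using J hh_pos[OF m] by (auto simp: \<eta>_def Min_gr_iff lessThan_empty_iff)
  have h1: "hh q j \<le> 1" if "j < J" for j using mesh_elem_sub[OF m that] mesh_less[OF m that] by (auto simp: hh_def)
  define g where "g j = integral {q j..q (Suc j)} (\<lambda>\<rho>. Hess (xr \<rho> 0) *v xr \<rho> 0) + integral {q j..q (Suc j)} (\<lambda>\<rho>. (\<rho> - emid q j) *\<^sub>R x \<rho> 0)" for j
  define k where "k j = integral {q j..q (Suc j)} (\<lambda>\<rho>. x \<rho> 0)" for j
  define \<alpha> where "\<alpha> w j = hh q j *\<^sub>R mid w j - k j" for w j
  define \<beta> where "\<beta> w j = (1 / hh q j) *\<^sub>R (Hint q j (slope q w j) - g j) + (hh q j / 12) *\<^sub>R jump w j" for w j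
  define L where "L = \<Gamma> / \<eta> + 1"
  have L: "0 \<le> \<Gamma> / \<eta>" using \<Gamma> \<eta> by simp
  have slope_jump': "slope q w j - slope q w' j = (jump w j - jump w' j) /\<^sub>R hh q j" for w w' :: "nat \<Rightarrow> real^'d" and j
    by (simp add: slope_def jump_def scaleR_diff_right)
  have "\<exists>w. w J = w 0 \<and> (\<forall>v. v J = v 0 \<longrightarrow> (\<Sum>e<J. \<alpha> w e \<bullet> mid v e + \<beta> w e \<bullet> jump v e) = 0)"
  proof (rule variational_solvable[OF J])
    show "0 < \<eta> / 6" using \<eta> by simp
    show "0 \<le> L" using L by (simp add: L_def)
    fix w w' :: "nat \<Rightarrow> real^'d"
    have a: "\<alpha> w e - \<alpha> w' e = hh q e *\<^sub>R (mid w e - mid w' e)" for e by (simp add: \<alpha>_def scaleR_diff_right)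
    have b: "\<beta> w e - \<beta> w' e = (1 / hh q e) *\<^sub>R Hint q e (slope q w e - slope q w' e) + (hh q e / 12) *\<^sub>R (jump w e - jump w' e)" for e
      by (simp add: \<beta>_def Hint_diff scaleR_diff_right)
    show "norm (\<alpha> w e - \<alpha> w' e) \<le> L * (norm (mid w e - mid w' e) + norm (jump w e - jump w' e))" if e: "e < J" for e
    proof -
      have "norm (\<alpha> w e - \<alpha> w' e) = hh q e * norm (mid w e - mid w' e)" using hh_pos[OF m e] by (simp add: a)
      also have "\<dots> \<le> L * (norm (mid w e - mid w' e) + norm (jump w e - jump w' e))"
        using h1[OF e] hh_pos[OF m e] L by (intro mult_mono) (auto simp: L_def)
      finally show ?thesis .
    qed
    show "norm (\<beta> w e - \<beta> w' e) \<le> L * (norm (mid w e - mid w' e) + norm (jump w e - jump w' e))" if e: "e < J" for e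
    proof -
      have he: "0 < hh q e" by (rule hh_pos[OF m e])
      have "norm ((1 / hh q e) *\<^sub>R Hint q e (slope q w e - slope q w' e)) = norm (Hint q e (slope q w e - slope q w' e)) / hh q e"
        using he by simp
      also have "\<dots> \<le> (hh q e * (\<Gamma> * norm (slope q w e - slope q w' e))) / hh q e"
        using he by (intro divide_right_mono Hint_bounds(1)[OF m e]) simp
      also have "\<dots> = \<Gamma> * (norm (jump w e - jump w' e) / hh q e)" using he by (simp add: slope_jump' divide_inverse mult.commute)
      also have "\<dots> \<le> \<Gamma> * (norm (jump w e - jump w' e) / \<eta>)"
        using \<eta> \<eta>(2)[OF e] \<Gamma> by (intro mult_left_mono divide_left_mono) auto
      finally have 1: "norm ((1 / hh q e) *\<^sub>R Hint q e (slope q w e - slope q w' e)) \<le> \<Gamma> / \<eta> * norm (jump w e - jump w' e)" by simp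
      have 2: "norm ((hh q e / 12) *\<^sub>R (jump w e - jump w' e)) \<le> 1 * norm (jump w e - jump w' e)"
        unfolding norm_scaleR using h1[OF e] he by (intro mult_right_mono) auto
      have "norm (\<beta> w e - \<beta> w' e) \<le> \<Gamma> / \<eta> * norm (jump w e - jump w' e) + 1 * norm (jump w e - jump w' e)"
        unfolding b using 1 2 by (rule norm_triangle_mono)
      also have "\<dots> = L * norm (jump w e - jump w' e)" by (simp add: L_def distrib_right)
      also have "\<dots> \<le> L * (norm (mid w e - mid w' e) + norm (jump w e - jump w' e))"
        using L by (intro mult_left_mono) (auto simp: L_def)
      finally show ?thesis .
    qed
    let ?z = "\<lambda>j. w j - w' j"
    have el: "\<eta> / 6 * (norm (?z e))\<^sup>2 \<le> (\<alpha> w e - \<alpha> w' e) \<bullet> mid ?z e + (\<beta> w e - \<beta> w' e) \<bullet> jump ?z e" if e: "e < J" for e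
    proof -
      have he: "0 < hh q e" by (rule hh_pos[OF m e])
      have "\<eta> / 6 * (norm (?z e))\<^sup>2 \<le> \<eta> / 6 * (6 * nn ?z e)" using \<eta> node_le_nn[of ?z e] by (intro mult_left_mono) auto
      also have "\<dots> \<le> hh q e * nn ?z e" using \<eta>(2)[OF e] nn_nonneg[of ?z e] by (simp add: mult_right_mono)
      also have "\<dots> = (hh q e *\<^sub>R mid ?z e) \<bullet> mid ?z e + ((hh q e / 12) *\<^sub>R jump ?z e) \<bullet> jump ?z e"
        by (simp add: nn_def power2_norm_eq_inner distrib_left)
      also have "\<dots> \<le> (\<alpha> w e - \<alpha> w' e) \<bullet> mid ?z e + (\<beta> w e - \<beta> w' e) \<bullet> jump ?z e"
      proof -
        have "0 \<le> hh q e * (\<gamma> * (norm (slope q ?z e))\<^sup>2)" using he \<gamma> by simp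
        also have "\<dots> \<le> Hint q e (slope q ?z e) \<bullet> slope q ?z e" by (rule Hint_bounds(2)[OF m e])
        also have "\<dots> = ((1 / hh q e) *\<^sub>R Hint q e (slope q w e - slope q w' e)) \<bullet> jump ?z e"
          using he by (simp add: jump_slope[OF m e] slope_diff)
        finally show ?thesis unfolding a b by (simp add: inner_add_left mid_diff jump_diff)
      qed
      finally show ?thesis .
    qed
    show "\<eta> / 6 * (\<Sum>j<J. (norm (w j - w' j))\<^sup>2) \<le> (\<Sum>e<J. (\<alpha> w e - \<alpha> w' e) \<bullet> mid ?z e + (\<beta> w e - \<beta> w' e) \<bullet> jump ?z e)"
      unfolding sum_distrib_left using el by (intro sum_mono) auto
  qed
  then obtain w where w: "w J = w 0" "\<And>v. v J = v 0 \<Longrightarrow> (\<Sum>e<J. \<alpha> w e \<bullet> mid v e + \<beta> w e \<bullet> jump v e) = 0" by blast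
  have "Q_form J q w v = (\<Sum>e<J. \<alpha> w e \<bullet> mid v e + \<beta> w e \<bullet> jump v e)" for v
    unfolding Q_form_def
  proof (rule sum.cong[OF refl])
    fix j assume "j \<in> {..<J}"
    then have j: "j < J" by simp
    have "((1 / hh q j) *\<^sub>R (Hint q j (slope q w j) - g j)) \<bullet> jump v j = (Hint q j (slope q w j) - g j) \<bullet> slope q v j"
      using hh_pos[OF m j] by (simp add: jump_slope[OF m j])
    then show "integral {q j..q (Suc j)} (\<lambda>\<rho>. (Hess (xr \<rho> 0) *v (slope q w j - xr \<rho> 0)) \<bullet> slope q v j)
     + integral {q j..q (Suc j)} (\<lambda>\<rho>. ((mid w j + (\<rho> - emid q j) *\<^sub>R slope q w j) - x \<rho> 0) \<bullet> (mid v j + (\<rho> - emid q j) *\<^sub>R slope q v j))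
     = \<alpha> w j \<bullet> mid v j + \<beta> w j \<bullet> jump v j"
      unfolding Q_form_split[OF m j]
      by (simp add: \<alpha>_def \<beta>_def g_def k_def mprod_def inner_add_left inner_diff_left algebra_simps)
  qed
  then show ?thesis using w by metis
qed

lemma projection_unique:
  assumes m: "mesh J q" and w: "w J = w 0" "\<And>v. v J = v 0 \<Longrightarrow> Q_form J q w v = 0"
    and w': "w' J = w' 0" "\<And>v. v J = v 0 \<Longrightarrow> Q_form J q w' v = 0" and j: "j < J"
  shows "w j = w' j"
proof -
  let ?z = "\<lambda>j. w j - w' j"
  have "?z J = ?z 0" using w w' by simp
  then have "Q_form J q w ?z - Q_form J q w' ?z = 0" using w(2) w'(2) by simp
  then have zero: "(\<Sum>j<J. Hint q j (slope q ?z j) \<bullet> slope q ?z j + hh q j * nn ?z j) = 0"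
    unfolding Q_form_def sum_subtractf[symmetric]
  proof -
    let ?q = "\<lambda>w j. integral {q j..q (Suc j)} (\<lambda>\<rho>. (Hess (xr \<rho> 0) *v (slope q w j - xr \<rho> 0)) \<bullet> slope q ?z j)
     + integral {q j..q (Suc j)} (\<lambda>\<rho>. ((mid w j + (\<rho> - emid q j) *\<^sub>R slope q w j) - x \<rho> 0) \<bullet> (mid ?z j + (\<rho> - emid q j) *\<^sub>R slope q ?z j))"
    assume zero: "(\<Sum>j<J. ?q w j - ?q w' j) = 0"
    have "Hint q j (slope q ?z j) \<bullet> slope q ?z j + hh q j * nn ?z j = ?q w j - ?q w' j" if j: "j < J" for j
    proof -
      have "Hint q j (slope q ?z j) = Hint q j (slope q w j) - Hint q j (slope q w' j)"
        by (simp only: slope_diff Hint_diff)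
      then have 1: "Hint q j (slope q ?z j) \<bullet> slope q ?z j = Hint q j (slope q w j) \<bullet> slope q ?z j - Hint q j (slope q w' j) \<bullet> slope q ?z j"
        by (simp only: inner_diff_left)
      have 2: "nn ?z j = mprod (mat 1) w ?z j - mprod (mat 1) w' ?z j"
        unfolding mprod_id[symmetric] by (rule mprod_diff_left)
      show ?thesis unfolding Q_form_split[OF m j] unfolding 1 2 inner_diff_left right_diff_distrib by linarith
    qed
    then have "(\<Sum>j<J. Hint q j (slope q ?z j) \<bullet> slope q ?z j + hh q j * nn ?z j) = (\<Sum>j<J. ?q w j - ?q w' j)"
      by (intro sum.cong) auto
    then show ?thesis using zero by (rule trans)
  qed
  have p: "0 \<le> Hint q j (slope q ?z j) \<bullet> slope q ?z j" if "j < J" for j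
    using order_trans[OF _ Hint_bounds(2)[OF m that, of "slope q ?z j"], of 0] hh_pos[OF m that] \<gamma> by simp
  have p2: "0 \<le> Hint q j (slope q ?z j) \<bullet> slope q ?z j + hh q j * nn ?z j" if "j < J" for j
    using p[OF that] hh_pos[OF m that] nn_nonneg[of ?z j] by simp
  have "Hint q j (slope q ?z j) \<bullet> slope q ?z j + hh q j * nn ?z j = 0"
    using zero sum_nonneg_eq_0_iff[of "{..<J}" "\<lambda>j. Hint q j (slope q ?z j) \<bullet> slope q ?z j + hh q j * nn ?z j"] p2 j by auto
  then have "hh q j * nn ?z j \<le> 0" using p[OF j] by linarith
  then have "nn ?z j = 0" using hh_pos[OF m j] nn_nonneg[of ?z j] by (simp add: mult_le_0_iff)
  then show ?thesis using node_le_nn[of ?z j] by simp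
qed

lemma near_annulus:
  assumes m: "mesh J q" and j: "j < J" and small: "K * mesh_size J q \<le> c0 / 8"
  shows "P q j 0 \<in> annulus (c0 / 2) (C0 + c0 / 2)"
proof -
  have "K * hh q j \<le> c0 / 8" using mult_left_mono[OF hh_le_mesh_size[OF m j] K0] small by linarith
  from half_ball(2)[OF m j this zero_T zero_T, of "q j"] mesh_less[OF m j] c0
  have "P q j 0 \<in> cball (xr (q j) 0) (c0 / 2)" by auto
  then show ?thesis using ball_in_annulus[OF zero_T, of "q j"] by (rule subsetD[rotated])
qed

lemma affine_norm_le:
  fixes v :: "nat \<Rightarrow> real^'d"
  assumes m: "mesh J q" and j: "j < J" and \<rho>: "\<rho> \<in> {q j..q (Suc j)}"
  shows "norm (mid v j + (\<rho> - emid q j) *\<^sub>R slope q v j) \<le> norm (mid v j) + norm (jump v j)"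
proof -
  have "\<bar>\<rho> - emid q j\<bar> \<le> hh q j" using \<rho> mesh_less[OF m j] by (auto simp: hh_def emid_def abs_le_iff field_simps)
  then have "norm ((\<rho> - emid q j) *\<^sub>R slope q v j) \<le> hh q j * norm (slope q v j)"
    unfolding norm_scaleR by (rule mult_right_mono) simp
  also have "\<dots> = norm (jump v j)" using hh_pos[OF m j] by (simp add: jump_slope[OF m j])
  finally show ?thesis using norm_triangle_ineq[of "mid v j"] by (meson add_left_mono order_trans)
qed

text \<open>The projection is superclose to the nodal interpolant. The equation is tested with their difference. On
  each element the derivative of the interpolation error has mean value zero, so the weight may be
  replaced by its oscillation, which gains a power of the mesh size.\<close>

lemma projection_superclose:
  assumes m: "mesh J q" and small: "K * mesh_size J q \<le> c0 / 8"
    and u: "u J = u 0" "\<And>v. v J = v 0 \<Longrightarrow> Q_form J q u v = 0"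
  shows "(\<Sum>j<J. hh q j * (\<gamma> / 2 * (norm (slope q (err q u 0) j))\<^sup>2 + nn (err q u 0) j / 2))
    \<le> (((real CARD('d))\<^sup>2 * B * K\<^sup>2)\<^sup>2 / (2 * \<gamma>) + 12 * K\<^sup>2) * (mesh_size J q) ^ 4"
proof -
  let ?e = "err q u 0"
  define h where "h = mesh_size J q"
  define D where "D = (real CARD('d))\<^sup>2 * B * K\<^sup>2"
  have D0: "0 \<le> D" using B0 by (simp add: D_def)
  have eper: "?e J = ?e 0" using x_periodic[OF zero_T m] u(1) by (simp add: err_def)
  have Q0: "Q_form J q u ?e = 0" by (rule u(2)[OF eper])
  have elem: "hh q j * (\<gamma> / 2 * (norm (slope q ?e j))\<^sup>2 + nn ?e j / 2) - hh q j * ((D\<^sup>2 / (2 * \<gamma>) + 12 * K\<^sup>2) * h ^ 4)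
    \<le> - (integral {q j..q (Suc j)} (\<lambda>\<rho>. (Hess (xr \<rho> 0) *v (slope q u j - xr \<rho> 0)) \<bullet> slope q ?e j)
     + integral {q j..q (Suc j)} (\<lambda>\<rho>. ((mid u j + (\<rho> - emid q j) *\<^sub>R slope q u j) - x \<rho> 0) \<bullet> (mid ?e j + (\<rho> - emid q j) *\<^sub>R slope q ?e j)))"
    if j: "j < J" for j
  proof -
    let ?I = "{q j..q (Suc j)}" and ?P = "P q j 0" and ?s = "slope q ?e j"
    have hj: "0 < hh q j" "hh q j \<le> h" using hh_pos[OF m j] hh_le_mesh_size[OF m j] by (auto simp: h_def)
    have le: "q j \<le> q (Suc j)" "q j < q (Suc j)" using mesh_less[OF m j] by simp_all
    have su: "slope q u j = ?P - ?s" by (simp add: slope_err)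
    have P0: "?P \<noteq> 0"
      by (rule annulus_nonzero[OF near_annulus[OF m j small]]) (use c0 in simp)
    have cx: "continuous_on ?I (\<lambda>\<rho>. x \<rho> 0)" by (rule x_cont[OF zero_T])
    have cr: "continuous_on ?I (\<lambda>\<rho>. xr \<rho> 0)" by (rule xr_cont[OF zero_T])
    have c1: "continuous_on ?I (\<lambda>\<rho>. (Hess (xr \<rho> 0) - Hess ?P) *v (?P - xr \<rho> 0))"
      by (intro continuous_on_matvec continuous_on_diff continuous_on_const cr)
        (simp, intro continuous_on_diff Hess_cont continuous_on_const)
    have c2: "continuous_on ?I (\<lambda>\<rho>. Hess ?P *v (?P - xr \<rho> 0))"
      by (intro continuous_on_matvec continuous_on_diff continuous_on_const cr)
    have zero: "integral ?I (\<lambda>\<rho>. Hess ?P *v (?P - xr \<rho> 0)) = 0"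
    proof -
      have "integral ?I (\<lambda>\<rho>. ?P - xr \<rho> 0) = 0"
        using P_integral[OF m j zero_T] le
        by (simp add: Henstock_Kurzweil_Integration.integral_diff integrable_continuous_real cr)
      then show ?thesis
        using integral_linear[OF integrable_continuous_real[of "q j" "q (Suc j)" "\<lambda>\<rho>. ?P - xr \<rho> 0"] matrix_vector_mul_bounded_linear[of "Hess ?P"]] cr
        by (simp add: comp_def continuous_on_diff)
    qed
    define R1 where "R1 = integral ?I (\<lambda>\<rho>. (Hess (xr \<rho> 0) - Hess ?P) *v (?P - xr \<rho> 0))"
    have t1: "integral ?I (\<lambda>\<rho>. (Hess (xr \<rho> 0) *v (slope q u j - xr \<rho> 0)) \<bullet> ?s) = R1 \<bullet> ?s - Hint q j ?s \<bullet> ?s"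
    proof -
      have lin: "integral ?I f \<bullet> z = integral ?I (\<lambda>\<rho>. f \<rho> \<bullet> z)" if "continuous_on ?I f" for f :: "real \<Rightarrow> real^'d" and z
        using integral_linear[OF integrable_continuous_real[OF that] bounded_linear_inner_left[of z]] by (simp add: comp_def)
      have c3: "continuous_on ?I (\<lambda>\<rho>. Hess (xr \<rho> 0) *v ?s)" by (rule Hess_matvec_cont) simp
      have expand: "Hess (xr \<rho> 0) *v (slope q u j - xr \<rho> 0)
        = (Hess (xr \<rho> 0) - Hess ?P) *v (?P - xr \<rho> 0) + Hess ?P *v (?P - xr \<rho> 0) - Hess (xr \<rho> 0) *v ?s" for \<rho>
        by (simp add: su matrix_vector_mult_diff_rdistrib matrix_vector_mult_diff_distrib)
      have "(\<lambda>\<rho>. (Hess (xr \<rho> 0) *v (slope q u j - xr \<rho> 0)) \<bullet> ?s)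
        = (\<lambda>\<rho>. ((Hess (xr \<rho> 0) - Hess ?P) *v (?P - xr \<rho> 0) + Hess ?P *v (?P - xr \<rho> 0) - Hess (xr \<rho> 0) *v ?s) \<bullet> ?s)"
        by (simp only: expand)
      then have "integral ?I (\<lambda>\<rho>. (Hess (xr \<rho> 0) *v (slope q u j - xr \<rho> 0)) \<bullet> ?s)
        = integral ?I (\<lambda>\<rho>. (Hess (xr \<rho> 0) - Hess ?P) *v (?P - xr \<rho> 0) + Hess ?P *v (?P - xr \<rho> 0) - Hess (xr \<rho> 0) *v ?s) \<bullet> ?s"
        using lin[of "\<lambda>\<rho>. (Hess (xr \<rho> 0) - Hess ?P) *v (?P - xr \<rho> 0) + Hess ?P *v (?P - xr \<rho> 0) - Hess (xr \<rho> 0) *v ?s" ?s]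
        by (simp add: continuous_on_diff continuous_on_add c1 c2 c3)
      also have "integral ?I (\<lambda>\<rho>. (Hess (xr \<rho> 0) - Hess ?P) *v (?P - xr \<rho> 0) + Hess ?P *v (?P - xr \<rho> 0) - Hess (xr \<rho> 0) *v ?s)
        = R1 + 0 - Hint q j ?s"
        unfolding R1_def Hint_def zero[symmetric]
        using c1 c2 c3 by (simp add: Henstock_Kurzweil_Integration.integral_diff Henstock_Kurzweil_Integration.integral_add integrable_add integrable_continuous_real)
      finally show ?thesis by (simp add: inner_diff_left)
    qed
    have R1n: "norm R1 \<le> hh q j * (D * h\<^sup>2)"
    proof -
      have "norm R1 \<le> (q (Suc j) - q j) * (D * h\<^sup>2)"
        unfolding R1_def
      proof (rule integral_norm_bound[OF c1 _ le(1)])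
        fix \<rho> assume \<rho>: "\<rho> \<in> ?I"
        have near: "norm (?P - xr \<rho> 0) \<le> K * h"
          using P_near[OF m j zero_T \<rho>] mult_left_mono[OF hj(2) K0] by linarith
        have seg: "closed_segment (xr \<rho> 0) ?P \<subseteq> annulus (c0 / 2) (C0 + c0 / 2)"
        proof -
          have "K * hh q j \<le> c0 / 8" using mult_left_mono[OF hj(2) K0] small by (simp add: h_def)
          from half_ball[OF m j this zero_T zero_T _ \<rho>] c0
          have "xr \<rho> 0 \<in> cball (xr (q j) 0) (c0 / 2)" "?P \<in> cball (xr (q j) 0) (c0 / 2)" by auto
          then show ?thesis using closed_segment_sub[OF _ ball_in_annulus[OF zero_T]] by blast
        qed
        have "norm ((Hess (xr \<rho> 0) - Hess ?P) *v (?P - xr \<rho> 0)) \<le> (real CARD('d))\<^sup>2 * (B * norm (xr \<rho> 0 - ?P)) * norm (?P - xr \<rho> 0)"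
        proof (rule norm_matvec_le)
          fix i l
          show "\<bar>(Hess (xr \<rho> 0) - Hess ?P) $ i $ l\<bar> \<le> B * norm (xr \<rho> 0 - ?P)"
            using C3_boundD(9)[OF BP seg, of l i] by (simp add: hess_entry P0 xr_nz[OF zero_T])
        qed
        also have "\<dots> \<le> (real CARD('d))\<^sup>2 * (B * (K * h)) * (K * h)"
          using near B0 K0 hj by (intro mult_mono mult_nonneg_nonneg) (auto simp: norm_minus_commute)
        also have "\<dots> = D * h\<^sup>2" by (simp add: D_def power2_eq_square mult_ac)
        finally show "norm ((Hess (xr \<rho> 0) - Hess ?P) *v (?P - xr \<rho> 0)) \<le> D * h\<^sup>2" .
      qed
      then show ?thesis by (simp add: hh_def)
    qed
    \<comment> \<open>The interpolation error \<open>b\<close> itself is of second order.\<close>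
    define a where "a \<rho> = mid ?e j + (\<rho> - emid q j) *\<^sub>R ?s" for \<rho>
    define b where "b \<rho> = (mid (\<lambda>j. x (q j) 0) j + (\<rho> - emid q j) *\<^sub>R ?P) - x \<rho> 0" for \<rho>
    have ca: "continuous_on ?I a" unfolding a_def by (intro continuous_intros)
    have cb: "continuous_on ?I b" unfolding b_def by (intro continuous_intros cx)
    have t2: "integral ?I (\<lambda>\<rho>. ((mid u j + (\<rho> - emid q j) *\<^sub>R slope q u j) - x \<rho> 0) \<bullet> (mid ?e j + (\<rho> - emid q j) *\<^sub>R ?s))
      = integral ?I (\<lambda>\<rho>. b \<rho> \<bullet> a \<rho>) - hh q j * nn ?e j"
    proof -
      have me: "mid u j = mid (\<lambda>j. x (q j) 0) j - mid ?e j" by (simp add: err_def mid_diff)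
      have "(\<lambda>\<rho>. ((mid u j + (\<rho> - emid q j) *\<^sub>R slope q u j) - x \<rho> 0) \<bullet> (mid ?e j + (\<rho> - emid q j) *\<^sub>R ?s)) = (\<lambda>\<rho>. b \<rho> \<bullet> a \<rho> - a \<rho> \<bullet> a \<rho>)"
        unfolding inner_diff_left[symmetric] by (simp add: a_def b_def su me fun_eq_iff scaleR_diff_right algebra_simps)
      moreover have "integral ?I (\<lambda>\<rho>. a \<rho> \<bullet> a \<rho>) = hh q j * nn ?e j"
      proof -
        have "integral ?I (\<lambda>\<rho>. (mat 1 *v (mid ?e j + (\<rho> - (q j + q (Suc j)) / 2) *\<^sub>R ?s)) \<bullet> (mid ?e j + (\<rho> - (q j + q (Suc j)) / 2) *\<^sub>R ?s))
          = (q (Suc j) - q j) * ((mat 1 *v mid ?e j) \<bullet> mid ?e j + (q (Suc j) - q j)\<^sup>2 / 12 * ((mat 1 *v ?s) \<bullet> ?s))"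
          by (rule affine_product_integral[OF le(1)])
        moreover have "nn ?e j = mid ?e j \<bullet> mid ?e j + (hh q j)\<^sup>2 / 12 * (?s \<bullet> ?s)"
          unfolding nn_def jump_slope[OF m j] power2_norm_eq_inner by (simp add: power2_eq_square)
        ultimately show ?thesis by (simp add: a_def emid_def hh_def)
      qed
      ultimately show ?thesis
        by (simp add: Henstock_Kurzweil_Integration.integral_diff integrable_continuous_real continuous_on_inner ca cb)
    qed
    have bn: "norm (b \<rho>) \<le> K * h\<^sup>2" if "\<rho> \<in> ?I" for \<rho>
    proof -
      have "norm (b \<rho>) \<le> K * (hh q j)\<^sup>2" using interpolation_error(1)[OF m j zero_T that] by (simp add: b_def norm_minus_commute)
      also have "\<dots> \<le> K * h\<^sup>2" using hj K0 by (intro mult_left_mono power_mono) auto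
      finally show ?thesis .
    qed
    have an: "norm (a \<rho>) \<le> norm (mid ?e j) + norm (jump ?e j)" if "\<rho> \<in> ?I" for \<rho>
      unfolding a_def by (rule affine_norm_le[OF m j that])
    have "norm (integral ?I (\<lambda>\<rho>. b \<rho> \<bullet> a \<rho>)) \<le> (q (Suc j) - q j) * ((K * h\<^sup>2) * (norm (mid ?e j) + norm (jump ?e j)))"
    proof (rule integral_norm_bound[OF continuous_on_inner[OF cb ca] _ le(1)])
      fix \<rho> assume \<rho>: "\<rho> \<in> ?I"
      have "norm (b \<rho> \<bullet> a \<rho>) \<le> norm (b \<rho>) * norm (a \<rho>)" by (simp add: Cauchy_Schwarz_ineq2)
      also have "\<dots> \<le> (K * h\<^sup>2) * (norm (mid ?e j) + norm (jump ?e j))"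
        using bn[OF \<rho>] an[OF \<rho>] K0 by (intro mult_mono) auto
      finally show "norm (b \<rho> \<bullet> a \<rho>) \<le> (K * h\<^sup>2) * (norm (mid ?e j) + norm (jump ?e j))" .
    qed
    then have t2n: "integral ?I (\<lambda>\<rho>. b \<rho> \<bullet> a \<rho>) \<le> hh q j * ((norm (mid ?e j) + norm (jump ?e j)) * (K * h\<^sup>2))"
      by (simp add: hh_def mult.commute)
    have y1: "R1 \<bullet> ?s \<le> hh q j * (\<gamma> / 2 * (norm ?s)\<^sup>2 + D\<^sup>2 / (2 * \<gamma>) * h ^ 4)"
    proof -
      have "R1 \<bullet> ?s \<le> norm R1 * norm ?s" by (rule norm_cauchy_schwarz)
      also have "\<dots> \<le> hh q j * (D * h\<^sup>2) * norm ?s" using R1n by (rule mult_right_mono) simp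
      also have "\<dots> = hh q j * (norm ?s * (D * h\<^sup>2))" by simp
      also have "\<dots> \<le> hh q j * (\<gamma> / 2 * (norm ?s)\<^sup>2 + (D * h\<^sup>2)\<^sup>2 / (2 * \<gamma>))"
        using hj by (intro mult_left_mono young_weighted \<gamma>) auto
      finally show ?thesis by (simp add: power_mult_distrib)
    qed
    have y2: "(norm (mid ?e j) + norm (jump ?e j)) * (K * h\<^sup>2) \<le> nn ?e j / 2 + 12 * K\<^sup>2 * h ^ 4"
    proof -
      have "(norm (mid ?e j) + norm (jump ?e j)) * (K * h\<^sup>2)
        \<le> (1 / 24) / 2 * (norm (mid ?e j) + norm (jump ?e j))\<^sup>2 + (K * h\<^sup>2)\<^sup>2 / (2 * (1 / 24))"
        by (rule young_weighted) simp
      also have "\<dots> \<le> nn ?e j / 2 + 12 * K\<^sup>2 * h ^ 4" using norm_sum_square_le[of ?e j] by (simp add: power_mult_distrib)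
      finally show ?thesis .
    qed
    have y3: "hh q j * ((norm (mid ?e j) + norm (jump ?e j)) * (K * h\<^sup>2)) \<le> hh q j * (nn ?e j / 2 + 12 * K\<^sup>2 * h ^ 4)"
      using y2 hj by (intro mult_left_mono) auto
    have y4: "hh q j * (\<gamma> * (norm ?s)\<^sup>2) \<le> Hint q j ?s \<bullet> ?s" by (rule Hint_bounds(2)[OF m j])
    have z1: "hh q j * (\<gamma> / 2 * (norm ?s)\<^sup>2 + nn ?e j / 2) = hh q j * (\<gamma> * (norm ?s)\<^sup>2) - hh q j * (\<gamma> / 2 * (norm ?s)\<^sup>2) + hh q j * nn ?e j - hh q j * (nn ?e j / 2)"
      by (simp add: algebra_simps)
    have z2: "hh q j * ((D\<^sup>2 / (2 * \<gamma>) + 12 * K\<^sup>2) * h ^ 4) = hh q j * (D\<^sup>2 / (2 * \<gamma>) * h ^ 4) + hh q j * (12 * K\<^sup>2 * h ^ 4)"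
      by (simp add: algebra_simps)
    show ?thesis
      unfolding t1 t2 z1 z2 using y1[unfolded distrib_left] y3[unfolded distrib_left] y4 t2n by linarith
  qed
  have "(\<Sum>j<J. hh q j * (\<gamma> / 2 * (norm (slope q ?e j))\<^sup>2 + nn ?e j / 2) - hh q j * ((D\<^sup>2 / (2 * \<gamma>) + 12 * K\<^sup>2) * h ^ 4)) \<le> - Q_form J q u ?e"
    unfolding Q_form_def sum_negf[symmetric] using elem by (intro sum_mono) auto
  then have "(\<Sum>j<J. hh q j * (\<gamma> / 2 * (norm (slope q ?e j))\<^sup>2 + nn ?e j / 2)) \<le> (\<Sum>j<J. hh q j * ((D\<^sup>2 / (2 * \<gamma>) + 12 * K\<^sup>2) * h ^ 4))"
    by (simp add: sum_subtractf Q0)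
  also have "\<dots> = (D\<^sup>2 / (2 * \<gamma>) + 12 * K\<^sup>2) * h ^ 4"
    unfolding sum_distrib_right[symmetric] sum_hh[OF m] by simp
  finally show ?thesis by (simp add: D_def h_def)
qed

end

section \<open>The scheme in terms of nodal values\<close>

context flow
begin

lemma step_eq_cong:
  assumes u: "\<And>j. j \<le> J \<Longrightarrow> u j = w j" and u': "\<And>j. j \<le> J \<Longrightarrow> u' j = w' j"
  shows "step_eq J q \<Delta>t u u' \<longleftrightarrow> step_eq J q \<Delta>t w w'"
proof -
  have "(\<Sum>j<J. hh q j * (1 / \<Delta>t * mprod (H (slope q u j)) (\<lambda>j. u' j - u j) v j + G (slope q u' j) \<bullet> slope q v j))
    = (\<Sum>j<J. hh q j * (1 / \<Delta>t * mprod (H (slope q w j)) (\<lambda>j. w' j - w j) v j + G (slope q w' j) \<bullet> slope q v j))" for v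
    by (intro sum.cong refl)
      (simp add: mprod_def mid_diff jump_diff elem_cong[of J u w, OF u] elem_cong[of J u' w', OF u'])
  then show ?thesis by (simp add: step_eq_def)
qed

lemma scheme_step_iff:
  assumes m: "mesh J q" and f: "f \<in> Vh J q" and g: "g \<in> Vh J q"
  shows "(\<forall>\<eta>\<in>Vh J q. 1 / \<Delta>t * (LINT \<rho>|\<I>. (H (d_rho f \<rho>) *v (g \<rho> - f \<rho>)) \<bullet> \<eta> \<rho>)
      + (LINT \<rho>|\<I>. G (d_rho g \<rho>) \<bullet> d_rho \<eta> \<rho>) = 0)
    \<longleftrightarrow> step_eq J q \<Delta>t (\<lambda>j. f (q j)) (\<lambda>j. g (q j))"
proof -
  let ?u = "\<lambda>j. f (q j)" and ?u' = "\<lambda>j. g (q j)"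
  define E where "E v = (\<Sum>j<J. hh q j * (1 / \<Delta>t * mprod (H (slope q ?u j)) (\<lambda>j. ?u' j - ?u j) v j + G (slope q ?u' j) \<bullet> slope q v j))" for v
  have lint: "1 / \<Delta>t * (LINT \<rho>|\<I>. (H (d_rho f \<rho>) *v (g \<rho> - f \<rho>)) \<bullet> \<eta> \<rho>)
      + (LINT \<rho>|\<I>. G (d_rho g \<rho>) \<bullet> d_rho \<eta> \<rho>) = E (\<lambda>j. \<eta> (q j))" if \<eta>: "\<eta> \<in> Vh J q" for \<eta>
  proof -
    have 1: "(LINT \<rho>|\<I>. (H (d_rho f \<rho>) *v (g \<rho> - f \<rho>)) \<bullet> \<eta> \<rho>)
      = (\<Sum>j<J. hh q j * mprod (H (slope q ?u j)) (\<lambda>j. ?u' j - ?u j) (\<lambda>j. \<eta> (q j)) j)"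
      by (rule LINT_mass[OF m g f \<eta>]) (simp add: Vh_d_rho(2)[OF m f])
    have 2: "(LINT \<rho>|\<I>. G (d_rho g \<rho>) \<bullet> d_rho \<eta> \<rho>) = (\<Sum>j<J. hh q j * (G (slope q ?u' j) \<bullet> slope q (\<lambda>j. \<eta> (q j)) j))"
      by (rule LINT_stiff[OF m \<eta>]) (simp add: Vh_d_rho(2)[OF m g])
    show ?thesis
      unfolding 1 2 E_def sum_distrib_left sum.distrib[symmetric]
      by (intro sum.cong refl) (simp add: algebra_simps)
  qed
  have "(\<forall>\<eta>\<in>Vh J q. E (\<lambda>j. \<eta> (q j)) = 0) \<longleftrightarrow> (\<forall>v. v J = v 0 \<longrightarrow> E v = 0)"
  proof (intro iffI ballI allI impI)
    fix v :: "nat \<Rightarrow> real^'d"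
    assume *: "\<forall>\<eta>\<in>Vh J q. E (\<lambda>j. \<eta> (q j)) = 0" and v: "v J = v 0"
    from Vh_exists[OF m v] obtain \<eta> where \<eta>: "\<eta> \<in> Vh J q" "\<And>j. j \<le> J \<Longrightarrow> \<eta> (q j) = v j" by blast
    have "E v = E (\<lambda>j. \<eta> (q j))"
      unfolding E_def by (intro sum.cong refl)
        (simp add: mprod_def elem_cong[of J "\<lambda>j. \<eta> (q j)" v, OF \<eta>(2)])
    with * \<eta> show "E v = 0" by simp
  next
    fix \<eta> :: "real \<Rightarrow> real^'d" assume *: "\<forall>v. v J = v 0 \<longrightarrow> E v = 0" and \<eta>: "\<eta> \<in> Vh J q"
    show "E (\<lambda>j. \<eta> (q j)) = 0" using * Vh_nodal_periodic[OF m \<eta>] mesh_ends[OF m] by simp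
  qed
  then show ?thesis using lint unfolding step_eq_def E_def by auto
qed

lemma initial_value: "x0 = (\<lambda>\<rho>. x \<rho> 0)"
  using sol by (auto simp: weak_solution_def)

lemma projection_iff:
  assumes m: "mesh J q" and z: "z \<in> Vh J q"
  shows "(\<forall>\<eta>\<in>Vh J q. (LINT \<rho>|\<I>. (Hess (d_rho x0 \<rho>) *v d_rho (\<lambda>\<sigma>. z \<sigma> - x0 \<sigma>) \<rho>) \<bullet> d_rho \<eta> \<rho>)
      + (LINT \<rho>|\<I>. (z \<rho> - x0 \<rho>) \<bullet> \<eta> \<rho>) = 0)
    \<longleftrightarrow> (\<forall>v. v J = v 0 \<longrightarrow> Q_form J q (\<lambda>j. z (q j)) v = 0)"
proof -
  let ?u = "\<lambda>j. z (q j)"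
  have lint: "(LINT \<rho>|\<I>. (Hess (d_rho x0 \<rho>) *v d_rho (\<lambda>\<sigma>. z \<sigma> - x0 \<sigma>) \<rho>) \<bullet> d_rho \<eta> \<rho>)
      + (LINT \<rho>|\<I>. (z \<rho> - x0 \<rho>) \<bullet> \<eta> \<rho>) = Q_form J q ?u (\<lambda>j. \<eta> (q j))" if \<eta>: "\<eta> \<in> Vh J q" for \<eta>
  proof -
    let ?v = "\<lambda>j. \<eta> (q j)"
    have d: "d_rho (\<lambda>\<sigma>. z \<sigma> - x \<sigma> 0) \<rho> = slope q ?u j - xr \<rho> 0" if "j < J" "\<rho> \<in> {q j<..<q (Suc j)}" for j \<rho>
      unfolding d_rho_def
      by (rule vector_derivative_at[OF has_vector_derivative_diff[OF Vh_d_rho(1)[OF m z that] xr_deriv[OF zero_T]]])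
    have 1: "(LINT \<rho>|\<I>. (Hess (d_rho x0 \<rho>) *v d_rho (\<lambda>\<sigma>. z \<sigma> - x0 \<sigma>) \<rho>) \<bullet> d_rho \<eta> \<rho>)
      = (\<Sum>j<J. integral {q j..q (Suc j)} (\<lambda>\<rho>. (Hess (xr \<rho> 0) *v (slope q ?u j - xr \<rho> 0)) \<bullet> slope q ?v j))"
    proof (rule LINT_mesh(2)[OF m])
      show "continuous_on {q j..q (Suc j)} (\<lambda>\<rho>. (Hess (xr \<rho> 0) *v (slope q ?u j - xr \<rho> 0)) \<bullet> slope q ?v j)" for j
        by (intro continuous_on_inner continuous_on_const Hess_matvec_cont continuous_on_diff xr_cont[OF zero_T])
      show "(Hess (d_rho x0 \<rho>) *v d_rho (\<lambda>\<sigma>. z \<sigma> - x0 \<sigma>) \<rho>) \<bullet> d_rho \<eta> \<rho>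
        = (Hess (xr \<rho> 0) *v (slope q ?u j - xr \<rho> 0)) \<bullet> slope q ?v j" if "j < J" "\<rho> \<in> {q j<..<q (Suc j)}" for j \<rho>
        unfolding initial_value d[OF that] Vh_d_rho(2)[OF m \<eta> that] xr_def ..
    qed
    have 2: "(LINT \<rho>|\<I>. (z \<rho> - x0 \<rho>) \<bullet> \<eta> \<rho>) = (\<Sum>j<J. integral {q j..q (Suc j)}
        (\<lambda>\<rho>. ((mid ?u j + (\<rho> - emid q j) *\<^sub>R slope q ?u j) - x \<rho> 0) \<bullet> (mid ?v j + (\<rho> - emid q j) *\<^sub>R slope q ?v j)))"
    proof (rule LINT_mesh(2)[OF m])
      show "continuous_on {q j..q (Suc j)} (\<lambda>\<rho>. ((mid ?u j + (\<rho> - emid q j) *\<^sub>R slope q ?u j) - x \<rho> 0) \<bullet> (mid ?v j + (\<rho> - emid q j) *\<^sub>R slope q ?v j))" for j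
        by (intro continuous_intros x_cont[OF zero_T])
      show "(z \<rho> - x0 \<rho>) \<bullet> \<eta> \<rho>
        = ((mid ?u j + (\<rho> - emid q j) *\<^sub>R slope q ?u j) - x \<rho> 0) \<bullet> (mid ?v j + (\<rho> - emid q j) *\<^sub>R slope q ?v j)"
        if j: "j < J" and \<rho>: "\<rho> \<in> {q j<..<q (Suc j)}" for j \<rho>
      proof -
        have "\<rho> \<in> {q j..q (Suc j)}" using \<rho> by simp
        from Vh_affine[OF m z j this] Vh_affine[OF m \<eta> j this] show ?thesis by (simp only: initial_value)
      qed
    qed
    show ?thesis unfolding 1 2 Q_form_def sum.distrib ..
  qed
  have "(\<forall>\<eta>\<in>Vh J q. Q_form J q ?u (\<lambda>j. \<eta> (q j)) = 0) \<longleftrightarrow> (\<forall>v. v J = v 0 \<longrightarrow> Q_form J q ?u v = 0)"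
  proof (intro iffI ballI allI impI)
    fix v :: "nat \<Rightarrow> real^'d"
    assume *: "\<forall>\<eta>\<in>Vh J q. Q_form J q ?u (\<lambda>j. \<eta> (q j)) = 0" and v: "v J = v 0"
    from Vh_exists[OF m v] obtain \<eta> where \<eta>: "\<eta> \<in> Vh J q" "\<And>j. j \<le> J \<Longrightarrow> \<eta> (q j) = v j" by blast
    have "Q_form J q ?u v = Q_form J q ?u (\<lambda>j. \<eta> (q j))" using \<eta>(2) by (intro Q_form_cong) auto
    with * \<eta> show "Q_form J q ?u v = 0" by simp
  next
    fix \<eta> :: "real \<Rightarrow> real^'d" assume *: "\<forall>v. v J = v 0 \<longrightarrow> Q_form J q ?u v = 0" and \<eta>: "\<eta> \<in> Vh J q"
    show "Q_form J q ?u (\<lambda>j. \<eta> (q j)) = 0" using * Vh_nodal_periodic[OF m \<eta>] mesh_ends[OF m] by simp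
  qed
  then show ?thesis using lint by auto
qed

text \<open>The projection is defined by a definite description; existence and uniqueness for nodal values give
  access to it.\<close>

lemma Qh_characterization:
  assumes m: "mesh J q"
  shows "Qh \<phi> J q x0 \<in> Vh J q" "\<And>v. v J = v 0 \<Longrightarrow> Q_form J q (\<lambda>j. Qh \<phi> J q x0 (q j)) v = 0"
proof -
  let ?R = "\<lambda>z. z \<in> Vh J q \<and> (\<forall>\<eta>\<in>Vh J q. (LINT \<rho>|\<I>. (Hess (d_rho x0 \<rho>) *v d_rho (\<lambda>\<sigma>. z \<sigma> - x0 \<sigma>) \<rho>) \<bullet> d_rho \<eta> \<rho>)
      + (LINT \<rho>|\<I>. (z \<rho> - x0 \<rho>) \<bullet> \<eta> \<rho>) = 0)"
  have R: "?R z \<longleftrightarrow> z \<in> Vh J q \<and> (\<forall>v. v J = v 0 \<longrightarrow> Q_form J q (\<lambda>j. z (q j)) v = 0)" for z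
    using projection_iff[OF m] by blast
  obtain u where u: "u J = u 0" "\<And>v. v J = v 0 \<Longrightarrow> Q_form J q u v = 0" using projection_solvable[OF m] by blast
  from Vh_exists[OF m u(1)] obtain z where z: "z \<in> Vh J q" "\<And>j. j \<le> J \<Longrightarrow> z (q j) = u j" by blast
  have "Q_form J q (\<lambda>j. z (q j)) v = Q_form J q u v" for v using z(2) by (intro Q_form_cong) auto
  then have Rz: "?R z" unfolding R using z(1) u(2) by simp
  have "y = z" if "?R y" for y
  proof (rule Vh_eqI[OF m])
    have y: "y \<in> Vh J q" "\<And>v. v J = v 0 \<Longrightarrow> Q_form J q (\<lambda>j. y (q j)) v = 0"
      using that unfolding R by blast+
    have z': "\<And>v. v J = v 0 \<Longrightarrow> Q_form J q (\<lambda>j. z (q j)) v = 0"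
      using Rz unfolding R by blast
    show "y \<in> Vh J q" "z \<in> Vh J q" by (fact y(1), fact z(1))
    show "y (q j) = z (q j)" if "j < J" for j
      using projection_unique[OF m Vh_nodal_periodic[OF m y(1)] y(2) Vh_nodal_periodic[OF m z(1)] z' that] by simp
  qed
  with Rz have "\<exists>!z. ?R z" by blast
  from theI'[OF this] have "?R (Qh \<phi> J q x0)" unfolding Qh_def .
  then show "Qh \<phi> J q x0 \<in> Vh J q" "\<And>v. v J = v 0 \<Longrightarrow> Q_form J q (\<lambda>j. Qh \<phi> J q x0 (q j)) v = 0"
    unfolding R by blast+
qed

section \<open>Existence, uniqueness and convergence of the discrete solution\<close>

definition E0 :: real where "E0 = ((real CARD('d))\<^sup>2 * B * K\<^sup>2)\<^sup>2 / (2 * \<gamma>) + 12 * K\<^sup>2"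
definition \<Lambda>0 :: real where "\<Lambda>0 = ((\<Gamma> + C) * (2 / \<gamma>) + 2 * \<beta>) * E0 + C + \<kappa>"
definition \<Lambda> :: real where "\<Lambda> = exp (M3 * T) * (\<Lambda>0 + M4 * T)"

lemma \<Lambda>_nonneg: "0 \<le> \<Lambda>0" "0 \<le> \<Lambda>"
proof -
  have "0 \<le> E0" using \<gamma> by (simp add: E0_def)
  then show "0 \<le> \<Lambda>0" using \<gamma> \<Gamma> C0' \<beta>_pos by (simp add: \<Lambda>0_def \<kappa>_def)
  then show "0 \<le> \<Lambda>" using M_nonneg T by (simp add: \<Lambda>_def)
qed

lemma S_lower:
  assumes "mesh J q" "K * mesh_size J q \<le> c0 / 8" "t \<in> {0..T}"
  shows "(\<Sum>j<J. hh q j * (\<gamma> / 4 * (norm (slope q (err q u t) j))\<^sup>2 + \<beta> * nn (err q u t) j)) \<le> S J q u t"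
  unfolding S_def
  by (intro sum_mono mult_left_mono Sj_lower assms less_imp_le[OF hh_pos[OF assms(1)]]) auto

text \<open>The energy starts out at the fourth power of the mesh size because the initial error is measured against
  the nodal interpolant, to which the projection is superclose.\<close>

lemma initial_energy:
  assumes m: "mesh J q" and small: "K * mesh_size J q \<le> c0 / 8"
    and u: "u J = u 0" "\<And>v. v J = v 0 \<Longrightarrow> Q_form J q u v = 0"
  shows "S J q u 0 \<le> \<Lambda>0 * (mesh_size J q) ^ 4"
proof -
  let ?h = "mesh_size J q"
  define a where "a = (\<Gamma> + C) * (2 / \<gamma>) + 2 * \<beta>"
  have a: "0 \<le> a" using \<gamma> \<Gamma> C0' \<beta>_pos by (simp add: a_def)
  define s where "s j = (norm (slope q (err q u 0) j))\<^sup>2" for j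
  define n where "n j = nn (err q u 0) j" for j
  have sn: "0 \<le> s j" "0 \<le> n j" for j by (simp_all add: s_def n_def nn_nonneg)
  have "hh q j * Sj q ?h u 0 j \<le> a * (hh q j * (\<gamma> / 2 * s j + n j / 2)) + hh q j * ((C + \<kappa>) * ?h ^ 4)" if j: "j < J" for j
  proof -
    have "Sj q ?h u 0 j \<le> (\<Gamma> + C) * s j + (C + \<kappa>) * ?h ^ 4 + \<beta> * n j"
      using Sj_upper[OF m j small zero_T, of u] by (simp only: s_def n_def)
    also have "\<dots> \<le> a * (\<gamma> / 2 * s j + n j / 2) + (C + \<kappa>) * ?h ^ 4"
    proof -
      have "a * (\<gamma> / 2 * s j + n j / 2) = (\<Gamma> + C) * s j + \<beta> * n j + ((\<Gamma> + C) * (2 / \<gamma>) * (n j / 2) + 2 * \<beta> * (\<gamma> / 2 * s j))"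
        unfolding a_def using \<gamma> by (simp add: field_simps)
      moreover have "0 \<le> (\<Gamma> + C) * (2 / \<gamma>) * (n j / 2) + 2 * \<beta> * (\<gamma> / 2 * s j)"
        using \<gamma> \<Gamma> C0' \<beta>_pos sn[of j] by simp
      ultimately show ?thesis by linarith
    qed
    finally have "hh q j * Sj q ?h u 0 j \<le> hh q j * (a * (\<gamma> / 2 * s j + n j / 2) + (C + \<kappa>) * ?h ^ 4)"
      using hh_pos[OF m j] by (intro mult_left_mono) auto
    then show ?thesis by (simp only: distrib_left mult.left_commute)
  qed
  then have "S J q u 0 \<le> (\<Sum>j<J. a * (hh q j * (\<gamma> / 2 * s j + n j / 2)) + hh q j * ((C + \<kappa>) * ?h ^ 4))"
    unfolding S_def by (intro sum_mono) auto
  also have "\<dots> = a * (\<Sum>j<J. hh q j * (\<gamma> / 2 * s j + n j / 2)) + (C + \<kappa>) * ?h ^ 4"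
    unfolding sum.distrib sum_distrib_left[symmetric] sum_distrib_right[symmetric] sum_hh[OF m] by simp
  also have "\<dots> \<le> a * (E0 * ?h ^ 4) + (C + \<kappa>) * ?h ^ 4"
    using projection_superclose[OF m small u] a unfolding s_def n_def E0_def by (intro add_right_mono mult_left_mono)
  also have "\<dots> = \<Lambda>0 * ?h ^ 4" by (simp add: \<Lambda>0_def a_def algebra_simps)
  finally show ?thesis .
qed

context
  fixes J M :: nat and q and c \<Delta>t :: real
  assumes m: "mesh J q" and qu: "quasi_uniform c J q" and c: "0 < c" and M: "0 < M" "\<Delta>t = T / real M"
    and small: "K * mesh_size J q \<le> c0 / 8" "K * \<Delta>t \<le> c0 / 8" "mesh_size J q \<le> 1" "\<Delta>t \<le> mesh_size J q"
      "256 * \<Lambda> * c * mesh_size J q \<le> \<gamma> * c0\<^sup>2"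
begin

abbreviation "h \<equiv> mesh_size J q"

definition y where "y = h\<^sup>2 + \<Delta>t"

lemma dt: "0 < \<Delta>t" and h_pos: "0 < h" and y_nonneg: "0 \<le> y" and time: "n \<le> M \<Longrightarrow> real n * \<Delta>t \<in> {0..T}"
proof -
  show dt: "0 < \<Delta>t" using M T by simp
  show "0 < h" using dt small(4) by simp
  show "0 \<le> y" using dt by (simp add: y_def)
  assume "n \<le> M"
  then have "real n * \<Delta>t \<le> real M * \<Delta>t" using dt by (intro mult_right_mono) auto
  moreover have "real M * \<Delta>t = T" using M by simp
  moreover have "0 \<le> real n * \<Delta>t" using dt by simp
  ultimately show "real n * \<Delta>t \<in> {0..T}" by simp
qed

text \<open>An inverse estimate: the energy bounds the error of the tangent on a single element only after division
  by the length of the element. By quasi-uniformity and since the time step is bounded by the mesh size,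
  \<open>y\<^sup>2 / h \<le> 4 h\<close>, so the error of the tangent is small for small \<open>h\<close>.\<close>

lemma near_exact_of_energy:
  assumes t: "t \<in> {0..T}" and S: "S J q u t \<le> \<Lambda> * y\<^sup>2"
  shows "near_exact J q u t"
  unfolding near_exact_def
proof (intro allI impI)
  fix j assume j: "j < J"
  let ?e = "norm (slope q (err q u t) j)"
  have hj: "0 < hh q j" by (rule hh_pos[OF m j])
  have "hh q j * (\<gamma> / 4 * ?e\<^sup>2) \<le> hh q j * (\<gamma> / 4 * ?e\<^sup>2 + \<beta> * nn (err q u t) j)"
    using hj \<beta>_pos nn_nonneg[of "err q u t" j] by (intro mult_left_mono) auto
  also have "\<dots> \<le> (\<Sum>j<J. hh q j * (\<gamma> / 4 * (norm (slope q (err q u t) j))\<^sup>2 + \<beta> * nn (err q u t) j))"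
    using j hh_pos[OF m] \<gamma> \<beta>_pos
    by (intro member_le_sum) (auto intro!: mult_nonneg_nonneg add_nonneg_nonneg nn_nonneg simp: less_imp_le)
  also have "\<dots> \<le> \<Lambda> * y\<^sup>2" using S_lower[OF m small(1) t, of u] S by linarith
  also have "\<dots> \<le> \<Lambda> * (4 * h\<^sup>2)"
  proof (rule mult_left_mono[OF _ \<Lambda>_nonneg(2)])
    have "h * h \<le> h * 1" using small(3) h_pos by (intro mult_left_mono) auto
    then have "y \<le> 2 * h" using small(4) by (simp add: y_def power2_eq_square)
    then have "y\<^sup>2 \<le> (2 * h)\<^sup>2" using y_nonneg by (rule power_mono)
    then show "y\<^sup>2 \<le> 4 * h\<^sup>2" by (simp add: power_mult_distrib)
  qed
  also have "\<dots> = 4 * \<Lambda> * h * h" by (simp add: power2_eq_square)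
  also have "\<dots> \<le> 4 * \<Lambda> * h * (c * hh q j)"
    using mesh_size_le_hh[OF m qu j] \<Lambda>_nonneg h_pos by (intro mult_left_mono) auto
  also have "\<dots> = hh q j * ((256 * \<Lambda> * c * h) / 64)" by simp
  also have "\<dots> \<le> hh q j * (\<gamma> * c0\<^sup>2 / 64)" using small(5) hj by (intro mult_left_mono divide_right_mono) auto
  finally have "\<gamma> / 4 * ?e\<^sup>2 \<le> \<gamma> * c0\<^sup>2 / 64" using hj by (rule mult_left_le_imp_le)
  then have "\<gamma> * ?e\<^sup>2 \<le> \<gamma> * (c0 / 4)\<^sup>2" by (simp add: power_divide)
  then have "?e\<^sup>2 \<le> (c0 / 4)\<^sup>2" using \<gamma> by (rule mult_left_le_imp_le)
  then show "?e \<le> c0 / 4" by (rule power2_le_imp_le) (use c0 in simp)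
qed

text \<open>An initial segment of a discrete solution. Whether the next step is solvable depends on the error bound for
  the steps so far, so existence is proved by extending segments.\<close>

definition trajectory :: "nat \<Rightarrow> (nat \<Rightarrow> real \<Rightarrow> real^'d) \<Rightarrow> bool" where
  "trajectory n f \<longleftrightarrow> f 0 = Qh \<phi> J q x0 \<and> (\<forall>k\<le>n. f k \<in> Vh J q) \<and>
     (\<forall>k<n. step_eq J q \<Delta>t (\<lambda>j. f k (q j)) (\<lambda>j. f (Suc k) (q j)))"

text \<open>The discrete Gronwall lemma, with the comparison sequence \<open>b\<close> written out. The induction also carries the
  closeness of the tangents, without which a step of the energy estimate is not available.\<close>

lemma trajectory_energy:
  assumes f: "trajectory n f" and n: "n \<le> M"
  shows "S J q (\<lambda>j. f n (q j)) (real n * \<Delta>t) \<le> \<Lambda> * y\<^sup>2"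
proof -
  define b where "b k = exp (M3 * (real k * \<Delta>t)) * (\<Lambda>0 + M4 * (real k * \<Delta>t)) * y\<^sup>2" for k
  have b_le: "b k \<le> \<Lambda> * y\<^sup>2" if "k \<le> M" for k
  proof -
    have "real k * \<Delta>t \<le> T" "0 \<le> real k * \<Delta>t" using time[OF that] by auto
    then show ?thesis unfolding b_def \<Lambda>_def using M_nonneg \<Lambda>_nonneg T
      by (intro mult_right_mono mult_mono) (auto intro!: mult_left_mono mult_nonneg_nonneg add_nonneg_nonneg)
  qed
  have "S J q (\<lambda>j. f k (q j)) (real k * \<Delta>t) \<le> b k" if "k \<le> n" for k
    using that
  proof (induction k)
    case 0
    have V: "f 0 \<in> Vh J q" using f Qh_characterization(1)[OF m] by (simp add: trajectory_def)
    have per: "f 0 (q J) = f 0 (q 0)" by (rule Vh_nodal_periodic[OF m V])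
    have orth: "Q_form J q (\<lambda>j. f 0 (q j)) v = 0" if "v J = v 0" for v
      using Qh_characterization(2)[OF m that] f by (simp add: trajectory_def)
    have "S J q (\<lambda>j. f 0 (q j)) 0 \<le> \<Lambda>0 * h ^ 4"
      by (rule initial_energy[OF m small(1) per orth])
    also have "\<dots> \<le> \<Lambda>0 * y\<^sup>2"
    proof (rule mult_left_mono[OF _ \<Lambda>_nonneg(1)])
      have "(h\<^sup>2)\<^sup>2 \<le> y\<^sup>2" using dt by (intro power_mono) (auto simp: y_def)
      then show "h ^ 4 \<le> y\<^sup>2" by simp
    qed
    finally show ?case by (simp add: b_def)
  next
    case (Suc k)
    then have k: "k \<le> n" "k < n" "k \<le> M" "Suc k \<le> M" using n by auto
    have IH: "S J q (\<lambda>j. f k (q j)) (real k * \<Delta>t) \<le> b k" using Suc k by simp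
    have V: "f k \<in> Vh J q" "f (Suc k) \<in> Vh J q" and step: "step_eq J q \<Delta>t (\<lambda>j. f k (q j)) (\<lambda>j. f (Suc k) (q j))"
      using f k Suc.prems by (auto simp: trajectory_def)
    have ne: "near_exact J q (\<lambda>j. f k (q j)) (real k * \<Delta>t)"
      using IH b_le[OF k(3)] by (intro near_exact_of_energy time k) linarith
    have tn: "real (Suc k) * \<Delta>t = real k * \<Delta>t + \<Delta>t" by (simp add: algebra_simps)
    have "S J q (\<lambda>j. f (Suc k) (q j)) (real k * \<Delta>t + \<Delta>t) \<le> (1 + M3 * \<Delta>t) * S J q (\<lambda>j. f k (q j)) (real k * \<Delta>t) + M4 * \<Delta>t * y\<^sup>2"
      unfolding y_def
      by (rule energy_step[OF m small(1) time[OF k(3)] time[OF k(4), unfolded tn] dt small(2)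
            Vh_nodal_periodic[OF m V(1)] Vh_nodal_periodic[OF m V(2)] ne step])
    also have "\<dots> \<le> exp (M3 * \<Delta>t) * b k + exp (M3 * (real k * \<Delta>t + \<Delta>t)) * (M4 * \<Delta>t) * y\<^sup>2"
    proof (rule add_mono)
      have p: "0 \<le> M3 * \<Delta>t" "0 \<le> M4 * \<Delta>t" "0 \<le> M3 * (real k * \<Delta>t + \<Delta>t)" using M_nonneg dt by auto
      have "(1 + M3 * \<Delta>t) * S J q (\<lambda>j. f k (q j)) (real k * \<Delta>t) \<le> (1 + M3 * \<Delta>t) * b k"
        using IH p by (intro mult_left_mono) auto
      also have "\<dots> \<le> exp (M3 * \<Delta>t) * b k"
        using M_nonneg \<Lambda>_nonneg dt by (intro mult_right_mono exp_ge_add_one_self) (auto simp: b_def)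
      finally show "(1 + M3 * \<Delta>t) * S J q (\<lambda>j. f k (q j)) (real k * \<Delta>t) \<le> exp (M3 * \<Delta>t) * b k" .
      have "1 * (M4 * \<Delta>t) \<le> exp (M3 * (real k * \<Delta>t + \<Delta>t)) * (M4 * \<Delta>t)"
        using p by (intro mult_right_mono) auto
      then show "M4 * \<Delta>t * y\<^sup>2 \<le> exp (M3 * (real k * \<Delta>t + \<Delta>t)) * (M4 * \<Delta>t) * y\<^sup>2"
        by (intro mult_right_mono) auto
    qed
    also have "\<dots> = b (Suc k)"
      unfolding b_def tn by (simp add: distrib_left exp_add algebra_simps)
    finally show ?case unfolding tn .
  qed
  from order_trans[OF this[OF order_refl] b_le[OF n]] show ?thesis .
qed

lemma trajectory_mono: "trajectory n f \<Longrightarrow> k \<le> n \<Longrightarrow> trajectory k f"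
  by (simp add: trajectory_def)

lemma trajectory_near_exact: "trajectory n f \<Longrightarrow> n \<le> M \<Longrightarrow> near_exact J q (\<lambda>j. f n (q j)) (real n * \<Delta>t)"
  by (rule near_exact_of_energy[OF time trajectory_energy])

lemma trajectory_slope:
  assumes "trajectory n f" "n \<le> M" "j < J"
  shows "slope q (\<lambda>j. f n (q j)) j \<in> annulus (c0 / 2) (C0 + c0 / 2)"
  using near_exact_slope[OF m small(1) time[OF assms(2)] trajectory_near_exact[OF assms(1,2)] assms(3)] .

lemma trajectory_exists: "n \<le> M \<Longrightarrow> \<exists>f. trajectory n f"
proof (induction n)
  case 0
  show ?case using Qh_characterization(1)[OF m] by (auto simp: trajectory_def)
next
  case (Suc n)
  then obtain f where f: "trajectory n f" by auto
  have "n \<le> M" using Suc by simp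
  from step_solvable[OF m dt trajectory_slope[OF f this]]
  obtain u' where u': "u' J = u' 0" "step_eq J q \<Delta>t (\<lambda>j. f n (q j)) u'" by blast
  from Vh_exists[OF m u'(1)] obtain g where g: "g \<in> Vh J q" "\<And>j. j \<le> J \<Longrightarrow> g (q j) = u' j" by blast
  have step: "step_eq J q \<Delta>t (\<lambda>j. f n (q j)) (\<lambda>j. g (q j))"
    using u'(2) step_eq_cong[of J "\<lambda>j. f n (q j)" "\<lambda>j. f n (q j)" "\<lambda>j. g (q j)" u'] g(2) by simp
  have "trajectory (Suc n) (f(Suc n := g))"
    using f g(1) step by (auto simp: trajectory_def le_Suc_eq less_Suc_eq)
  then show ?case by blast
qed

lemma trajectory_unique:
  assumes f: "trajectory n f" "trajectory n g" and n: "n \<le> M"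
  shows "k \<le> n \<Longrightarrow> f k = g k"
proof (induction k)
  case 0
  then show ?case using f by (simp add: trajectory_def)
next
  case (Suc k)
  then have k: "k \<le> n" "k < n" "k \<le> M" "f k = g k" using n by auto
  have V: "f (Suc k) \<in> Vh J q" "g (Suc k) \<in> Vh J q" using f Suc.prems by (auto simp: trajectory_def)
  have step: "step_eq J q \<Delta>t (\<lambda>j. f k (q j)) (\<lambda>j. f (Suc k) (q j))" "step_eq J q \<Delta>t (\<lambda>j. f k (q j)) (\<lambda>j. g (Suc k) (q j))"
    using f k by (auto simp: trajectory_def)
  show ?case
  proof (rule Vh_eqI[OF m V])
    fix j assume j: "j < J"
    show "f (Suc k) (q j) = g (Suc k) (q j)"
      using step_unique[OF m dt trajectory_slope[OF trajectory_mono[OF f(1) k(1)] k(3)]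
          Vh_nodal_periodic[OF m V(1)] step(1) Vh_nodal_periodic[OF m V(2)] step(2) j] by simp
  qed
qed

lemma trajectory_regular:
  assumes f: "trajectory n f" and n: "n \<le> M"
  shows "AE \<rho> in \<I>. d_rho (f n) \<rho> \<noteq> 0"
proof -
  have V: "f n \<in> Vh J q" using f by (simp add: trajectory_def)
  have "d_rho (f n) \<rho> \<noteq> 0" if \<rho>: "\<rho> \<in> {0..1}" "\<rho> \<notin> q ` {..J}" for \<rho>
  proof -
    obtain j where j: "j < J" "\<rho> \<in> {q j..q (Suc j)}" using mesh_cover[OF m \<rho>(1)] by blast
    have "\<rho> \<noteq> q j" "\<rho> \<noteq> q (Suc j)" using \<rho>(2) j(1) by auto
    then have "\<rho> \<in> {q j<..<q (Suc j)}" using j(2) by auto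
    then have "d_rho (f n) \<rho> = slope q (\<lambda>j. f n (q j)) j" by (rule Vh_d_rho(2)[OF m V j(1)])
    then show ?thesis using annulus_nonzero[OF trajectory_slope[OF f n j(1)]] c0 by simp
  qed
  moreover have "negligible (q ` {..J})" by (intro negligible_finite) simp
  ultimately show ?thesis
    by (intro AE_I'[of "{0..1} \<inter> q ` {..J}"]) (auto simp: null_sets_restrict_space negligible_iff_null_sets intro: null_set_Int1)
qed

lemma scheme_solution_iff:
  "scheme_solution \<phi> \<mu> J q M \<Delta>t x0 xh \<longleftrightarrow> xh \<in> extensional {0..M} \<and> trajectory M xh"
proof
  assume s: "scheme_solution \<phi> \<mu> J q M \<Delta>t x0 xh"
  then have V: "xh k \<in> Vh J q" if "k \<le> M" for k using that by (auto simp: scheme_solution_def)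
  have "step_eq J q \<Delta>t (\<lambda>j. xh k (q j)) (\<lambda>j. xh (Suc k) (q j))" if "k < M" for k
  proof -
    have "k \<le> M" "Suc k \<le> M" using that by auto
    from scheme_step_iff[OF m V[OF this(1)] V[OF this(2)]] s that show ?thesis unfolding scheme_solution_def by blast
  qed
  then show "xh \<in> extensional {0..M} \<and> trajectory M xh"
    using s V by (auto simp: scheme_solution_def trajectory_def PiE_def)
next
  assume "xh \<in> extensional {0..M} \<and> trajectory M xh"
  then have e: "xh \<in> extensional {0..M}" and t: "trajectory M xh" by auto
  then have V: "xh k \<in> Vh J q" if "k \<le> M" for k using that by (auto simp: trajectory_def)
  have "\<forall>\<eta>\<in>Vh J q. 1 / \<Delta>t * (LINT \<rho>|\<I>. (H (d_rho (xh k) \<rho>) *v (xh (Suc k) \<rho> - xh k \<rho>)) \<bullet> \<eta> \<rho>)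
      + (LINT \<rho>|\<I>. G (d_rho (xh (Suc k)) \<rho>) \<bullet> d_rho \<eta> \<rho>) = 0" if "k < M" for k
  proof -
    have "k \<le> M" "Suc k \<le> M" using that by auto
    from scheme_step_iff[OF m V[OF this(1)] V[OF this(2)]] t that show ?thesis unfolding trajectory_def by blast
  qed
  moreover have "AE \<rho> in \<I>. d_rho (xh k) \<rho> \<noteq> 0" if "k < M" for k
    using that by (intro trajectory_regular[OF trajectory_mono[OF t]]) auto
  ultimately show "scheme_solution \<phi> \<mu> J q M \<Delta>t x0 xh"
    unfolding scheme_solution_def using e t V by (auto simp: PiE_def trajectory_def)
qed

lemma scheme_has_unique_solution: "\<exists>!xh. scheme_solution \<phi> \<mu> J q M \<Delta>t x0 xh"
proof -
  obtain f where f: "trajectory M f" using trajectory_exists by blast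
  have "trajectory M (restrict f {0..M})" using f by (auto simp: trajectory_def)
  then have "scheme_solution \<phi> \<mu> J q M \<Delta>t x0 (restrict f {0..M})" by (simp add: scheme_solution_iff)
  moreover have "xh = xh'" if "scheme_solution \<phi> \<mu> J q M \<Delta>t x0 xh" "scheme_solution \<phi> \<mu> J q M \<Delta>t x0 xh'" for xh xh'
    using that trajectory_unique[of M xh xh'] unfolding scheme_solution_iff by (intro extensionalityI[of xh "{0..M}"]) auto
  ultimately show ?thesis by blast
qed

text \<open>To the error at the nodes, controlled by the energy, the interpolation error is added: it is of second
  order in \<open>L\<^sup>2\<close> and of first order for the derivative.\<close>

lemma error_at_time:
  assumes f: "f \<in> Vh J q" and t: "t \<in> {0..T}" and S: "S J q (\<lambda>j. f (q j)) t \<le> \<Lambda> * y\<^sup>2"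
  shows "(L2_norm (\<lambda>\<rho>. x \<rho> t - f \<rho>))\<^sup>2 \<le> (4 * K\<^sup>2 + 96 * \<Lambda> / \<beta>) * (h ^ 4 + \<Delta>t\<^sup>2)"
    "(H1_seminorm (\<lambda>\<rho>. x \<rho> t - f \<rho>))\<^sup>2 \<le> (2 * K\<^sup>2 + 16 * \<Lambda> / \<gamma>) * (h\<^sup>2 + \<Delta>t\<^sup>2)"
proof -
  define u where "u = (\<lambda>j. f (q j))"
  define e where "e = err q u t"
  define s where "s j = (norm (slope q e j))\<^sup>2" for j
  have sn: "0 \<le> s j" "0 \<le> nn e j" for j by (simp_all add: s_def nn_nonneg)
  have lo: "(\<Sum>j<J. hh q j * (\<gamma> / 4 * s j + \<beta> * nn e j)) \<le> \<Lambda> * y\<^sup>2"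
    using S_lower[OF m small(1) t, of u] S unfolding u_def[symmetric] e_def s_def by linarith
  have part: "(\<Sum>j<J. hh q j * (\<beta> * nn e j)) \<le> \<Lambda> * y\<^sup>2" "(\<Sum>j<J. hh q j * (\<gamma> / 4 * s j)) \<le> \<Lambda> * y\<^sup>2"
  proof -
    have "(\<Sum>j<J. hh q j * (\<beta> * nn e j)) \<le> (\<Sum>j<J. hh q j * (\<gamma> / 4 * s j + \<beta> * nn e j))"
      using sn \<gamma> by (intro sum_mono mult_left_mono less_imp_le[OF hh_pos[OF m]]) auto
    then show "(\<Sum>j<J. hh q j * (\<beta> * nn e j)) \<le> \<Lambda> * y\<^sup>2" using lo by linarith
    have "(\<Sum>j<J. hh q j * (\<gamma> / 4 * s j)) \<le> (\<Sum>j<J. hh q j * (\<gamma> / 4 * s j + \<beta> * nn e j))"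
      using sn \<beta>_pos by (intro sum_mono mult_left_mono less_imp_le[OF hh_pos[OF m]]) auto
    then show "(\<Sum>j<J. hh q j * (\<gamma> / 4 * s j)) \<le> \<Lambda> * y\<^sup>2" using lo by linarith
  qed
  have y2: "y\<^sup>2 \<le> 2 * (h ^ 4 + \<Delta>t\<^sup>2)"
    using sum_squares_bound[of "h\<^sup>2" "\<Delta>t"] by (simp add: y_def power2_sum)
  have h4: "h ^ 4 \<le> h\<^sup>2" using small(3) h_pos by (intro power_decreasing) auto
  have ej: "slope q e j = P q j t - slope q u j" for j by (simp add: e_def slope_err)
  have hj: "(hh q j)\<^sup>2 \<le> h\<^sup>2" "0 < hh q j" if "j < J" for j
    using hh_le_mesh_size[OF m that] hh_pos[OF m that] by (auto intro: power_mono)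
  have sq: "(norm (v + w))\<^sup>2 \<le> 2 * a\<^sup>2 + 2 * b\<^sup>2" if "norm v \<le> a" "norm w \<le> b" for v w :: "real^'d" and a b
  proof -
    have "norm (v + w) \<le> a + b" using norm_triangle_ineq[of v w] that by linarith
    then have "(norm (v + w))\<^sup>2 \<le> (a + b)\<^sup>2" by (intro power_mono) auto
    also have "\<dots> \<le> 2 * a\<^sup>2 + 2 * b\<^sup>2" using sum_squares_bound[of a b] by (simp add: power2_sum)
    finally show ?thesis .
  qed
  have l2: "(L2_norm (\<lambda>\<rho>. x \<rho> t - f \<rho>))\<^sup>2 \<le> (\<Sum>j<J. hh q j * (2 * K\<^sup>2 * h ^ 4 + 48 * nn e j))"
  proof (rule LINT_square_le[OF m])
    show "continuous_on {q j..q (Suc j)} (\<lambda>\<rho>. x \<rho> t - (mid u j + (\<rho> - emid q j) *\<^sub>R slope q u j))" for j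
      by (intro continuous_intros x_cont t)
    fix j \<rho> assume j: "j < J"
    show "x \<rho> t - f \<rho> = x \<rho> t - (mid u j + (\<rho> - emid q j) *\<^sub>R slope q u j)" if "\<rho> \<in> {q j<..<q (Suc j)}"
      using Vh_affine[OF m f j, of \<rho>] that by (simp add: u_def)
    show "(norm (x \<rho> t - (mid u j + (\<rho> - emid q j) *\<^sub>R slope q u j)))\<^sup>2 \<le> 2 * K\<^sup>2 * h ^ 4 + 48 * nn e j" if \<rho>: "\<rho> \<in> {q j..q (Suc j)}"
    proof -
      let ?v = "x \<rho> t - (mid (\<lambda>j. x (q j) t) j + (\<rho> - emid q j) *\<^sub>R P q j t)" and ?w = "mid e j + (\<rho> - emid q j) *\<^sub>R slope q e j"
      have "mid e j = mid (\<lambda>j. x (q j) t) j - mid u j" by (simp add: e_def err_def mid_diff)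
      then have split: "x \<rho> t - (mid u j + (\<rho> - emid q j) *\<^sub>R slope q u j) = ?v + ?w" by (simp add: ej scaleR_diff_right)
      have "norm ?v \<le> K * h\<^sup>2"
        using interpolation_error(1)[OF m j t \<rho>] mult_left_mono[OF hj(1)[OF j] K0] by linarith
      from sq[OF this affine_norm_le[OF m j \<rho>, of e]] norm_sum_square_le[of e j]
      show ?thesis unfolding split by (simp add: power_mult_distrib)
    qed
  qed
  also have "\<dots> = 2 * K\<^sup>2 * h ^ 4 + 48 / \<beta> * (\<Sum>j<J. hh q j * (\<beta> * nn e j))"
    unfolding distrib_left sum.distrib sum_distrib_right[symmetric] sum_hh[OF m] sum_distrib_left
    using \<beta>_pos by (auto intro!: sum.cong)
  also have "\<dots> \<le> 2 * K\<^sup>2 * y\<^sup>2 + 48 / \<beta> * (\<Lambda> * y\<^sup>2)"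
  proof (intro add_mono mult_left_mono part(1))
    have "(h\<^sup>2)\<^sup>2 \<le> y\<^sup>2" using dt by (intro power_mono) (auto simp: y_def)
    then show "h ^ 4 \<le> y\<^sup>2" by simp
  qed (use \<beta>_pos in auto)
  also have "\<dots> = (2 * K\<^sup>2 + 48 * \<Lambda> / \<beta>) * y\<^sup>2" by (simp add: algebra_simps add_divide_distrib)
  also have "\<dots> \<le> (2 * K\<^sup>2 + 48 * \<Lambda> / \<beta>) * (2 * (h ^ 4 + \<Delta>t\<^sup>2))"
    using y2 \<Lambda>_nonneg \<beta>_pos by (intro mult_left_mono) auto
  also have "\<dots> = (4 * K\<^sup>2 + 96 * \<Lambda> / \<beta>) * (h ^ 4 + \<Delta>t\<^sup>2)" by (simp add: algebra_simps add_divide_distrib)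
  finally show "(L2_norm (\<lambda>\<rho>. x \<rho> t - f \<rho>))\<^sup>2 \<le> (4 * K\<^sup>2 + 96 * \<Lambda> / \<beta>) * (h ^ 4 + \<Delta>t\<^sup>2)" .
  have "(H1_seminorm (\<lambda>\<rho>. x \<rho> t - f \<rho>))\<^sup>2 \<le> (\<Sum>j<J. hh q j * (2 * K\<^sup>2 * h\<^sup>2 + 2 * s j))"
    unfolding H1_seminorm_def
  proof (rule LINT_square_le[OF m])
    show "continuous_on {q j..q (Suc j)} (\<lambda>\<rho>. xr \<rho> t - slope q u j)" for j
      by (intro continuous_intros xr_cont t)
    fix j \<rho> assume j: "j < J"
    show "d_rho (\<lambda>\<rho>. x \<rho> t - f \<rho>) \<rho> = xr \<rho> t - slope q u j" if "\<rho> \<in> {q j<..<q (Suc j)}"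
      unfolding d_rho_def u_def
      by (rule vector_derivative_at[OF has_vector_derivative_diff[OF xr_deriv[OF t] Vh_d_rho(1)[OF m f j that]]])
    show "(norm (xr \<rho> t - slope q u j))\<^sup>2 \<le> 2 * K\<^sup>2 * h\<^sup>2 + 2 * s j" if \<rho>: "\<rho> \<in> {q j..q (Suc j)}"
    proof -
      have "norm (xr \<rho> t - P q j t) \<le> K * h"
        using P_near[OF m j t \<rho>] mult_left_mono[OF hh_le_mesh_size[OF m j] K0] by (simp add: norm_minus_commute)
      from sq[OF this order_refl, of "slope q e j"] show ?thesis by (simp add: ej s_def power_mult_distrib)
    qed
  qed
  also have "\<dots> = 2 * K\<^sup>2 * h\<^sup>2 + 8 / \<gamma> * (\<Sum>j<J. hh q j * (\<gamma> / 4 * s j))"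
    unfolding distrib_left sum.distrib sum_distrib_right[symmetric] sum_hh[OF m] sum_distrib_left
    using \<gamma> by (auto intro!: sum.cong)
  also have "\<dots> \<le> 2 * K\<^sup>2 * (h\<^sup>2 + \<Delta>t\<^sup>2) + 8 / \<gamma> * (\<Lambda> * (2 * (h\<^sup>2 + \<Delta>t\<^sup>2)))"
  proof (intro add_mono mult_left_mono)
    have "y\<^sup>2 \<le> 2 * (h\<^sup>2 + \<Delta>t\<^sup>2)"
      by (rule order_trans[OF y2]) (intro mult_left_mono add_right_mono h4; simp)
    from order_trans[OF part(2) mult_left_mono[OF this \<Lambda>_nonneg(2)]]
    show "(\<Sum>j<J. hh q j * (\<gamma> / 4 * s j)) \<le> \<Lambda> * (2 * (h\<^sup>2 + \<Delta>t\<^sup>2))" .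
  qed (use \<gamma> in auto)
  also have "\<dots> = (2 * K\<^sup>2 + 16 * \<Lambda> / \<gamma>) * (h\<^sup>2 + \<Delta>t\<^sup>2)" by (simp add: algebra_simps add_divide_distrib)
  finally show "(H1_seminorm (\<lambda>\<rho>. x \<rho> t - f \<rho>))\<^sup>2 \<le> (2 * K\<^sup>2 + 16 * \<Lambda> / \<gamma>) * (h\<^sup>2 + \<Delta>t\<^sup>2)" .
qed

lemma error_bounds:
  assumes s: "scheme_solution \<phi> \<mu> J q M \<Delta>t x0 xh"
  shows "Max ((\<lambda>m. (L2_norm (\<lambda>\<rho>. x \<rho> (real m * \<Delta>t) - xh m \<rho>))\<^sup>2) ` {0..M}) \<le> (4 * K\<^sup>2 + 96 * \<Lambda> / \<beta>) * (h ^ 4 + \<Delta>t\<^sup>2)"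
    "Max ((\<lambda>m. (H1_seminorm (\<lambda>\<rho>. x \<rho> (real m * \<Delta>t) - xh m \<rho>))\<^sup>2) ` {0..M}) \<le> (2 * K\<^sup>2 + 16 * \<Lambda> / \<gamma>) * (h\<^sup>2 + \<Delta>t\<^sup>2)"
proof -
  have t: "trajectory M xh" using s by (simp add: scheme_solution_iff)
  have k: "xh k \<in> Vh J q" "real k * \<Delta>t \<in> {0..T}" "S J q (\<lambda>j. xh k (q j)) (real k * \<Delta>t) \<le> \<Lambda> * y\<^sup>2" if "k \<le> M" for k
    using t that by (auto simp only: trajectory_def intro!: time trajectory_energy[OF trajectory_mono[OF t]])
  show "Max ((\<lambda>m. (L2_norm (\<lambda>\<rho>. x \<rho> (real m * \<Delta>t) - xh m \<rho>))\<^sup>2) ` {0..M}) \<le> (4 * K\<^sup>2 + 96 * \<Lambda> / \<beta>) * (h ^ 4 + \<Delta>t\<^sup>2)"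
    using error_at_time(1)[OF k] by (intro Max.boundedI) auto
  show "Max ((\<lambda>m. (H1_seminorm (\<lambda>\<rho>. x \<rho> (real m * \<Delta>t) - xh m \<rho>))\<^sup>2) ` {0..M}) \<le> (2 * K\<^sup>2 + 16 * \<Lambda> / \<gamma>) * (h\<^sup>2 + \<Delta>t\<^sup>2)"
    using error_at_time(2)[OF k] by (intro Max.boundedI) auto
qed

end


text \<open>The bounds on the mesh size come from the geometry (all tangents of an element in one ball) and from the
  inverse estimate; \<open>\<Delta>t \<le> h\<close> suffices as the condition on the time step.\<close>

lemma convergence:
  assumes "0 < c"
  shows "\<exists>\<delta> h0 C. \<delta> > 0 \<and> h0 > 0 \<and> C > 0 \<and>
    (\<forall>J q M h \<Delta>t.
       mesh J q \<and> quasi_uniform c J q \<and> h = mesh_size J q \<and>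
       M > 0 \<and> \<Delta>t = T / real M \<and>
       h \<le> h0 \<and> \<Delta>t \<le> \<delta> * h \<longrightarrow>
         (\<exists>!xh. scheme_solution \<phi> \<mu> J q M \<Delta>t x0 xh) \<and>
         (\<forall>xh. scheme_solution \<phi> \<mu> J q M \<Delta>t x0 xh \<longrightarrow>
            Max ((\<lambda>m. (L2_norm (\<lambda>\<rho>. x \<rho> (real m * \<Delta>t) - xh m \<rho>))\<^sup>2) ` {0..M})
              \<le> C * (h ^ 4 + \<Delta>t\<^sup>2) \<and>
            Max ((\<lambda>m. (H1_seminorm (\<lambda>\<rho>. x \<rho> (real m * \<Delta>t) - xh m \<rho>))\<^sup>2) ` {0..M})
              \<le> C * (h\<^sup>2 + \<Delta>t\<^sup>2)))"
proof -
  define h0 where "h0 = min 1 (min (c0 / (8 * (K + 1))) (\<gamma> * c0\<^sup>2 / (256 * (\<Lambda> + 1) * c)))"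
  define D where "D = (4 * K\<^sup>2 + 96 * \<Lambda> / \<beta>) + (2 * K\<^sup>2 + 16 * \<Lambda> / \<gamma>) + 1"
  have "0 < h0" using K0 \<Lambda>_nonneg c0 \<gamma> assms by (simp add: h0_def)
  have parts: "0 \<le> 4 * K\<^sup>2 + 96 * \<Lambda> / \<beta>" "0 \<le> 2 * K\<^sup>2 + 16 * \<Lambda> / \<gamma>" using \<Lambda>_nonneg \<gamma> \<beta>_pos by simp_all
  then have D: "0 < D" "4 * K\<^sup>2 + 96 * \<Lambda> / \<beta> \<le> D" "2 * K\<^sup>2 + 16 * \<Lambda> / \<gamma> \<le> D" by (simp_all add: D_def)
  have main: "(\<exists>!xh. scheme_solution \<phi> \<mu> J q M \<Delta>t x0 xh) \<and>
         (\<forall>xh. scheme_solution \<phi> \<mu> J q M \<Delta>t x0 xh \<longrightarrow>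
            Max ((\<lambda>m. (L2_norm (\<lambda>\<rho>. x \<rho> (real m * \<Delta>t) - xh m \<rho>))\<^sup>2) ` {0..M})
              \<le> D * (h ^ 4 + \<Delta>t\<^sup>2) \<and>
            Max ((\<lambda>m. (H1_seminorm (\<lambda>\<rho>. x \<rho> (real m * \<Delta>t) - xh m \<rho>))\<^sup>2) ` {0..M})
              \<le> D * (h\<^sup>2 + \<Delta>t\<^sup>2))"
    if "mesh J q \<and> quasi_uniform c J q \<and> h = mesh_size J q \<and> M > 0 \<and> \<Delta>t = T / real M \<and> h \<le> h0 \<and> \<Delta>t \<le> 1 * h"
    for J q M h \<Delta>t
  proof -
    from that have m: "mesh J q" and qu: "quasi_uniform c J q" and h: "h = mesh_size J q" and M: "0 < M" "\<Delta>t = T / real M"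
      and le: "mesh_size J q \<le> h0" "\<Delta>t \<le> mesh_size J q" by auto
    have K_le: "K * s \<le> c0 / 8" if "s \<le> h0" for s
    proof -
      have "K * s \<le> K * (c0 / (8 * (K + 1)))" using that K0 by (intro mult_left_mono) (auto simp: h0_def)
      also have "\<dots> \<le> c0 / 8" using K0 c0 by (simp add: field_simps)
      finally show ?thesis .
    qed
    have p: "0 < 256 * (\<Lambda> + 1) * c" using assms \<Lambda>_nonneg by simp
    have h0': "0 \<le> mesh_size J q" using that h T M le(2) by (smt (verit) divide_nonneg_nonneg of_nat_0_le_iff)
    have "mesh_size J q \<le> \<gamma> * c0\<^sup>2 / (256 * (\<Lambda> + 1) * c)" using le(1) by (simp add: h0_def)
    then have "mesh_size J q * (256 * (\<Lambda> + 1) * c) \<le> \<gamma> * c0\<^sup>2" unfolding pos_le_divide_eq[OF p] .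
    moreover have "256 * \<Lambda> * c * mesh_size J q \<le> mesh_size J q * (256 * (\<Lambda> + 1) * c)"
      using assms h0' by (simp add: algebra_simps)
    ultimately have small: "256 * \<Lambda> * c * mesh_size J q \<le> \<gamma> * c0\<^sup>2" by (rule order_trans[rotated])
    have "mesh_size J q \<le> 1" using le(1) by (simp add: h0_def)
    note conds = m qu assms M K_le[OF le(1)] K_le[OF order_trans[OF le(2) le(1)]] this le(2) small
    have "0 \<le> h ^ 4 + \<Delta>t\<^sup>2" "0 \<le> h\<^sup>2 + \<Delta>t\<^sup>2" by simp_all
    from mult_right_mono[OF D(2) this(1)] mult_right_mono[OF D(3) this(2)]
    show ?thesis
      using scheme_has_unique_solution[OF conds] error_bounds[OF conds] unfolding h[symmetric]
      by (blast intro: order_trans)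
  qed
  show ?thesis
  proof (rule exI[of _ "1 :: real"], rule exI[of _ h0], rule exI[of _ D], intro conjI)
    show "(0 :: real) < 1" "0 < h0" "0 < D" by (simp, fact, rule D(1))
  qed (intro allI impI, rule main)
qed

end

theorem theorem3p2:
  fixes \<phi> \<mu> :: "real^'d \<Rightarrow> real"
    and x :: "real \<Rightarrow> real \<Rightarrow> real^'d"
    and x0 :: "real \<Rightarrow> real^'d"
    and T c0 C0 c :: real
  assumes "CARD('d) \<ge> 2"
    and "anisotropy \<phi>"
    and "mobility \<mu>"
    and "T > 0"
    and "C1_space_time T x"
    and "weak_solution \<phi> \<mu> T x0 x"
    and "Bochner_W1inf T W2inf W2inf_norm (\<lambda>t \<rho>. x \<rho> t)"
    and "\<exists>z. has_weak_time_deriv T (\<lambda>t \<rho>. d_t T x \<rho> t) z \<and> Bochner_Linf T Linf Linf_norm z"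
    and "c0 > 0" and "C0 > 0"
    and "\<And>\<rho> t. t \<in> {0..T} \<Longrightarrow>
           c0 \<le> norm (d_rho (\<lambda>\<sigma>. x \<sigma> t) \<rho>) \<and> norm (d_rho (\<lambda>\<sigma>. x \<sigma> t) \<rho>) \<le> C0"
    and "c > 0"
  shows "\<exists>\<delta> h0 C. \<delta> > 0 \<and> h0 > 0 \<and> C > 0 \<and>
    (\<forall>J q M h \<Delta>t.
       mesh J q \<and> quasi_uniform c J q \<and> h = mesh_size J q \<and>
       M > 0 \<and> \<Delta>t = T / real M \<and>
       h \<le> h0 \<and> \<Delta>t \<le> \<delta> * h \<longrightarrow>
         (\<exists>!xh. scheme_solution \<phi> \<mu> J q M \<Delta>t x0 xh) \<and>
         (\<forall>xh. scheme_solution \<phi> \<mu> J q M \<Delta>t x0 xh \<longrightarrow>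
            Max ((\<lambda>m. (L2_norm (\<lambda>\<rho>. x \<rho> (real m * \<Delta>t) - xh m \<rho>))\<^sup>2) ` {0..M})
              \<le> C * (h ^ 4 + \<Delta>t\<^sup>2) \<and>
            Max ((\<lambda>m. (H1_seminorm (\<lambda>\<rho>. x \<rho> (real m * \<Delta>t) - xh m \<rho>))\<^sup>2) ` {0..M})
              \<le> C * (h\<^sup>2 + \<Delta>t\<^sup>2)))"
proof -
  obtain z where z: "has_weak_time_deriv T (\<lambda>t \<rho>. d_t T x \<rho> t) z" "Bochner_Linf T Linf Linf_norm z"
    using assms(8) by blast
  obtain K where K: "regular K T x" by (rule regularity[OF assms(4,5,7) z])
  obtain \<gamma> \<Gamma> where \<gamma>\<Gamma>: "0 < \<gamma>" "0 < \<Gamma>"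
    "\<And>p q. \<gamma> * (norm (p - q))\<^sup>2 \<le> (grad (Phi \<phi>) p - grad (Phi \<phi>) q) \<bullet> (p - q)"
    "\<And>p q. norm (grad (Phi \<phi>) p - grad (Phi \<phi>) q) \<le> \<Gamma> * norm (p - q)"
    "\<And>p z. p \<noteq> 0 \<Longrightarrow> \<gamma> * (norm z)\<^sup>2 \<le> (hessian (Phi \<phi>) p *v z) \<bullet> z"
    "\<And>p z. p \<noteq> 0 \<Longrightarrow> norm (hessian (Phi \<phi>) p *v z) \<le> \<Gamma> * norm z"
    using grad_Phi_monotone_Lipschitz[OF assms(2)] by blast
  have a: "0 < c0 / 2" using assms(9) by simp
  obtain c1 where c1: "0 < c1" "\<And>p z. p \<in> annulus (c0 / 2) (C0 + c0 / 2) \<Longrightarrow> c1 * (norm z)\<^sup>2 \<le> (Hmat \<phi> \<mu> p *v z) \<bullet> z"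
    using H_uniformly_coercive[OF assms(2,3) a] by blast
  have Phi3: "Ck_on 3 (- {0}) (Phi \<phi>)"
    using Ck_on_SucD[OF Phi_C4[OF assms(2)]] by (simp only: numeral_3_eq_3)
  have G3: "Ck_on 3 (- {0}) (\<lambda>p. grad (Phi \<phi>) p $ i)" for i
    using Ck_on_pd[OF Phi_C4[OF assms(2)], of i] by (simp only: numeral_3_eq_3 grad_nth)
  obtain B1 where B1: "\<And>i. C3_bound (c0 / 2) (C0 + c0 / 2) B1 (\<lambda>p. grad (Phi \<phi>) p $ i)"
    using finite_C3_bound[of "\<lambda>i p. grad (Phi \<phi>) p $ i", OF G3 a] by blast
  have H3: "Ck_on 3 (- {0}) (\<lambda>p. Hmat \<phi> \<mu> p $ fst ij $ snd ij)" for ij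
    by (rule H_C3(1)[OF assms(2,3)])
  obtain B2 where "\<And>ij. C3_bound (c0 / 2) (C0 + c0 / 2) B2 (\<lambda>p. Hmat \<phi> \<mu> p $ fst ij $ snd ij)"
    using finite_C3_bound[of "\<lambda>ij p. Hmat \<phi> \<mu> p $ fst ij $ snd ij", OF H3 a] by blast
  from this[of "(_, _)"] have B2: "C3_bound (c0 / 2) (C0 + c0 / 2) B2 (\<lambda>p. Hmat \<phi> \<mu> p $ i $ j)" for i j by simp
  obtain B3 where B3: "C3_bound (c0 / 2) (C0 + c0 / 2) B3 (Phi \<phi>)"
    using C3_bound_exists[OF Phi3 a] by blast
  define B where "B = max B1 (max B2 B3)"
  have BG: "C3_bound (c0 / 2) (C0 + c0 / 2) B (\<lambda>p. grad (Phi \<phi>) p $ i)" for i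
    by (rule C3_bound_mono[OF B1]) (simp add: B_def)
  have BH: "C3_bound (c0 / 2) (C0 + c0 / 2) B (\<lambda>p. Hmat \<phi> \<mu> p $ i $ j)" for i j
    by (rule C3_bound_mono[OF B2]) (simp add: B_def)
  have BP: "C3_bound (c0 / 2) (C0 + c0 / 2) B (Phi \<phi>)"
    by (rule C3_bound_mono[OF B3]) (simp add: B_def)
  have "flow \<phi> \<mu> x x0 T c0 C0 K B c1 \<gamma> \<Gamma>"
    by (rule flow.intro[OF assms(2,3,4,9,5,6) K assms(11) BG BH BP c1 \<gamma>\<Gamma>])
  from flow.convergence[OF this assms(12)] show ?thesis .
qed

end
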